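(* Let $G$ be a locally compact abelian group and let $\widehat G$ be its Pontryagin dual group. Then the following properties are equivalent: (i) $G$ is metrisable as a topological group; (ii) the coarse group $(\widehat G,\mathcal K(\widehat G))$ is metrisable; (iii) the coarse group $(\widehat G,\mathcal{CB}(\widehat G))$ is metrisable.
   Context: Locally compact abelian groups are assumed Hausdorff, as is standard in Pontryagin duality. $\widehat G$ is the group of continuous characters of $G$ with the compact-open topology. For a topological group $H$, $\mathcal K(H)$ is the family of subsets of $H$ with compact closure, and $\mathcal{CB}(H)$ is the family of subsets $A\subseteq H$ such that $\operatorname{diam}_d(A)<\infty$ for every continuous left-invariant pseudometric $d$ on $H$ (left-invariant: $d(kg,kh)=d(g,h)$ for all $g,h,k$). A group ideal on a group $H$ is a family $\mathcal I$ of subsets of $H$ containing $\{e_H\}$, closed under taking subsets, finite unions, products $KJ=\{kj\mid k\in K,\,j\in J\}$ and inverses $K^{-1}$; both $\mathcal K(H)$ and $\mathcal{CB}(H)$ are group ideals. A group ideal $\mathcal I$ on $H$ determines the coarse structure $\mathcal E_{\mathcal I}=\{E\subseteq H\times H\mid \exists K\in\mathcal I:\ E\subseteq\{(x,y)\mid x^{-1}y\in K\}\}$, and $(H,\mathcal I)$ denotes $H$ with this coarse structure. For a metric $d$ on $H$, its metric-coarse structure is $\mathcal E_d=\{E\subseteq H\times H\mid \exists R>0\ \forall (x,y)\in E:\ d(x,y)\le R\}$. The coarse group $(H,\mathcal I)$ is called metrisable if there exists a left-invariant metric $d$ on $H$ (not required to be compatible with any topology) such that $\mathcal E_{\mathcal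 I}=\mathcal E_d$. *)

theory Defs
  imports "HOL-Analysis.Analysis" "HOL-Algebra.Group"
begin

section \<open>Locally compact abelian groups\<close>

locale topological_group = group G for G (structure) and T :: "'a topology" +
  assumes topspace_eq_carrier: "topspace T = carrier G"
    and continuous_mult: "continuous_map (prod_topology T T) T (\<lambda>(x, y). x \<otimes> y)"
    and continuous_inv: "continuous_map T T (\<lambda>x. inv x)"

locale locally_compact_abelian_group = topological_group G T + comm_group G
  for G (structure) and T +
  assumes locally_compact: "locally_compact_space T"
    and Hausdorff: "Hausdorff_space T"


section \<open>The Pontryagin dual\<close>

definition circle_group :: "complex monoid" where
  "circle_group = \<lparr>carrier = sphere 0 1, mult = (*), one = 1\<rparr>"

definition circle_topology :: "complex topology" where
  "circle_topology = top_of_set (sphere 0 1)"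

text \<open>
  A map on a carrier set is represented by an \<^const>\<open>extensional\<close> function, so that two maps are
  equal as soon as they agree on the carrier.
\<close>

definition compact_open_topology :: "'a topology \<Rightarrow> 'b topology \<Rightarrow> ('a \<Rightarrow> 'b) topology" where
  "compact_open_topology X Y = topology_generated_by
     {{f \<in> extensional (topspace X). continuous_map X Y f \<and> f ` K \<subseteq> U} | K U.
        compactin X K \<and> openin Y U}"

definition dual_group :: "('a, 'b) monoid_scheme \<Rightarrow> 'a topology \<Rightarrow> ('a \<Rightarrow> complex) monoid" where
  "dual_group G T =
     \<lparr>carrier = {\<phi> \<in> extensional (carrier G).
                   \<phi> \<in> hom G circle_group \<and> continuous_map T circle_topology \<phi>},
      mult = (\<lambda>\<phi> \<psi>. \<lambda>x\<in>carrier G. \<phi> x * \<psi> x),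
      one = (\<lambda>x\<in>carrier G. 1)\<rparr>"

definition dual_topology :: "('a, 'b) monoid_scheme \<Rightarrow> 'a topology \<Rightarrow> ('a \<Rightarrow> complex) topology" where
  "dual_topology G T =
     subtopology (compact_open_topology T circle_topology) (carrier (dual_group G T))"


section \<open>Coarse groups\<close>

definition left_invariant :: "('a, 'b) monoid_scheme \<Rightarrow> ('a \<Rightarrow> 'a \<Rightarrow> real) \<Rightarrow> bool" where
  "left_invariant H d \<longleftrightarrow>
     (\<forall>g\<in>carrier H. \<forall>h\<in>carrier H. \<forall>k\<in>carrier H. d (k \<otimes>\<^bsub>H\<^esub> g) (k \<otimes>\<^bsub>H\<^esub> h) = d g h)"

definition pseudometric_on :: "'a set \<Rightarrow> ('a \<Rightarrow> 'a \<Rightarrow> real) \<Rightarrow> bool" where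
  "pseudometric_on M d \<longleftrightarrow>
     (\<forall>x\<in>M. d x x = 0) \<and>
     (\<forall>x\<in>M. \<forall>y\<in>M. 0 \<le> d x y \<and> d x y = d y x) \<and>
     (\<forall>x\<in>M. \<forall>y\<in>M. \<forall>z\<in>M. d x z \<le> d x y + d y z)"

text \<open>The family \<open>\<K>(H)\<close> of relatively compact subsets.\<close>

definition relatively_compact_sets :: "'a topology \<Rightarrow> 'a set set" where
  "relatively_compact_sets T = {A. A \<subseteq> topspace T \<and> compactin T (T closure_of A)}"

text \<open>
  The family \<open>\<C>\<B>(H)\<close>; finiteness of the diameter is stated as boundedness above of the set of
  distances, since a supremum of reals is only meaningful for bounded sets.
\<close>

definition coarsely_bounded_sets :: "('a, 'b) monoid_scheme \<Rightarrow> 'a topology \<Rightarrow> 'a set set" where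
  "coarsely_bounded_sets H T =
     {A. A \<subseteq> carrier H \<and>
         (\<forall>d. pseudometric_on (carrier H) d \<and> left_invariant H d \<and>
              continuous_map (prod_topology T T) euclideanreal (\<lambda>(x, y). d x y)
              \<longrightarrow> bdd_above {d x y | x y. x \<in> A \<and> y \<in> A})}"

definition ideal_coarse_structure ::
    "('a, 'b) monoid_scheme \<Rightarrow> 'a set set \<Rightarrow> ('a \<times> 'a) set set" where
  "ideal_coarse_structure H \<I> =
     {E. E \<subseteq> carrier H \<times> carrier H \<and>
         (\<exists>K\<in>\<I>. E \<subseteq> {(x, y). inv\<^bsub>H\<^esub> x \<otimes>\<^bsub>H\<^esub> y \<in> K})}"

definition metric_coarse_structure :: "'a set \<Rightarrow> ('a \<Rightarrow> 'a \<Rightarrow> real) \<Rightarrow> ('a \<times> 'a) set set" where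
  "metric_coarse_structure M d =
     {E. E \<subseteq> M \<times> M \<and> (\<exists>R>0. \<forall>(x, y)\<in>E. d x y \<le> R)}"

definition coarse_group_metrisable :: "('a, 'b) monoid_scheme \<Rightarrow> 'a set set \<Rightarrow> bool" where
  "coarse_group_metrisable H \<I> \<longleftrightarrow>
     (\<exists>d. Metric_space (carrier H) d \<and> left_invariant H d \<and>
          ideal_coarse_structure H \<I> = metric_coarse_structure (carrier H) d)"

end

theory Submission
  imports Defs "HOL-Library.Function_Algebras"
begin

text \<open>
  A set of characters is relatively compact in the dual exactly when it is equicontinuous at the
  identity (\<open>equicontinuous_imp_relatively_compact\<close>, \<open>compact_imp_equicontinuous\<close>), so large
  subsets of the dual correspond to small neighbourhoods of the identity in \<open>G\<close>. The three
  equivalences come from making this correspondence quantitative.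

  \<^bold>\<open>The two ideals coincide.\<close> For decreasing neighbourhoods \<open>V n\<close> of the identity
  such that \<open>x \<otimes> x \<in> V n\<close> for \<open>x \<in> V (n + 1)\<close>, the length of a character \<open>\<phi>\<close> is the supremum of
  \<open>(3/2)^n * norm (\<phi> x - 1)\<close> over all \<open>n\<close> and all \<open>x \<in> V n\<close>. It is subadditive and small for characters
  near the trivial one: passing from \<open>x\<close> to \<open>x \<otimes> x\<close> multiplies \<open>norm (\<phi> x - 1)\<close> by
  \<open>norm (\<phi> x + 1) \<ge> 3/2\<close>. If \<open>A\<close> is not equicontinuous, then the \<open>V n\<close> can be chosen so that \<open>A\<close>
  contains characters of finite but arbitrarily large length. The length may be infinite elsewhere;
  a minimal length function that agrees with it where it is finite is finite everywhere
  (\<open>extend_length_function\<close>), and gives a continuous invariant pseudometric that is unbounded on \<open>A\<close>.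
  So coarsely bounded sets are relatively compact (\<open>coarsely_bounded_eq_relatively_compact\<close>), and the
  two coarse groups of the theorem are equal.

  \<^bold>\<open>A metrizable group has a metrisable coarse dual.\<close> If the \<open>V n\<close> form a neighbourhood base, then
  continuity of each character makes its length finite, and the sets of bounded length are
  exactly the relatively compact ones.

  \<^bold>\<open>The converse.\<close> The balls of a metric for the coarse structure have compact closure, so countably
  many compact sets exhaust the dual. Each is equicontinuous, which gives countably many
  neighbourhoods of the identity of \<open>G\<close> on whose intersection every character is \<open>1\<close>. Characters separate the points
  of \<open>G\<close> (\<open>characters_separate_points\<close>), so this intersection is trivial; local compactness turns the
  neighbourhoods into a countable base, and a metric follows as in the Birkhoff-Kakutani theorem.

  \<^bold>\<open>Characters separate points.\<close> Invariant integration and a spectral argument supply the characters.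
  A version of the Hahn-Banach theorem invariant under commuting maps yields a Haar integral on the
  continuous functions of compact support. For \<open>a \<noteq> \<one>\<close>, convolution with a
  symmetric bump followed by the second difference \<open>2 - translate a - translate (inv a)\<close> is a
  nonzero operator that is self-adjoint for the \<open>L2\<close> inner product, so the norms of its powers
  decay at most geometrically. In a commutative algebra containing it and all translations, a minimal
  submultiplicative seminorm retaining that growth is multiplicative, and is the modulus of an
  algebra character (\<open>exists_character_of_commutative_algebra\<close>). The values of that algebra character on the
  translations form a continuous character of \<open>G\<close>, and its value at \<open>a\<close> is not \<open>1\<close>
  because the algebra character does not vanish on the second difference.
\<close>

section \<open>Zorn minimality and an invariant Hahn-Banach theorem\<close>

lemma minimal_element_if_chains_bounded_below:
  fixes F :: "'o::order set"
  assumes ne: "F \<noteq> {}"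
    and ch: "\<And>C. \<lbrakk>C \<subseteq> F; C \<noteq> {}; \<forall>a\<in>C. \<forall>b\<in>C. a \<le> b \<or> b \<le> a\<rbrakk> \<Longrightarrow> \<exists>u\<in>F. \<forall>a\<in>C. u \<le> a"
  shows "\<exists>m\<in>F. \<forall>a\<in>F. a \<le> m \<longrightarrow> a = m"
proof -
  have "\<exists>m\<in>F. \<forall>a\<in>F. (\<lambda>a b. b \<le> a) m a \<longrightarrow> a = m"
  proof (rule predicate_Zorn)
    show "partial_order_on F (relation_of (\<lambda>a b. b \<le> a) F)"
      by (rule partial_order_on_relation_ofI) auto
  next
    fix C assume C: "C \<in> Chains (relation_of (\<lambda>a b. b \<le> a) F)"
    then have "C \<subseteq> F" "\<forall>a\<in>C. \<forall>b\<in>C. a \<le> b \<or> b \<le> a"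
      by (auto simp: Chains_def relation_of_def)
    then show "\<exists>u\<in>F. \<forall>a\<in>C. u \<le> a"
      using ch[of C] ne by (cases "C = {}") auto
  qed
  then show ?thesis by auto
qed

lemma le_INF_add_INF:
  fixes f g :: "'i \<Rightarrow> real"
  assumes "A \<noteq> {}" "B \<noteq> {}" and le: "\<And>a b. a \<in> A \<Longrightarrow> b \<in> B \<Longrightarrow> c \<le> f a + g b"
  shows "c \<le> (INF a\<in>A. f a) + (INF b\<in>B. g b)"
proof -
  have "c - g b \<le> (INF a\<in>A. f a)" if "b \<in> B" for b
    using assms that by (intro cINF_greatest) (auto simp: algebra_simps)
  then have "c - (INF a\<in>A. f a) \<le> (INF b\<in>B. g b)"
    using assms by (intro cINF_greatest) (auto simp: algebra_simps)
  then show ?thesis by simp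
qed

lemma le_mult_INF:
  fixes f :: "'i \<Rightarrow> real"
  assumes "A \<noteq> {}" "0 \<le> k" "k = 0 \<Longrightarrow> c \<le> 0" and le: "\<And>a. a \<in> A \<Longrightarrow> c \<le> k * f a"
  shows "c \<le> k * (INF a\<in>A. f a)"
proof (cases "k = 0")
  case False
  then have "c / k \<le> (INF a\<in>A. f a)"
    using assms by (intro cINF_greatest) (auto simp: field_simps)
  then show ?thesis using False assms(2) by (simp add: field_simps)
qed (use assms in auto)

lemma le_INF_mult_INF:
  fixes f g :: "'i \<Rightarrow> real"
  assumes "A \<noteq> {}" "B \<noteq> {}" "\<And>a. a \<in> A \<Longrightarrow> 0 \<le> f a" "\<And>b. b \<in> B \<Longrightarrow> 0 \<le> g b"
    and le: "\<And>a b. a \<in> A \<Longrightarrow> b \<in> B \<Longrightarrow> c \<le> f a * g b"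
  shows "c \<le> (INF a\<in>A. f a) * (INF b\<in>B. g b)"
proof (rule le_mult_INF)
  show "0 \<le> (INF a\<in>A. f a)" using assms by (intro cINF_greatest) auto
  have *: "c \<le> g b * (INF a\<in>A. f a)" if "b \<in> B" for b
  proof (rule le_mult_INF)
    show "c \<le> 0" if "g b = 0" using le \<open>b \<in> B\<close> that assms(1) by fastforce
  qed (use assms that in \<open>auto simp: mult.commute\<close>)
  then show "c \<le> (INF a\<in>A. f a) * g b" if "b \<in> B" for b
    using that by (simp add: mult.commute)
  show "c \<le> 0" if "(INF a\<in>A. f a) = 0" using * that assms(2) by fastforce
qed (use assms in auto)

text \<open>
  Among the sublinear functionals below \<open>p\<close> that decrease under \<open>\<Gamma>\<close>, a
  minimal one \<open>q\<close> is linear and invariant. Averaging \<open>q\<close> over the first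
  \<open>n\<close> iterates of some \<open>g \<in> \<Gamma>\<close> again gives a competitor because
  \<open>\<Gamma>\<close> is commutative, so by minimality the average is \<open>q\<close>; on
  \<open>x - g x\<close> the average telescopes to a quantity of order \<open>1 / n\<close>. Linearity comes
  from the competitor \<open>q' x = inf {q (x + t * y) - t * q y | t \<ge> 0}\<close>.
\<close>

lemma invariant_hahn_banach:
  fixes scale :: "real \<Rightarrow> 'v::ab_group_add \<Rightarrow> 'v" (infixr \<open>*r\<close> 75)
  assumes vs: "vector_space scale" and W: "module.subspace scale W"
    and into: "\<And>g x. \<lbrakk>g \<in> \<Gamma>; x \<in> W\<rbrakk> \<Longrightarrow> g x \<in> W"
    and add: "\<And>g x y. \<lbrakk>g \<in> \<Gamma>; x \<in> W; y \<in> W\<rbrakk> \<Longrightarrow> g (x + y) = g x + g y"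
    and hom: "\<And>g x c. \<lbrakk>g \<in> \<Gamma>; x \<in> W\<rbrakk> \<Longrightarrow> g (c *r x) = c *r g x"
    and comm: "\<And>g h x. \<lbrakk>g \<in> \<Gamma>; h \<in> \<Gamma>; x \<in> W\<rbrakk> \<Longrightarrow> g (h x) = h (g x)"
    and p_add: "\<And>x y. \<lbrakk>x \<in> W; y \<in> W\<rbrakk> \<Longrightarrow> p (x + y) \<le> p x + p y"
    and p_hom: "\<And>x c. \<lbrakk>x \<in> W; 0 \<le> c\<rbrakk> \<Longrightarrow> p (c *r x) \<le> c * p x"
    and p_inv: "\<And>g x. \<lbrakk>g \<in> \<Gamma>; x \<in> W\<rbrakk> \<Longrightarrow> p (g x) \<le> p x"
  obtains I :: "'v \<Rightarrow> real"
  where "\<And>x y. \<lbrakk>x \<in> W; y \<in> W\<rbrakk> \<Longrightarrow> I (x + y) = I x + I y"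
    and "\<And>x c. x \<in> W \<Longrightarrow> I (c *r x) = c * I x"
    and "\<And>x. x \<in> W \<Longrightarrow> I x \<le> p x"
    and "\<And>g x. \<lbrakk>g \<in> \<Gamma>; x \<in> W\<rbrakk> \<Longrightarrow> I (g x) = I x"
proof -
  interpret vector_space scale by (rule vs)
  note Wcl [simp, intro] = subspace_0[OF W] subspace_add[OF W] subspace_diff[OF W] subspace_scale[OF W]
    subspace_neg[OF W] into
  define F where "F = {q :: 'v \<Rightarrow> real. (\<forall>x. x \<notin> W \<longrightarrow> q x = 0) \<and>
    (\<forall>x\<in>W. \<forall>y\<in>W. q (x + y) \<le> q x + q y) \<and> (\<forall>x\<in>W. \<forall>c\<ge>0. q (c *r x) \<le> c * q x) \<and>
    (\<forall>g\<in>\<Gamma>. \<forall>x\<in>W. q (g x) \<le> q x) \<and> (\<forall>x\<in>W. q x \<le> p x)}"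
  have FI: "(\<lambda>x. if x \<in> W then q x else 0) \<in> F"
    if "\<And>x y. \<lbrakk>x \<in> W; y \<in> W\<rbrakk> \<Longrightarrow> q (x + y) \<le> q x + q y" "\<And>x c. \<lbrakk>x \<in> W; 0 \<le> c\<rbrakk> \<Longrightarrow> q (c *r x) \<le> c * q x"
      "\<And>g x. \<lbrakk>g \<in> \<Gamma>; x \<in> W\<rbrakk> \<Longrightarrow> q (g x) \<le> q x" "\<And>x. x \<in> W \<Longrightarrow> q x \<le> p x" for q :: "'v \<Rightarrow> real"
    using that unfolding F_def by auto
  have q0: "q 0 = 0" if "q \<in> F" for q
  proof -
    have "q (0 *r 0) \<le> 0 * q 0" using that unfolding F_def by blast
    moreover have "q (0 + 0) \<le> q 0 + q 0" using that unfolding F_def by blast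
    ultimately show ?thesis by simp
  qed
  have low: "- q (- x) \<le> q x" if "q \<in> F" "x \<in> W" for q x
  proof -
    have "q (x + (- x)) \<le> q x + q (- x)" using that unfolding F_def by blast
    then show ?thesis using q0[OF that(1)] by simp
  qed
  have low': "- p (- x) \<le> q x" if "q \<in> F" "x \<in> W" for q x
  proof -
    have "q (- x) \<le> p (- x)" using that unfolding F_def by blast
    then show ?thesis using low[OF that] by linarith
  qed
  have "\<exists>m\<in>F. \<forall>a\<in>F. a \<le> m \<longrightarrow> a = m"
  proof (rule minimal_element_if_chains_bounded_below)
    show "F \<noteq> {}" using FI[of p] p_add p_hom p_inv by blast
  next
    fix C assume C: "C \<subseteq> F" "C \<noteq> {}" "\<forall>a\<in>C. \<forall>b\<in>C. a \<le> b \<or> b \<le> a"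
    define u where "u x = (INF q\<in>C. q x)" for x
    have bdd: "bdd_below ((\<lambda>q. q x) ` C)" if "x \<in> W" for x
      using low' C(1) that by (intro bdd_belowI2[of _ "- p (- x)"]) auto
    have ule: "u x \<le> q x" if "x \<in> W" "q \<in> C" for x q
      unfolding u_def using bdd that by (intro cINF_lower) auto
    have uF: "(\<lambda>x. if x \<in> W then u x else 0) \<in> F"
    proof (rule FI)
      fix x y assume xy: "x \<in> W" "y \<in> W"
      have "u (x + y) \<le> a x + b y" if ab: "a \<in> C" "b \<in> C" for a b
      proof -
        obtain q where q: "q \<in> C" "q \<le> a" "q \<le> b" using C(3) ab by blast
        have "u (x + y) \<le> q (x + y)" using ule q xy by blast
        also have "\<dots> \<le> q x + q y" using q C xy unfolding F_def by blast
        also have "\<dots> \<le> a x + b y" using q by (intro add_mono) (auto simp: le_fun_def)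
        finally show ?thesis .
      qed
      then show "u (x + y) \<le> u x + u y"
        unfolding u_def[of x] u_def[of y] using C(2) by (intro le_INF_add_INF) auto
    next
      fix x and c :: real assume x: "x \<in> W" "0 \<le> c"
      have *: "u (c *r x) \<le> c * q x" if "q \<in> C" for q
      proof -
        have "q (c *r x) \<le> c * q x" using C that x unfolding F_def by blast
        then show ?thesis using ule[of "c *r x" q] that x by auto
      qed
      show "u (c *r x) \<le> c * u x"
        unfolding u_def[of x] using C(2) x * by (intro le_mult_INF) auto
    next
      fix g x assume gx: "g \<in> \<Gamma>" "x \<in> W"
      have "u (g x) \<le> q x" if "q \<in> C" for q
      proof -
        have "q (g x) \<le> q x" using C that gx unfolding F_def by blast
        then show ?thesis using ule[of "g x" q] that gx by auto
      qed
      then show "u (g x) \<le> u x" unfolding u_def[of x] using C(2) by (intro cINF_greatest) auto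
    next
      fix x assume "x \<in> W"
      obtain q where "q \<in> C" using C(2) by blast
      then show "u x \<le> p x" using ule[of x q] C \<open>x \<in> W\<close> unfolding F_def by force
    qed
    moreover have "(\<lambda>x. if x \<in> W then u x else 0) \<le> q" if "q \<in> C" for q
      using ule that C(1) unfolding F_def le_fun_def by auto
    ultimately show "\<exists>u\<in>F. \<forall>a\<in>C. u \<le> a" by blast
  qed
  then obtain q where q: "q \<in> F" and min: "\<And>a. a \<in> F \<Longrightarrow> a \<le> q \<Longrightarrow> a = q" by blast
  have q_add: "q (x + y) \<le> q x + q y" if "x \<in> W" "y \<in> W" for x y
    using q that unfolding F_def by blast
  have q_hom: "q (c *r x) \<le> c * q x" if "x \<in> W" "0 \<le> c" for x c
    using q that unfolding F_def by blast
  have q_inv: "q (g x) \<le> q x" if "g \<in> \<Gamma>" "x \<in> W" for g x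
    using q that unfolding F_def by blast
  have q_p: "q x \<le> p x" if "x \<in> W" for x
    using q that unfolding F_def by blast
  have minimal: "q' x = q x"
    if "\<And>x y. \<lbrakk>x \<in> W; y \<in> W\<rbrakk> \<Longrightarrow> q' (x + y) \<le> q' x + q' y" "\<And>x c. \<lbrakk>x \<in> W; 0 \<le> c\<rbrakk> \<Longrightarrow> q' (c *r x) \<le> c * q' x"
      "\<And>g x. \<lbrakk>g \<in> \<Gamma>; x \<in> W\<rbrakk> \<Longrightarrow> q' (g x) \<le> q' x" "\<And>x. x \<in> W \<Longrightarrow> q' x \<le> q x" "x \<in> W" for q' x
  proof -
    have "(\<lambda>x. if x \<in> W then q' x else 0) \<in> F"
      using that(1-4) by (intro FI) (auto intro: order_trans[OF _ q_p])
    moreover have "(\<lambda>x. if x \<in> W then q' x else 0) \<le> q"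
      using that(4) q unfolding F_def le_fun_def by auto
    ultimately have "(\<lambda>x. if x \<in> W then q' x else 0) = q" by (rule min)
    from fun_cong[OF this, of x] show ?thesis using that(5) by simp
  qed
  \<comment> \<open>Cesaro averages: the telescoping sum bounds \<open>n * q (x - g x)\<close> independently of \<open>n\<close>.\<close>
  have inv: "q (x - g x) \<le> 0" if g: "g \<in> \<Gamma>" and x: "x \<in> W" for g x
  proof -
    have pow_W: "(g ^^ i) y \<in> W" if "y \<in> W" for i y
      using that g by (induction i) auto
    have pow_add: "(g ^^ i) (y + z) = (g ^^ i) y + (g ^^ i) z" if "y \<in> W" "z \<in> W" for i y z
      using that g pow_W by (induction i) (auto simp: add)
    have pow_hom: "(g ^^ i) (c *r y) = c *r (g ^^ i) y" if "y \<in> W" for i y c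
      using that g pow_W by (induction i) (auto simp: hom)
    have pow_comm: "(g ^^ i) (h y) = h ((g ^^ i) y)" if "y \<in> W" "h \<in> \<Gamma>" for i y h
      using that g pow_W by (induction i) (auto simp: comm)
    have pow_le: "q ((g ^^ i) y) \<le> q y" if "y \<in> W" for i y
      using that g pow_W by (induction i) (auto intro: order_trans[OF q_inv])
    have "real n * q (x - g x) \<le> q x + q (- x)" if n: "n > 0" for n
    proof -
      define A where "A y = (1 / real n) *r (\<Sum>i<n. (g ^^ i) y)" for y
      have sumW: "(\<Sum>i<m. (g ^^ i) y) \<in> W" if "y \<in> W" for y m
        using that pow_W by (intro subspace_sum[OF W]) auto
      have AW: "A y \<in> W" if "y \<in> W" for y
        using that sumW unfolding A_def by auto
      have A_add: "A (y + z) = A y + A z" if "y \<in> W" "z \<in> W" for y z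
        using that by (simp add: A_def pow_add sum.distrib scale_right_distrib)
      have A_hom: "A (c *r y) = c *r A y" if "y \<in> W" for y c
        using that by (simp add: A_def pow_hom scale_sum_right[symmetric] scale_left_commute)
      have h_sum: "h (\<Sum>i<m. (g ^^ i) y) = (\<Sum>i<m. h ((g ^^ i) y))" if "y \<in> W" "h \<in> \<Gamma>" for h y m
      proof (induction m)
        case 0
        have "h (0 *r 0) = 0 *r h 0" using that hom Wcl(1) by blast
        then show ?case by simp
      next
        case (Suc m)
        then show ?case using add[OF that(2) sumW[OF that(1)] pow_W[OF that(1)]] by simp
      qed
      have A_comm: "A (h y) = h (A y)" if "y \<in> W" "h \<in> \<Gamma>" for h y
        using that by (simp add: A_def pow_comm h_sum hom sumW)
      have sum_le: "q (\<Sum>i<m. (g ^^ i) y) \<le> real m * q y" if "y \<in> W" for y m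
      proof (induction m)
        case 0 then show ?case using q0[OF q] by simp
      next
        case (Suc m)
        have "q ((\<Sum>i<m. (g ^^ i) y) + (g ^^ m) y) \<le> q (\<Sum>i<m. (g ^^ i) y) + q ((g ^^ m) y)"
          using sumW pow_W that by (intro q_add) auto
        then show ?case using Suc pow_le[OF that, of m] by (simp add: algebra_simps)
      qed
      have A_le: "q (A y) \<le> q y" if "y \<in> W" for y
      proof -
        have "q (A y) \<le> (1 / real n) * q (\<Sum>i<n. (g ^^ i) y)"
          unfolding A_def using sumW that by (intro q_hom) auto
        also have "\<dots> \<le> (1 / real n) * (real n * q y)"
          using sum_le[OF that] by (intro mult_left_mono) auto
        finally show ?thesis using n by simp
      qed
      have qA: "q (A y) = q y" if "y \<in> W" for y
      proof (rule minimal[where q' = "\<lambda>y. q (A y)"])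
        show "q (A (y + z)) \<le> q (A y) + q (A z)" if "y \<in> W" "z \<in> W" for y z
          using that by (simp add: A_add q_add AW)
        show "q (A (c *r y)) \<le> c * q (A y)" if "y \<in> W" "0 \<le> c" for y c
          using that by (simp add: A_hom q_hom AW)
        show "q (A (h y)) \<le> q (A y)" if "h \<in> \<Gamma>" "y \<in> W" for h y
          using that by (simp add: A_comm q_inv AW)
      qed (use A_le that in auto)
      have g_neg: "(g ^^ i) (- y) = - ((g ^^ i) y)" if "y \<in> W" for i y
        using pow_hom[OF that, of i "-1"] by simp
      have tele: "(\<Sum>i<n. (g ^^ i) (x - g x)) = x - (g ^^ n) x"
      proof -
        have "(g ^^ i) (x - g x) = (g ^^ i) x - (g ^^ Suc i) x" for i
          using pow_add[of x "- g x" i] g_neg[of "g x" i] x g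
          by (simp add: funpow_swap1[symmetric] del: funpow.simps) (simp add: funpow_swap1)
        then show ?thesis using sum_lessThan_telescope'[of "\<lambda>i. (g ^^ i) x" n] by simp
      qed
      have gx: "g x \<in> W" using x g by blast
      have "real n * q (x - g x) = real n * q (A (x - g x))" using qA x gx by simp
      also have "\<dots> \<le> q (x + (g ^^ n) (- x))"
      proof -
        have "q (A (x - g x)) \<le> (1 / real n) * q (x - (g ^^ n) x)"
          unfolding A_def tele using x pow_W by (intro q_hom) auto
        then show ?thesis using n g_neg[OF x] by (simp add: field_simps)
      qed
      also have "\<dots> \<le> q x + q ((g ^^ n) (- x))" using x pow_W by (intro q_add) auto
      also have "\<dots> \<le> q x + q (- x)" using pow_le[of "- x" n] x by auto
      finally show ?thesis .
    qed
    then have *: "real (Suc n) * q (x - g x) \<le> q x + q (- x)" for n by blast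
    show ?thesis
    proof (rule ccontr)
      assume pos: "\<not> ?thesis"
      then obtain n where "q x + q (- x) < real n * q (x - g x)"
        using reals_Archimedean3[of "q (x - g x)"] by auto
      also have "\<dots> \<le> real (Suc n) * q (x - g x)"
        using pos by (intro mult_right_mono) auto
      finally show False using *[of n] by simp
    qed
  qed
  have inv': "q (g x - x) \<le> 0" if "g \<in> \<Gamma>" "x \<in> W" for g x
  proof -
    have "g (- x) = - g x" using hom[OF that, of "-1"] by simp
    then show ?thesis using inv[of g "- x"] that by simp
  qed
  have superadd: "q x + q y \<le> q (x + y)" if x: "x \<in> W" and y: "y \<in> W" for x y
  proof -
    define q' where "q' x = (INF t\<in>{0..}. q (x + t *r y) - t * q y)" for x
    have b: "- q (- z) \<le> q (z + t *r y) - t * q y" if "z \<in> W" "0 \<le> t" for z t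
    proof -
      have "t * q y = t * q ((1 / t) *r t *r y)" if "t \<noteq> 0" using that by simp
      also have "\<dots> \<le> q (t *r y)" if "t \<noteq> 0"
        using q_hom[of "t *r y" "1 / t"] \<open>0 \<le> t\<close> that y by (simp add: field_simps)
      finally have "t * q y \<le> q (t *r y)" using q0[OF q] by (cases "t = 0") auto
      also have "q (t *r y) \<le> q (z + t *r y) + q (- z)"
        using q_add[of "z + t *r y" "- z"] that y by auto
      finally show ?thesis by simp
    qed
    have q'le: "q' z \<le> q (z + t *r y) - t * q y" if "z \<in> W" "0 \<le> t" for z t
      unfolding q'_def using b that by (intro cINF_lower bdd_belowI2[of _ "- q (- z)"]) auto
    have "q' x = q x"
    proof (rule minimal)
      fix w z assume wz: "w \<in> W" "z \<in> W"
      have "q' (w + z) \<le> (q (w + s *r y) - s * q y) + (q (z + t *r y) - t * q y)" if "s \<in> {0..}" "t \<in> {0..}" for s t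
      proof -
        have "q' (w + z) \<le> q ((w + z) + (s + t) *r y) - (s + t) * q y"
          using that wz by (intro q'le) auto
        also have "(w + z) + (s + t) *r y = (w + s *r y) + (z + t *r y)"
          by (simp add: scale_left_distrib)
        also have "q \<dots> \<le> q (w + s *r y) + q (z + t *r y)" using wz y by (intro q_add) auto
        finally show ?thesis by (simp add: algebra_simps)
      qed
      then show "q' (w + z) \<le> q' w + q' z"
        unfolding q'_def[of w] q'_def[of z] by (intro le_INF_add_INF) auto
    next
      fix z and c :: real assume z: "z \<in> W" "0 \<le> c"
      have zero: "q' 0 \<le> 0" using q'le[of 0 0] q0[OF q] by simp
      show "q' (c *r z) \<le> c * q' z"
        unfolding q'_def[of z]
      proof (rule le_mult_INF)
        fix t :: real assume t: "t \<in> {0..}"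
        have "q' (c *r z) \<le> q (c *r z + (c * t) *r y) - (c * t) * q y"
          using z t by (intro q'le) auto
        also have "c *r z + (c * t) *r y = c *r (z + t *r y)" by (simp add: scale_right_distrib)
        also have "q \<dots> \<le> c * q (z + t *r y)" using z y by (intro q_hom) auto
        finally show "q' (c *r z) \<le> c * (q (z + t *r y) - t * q y)" by (simp add: algebra_simps)
      qed (use z zero in auto)
    next
      fix g z assume gz: "g \<in> \<Gamma>" "z \<in> W"
      show "q' (g z) \<le> q' z"
        unfolding q'_def[of z]
      proof (rule cINF_greatest)
        fix t :: real assume t: "t \<in> {0..}"
        have "q' (g z) \<le> q (g z + t *r y) - t * q y" using gz t by (intro q'le) auto
        also have "q (g z + t *r y) = q ((z + t *r y) + (g z - z))" by (simp add: algebra_simps)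
        also have "\<dots> \<le> q (z + t *r y) + q (g z - z)" using gz y by (intro q_add) auto
        finally show "q' (g z) \<le> q (z + t *r y) - t * q y" using inv'[OF gz] by simp
      qed auto
    next
      fix z assume "z \<in> W"
      then show "q' z \<le> q z" using q'le[of z 0] by simp
    qed (rule x)
    then show ?thesis using q'le[OF x, of 1] by simp
  qed
  have ladd: "q (x + y) = q x + q y" if "x \<in> W" "y \<in> W" for x y
    using superadd[OF that] q_add[OF that] by simp
  have lneg: "q (- x) = - q x" if "x \<in> W" for x
    using ladd[of x "- x"] that q0[OF q] by simp
  have lpos: "q (c *r x) = c * q x" if "x \<in> W" "0 < c" for x c
  proof -
    have "q ((1 / c) *r c *r x) \<le> (1 / c) * q (c *r x)" using that by (intro q_hom) auto
    then show ?thesis using q_hom[of x c] that by (simp add: field_simps)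
  qed
  have lhom: "q (c *r x) = c * q x" if "x \<in> W" for x c
  proof (cases "0 < c")
    case False
    then show ?thesis
      using lneg[of "(- c) *r x"] lpos[OF that, of "- c"] that q0[OF q] by (cases "c = 0") auto
  qed (use lpos that in auto)
  have linv: "q (g x) = q x" if "g \<in> \<Gamma>" "x \<in> W" for g x
    using ladd[of "g x - x" x] ladd[of "x - g x" "g x"] inv[OF that] inv'[OF that] that
    by auto
  show thesis using that ladd lhom q_p linv by blast
qed

section \<open>Characters of commutative complex algebras\<close>

text \<open>
  The algebra is a subspace \<open>S\<close> of an ambient vector space, so that algebras of operators,
  which are not types, are instances.
\<close>

locale commutative_algebra = vector_space scale
  for scale :: "complex \<Rightarrow> 'v::ab_group_add \<Rightarrow> 'v" (infixr \<open>*c\<close> 75) +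
  fixes S :: "'v set" and mul :: "'v \<Rightarrow> 'v \<Rightarrow> 'v" (infixl \<open>\<odot>\<close> 70) and unit :: 'v (\<open>\<e>\<close>)
  assumes S_subspace: "subspace S"
    and mul_closed [simp, intro]: "\<lbrakk>x \<in> S; y \<in> S\<rbrakk> \<Longrightarrow> x \<odot> y \<in> S"
    and unit_closed [simp, intro]: "\<e> \<in> S"
    and mul_assoc: "\<lbrakk>x \<in> S; y \<in> S; z \<in> S\<rbrakk> \<Longrightarrow> (x \<odot> y) \<odot> z = x \<odot> (y \<odot> z)"
    and mul_commute: "\<lbrakk>x \<in> S; y \<in> S\<rbrakk> \<Longrightarrow> x \<odot> y = y \<odot> x"
    and unit_mul [simp]: "x \<in> S \<Longrightarrow> \<e> \<odot> x = x"
    and add_mul: "\<lbrakk>x \<in> S; y \<in> S; z \<in> S\<rbrakk> \<Longrightarrow> (x + y) \<odot> z = x \<odot> z + y \<odot> z"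
    and scale_mul: "\<lbrakk>x \<in> S; y \<in> S\<rbrakk> \<Longrightarrow> (c *c x) \<odot> y = c *c (x \<odot> y)"
begin

lemma S_closed [simp, intro]:
  "0 \<in> S" "\<lbrakk>x \<in> S; y \<in> S\<rbrakk> \<Longrightarrow> x + y \<in> S" "\<lbrakk>x \<in> S; y \<in> S\<rbrakk> \<Longrightarrow> x - y \<in> S" "x \<in> S \<Longrightarrow> c *c x \<in> S" "x \<in> S \<Longrightarrow> - x \<in> S"
  using S_subspace by (simp_all add: subspace_0 subspace_add subspace_diff subspace_scale subspace_neg)

lemma mul_add: "\<lbrakk>x \<in> S; y \<in> S; z \<in> S\<rbrakk> \<Longrightarrow> z \<odot> (x + y) = z \<odot> x + z \<odot> y"
  using add_mul[of x y z] mul_commute[of z "x + y"] mul_commute[of z x] mul_commute[of z y] by simp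

lemma mul_scale: "\<lbrakk>x \<in> S; y \<in> S\<rbrakk> \<Longrightarrow> x \<odot> (c *c y) = c *c (x \<odot> y)"
  using scale_mul[of y x c] mul_commute[of x "c *c y"] mul_commute[of x y] by simp

lemma mul_unit [simp]: "x \<in> S \<Longrightarrow> x \<odot> \<e> = x"
  using mul_commute[of x \<e>] by simp

lemma mul_left_commute: "\<lbrakk>x \<in> S; y \<in> S; z \<in> S\<rbrakk> \<Longrightarrow> x \<odot> (y \<odot> z) = y \<odot> (x \<odot> z)"
  using mul_assoc[of x y z] mul_assoc[of y x z] mul_commute[of x y] by simp

definition pow :: "'v \<Rightarrow> nat \<Rightarrow> 'v" where
  "pow x n = ((\<odot>) x ^^ n) \<e>"

lemma pow_0 [simp]: "pow x 0 = \<e>"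
  and pow_Suc: "pow x (Suc n) = x \<odot> pow x n"
  by (simp_all add: pow_def)

lemma pow_closed [simp, intro]: "x \<in> S \<Longrightarrow> pow x n \<in> S"
  by (induction n) (auto simp: pow_Suc)

lemma pow_add: "x \<in> S \<Longrightarrow> pow x (m + n) = pow x m \<odot> pow x n"
  by (induction m) (auto simp: pow_Suc mul_assoc)

lemma pow_mul: "\<lbrakk>x \<in> S; y \<in> S\<rbrakk> \<Longrightarrow> pow (x \<odot> y) n = pow x n \<odot> pow y n"
  by (induction n) (auto simp: pow_Suc mul_assoc mul_left_commute)

lemma pow_pow: "x \<in> S \<Longrightarrow> pow (pow x m) n = pow x (m * n)"
  by (induction n) (auto simp: pow_Suc pow_add)

lemma pow_scale: "x \<in> S \<Longrightarrow> pow (c *c x) n = c ^ n *c pow x n"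
  by (induction n) (auto simp: pow_Suc scale_mul mul_scale)

definition submultiplicative_seminorm :: "('v \<Rightarrow> real) \<Rightarrow> bool" where
  "submultiplicative_seminorm q \<longleftrightarrow>
     (\<forall>x\<in>S. 0 \<le> q x) \<and> (\<forall>x\<in>S. \<forall>y\<in>S. q (x + y) \<le> q x + q y) \<and>
     (\<forall>x\<in>S. \<forall>y\<in>S. q (x \<odot> y) \<le> q x * q y) \<and> (\<forall>x\<in>S. \<forall>c. q (c *c x) \<le> cmod c * q x)"

lemma submultiplicative_seminormD:
  assumes "submultiplicative_seminorm q"
  shows "x \<in> S \<Longrightarrow> 0 \<le> q x"
    and "\<lbrakk>x \<in> S; y \<in> S\<rbrakk> \<Longrightarrow> q (x + y) \<le> q x + q y"
    and "\<lbrakk>x \<in> S; y \<in> S\<rbrakk> \<Longrightarrow> q (x \<odot> y) \<le> q x * q y"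
    and "x \<in> S \<Longrightarrow> q (c *c x) \<le> cmod c * q x"
  using assms unfolding submultiplicative_seminorm_def by blast+

lemma seminorm_pow_le:
  assumes q: "submultiplicative_seminorm q" and x: "x \<in> S"
  shows "q (pow x n) \<le> q \<e> * q x ^ n"
proof (induction n)
  case (Suc n)
  have "q (pow x (Suc n)) \<le> q x * q (pow x n)"
    using submultiplicative_seminormD(3)[OF q] x by (auto simp: pow_Suc)
  also have "\<dots> \<le> q x * (q \<e> * q x ^ n)"
    using Suc submultiplicative_seminormD(1)[OF q] x by (intro mult_left_mono) auto
  finally show ?case by (simp add: mult_ac)
qed auto

definition growth_rates :: "('v \<Rightarrow> real) \<Rightarrow> 'v \<Rightarrow> real set" where
  "growth_rates q x = {\<alpha>. 0 < \<alpha> \<and> (\<exists>C\<ge>0. \<forall>n. q (pow x n) \<le> C * \<alpha> ^ n)}"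

text \<open>
  The spectral radius of \<open>x\<close> for the seminorm \<open>q\<close>. An infimum of growth rates
  replaces the limit of \<open>n\<close>-th roots, so that sums and products can be handled by adding and
  multiplying rates.
\<close>

definition spectral_seminorm :: "('v \<Rightarrow> real) \<Rightarrow> 'v \<Rightarrow> real" where
  "spectral_seminorm q x = Inf (growth_rates q x)"

lemma growth_ratesI: "\<lbrakk>0 < \<alpha>; 0 \<le> C; \<And>n. q (pow x n) \<le> C * \<alpha> ^ n\<rbrakk> \<Longrightarrow> \<alpha> \<in> growth_rates q x"
  unfolding growth_rates_def by auto

lemma growth_ratesI_ge:
  assumes q: "submultiplicative_seminorm q" and x: "x \<in> S" and "0 < \<alpha>" "q x \<le> \<alpha>"
  shows "\<alpha> \<in> growth_rates q x"
proof (rule growth_ratesI)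
  show "q (pow x n) \<le> q \<e> * \<alpha> ^ n" for n
  proof -
    have "q \<e> * q x ^ n \<le> q \<e> * \<alpha> ^ n"
      using assms submultiplicative_seminormD(1)[OF q] by (intro mult_left_mono power_mono) auto
    then show ?thesis using seminorm_pow_le[OF q x, of n] by linarith
  qed
qed (use assms submultiplicative_seminormD(1)[OF q] in auto)

lemma spectral_seminorm_le_rate: "\<alpha> \<in> growth_rates q x \<Longrightarrow> spectral_seminorm q x \<le> \<alpha>"
  unfolding spectral_seminorm_def
  by (rule cInf_lower) (auto intro!: bdd_belowI[of _ 0] simp: growth_rates_def)

lemma growth_rates_nonempty:
  assumes "submultiplicative_seminorm q" "x \<in> S"
  shows "growth_rates q x \<noteq> {}"
proof -
  have "max 1 (q x) \<in> growth_rates q x" using assms by (intro growth_ratesI_ge) auto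
  then show ?thesis by blast
qed

lemma spectral_seminorm_greatest:
  assumes "submultiplicative_seminorm q" "x \<in> S" "\<And>\<alpha>. \<alpha> \<in> growth_rates q x \<Longrightarrow> b \<le> \<alpha>"
  shows "b \<le> spectral_seminorm q x"
  unfolding spectral_seminorm_def using growth_rates_nonempty[OF assms(1,2)] assms(3)
  by (rule cInf_greatest)

lemma spectral_seminorm_le:
  assumes q: "submultiplicative_seminorm q" and x: "x \<in> S"
  shows "spectral_seminorm q x \<le> q x"
proof (rule field_le_epsilon)
  fix e :: real assume "0 < e"
  then show "spectral_seminorm q x \<le> q x + e"
    using submultiplicative_seminormD(1)[OF q x]
    by (intro spectral_seminorm_le_rate growth_ratesI_ge[OF q x]) auto
qed

text \<open>
  The inequality proved by induction unfolds the binomial expansion of \<open>(x + y)^n\<close> one factor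
  at a time: a product \<open>x^i y^j (x + y)^n\<close> splits into two products with one factor
  \<open>x + y\<close> fewer.
\<close>

lemma growth_rates_add:
  assumes q: "submultiplicative_seminorm q" and xy: "x \<in> S" "y \<in> S"
    and a: "\<alpha> \<in> growth_rates q x" and b: "\<beta> \<in> growth_rates q y"
  shows "\<alpha> + \<beta> \<in> growth_rates q (x + y)"
proof -
  obtain C where C: "0 < \<alpha>" "0 \<le> C" "\<And>n. q (pow x n) \<le> C * \<alpha> ^ n" using a unfolding growth_rates_def by blast
  obtain D where D: "0 < \<beta>" "0 \<le> D" "\<And>n. q (pow y n) \<le> D * \<beta> ^ n" using b unfolding growth_rates_def by blast
  have "q (pow x i \<odot> pow y j \<odot> pow (x + y) n) \<le> C * D * \<alpha> ^ i * \<beta> ^ j * (\<alpha> + \<beta>) ^ n" for i j n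
  proof (induction n arbitrary: i j)
    case 0
    have "q (pow x i \<odot> pow y j) \<le> q (pow x i) * q (pow y j)"
      using xy by (intro submultiplicative_seminormD(3)[OF q]) auto
    also have "\<dots> \<le> (C * \<alpha> ^ i) * (D * \<beta> ^ j)"
      using C D xy submultiplicative_seminormD(1)[OF q] by (intro mult_mono) auto
    finally show ?case using xy by (simp add: mult_ac)
  next
    case (Suc n)
    have "pow x i \<odot> pow y j \<odot> pow (x + y) (Suc n)
        = pow x (Suc i) \<odot> pow y j \<odot> pow (x + y) n + pow x i \<odot> pow y (Suc j) \<odot> pow (x + y) n"
      using xy by (simp add: pow_Suc add_mul mul_add mul_assoc mul_left_commute)
    then have "q (pow x i \<odot> pow y j \<odot> pow (x + y) (Suc n))
        \<le> q (pow x (Suc i) \<odot> pow y j \<odot> pow (x + y) n) + q (pow x i \<odot> pow y (Suc j) \<odot> pow (x + y) n)"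
      using submultiplicative_seminormD(2)[OF q] xy by simp
    also have "\<dots> \<le> C * D * \<alpha> ^ Suc i * \<beta> ^ j * (\<alpha> + \<beta>) ^ n + C * D * \<alpha> ^ i * \<beta> ^ Suc j * (\<alpha> + \<beta>) ^ n"
      by (intro add_mono Suc)
    finally show ?case by (simp add: algebra_simps)
  qed
  from this[of 0 0] show ?thesis
    using xy C D by (intro growth_ratesI[of _ "C * D"]) auto
qed

lemma growth_rates_mul:
  assumes q: "submultiplicative_seminorm q" and xy: "x \<in> S" "y \<in> S"
    and a: "\<alpha> \<in> growth_rates q x" and b: "\<beta> \<in> growth_rates q y"
  shows "\<alpha> * \<beta> \<in> growth_rates q (x \<odot> y)"
proof -
  obtain C where C: "0 < \<alpha>" "0 \<le> C" "\<And>n. q (pow x n) \<le> C * \<alpha> ^ n" using a unfolding growth_rates_def by blast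
  obtain D where D: "0 < \<beta>" "0 \<le> D" "\<And>n. q (pow y n) \<le> D * \<beta> ^ n" using b unfolding growth_rates_def by blast
  have "q (pow (x \<odot> y) n) \<le> (C * D) * (\<alpha> * \<beta>) ^ n" for n
  proof -
    have "q (pow (x \<odot> y) n) \<le> q (pow x n) * q (pow y n)"
      using xy submultiplicative_seminormD(3)[OF q] by (simp add: pow_mul)
    also have "\<dots> \<le> (C * \<alpha> ^ n) * (D * \<beta> ^ n)"
      using C D xy submultiplicative_seminormD(1)[OF q] by (intro mult_mono) auto
    finally show ?thesis by (simp add: power_mult_distrib mult_ac)
  qed
  then show ?thesis using C D by (intro growth_ratesI[of _ "C * D"]) auto
qed

lemma growth_rates_scale:
  assumes q: "submultiplicative_seminorm q" and x: "x \<in> S"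
    and a: "\<alpha> \<in> growth_rates q x" and b: "cmod c \<le> b" "0 < b"
  shows "b * \<alpha> \<in> growth_rates q (c *c x)"
proof -
  obtain C where C: "0 < \<alpha>" "0 \<le> C" "\<And>n. q (pow x n) \<le> C * \<alpha> ^ n" using a unfolding growth_rates_def by blast
  have "q (pow (c *c x) n) \<le> C * (b * \<alpha>) ^ n" for n
  proof -
    have "q (pow (c *c x) n) \<le> cmod (c ^ n) * q (pow x n)"
      using x submultiplicative_seminormD(4)[OF q] by (simp add: pow_scale)
    also have "\<dots> \<le> b ^ n * (C * \<alpha> ^ n)"
      using C b x submultiplicative_seminormD(1)[OF q]
      by (intro mult_mono) (auto simp: norm_power intro: power_mono)
    finally show ?thesis by (simp add: power_mult_distrib mult_ac)
  qed
  then show ?thesis using C b by (intro growth_ratesI[of _ C]) auto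
qed

text \<open>
  For commuting elements the spectral radius is again a submultiplicative seminorm. Minimality below uses
  this to conclude that a minimal seminorm agrees with its own spectral radius.
\<close>

lemma submultiplicative_spectral_seminorm:
  assumes q: "submultiplicative_seminorm q"
  shows "submultiplicative_seminorm (spectral_seminorm q)"
proof -
  note ne = growth_rates_nonempty[OF q]
  have nonneg: "0 \<le> spectral_seminorm q x" if "x \<in> S" for x
    using that by (intro spectral_seminorm_greatest[OF q]) (auto simp: growth_rates_def)
  have rate_nonneg: "0 \<le> \<alpha>" if "\<alpha> \<in> growth_rates q x" for \<alpha> x
    using that unfolding growth_rates_def by auto
  have INF: "spectral_seminorm q x = (INF \<alpha>\<in>growth_rates q x. \<alpha>)" for x
    by (simp add: spectral_seminorm_def)
  have add: "spectral_seminorm q (x + y) \<le> spectral_seminorm q x + spectral_seminorm q y" if "x \<in> S" "y \<in> S" for x y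
    unfolding INF[of x] INF[of y]
    using that ne spectral_seminorm_le_rate growth_rates_add[OF q] by (intro le_INF_add_INF) auto
  have mul: "spectral_seminorm q (x \<odot> y) \<le> spectral_seminorm q x * spectral_seminorm q y" if "x \<in> S" "y \<in> S" for x y
    unfolding INF[of x] INF[of y]
    using that ne spectral_seminorm_le_rate growth_rates_mul[OF q] rate_nonneg
    by (intro le_INF_mult_INF) auto
  have scl: "spectral_seminorm q (c *c x) \<le> cmod c * spectral_seminorm q x" if x: "x \<in> S" for x c
  proof -
    have *: "spectral_seminorm q (c *c x) \<le> cmod c * \<alpha>" if \<alpha>: "\<alpha> \<in> growth_rates q x" for \<alpha>
    proof (rule field_le_epsilon)
      fix e :: real assume e: "0 < e"
      have pos: "0 < \<alpha>" using \<alpha> unfolding growth_rates_def by blast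
      have "(cmod c + e / \<alpha>) * \<alpha> \<in> growth_rates q (c *c x)"
        using e pos by (intro growth_rates_scale[OF q x \<alpha>]) (auto intro: add_nonneg_pos)
      then have "spectral_seminorm q (c *c x) \<le> (cmod c + e / \<alpha>) * \<alpha>"
        by (rule spectral_seminorm_le_rate)
      then show "spectral_seminorm q (c *c x) \<le> cmod c * \<alpha> + e"
        using pos by (simp add: distrib_right)
    qed
    have z: "spectral_seminorm q (c *c x) \<le> 0" if "cmod c = 0"
      using ne[OF x] * that by fastforce
    show ?thesis
      unfolding INF[of x] using * z ne[OF x] by (intro le_mult_INF) auto
  qed
  show ?thesis
    unfolding submultiplicative_seminorm_def by (intro conjI ballI allI nonneg add mul scl)
qed

text \<open>
  A geometric lower bound on the norms of the powers bounds every growth rate from below. This is how a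
  lower bound on powers survives the passage to the spectral radius.
\<close>

lemma le_growth_rate_if_power_le:
  assumes "\<alpha> \<in> growth_rates q x" "0 \<le> b" "\<And>n. b ^ n \<le> q (pow x n)"
  shows "b \<le> \<alpha>"
proof (rule ccontr)
  assume "\<not> b \<le> \<alpha>"
  obtain C where C: "0 < \<alpha>" "0 \<le> C" "\<And>n. q (pow x n) \<le> C * \<alpha> ^ n" using assms(1) unfolding growth_rates_def by blast
  have "1 < b / \<alpha>" using C \<open>\<not> b \<le> \<alpha>\<close> by simp
  then obtain n where "C < (b / \<alpha>) ^ n" using real_arch_pow by blast
  then have "C * \<alpha> ^ n < b ^ n" using C(1) by (simp add: power_divide field_simps)
  then show False using C(3)[of n] assms(3)[of n] by linarith
qed

text \<open>
  Together with submultiplicativity this gives \<open>q (x * x) = (q x)\<^sup>2\<close> as soon as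
  \<open>q\<close> is its own spectral radius. Odd powers cost one extra factor \<open>q x\<close>, which
  only affects the constant.
\<close>

lemma spectral_seminorm_square:
  assumes q: "submultiplicative_seminorm q" and x: "x \<in> S"
  shows "(spectral_seminorm q x)\<^sup>2 \<le> spectral_seminorm q (x \<odot> x)"
proof (rule spectral_seminorm_greatest[OF q])
  fix \<alpha> assume "\<alpha> \<in> growth_rates q (x \<odot> x)"
  then obtain C where C: "0 < \<alpha>" "0 \<le> C" "\<And>n. q (pow (x \<odot> x) n) \<le> C * \<alpha> ^ n"
    unfolding growth_rates_def by blast
  define s where "s = sqrt \<alpha>"
  have s: "0 < s" "s ^ 2 = \<alpha>" using C(1) by (auto simp: s_def)
  have even: "q (pow x (2 * m)) \<le> C * s ^ (2 * m)" for m
  proof -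
    have "pow (x \<odot> x) m = pow x (2 * m)" using x by (simp add: pow_mul pow_add mult_2)
    moreover have "s ^ (2 * m) = \<alpha> ^ m" using s(2) by (simp add: power_mult)
    ultimately show ?thesis using C(3)[of m] by simp
  qed
  have "s \<in> growth_rates q x"
  proof (rule growth_ratesI)
    show "q (pow x n) \<le> (C + q x * C / s) * s ^ n" for n
    proof (cases "even n")
      case True
      then obtain m where m: "n = 2 * m" by blast
      have "q (pow x n) \<le> C * s ^ n" using even m by simp
      also have "\<dots> \<le> (C + q x * C / s) * s ^ n"
        using C s submultiplicative_seminormD(1)[OF q x] by (intro mult_right_mono) auto
      finally show ?thesis .
    next
      case False
      then obtain m where m: "n = Suc (2 * m)" by (metis oddE Suc_eq_plus1)
      have "q (pow x n) \<le> q x * q (pow x (2 * m))"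
        unfolding m pow_Suc using x by (intro submultiplicative_seminormD(3)[OF q]) auto
      also have "\<dots> \<le> q x * (C * s ^ (2 * m))"
        using even submultiplicative_seminormD(1)[OF q x] by (intro mult_left_mono) auto
      also have "\<dots> = (q x * C / s) * s ^ n" using s unfolding m by simp
      also have "\<dots> \<le> (C + q x * C / s) * s ^ n"
        using C s submultiplicative_seminormD(1)[OF q x] by (intro mult_right_mono) auto
      finally show ?thesis .
    qed
  qed (use C s submultiplicative_seminormD(1)[OF q x] in auto)
  then have "spectral_seminorm q x \<le> s" by (rule spectral_seminorm_le_rate)
  moreover have "0 \<le> spectral_seminorm q x"
    by (rule submultiplicative_seminormD(1)[OF submultiplicative_spectral_seminorm[OF q] x])
  ultimately have "(spectral_seminorm q x)\<^sup>2 \<le> s\<^sup>2" by (rule power_mono)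
  then show "(spectral_seminorm q x)\<^sup>2 \<le> \<alpha>" using s by simp
qed (use x in auto)

end

context commutative_algebra
begin

lemma submultiplicative_seminorm_scale_eq:
  assumes q: "submultiplicative_seminorm q" and x: "x \<in> S"
  shows "q (c *c x) = cmod c * q x"
proof (cases "c = 0")
  case True
  then show ?thesis
    using submultiplicative_seminormD(4)[OF q x, of c] submultiplicative_seminormD(1)[OF q, of "c *c x"] x by simp
next
  case False
  have "q (inverse c *c c *c x) \<le> cmod (inverse c) * q (c *c x)"
    using x by (intro submultiplicative_seminormD(4)[OF q]) auto
  then have "q x \<le> inverse (cmod c) * q (c *c x)" using False by (simp add: norm_inverse)
  then have "cmod c * q x \<le> q (c *c x)" using False by (simp add: field_simps)
  then show ?thesis using submultiplicative_seminormD(4)[OF q x, of c] by simp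
qed

lemma chain_infimum_submultiplicative:
  assumes ne: "C \<noteq> {}" and chain: "\<And>a b. a \<in> C \<Longrightarrow> b \<in> C \<Longrightarrow> a \<le> b \<or> b \<le> a"
    and sub: "\<And>a. a \<in> C \<Longrightarrow> submultiplicative_seminorm a"
  shows "submultiplicative_seminorm (\<lambda>x. INF q\<in>C. q x)"
proof -
  define u where "u x = (INF q\<in>C. q x)" for x
  have ule: "u x \<le> q x" if "x \<in> S" "q \<in> C" for x q
    unfolding u_def using that submultiplicative_seminormD(1)[OF sub]
    by (intro cINF_lower bdd_belowI2[of _ 0]) auto
  have nonneg: "0 \<le> u x" if "x \<in> S" for x
    unfolding u_def using ne submultiplicative_seminormD(1)[OF sub] that by (intro cINF_greatest) auto
  have below: "\<exists>q\<in>C. q \<le> a \<and> q \<le> b" if "a \<in> C" "b \<in> C" for a b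
    using chain[OF that] that by blast
  have add: "u (x + y) \<le> u x + u y" if xy: "x \<in> S" "y \<in> S" for x y
    unfolding u_def[of x] u_def[of y]
  proof (rule le_INF_add_INF[OF ne ne])
    fix a b assume "a \<in> C" "b \<in> C"
    then obtain q where q: "q \<in> C" "q \<le> a" "q \<le> b" using below by blast
    have "u (x + y) \<le> q (x + y)" using ule xy q by auto
    also have "\<dots> \<le> q x + q y" using submultiplicative_seminormD(2)[OF sub[OF q(1)] xy] .
    also have "\<dots> \<le> a x + b y" using q by (intro add_mono) (auto simp: le_fun_def)
    finally show "u (x + y) \<le> a x + b y" .
  qed
  have mul: "u (x \<odot> y) \<le> u x * u y" if xy: "x \<in> S" "y \<in> S" for x y
    unfolding u_def[of x] u_def[of y]
  proof (rule le_INF_mult_INF[OF ne ne])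
    fix a b assume ab: "a \<in> C" "b \<in> C"
    then obtain q where q: "q \<in> C" "q \<le> a" "q \<le> b" using below by blast
    have "u (x \<odot> y) \<le> q (x \<odot> y)" using ule xy q by auto
    also have "\<dots> \<le> q x * q y" using submultiplicative_seminormD(3)[OF sub[OF q(1)] xy] .
    also have "\<dots> \<le> a x * b y"
      using q submultiplicative_seminormD(1)[OF sub[OF q(1)]] submultiplicative_seminormD(1)[OF sub[OF ab(1)]] xy
      by (intro mult_mono) (auto simp: le_fun_def)
    finally show "u (x \<odot> y) \<le> a x * b y" .
  qed (use submultiplicative_seminormD(1)[OF sub] xy in auto)
  have scl: "u (c *c x) \<le> cmod c * u x" if x: "x \<in> S" for x c
  proof -
    have *: "u (c *c x) \<le> cmod c * q x" if "q \<in> C" for q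
      using ule[of "c *c x" q] submultiplicative_seminormD(4)[OF sub[OF that] x, of c] x that by auto
    moreover have "u (c *c x) \<le> 0" if "cmod c = 0"
      using * that ne by fastforce
    ultimately show ?thesis unfolding u_def[of x] using ne by (intro le_mult_INF) auto
  qed
  have "submultiplicative_seminorm u"
    unfolding submultiplicative_seminorm_def by (intro conjI ballI allI nonneg add mul scl)
  moreover have "u = (\<lambda>x. INF q\<in>C. q x)" by (simp add: u_def fun_eq_iff)
  ultimately show ?thesis by simp
qed

text \<open>
  The quotients decrease in \<open>n\<close> because \<open>q (f * z) \<le> q f * q z\<close>, so their
  infimum inherits the seminorm inequalities of \<open>q\<close>. It is at most \<open>q x\<close> (take
  \<open>n = 0\<close>) and at most \<open>q (x * f) / q f\<close> (take \<open>n = 1\<close>). Hence a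
  \<open>q\<close> that is minimal in a class containing its localisation satisfies
  \<open>q (x * f) = q x * q f\<close>.
\<close>

lemma localised_seminorm_submultiplicative:
  assumes q: "submultiplicative_seminorm q" and f: "f \<in> S" "0 < q f"
  shows "submultiplicative_seminorm (\<lambda>x. INF n. q (x \<odot> pow f n) / q f ^ n)"
    and "\<And>n x. x \<in> S \<Longrightarrow> (INF n. q (x \<odot> pow f n) / q f ^ n) \<le> q (x \<odot> pow f n) / q f ^ n"
proof -
  define a where "a x n = q (x \<odot> pow f n) / q f ^ n" for x n
  define u where "u x = (INF n. a x n)" for x
  note qD = submultiplicative_seminormD[OF q]
  have a_nonneg: "0 \<le> a x n" if "x \<in> S" for x n
    using qD(1) that f by (simp add: a_def)
  have ule: "u x \<le> a x n" if "x \<in> S" for x n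
    unfolding u_def using a_nonneg that by (intro cINF_lower bdd_belowI2[of _ 0]) auto
  have a_Suc: "a x (Suc n) \<le> a x n" if "x \<in> S" for x n
  proof -
    have "q (x \<odot> pow f (Suc n)) = q (f \<odot> (x \<odot> pow f n))"
      using that f by (simp add: pow_Suc mul_left_commute)
    also have "\<dots> \<le> q f * q (x \<odot> pow f n)" using that f by (intro qD(3)) auto
    finally show ?thesis using f(2) by (simp add: a_def field_simps)
  qed
  have a_mono: "a x n \<le> a x m" if "x \<in> S" "m \<le> n" for x m n
    by (rule lift_Suc_antimono_le[of "a x"]) (use a_Suc that in auto)
  have a_add: "a (x + y) n \<le> a x n + a y n" if "x \<in> S" "y \<in> S" for x y n
    using qD(2)[of "x \<odot> pow f n" "y \<odot> pow f n"] that f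
    by (simp add: a_def add_mul divide_right_mono flip: add_divide_distrib)
  have a_mul: "a (x \<odot> y) (m + n) \<le> a x m * a y n" if "x \<in> S" "y \<in> S" for x y m n
  proof -
    have "x \<odot> y \<odot> pow f (m + n) = (x \<odot> pow f m) \<odot> (y \<odot> pow f n)"
      using that f by (simp add: pow_add mul_assoc mul_left_commute)
    then have "q (x \<odot> y \<odot> pow f (m + n)) \<le> q (x \<odot> pow f m) * q (y \<odot> pow f n)"
      using qD(3) that f by simp
    then show ?thesis using f(2) by (simp add: a_def power_add field_simps)
  qed
  have add: "u (x + y) \<le> u x + u y" if xy: "x \<in> S" "y \<in> S" for x y
    unfolding u_def[of x] u_def[of y]
  proof (rule le_INF_add_INF)
    fix m n
    have "u (x + y) \<le> a (x + y) (max m n)" using ule xy by auto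
    also have "\<dots> \<le> a x (max m n) + a y (max m n)" using a_add xy by blast
    also have "\<dots> \<le> a x m + a y n" using xy by (intro add_mono a_mono) auto
    finally show "u (x + y) \<le> a x m + a y n" .
  qed auto
  have mul: "u (x \<odot> y) \<le> u x * u y" if xy: "x \<in> S" "y \<in> S" for x y
    unfolding u_def[of x] u_def[of y]
  proof (rule le_INF_mult_INF)
    show "u (x \<odot> y) \<le> a x m * a y n" for m n
      using ule[of "x \<odot> y" "m + n"] a_mul[OF xy, of m n] xy by auto
  qed (use a_nonneg xy in auto)
  have scl: "u (c *c x) \<le> cmod c * u x" if x: "x \<in> S" for x c
  proof -
    have *: "u (c *c x) \<le> cmod c * a x n" for n
    proof -
      have "u (c *c x) \<le> a (c *c x) n" using ule x by auto
      also have "\<dots> \<le> cmod c * a x n"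
        using qD(4)[of "x \<odot> pow f n" c] x f by (simp add: a_def scale_mul divide_right_mono)
      finally show ?thesis .
    qed
    moreover have "u (c *c x) \<le> 0" if "cmod c = 0"
      using *[of 0] that by simp
    ultimately show ?thesis unfolding u_def[of x] by (intro le_mult_INF) auto
  qed
  have nonneg: "0 \<le> u x" if "x \<in> S" for x
    unfolding u_def using a_nonneg[OF that] by (intro cINF_greatest) auto
  have "submultiplicative_seminorm u"
    unfolding submultiplicative_seminorm_def by (intro conjI ballI allI nonneg add mul scl)
  moreover have "u = (\<lambda>x. INF n. q (x \<odot> pow f n) / q f ^ n)" by (simp add: u_def a_def fun_eq_iff)
  ultimately show "submultiplicative_seminorm (\<lambda>x. INF n. q (x \<odot> pow f n) / q f ^ n)" by simp
  show "\<And>n x. x \<in> S \<Longrightarrow> (INF n. q (x \<odot> pow f n) / q f ^ n) \<le> q (x \<odot> pow f n) / q f ^ n"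
    using ule by (simp add: u_def a_def)
qed

text \<open>
  Among the submultiplicative seminorms below \<open>p\<close> that are at least \<open>r^n\<close> at
  \<open>h^n\<close>, take a minimal one \<open>q\<close>. Replacing \<open>q\<close> by its spectral radius
  shows \<open>q (x^n) = (q x)^n\<close>; localising \<open>q\<close> at \<open>h\<close> shows that
  \<open>h\<close> is multiplicative for \<open>q\<close>, and this makes localisation at any other
  \<open>f\<close> with \<open>q f \<noteq> 0\<close> respect the lower bound at the powers of
  \<open>h\<close>.
\<close>

lemma exists_multiplicative_seminorm:
  assumes p: "submultiplicative_seminorm p" and h: "h \<in> S" and r: "0 < r" "\<And>n. r ^ n \<le> p (pow h n)"
  obtains q where "submultiplicative_seminorm q" "\<And>x. x \<in> S \<Longrightarrow> q x \<le> p x"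
    "\<And>x y. \<lbrakk>x \<in> S; y \<in> S\<rbrakk> \<Longrightarrow> q (x \<odot> y) = q x * q y" "0 < q h" "q \<e> = 1"
proof -
  define F where "F = {q. submultiplicative_seminorm q \<and> (\<forall>x. x \<notin> S \<longrightarrow> q x = 0) \<and>
    (\<forall>x\<in>S. q x \<le> p x) \<and> (\<forall>n. r ^ n \<le> q (pow h n))}"
  have FI: "(\<lambda>x. if x \<in> S then q x else 0) \<in> F"
    if "submultiplicative_seminorm q" "\<And>x. x \<in> S \<Longrightarrow> q x \<le> p x" "\<And>n. r ^ n \<le> q (pow h n)" for q
    using that h unfolding F_def submultiplicative_seminorm_def by auto
  have "\<exists>m\<in>F. \<forall>a\<in>F. a \<le> m \<longrightarrow> a = m"
  proof (rule minimal_element_if_chains_bounded_below)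
    show "F \<noteq> {}" using FI[OF p _ r(2)] by auto
  next
    fix C assume C: "C \<subseteq> F" "C \<noteq> {}" "\<forall>a\<in>C. \<forall>b\<in>C. a \<le> b \<or> b \<le> a"
    have sub: "submultiplicative_seminorm a" if "a \<in> C" for a using that C(1) unfolding F_def by auto
    have le: "(INF q\<in>C. q x) \<le> a x" if "x \<in> S" "a \<in> C" for a x
      using that submultiplicative_seminormD(1)[OF sub] by (intro cINF_lower bdd_belowI2[of _ 0]) auto
    have "(\<lambda>x. if x \<in> S then (INF q\<in>C. q x) else 0) \<in> F"
    proof (rule FI)
      show "submultiplicative_seminorm (\<lambda>x. INF q\<in>C. q x)"
        using C(2,3) sub by (intro chain_infimum_submultiplicative) auto
      obtain a where "a \<in> C" using C(2) by blast
      then show "(INF q\<in>C. q x) \<le> p x" if "x \<in> S" for x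
        using le[OF that] that C(1) unfolding F_def by force
      show "r ^ n \<le> (INF q\<in>C. q (pow h n))" for n
        using C(1,2) unfolding F_def by (intro cINF_greatest) auto
    qed
    moreover have "(\<lambda>x. if x \<in> S then (INF q\<in>C. q x) else 0) \<le> a" if "a \<in> C" for a
      using le that C(1) unfolding F_def le_fun_def by auto
    ultimately show "\<exists>u\<in>F. \<forall>a\<in>C. u \<le> a" by blast
  qed
  then obtain q where qF: "q \<in> F" and min: "\<And>a. a \<in> F \<Longrightarrow> a \<le> q \<Longrightarrow> a = q" by blast
  have q: "submultiplicative_seminorm q" and q_le: "\<And>x. x \<in> S \<Longrightarrow> q x \<le> p x"
    and q_r: "\<And>n. r ^ n \<le> q (pow h n)" and q_out: "\<And>x. x \<notin> S \<Longrightarrow> q x = 0"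
    using qF unfolding F_def by auto
  note qD = submultiplicative_seminormD[OF q]
  have minimal: "q' x = q x"
    if "submultiplicative_seminorm q'" "\<And>x. x \<in> S \<Longrightarrow> q' x \<le> q x" "\<And>n. r ^ n \<le> q' (pow h n)" "x \<in> S" for q' x
  proof -
    have "(\<lambda>x. if x \<in> S then q' x else 0) \<in> F"
      using order_trans[OF that(2) q_le] by (rule FI[OF that(1) _ that(3)])
    moreover have "(\<lambda>x. if x \<in> S then q' x else 0) \<le> q"
      using that(2) q_out by (auto simp: le_fun_def)
    ultimately have "(\<lambda>x. if x \<in> S then q' x else 0) = q" by (rule min)
    from fun_cong[OF this, of x] show ?thesis using that(4) by simp
  qed
  have spec: "spectral_seminorm q x = q x" if "x \<in> S" for x
  proof (rule minimal[OF submultiplicative_spectral_seminorm[OF q] spectral_seminorm_le[OF q] _ that])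
    fix m
    have "(r ^ m) ^ n \<le> q (pow (pow h m) n)" for n
      using q_r[of "m * n"] h by (simp add: pow_pow power_mult)
    then show "r ^ m \<le> spectral_seminorm q (pow h m)"
      using le_growth_rate_if_power_le[of _ q "pow h m" "r ^ m"] h r
      by (intro spectral_seminorm_greatest[OF q]) auto
  qed
  have square: "q (x \<odot> x) = (q x)\<^sup>2" if "x \<in> S" for x
    using spectral_seminorm_square[OF q that] qD(3)[OF that that] that
    by (simp add: spec power2_eq_square)
  have unit: "q \<e> = 1"
  proof -
    have "1 \<le> q \<e>" using q_r[of 0] by simp
    moreover have "q \<e> = (q \<e>)\<^sup>2" using square[of \<e>] by simp
    ultimately show ?thesis by (simp add: power2_eq_square)
  qed
  have pow2: "q (pow x (2 ^ k)) = q x ^ (2 ^ k)" if "x \<in> S" for x k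
  proof (induction k)
    case (Suc k)
    have "pow x (2 ^ Suc k) = pow x (2 ^ k) \<odot> pow x (2 ^ k)"
      using that by (simp add: mult_2 pow_add)
    then show ?case using square[of "pow x (2 ^ k)"] that Suc by (simp add: mult.commute flip: power_mult)
  qed (use that in \<open>simp add: pow_Suc\<close>)
  have q_pow: "q (pow x n) = q x ^ n" if x: "x \<in> S" for x n
  proof (rule antisym)
    show le: "q (pow x n) \<le> q x ^ n" for n using seminorm_pow_le[OF q x] unit by simp
    show "q x ^ n \<le> q (pow x n)"
    proof (cases "q x = 0")
      case False
      then have pos: "0 < q x" using qD(1)[OF x] by simp
      \<comment> \<open>The exact value is known at powers of two only; \<open>2 ^ n = n + k\<close> and \<open>q (x^k) \<le> (q x)^k\<close> give the lower bound.\<close>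
      define k where "k = 2 ^ n - n"
      have k: "2 ^ n = n + k" by (simp add: k_def less_imp_le)
      have "q x ^ n * q x ^ k = q (pow x n \<odot> pow x k)"
        using pow2[OF x, of n] x unfolding k by (simp add: power_add pow_add)
      also have "\<dots> \<le> q (pow x n) * q (pow x k)" using x by (intro qD(3)) auto
      also have "\<dots> \<le> q (pow x n) * q x ^ k" using x le qD(1) by (intro mult_left_mono) auto
      finally show ?thesis using pos by simp
    next
      case True
      then show ?thesis using unit qD(1)[of "pow x n"] x by (cases n) auto
    qed
  qed
  \<comment> \<open>By minimality \<open>q\<close> equals its localisation at \<open>f\<close>, provided that the localisation still respects the lower bound at the powers of \<open>h\<close>.\<close>
  have localise: "q (x \<odot> f) = q x * q f"
    if f: "f \<in> S" "0 < q f" and le: "\<And>m n. r ^ m * q f ^ n \<le> q (pow h m \<odot> pow f n)" and x: "x \<in> S" for f x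
  proof -
    note loc = localised_seminorm_submultiplicative[OF q f]
    have "(INF n. q (x \<odot> pow f n) / q f ^ n) = q x"
    proof (rule minimal[OF loc(1) _ _ x])
      show "(INF n. q (x \<odot> pow f n) / q f ^ n) \<le> q x" if "x \<in> S" for x
        using loc(2)[OF that, of 0] that by simp
      show "r ^ m \<le> (INF n. q (pow h m \<odot> pow f n) / q f ^ n)" for m
        using le f by (intro cINF_greatest) (auto simp: field_simps)
    qed
    then have "q x * q f \<le> q (x \<odot> f)"
      using loc(2)[OF x, of 1] f by (simp add: pow_Suc field_simps)
    then show ?thesis using qD(3)[OF x f(1)] by simp
  qed
  have r_le: "r \<le> q h" using q_r[of 1] h by (simp add: pow_Suc)
  have mul_h: "q (x \<odot> h) = q x * q h" if "x \<in> S" for x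
  proof (rule localise[OF h _ _ that])
    fix m n
    have "r ^ m * q h ^ n \<le> q h ^ m * q h ^ n"
      using r r_le by (intro mult_right_mono power_mono) auto
    also have "\<dots> = q (pow h m \<odot> pow h n)" using q_pow[OF h, of "m + n"] h by (simp add: pow_add power_add)
    finally show "r ^ m * q h ^ n \<le> q (pow h m \<odot> pow h n)" .
  qed (use r r_le in auto)
  have mul_h_pow: "q (x \<odot> pow h m) = q x * q h ^ m" if "x \<in> S" for x m
  proof (induction m)
    case (Suc m)
    have "q (x \<odot> pow h (Suc m)) = q ((x \<odot> pow h m) \<odot> h)"
      using that h by (simp add: pow_Suc mul_assoc mul_commute[of h])
    then show ?case using mul_h Suc that h by (simp add: mult_ac)
  qed (use that in simp)
  have mul: "q (x \<odot> f) = q x * q f" if "x \<in> S" "f \<in> S" for x f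
  proof (cases "q f = 0")
    case True
    then show ?thesis using qD(3)[OF that] qD(1)[of "x \<odot> f"] that by simp
  next
    case False
    then have pos: "0 < q f" using qD(1)[OF that(2)] by simp
    show ?thesis
    proof (rule localise[OF that(2) pos _ that(1)])
      fix m n
      have "r ^ m * q f ^ n \<le> q h ^ m * q f ^ n"
        using r r_le pos by (intro mult_right_mono power_mono) auto
      also have "\<dots> = q (pow f n \<odot> pow h m)"
        using mul_h_pow[of "pow f n" m] q_pow that by simp
      finally show "r ^ m * q f ^ n \<le> q (pow h m \<odot> pow f n)"
        using that h by (simp add: mul_commute)
    qed
  qed
  show thesis using that[OF q q_le mul _ unit] r r_le by simp
qed

end

context commutative_algebra
begin

text \<open>
  If \<open>c \<mapsto> q (y - c *c \<e>)\<close> is bounded below by \<open>m\<close>, then the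
  factorisation \<open>y^(2^i) - \<mu>^(2^i) = \<Prod>\<omega>. (y - \<omega> * \<mu>)\<close> over the
  \<open>2^i\<close>-th roots of unity bounds the factor at \<open>\<mu>\<close> from above. Iterated square
  roots replace the roots of unity.
\<close>

lemma min_modulus_doubling:
  assumes q: "submultiplicative_seminorm q" "q \<e> = 1"
    and mul: "\<And>x y. \<lbrakk>x \<in> S; y \<in> S\<rbrakk> \<Longrightarrow> q (x \<odot> y) = q x * q y"
  shows "\<lbrakk>y \<in> S; 0 \<le> m; \<And>c. m \<le> q (y - c *c \<e>)\<rbrakk> \<Longrightarrow>
    q (y - \<mu> *c \<e>) * m ^ (2 ^ i - 1) \<le> q y ^ (2 ^ i) + cmod \<mu> ^ (2 ^ i)"
proof (induction i arbitrary: y m \<mu>)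
  case 0
  have "q (y + (- \<mu>) *c \<e>) \<le> q y + q ((- \<mu>) *c \<e>)"
    by (rule submultiplicative_seminormD(2)[OF q(1) 0(1) S_closed(4)[OF unit_closed]])
  then show ?case using submultiplicative_seminorm_scale_eq[OF q(1) unit_closed, of "- \<mu>"] q(2) by simp
next
  case (Suc i)
  have factor: "y \<odot> y - b\<^sup>2 *c \<e> = (y - b *c \<e>) \<odot> (y - (- b) *c \<e>)" for b
  proof -
    have "(y + (- b) *c \<e>) \<odot> (y + b *c \<e>)
        = (y \<odot> y + b *c y) + ((- b) *c y + ((- b) * b) *c \<e>)"
      using Suc.prems(1)
      by (simp add: add_mul mul_add scale_mul mul_scale scale_right_distrib del: scale_minus_left mult_minus_left)
    then show ?thesis by (simp add: power2_eq_square scale_right_distrib scale_right_diff_distrib)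
  qed
  then have q_factor: "q (y \<odot> y - b\<^sup>2 *c \<e>) = q (y - b *c \<e>) * q (y - (- b) *c \<e>)" for b
    using mul Suc.prems(1) by (metis S_closed(3,4) unit_closed)
  have "m\<^sup>2 \<le> q (y \<odot> y - c *c \<e>)" for c
  proof -
    have "m * m \<le> q (y - csqrt c *c \<e>) * q (y - (- csqrt c) *c \<e>)"
      using Suc.prems(2) Suc.prems(3)[of "csqrt c"] Suc.prems(3)[of "- csqrt c"]
      by (intro mult_mono') simp_all
    then show ?thesis using q_factor[of "csqrt c"] unfolding power2_csqrt by (simp add: power2_eq_square)
  qed
  then have IH: "q (y \<odot> y - \<mu>\<^sup>2 *c \<e>) * (m\<^sup>2) ^ (2 ^ i - 1) \<le> q (y \<odot> y) ^ (2 ^ i) + cmod (\<mu>\<^sup>2) ^ (2 ^ i)"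
    using Suc.prems by (intro Suc.IH) auto
  obtain k where k: "(2::nat) ^ i = Suc k"
    using gr0_implies_Suc[of "2 ^ i"] by auto
  have "m ^ (2 ^ Suc i - 1) = m * (m\<^sup>2) ^ (2 ^ i - 1)"
    by (simp add: k power_mult)
  then have "q (y - \<mu> *c \<e>) * m ^ (2 ^ Suc i - 1) = (q (y - \<mu> *c \<e>) * m) * (m\<^sup>2) ^ (2 ^ i - 1)"
    by simp
  also have "\<dots> \<le> (q (y - \<mu> *c \<e>) * q (y - (- \<mu>) *c \<e>)) * (m\<^sup>2) ^ (2 ^ i - 1)"
    using Suc.prems(1,2) Suc.prems(3)[of "- \<mu>"] submultiplicative_seminormD(1)[OF q(1)]
    by (intro mult_right_mono mult_left_mono) auto
  also have "\<dots> \<le> q (y \<odot> y) ^ (2 ^ i) + cmod (\<mu>\<^sup>2) ^ (2 ^ i)"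
    using IH q_factor[of \<mu>] by simp
  also have "\<dots> = q y ^ (2 ^ Suc i) + cmod \<mu> ^ (2 ^ Suc i)"
    using mul Suc.prems(1) by (simp add: norm_power power2_eq_square[symmetric] flip: power_mult)
  finally show ?case .
qed

text \<open>
  A form of the Gelfand-Mazur theorem. The function \<open>c \<mapsto> q (x - c *c \<e>)\<close> is
  1-Lipschitz and tends to infinity, so it attains its minimum \<open>m\<close>. If \<open>m > 0\<close>,
  the doubling inequality shows that the minimum spreads to a disc of radius \<open>m / 2\<close> around
  every minimiser, hence arbitrarily far, contradicting the growth at infinity.
\<close>

lemma multiplicative_seminorm_eigenvalue:
  assumes q: "submultiplicative_seminorm q" "q \<e> = 1"
    and mul: "\<And>x y. \<lbrakk>x \<in> S; y \<in> S\<rbrakk> \<Longrightarrow> q (x \<odot> y) = q x * q y" and x: "x \<in> S"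
  obtains c where "q (x - c *c \<e>) = 0"
proof -
  note qD = submultiplicative_seminormD[OF q(1)]
  define g where "g c = q (x - c *c \<e>)" for c
  have scale_unit: "q (c *c \<e>) = cmod c" for c
    using submultiplicative_seminorm_scale_eq[OF q(1) unit_closed] q(2) by simp
  have lip: "g c \<le> g d + cmod (c - d)" for c d
  proof -
    have "g c = q ((x - d *c \<e>) + (d - c) *c \<e>)"
      by (simp add: g_def scale_left_diff_distrib)
    also have "\<dots> \<le> q (x - d *c \<e>) + q ((d - c) *c \<e>)"
      by (rule qD(2)) (use x in auto)
    also have "\<dots> = g d + cmod (c - d)"
      by (simp only: scale_unit g_def norm_minus_commute)
    finally show ?thesis .
  qed
  have g0: "g 0 = q x" by (simp add: g_def)
  have grow: "cmod c - q x \<le> g c" for c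
  proof -
    have "c *c \<e> = x + (- 1) *c (x - c *c \<e>)" by simp
    then have "cmod c \<le> q x + q ((- 1) *c (x - c *c \<e>))"
      using qD(2)[of x "(- 1) *c (x - c *c \<e>)"] x scale_unit by (metis S_closed(3,4) unit_closed)
    then show ?thesis using submultiplicative_seminorm_scale_eq[OF q(1), of "x - c *c \<e>" "-1"] x by (simp add: g_def)
  qed
  have "continuous_on (cball 0 (2 * q x + 1)) g"
  proof (rule lipschitz_on_continuous_on[of 1])
    show "1-lipschitz_on (cball 0 (2 * q x + 1)) g"
      by (rule lipschitz_onI)
        (use lip in \<open>force simp: dist_norm abs_le_iff norm_minus_commute algebra_simps\<close>)+
  qed
  then have "\<exists>c0\<in>cball 0 (2 * q x + 1). \<forall>c\<in>cball 0 (2 * q x + 1). g c0 \<le> g c"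
    using qD(1)[OF x] by (intro continuous_attains_inf) auto
  then obtain c0 where c0: "\<And>c. c \<in> cball 0 (2 * q x + 1) \<Longrightarrow> g c0 \<le> g c" by blast
  have min: "g c0 \<le> g c" for c
  proof (cases "c \<in> cball 0 (2 * q x + 1)")
    case False
    then have "q x \<le> g c" using grow[of c] qD(1)[OF x] by simp
    then show ?thesis using c0[of 0] g0 qD(1)[OF x] by simp
  qed (use c0 in auto)
  define m where "m = g c0"
  have "m = 0"
  proof (rule ccontr)
    assume "m \<noteq> 0"
    then have m: "0 < m" using qD(1)[of "x - c0 *c \<e>"] x by (simp add: m_def g_def)
    have spread: "g d = m" if c: "g c = m" and d: "cmod (d - c) \<le> m / 2" for c d
    proof (rule antisym)
      define y where "y = x - c *c \<e>"
      have y: "y \<in> S" "q y = m" using x c by (auto simp: y_def g_def)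
      have shift: "y - b *c \<e> = x - (c + b) *c \<e>" for b
        by (simp add: y_def scale_left_distrib)
      have "g d \<le> m + m * (1 / 2) ^ i" for i
      proof -
        have "g d * m ^ (2 ^ i - 1) \<le> q y ^ (2 ^ i) + cmod (d - c) ^ (2 ^ i)"
          using min_modulus_doubling[OF q mul y(1), of m "d - c" i] m min shift[of "d - c"]
          by (simp add: shift) (simp add: g_def m_def)
        also have "\<dots> \<le> m ^ (2 ^ i) + (m / 2) ^ (2 ^ i)"
          using d y(2) m by (intro add_mono power_mono) auto
        also have "\<dots> = (m + m * (1 / 2) ^ (2 ^ i)) * m ^ (2 ^ i - 1)"
          using power_Suc[of m "2 ^ i - 1"] by (simp add: power_divide field_simps)
        finally have "g d \<le> m + m * (1 / 2) ^ (2 ^ i)" using m by simp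
        also have "\<dots> \<le> m + m * (1 / 2) ^ i"
          using m less_exp[of i] by (intro add_left_mono mult_left_mono power_decreasing) auto
        finally show ?thesis .
      qed
      moreover have "(\<lambda>i. m + m * (1 / 2) ^ i) \<longlonglongrightarrow> m + m * 0"
        by (intro tendsto_intros) simp
      ultimately show "g d \<le> m" by (intro LIMSEQ_le_const[of _ m]) auto
      show "m \<le> g d" using min m_def by simp
    qed
    \<comment> \<open>Walking in steps of length \<open>m / 2\<close> along a ray keeps the minimal value.\<close>
    have far: "g (c0 + of_real (real k * (m / 2))) = m" for k
    proof (induction k)
      case (Suc k)
      have "real (Suc k) * (m / 2) = real k * (m / 2) + m / 2" by (simp add: field_simps)
      then have "(c0 + of_real (real (Suc k) * (m / 2))) - (c0 + of_real (real k * (m / 2))) = of_real (m / 2)"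
        by (simp only: of_real_add) (simp add: algebra_simps)
      then have "cmod ((c0 + of_real (real (Suc k) * (m / 2))) - (c0 + of_real (real k * (m / 2)))) \<le> m / 2"
        using m by (simp only: norm_of_real)
      then show ?case by (rule spread[OF Suc])
    qed (simp add: m_def)
    have "\<forall>y. \<exists>n. y < real n * (m / 2)" using m by (intro reals_Archimedean3) simp
    then obtain k where k: "m + q x + cmod c0 < real k * (m / 2)" by blast
    have "cmod (of_real (real k * (m / 2))) \<le> cmod (c0 + of_real (real k * (m / 2))) + cmod c0"
      using norm_triangle_ineq4[of "c0 + of_real (real k * (m / 2))" c0] by simp
    moreover have "cmod (of_real (real k * (m / 2))) = real k * (m / 2)"
      using m by (simp only: norm_of_real) simp
    ultimately show False
      using grow[of "c0 + of_real (real k * (m / 2))"] far[of k] k by linarith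
  qed
  then show thesis using that[of c0] by (simp add: m_def g_def)
qed

text \<open>
  Since every \<open>x\<close> differs from some scalar by an element of seminorm \<open>0\<close>, and
  scalars have their usual modulus, sending \<open>x\<close> to this scalar is a homomorphism whose modulus
  is the multiplicative seminorm.
\<close>

theorem exists_character_of_commutative_algebra:
  assumes p: "submultiplicative_seminorm p" and h: "h \<in> S" and r: "0 < r" "\<And>n. r ^ n \<le> p (pow h n)"
  obtains \<phi> :: "'v \<Rightarrow> complex" where
    "\<And>x y. \<lbrakk>x \<in> S; y \<in> S\<rbrakk> \<Longrightarrow> \<phi> (x + y) = \<phi> x + \<phi> y"
    "\<And>x y. \<lbrakk>x \<in> S; y \<in> S\<rbrakk> \<Longrightarrow> \<phi> (x \<odot> y) = \<phi> x * \<phi> y"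
    "\<And>x c. x \<in> S \<Longrightarrow> \<phi> (c *c x) = c * \<phi> x"
    "\<phi> \<e> = 1" "\<And>x. x \<in> S \<Longrightarrow> cmod (\<phi> x) \<le> p x" "\<phi> h \<noteq> 0"
proof -
  obtain q where q: "submultiplicative_seminorm q" "q \<e> = 1" and q_le: "\<And>x. x \<in> S \<Longrightarrow> q x \<le> p x"
    and mul: "\<And>x y. \<lbrakk>x \<in> S; y \<in> S\<rbrakk> \<Longrightarrow> q (x \<odot> y) = q x * q y" and qh: "0 < q h"
    using exists_multiplicative_seminorm[OF p h r] by metis
  note qD = submultiplicative_seminormD[OF q(1)]
  define \<phi> where "\<phi> x = (SOME c. q (x - c *c \<e>) = 0)" for x
  have \<phi>: "q (x - \<phi> x *c \<e>) = 0" if x: "x \<in> S" for x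
  proof -
    obtain c where "q (x - c *c \<e>) = 0" using multiplicative_seminorm_eigenvalue[OF q mul x] by blast
    then show ?thesis unfolding \<phi>_def by (rule someI[of "\<lambda>c. q (x - c *c \<e>) = 0"])
  qed
  have scale_unit: "q (c *c \<e>) = cmod c" for c
    using submultiplicative_seminorm_scale_eq[OF q(1) unit_closed] q(2) by simp
  have null_add: "q (x + y) = 0" if "x \<in> S" "y \<in> S" "q x = 0" "q y = 0" for x y
    using qD(2)[of x y] qD(1)[of "x + y"] that by simp
  have null_scale: "q (c *c x) = 0" if "x \<in> S" "q x = 0" for x c
    using submultiplicative_seminorm_scale_eq[OF q(1) that(1)] that(2) by simp
  have unique: "c = \<phi> x" if "x \<in> S" "q (x - c *c \<e>) = 0" for c x
  proof -
    have "q ((x - c *c \<e>) + (- 1) *c (x - \<phi> x *c \<e>)) = 0"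
      using that \<phi>[OF that(1)] by (intro null_add null_scale) auto
    also have "(x - c *c \<e>) + (- 1) *c (x - \<phi> x *c \<e>) = (\<phi> x - c) *c \<e>"
      by (simp add: scale_left_diff_distrib)
    finally show ?thesis by (simp add: scale_unit)
  qed
  have norm: "cmod (\<phi> x) = q x" if "x \<in> S" for x
  proof (rule antisym)
    have "\<phi> x *c \<e> = x + (- 1) *c (x - \<phi> x *c \<e>)" by simp
    then show "cmod (\<phi> x) \<le> q x"
      using qD(2)[of x "(- 1) *c (x - \<phi> x *c \<e>)"] null_scale[OF _ \<phi>[OF that], of "-1"] that
        scale_unit[of "\<phi> x"] by simp
    show "q x \<le> cmod (\<phi> x)"
      using qD(2)[of "x - \<phi> x *c \<e>" "\<phi> x *c \<e>"] \<phi>[OF that] that scale_unit[of "\<phi> x"] by simp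
  qed
  show thesis
  proof (rule that[of \<phi>])
    show "\<phi> (x + y) = \<phi> x + \<phi> y" if "x \<in> S" "y \<in> S" for x y
    proof (rule unique[symmetric])
      have "q ((x - \<phi> x *c \<e>) + (y - \<phi> y *c \<e>)) = 0"
        using that by (intro null_add \<phi>) auto
      also have "(x - \<phi> x *c \<e>) + (y - \<phi> y *c \<e>) = x + y - (\<phi> x + \<phi> y) *c \<e>"
        by (simp add: scale_left_distrib)
      finally show "q (x + y - (\<phi> x + \<phi> y) *c \<e>) = 0" .
    qed (use that in auto)
    show "\<phi> (x \<odot> y) = \<phi> x * \<phi> y" if "x \<in> S" "y \<in> S" for x y
    proof (rule unique[symmetric])
      have "(x - \<phi> x *c \<e>) \<odot> y = x \<odot> y - \<phi> x *c y"
        using that add_mul[of x "(- \<phi> x) *c \<e>" y] scale_mul[of \<e> y "- \<phi> x"] by simp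
      then have "x \<odot> y - (\<phi> x * \<phi> y) *c \<e> = (x - \<phi> x *c \<e>) \<odot> y + \<phi> x *c (y - \<phi> y *c \<e>)"
        by (simp add: scale_right_diff_distrib)
      moreover have "q ((x - \<phi> x *c \<e>) \<odot> y) = 0" using mul \<phi> that by simp
      moreover have "q (\<phi> x *c (y - \<phi> y *c \<e>)) = 0" using null_scale \<phi> that by simp
      ultimately show "q (x \<odot> y - (\<phi> x * \<phi> y) *c \<e>) = 0" using null_add that by simp
    qed (use that in auto)
    show "\<phi> (c *c x) = c * \<phi> x" if "x \<in> S" for c x
    proof (rule unique[symmetric])
      have "c *c x - (c * \<phi> x) *c \<e> = c *c (x - \<phi> x *c \<e>)" by (simp add: scale_right_diff_distrib)
      then show "q (c *c x - (c * \<phi> x) *c \<e>) = 0" using null_scale \<phi> that by simp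
    qed (use that in auto)
    show "\<phi> \<e> = 1"
    proof (rule unique[symmetric])
      have "\<e> - 1 *c \<e> = 0 *c \<e>" by simp
      then show "q (\<e> - 1 *c \<e>) = 0" using scale_unit[of 0] by simp
    qed auto
    show "cmod (\<phi> x) \<le> p x" if "x \<in> S" for x using norm q_le that by simp
    show "\<phi> h \<noteq> 0" using norm[OF h] qh by auto
  qed
qed

end

section \<open>Length functions with finite values\<close>

lemma ennreal_le_INF_add_INF:
  fixes f g :: "'i \<Rightarrow> ennreal"
  assumes "A \<noteq> {}" "B \<noteq> {}" and le: "\<And>a b. a \<in> A \<Longrightarrow> b \<in> B \<Longrightarrow> c \<le> f a + g b"
  shows "c \<le> (INF a\<in>A. f a) + (INF b\<in>B. g b)"
proof -
  have INF_add: "(INF i\<in>I. h i) + k = (INF i\<in>I. h i + k)" if "I \<noteq> {}" for h :: "'i \<Rightarrow> ennreal" and k I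
    using continuous_at_Inf_mono[of "\<lambda>x. x + k" "h ` I"]
      continuous_add[of "at_right (Inf (h ` I))", of "\<lambda>x. x" "\<lambda>x. k"] that
    by (auto simp: mono_def image_comp o_def)
  have "c \<le> (INF a\<in>A. f a) + g b" if "b \<in> B" for b
    unfolding INF_add[OF assms(1)] using le that by (intro INF_greatest) auto
  then have "c \<le> (INF b\<in>B. g b + (INF a\<in>A. f a))"
    by (intro INF_greatest) (auto simp: add.commute)
  then show ?thesis using INF_add[OF assms(2)] by (simp add: add.commute)
qed

text \<open>
  Take a minimal length function \<open>L\<close> below \<open>l\<close> that agrees with \<open>l\<close>
  where \<open>l\<close> is finite. If \<open>L t = \<infinity>\<close>, one may pay a finite price
  \<open>w\<close> for each factor \<open>t\<close>: the infimum of
  \<open>L (x \<otimes> t^(-i)) + \<bar>i\<bar> * w\<close> over all integers \<open>i\<close> is a length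
  function below \<open>L\<close>, finite at \<open>t\<close>. It agrees with \<open>L\<close> where
  \<open>L\<close> is finite provided \<open>w\<close> is not cheaper than the powers of \<open>t\<close>
  that already have finite length. Their exponents are the multiples of the least positive one
  \<open>m\<close>, so \<open>w = L (t^m)\<close> is enough.
\<close>

lemma (in comm_group) extend_length_function:
  fixes l :: "'a \<Rightarrow> ennreal"
  assumes one: "l \<one> = 0"
    and sub: "\<And>x y. \<lbrakk>x \<in> carrier G; y \<in> carrier G\<rbrakk> \<Longrightarrow> l (x \<otimes> y) \<le> l x + l y"
    and sym: "\<And>x. x \<in> carrier G \<Longrightarrow> l (inv x) = l x"
  obtains L :: "'a \<Rightarrow> ennreal" where
    "L \<one> = 0"
    "\<And>x y. \<lbrakk>x \<in> carrier G; y \<in> carrier G\<rbrakk> \<Longrightarrow> L (x \<otimes> y) \<le> L x + L y"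
    "\<And>x. x \<in> carrier G \<Longrightarrow> L (inv x) = L x"
    "\<And>x. x \<in> carrier G \<Longrightarrow> L x < \<infinity>"
    "\<And>x. x \<in> carrier G \<Longrightarrow> L x \<le> l x"
    "\<And>x. \<lbrakk>x \<in> carrier G; l x < \<infinity>\<rbrakk> \<Longrightarrow> L x = l x"
proof -
  define F where "F = {L :: 'a \<Rightarrow> ennreal. (\<forall>x. x \<notin> carrier G \<longrightarrow> L x = 0) \<and> L \<one> = 0 \<and>
    (\<forall>x\<in>carrier G. \<forall>y\<in>carrier G. L (x \<otimes> y) \<le> L x + L y) \<and> (\<forall>x\<in>carrier G. L (inv x) = L x) \<and>
    (\<forall>x\<in>carrier G. L x \<le> l x) \<and> (\<forall>x\<in>carrier G. l x < \<infinity> \<longrightarrow> L x = l x)}"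
  have FI: "(\<lambda>x. if x \<in> carrier G then L x else 0) \<in> F"
    if "L \<one> = 0" "\<And>x y. \<lbrakk>x \<in> carrier G; y \<in> carrier G\<rbrakk> \<Longrightarrow> L (x \<otimes> y) \<le> L x + L y"
      "\<And>x. x \<in> carrier G \<Longrightarrow> L (inv x) = L x"
      "\<And>x. x \<in> carrier G \<Longrightarrow> L x \<le> l x"
      "\<And>x. \<lbrakk>x \<in> carrier G; l x < \<infinity>\<rbrakk> \<Longrightarrow> L x = l x" for L
    using that unfolding F_def by auto
  have "\<exists>m\<in>F. \<forall>a\<in>F. a \<le> m \<longrightarrow> a = m"
  proof (rule minimal_element_if_chains_bounded_below)
    show "F \<noteq> {}" using FI[OF one sub sym] by auto
  next
    fix C assume C: "C \<subseteq> F" "C \<noteq> {}" "\<forall>a\<in>C. \<forall>b\<in>C. a \<le> b \<or> b \<le> a"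
    define u where "u x = (INF q\<in>C. q x)" for x
    have ule: "u x \<le> q x" if "q \<in> C" for x q
      unfolding u_def using that by (rule INF_lower)
    have CF: "q x \<le> l x" "l x < \<infinity> \<Longrightarrow> q x = l x" "q \<one> = 0" "q (inv x) = q x"
      if "q \<in> C" "x \<in> carrier G" for q x
      using that C(1) unfolding F_def by auto
    have "(\<lambda>x. if x \<in> carrier G then u x else 0) \<in> F"
    proof (rule FI)
      obtain q where q: "q \<in> C" using C(2) by blast
      show "u \<one> = 0" using ule[OF q, of \<one>] CF(3)[OF q one_closed] by simp
      show "u (inv x) = u x" if "x \<in> carrier G" for x
        unfolding u_def using CF(4) that by (intro INF_cong) auto
      show "u x \<le> l x" if "x \<in> carrier G" for x
        using C(2) ule CF(1)[OF _ that] order_trans by fastforce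
      show "u x = l x" if "x \<in> carrier G" "l x < \<infinity>" for x
      proof (rule antisym)
        show "u x \<le> l x" using ule[OF q, of x] CF(1)[OF q that(1)] by simp
        show "l x \<le> u x" unfolding u_def using CF(2)[OF _ that(1)] that(2) by (intro INF_greatest) simp
      qed
      fix x y assume xy: "x \<in> carrier G" "y \<in> carrier G"
      have le: "u (x \<otimes> y) \<le> a x + b y" if ab: "a \<in> C" "b \<in> C" for a b
      proof -
        obtain q where q: "q \<in> C" "q \<le> a" "q \<le> b" using C(3) ab by blast
        have "u (x \<otimes> y) \<le> q (x \<otimes> y)" using ule q by blast
        also have "\<dots> \<le> q x + q y" using q C xy unfolding F_def by blast
        also have "\<dots> \<le> a x + b y" using q by (intro add_mono) (auto simp: le_fun_def)
        finally show ?thesis .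
      qed
      then show "u (x \<otimes> y) \<le> u x + u y"
        unfolding u_def[of x] u_def[of y] using C(2) by (intro ennreal_le_INF_add_INF) auto
    qed
    moreover have "(\<lambda>x. if x \<in> carrier G then u x else 0) \<le> q" if "q \<in> C" for q
      using ule[OF that] by (auto simp: le_fun_def)
    ultimately show "\<exists>u\<in>F. \<forall>a\<in>C. u \<le> a" by blast
  qed
  then obtain L where LF: "L \<in> F" and min: "\<And>a. a \<in> F \<Longrightarrow> a \<le> L \<Longrightarrow> a = L" by blast
  have L: "L \<one> = 0" "\<And>x y. \<lbrakk>x \<in> carrier G; y \<in> carrier G\<rbrakk> \<Longrightarrow> L (x \<otimes> y) \<le> L x + L y"
      "\<And>x. x \<in> carrier G \<Longrightarrow> L (inv x) = L x"
      "\<And>x. x \<in> carrier G \<Longrightarrow> L x \<le> l x"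
      "\<And>x. \<lbrakk>x \<in> carrier G; l x < \<infinity>\<rbrakk> \<Longrightarrow> L x = l x" "\<And>x. x \<notin> carrier G \<Longrightarrow> L x = 0"
    using LF unfolding F_def by auto
  have fin: "L t < \<infinity>" if t: "t \<in> carrier G" for t
  proof (rule ccontr)
    assume "\<not> L t < \<infinity>"
    have L_npow: "L (x [^] n) \<le> of_nat n * L x" if "x \<in> carrier G" for x and n :: nat
    proof (induction n)
      case (Suc n)
      have "L (x [^] n \<otimes> x) \<le> L (x [^] n) + L x" using that by (intro L(2)) auto
      also have "\<dots> \<le> of_nat n * L x + L x" using Suc by (intro add_mono) auto
      finally show ?case by (simp add: distrib_right add.commute)
    qed (use L(1) in simp)
    have L_pow: "L (x [^] i) \<le> of_nat (nat \<bar>i\<bar>) * L x" if "x \<in> carrier G" for x and i :: int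
    proof (cases "0 \<le> i")
      case True
      then have "x [^] i = x [^] (nat i)" by (metis int_nat_eq int_pow_int nat_0_le)
      then show ?thesis using True L_npow[OF that, of "nat i"] by simp
    next
      case False
      then have "x [^] i = inv (x [^] (nat (- i)))"
        using that by (metis int_pow_def2 not_le)
      then show ?thesis using False L_npow[OF that, of "nat (- i)"] L(3) that by simp
    qed
    \<comment> \<open>The price \<open>w\<close> of one factor \<open>t\<close>. If no nonzero power of \<open>t\<close> has finite length, even \<open>w = 0\<close> works.\<close>
    obtain w :: ennreal where w: "w < \<infinity>" "\<And>i::int. L (t [^] i) < \<infinity> \<Longrightarrow> L (t [^] i) \<le> of_nat (nat \<bar>i\<bar>) * w"
    proof (cases "\<exists>m>0. L (t [^] (m::nat)) < \<infinity>")
      case False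
      show thesis
      proof (rule that[of 0])
        fix i :: int assume i: "L (t [^] i) < \<infinity>"
        have "L (t [^] nat \<bar>i\<bar>) = L (t [^] i)"
        proof (cases "0 \<le> i")
          case True
          then show ?thesis by (metis abs_of_nonneg int_pow_int nat_0_le)
        next
          case neg: False
          then have "t [^] i = inv (t [^] (nat (- i)))"
            using t by (metis int_pow_def2 not_le)
          then show ?thesis using neg L(3) t by simp
        qed
        then have "nat \<bar>i\<bar> = 0" using False i by (metis gr0I)
        then show "L (t [^] i) \<le> of_nat (nat \<bar>i\<bar>) * 0" using L(1) by simp
      qed auto
    next
      case True
      define m where "m = (LEAST m. 0 < m \<and> L (t [^] (m::nat)) < \<infinity>)"
      have m: "0 < m" "L (t [^] m) < \<infinity>" using LeastI_ex[OF True] unfolding m_def by auto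
      have least: "\<not> L (t [^] k) < \<infinity>" if "0 < k" "k < m" for k
        using not_less_Least[of k "\<lambda>m. 0 < m \<and> L (t [^] (m::nat)) < \<infinity>"] that unfolding m_def by auto
      show thesis
      proof (rule that[of "L (t [^] m)"])
        fix i :: int assume i: "L (t [^] i) < \<infinity>"
        define j k where "j = i mod int m" and "k = i div int m"
        have i_eq: "i = int m * k + j" by (simp add: j_def k_def)
        have j: "0 \<le> j" "j < int m" using m by (auto simp: j_def)
        have mk: "t [^] (int m * k) = (t [^] m) [^] k" using int_pow_pow[OF t, of "int m" k] by (simp add: int_pow_int)
        have "t [^] j = t [^] i \<otimes> inv ((t [^] m) [^] k)"
        proof -
          have "t [^] i = (t [^] m) [^] k \<otimes> t [^] j" using t by (simp add: i_eq int_pow_mult mk)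
          then show ?thesis using t by (simp add: m_comm[of "(t [^] m) [^] k"] m_assoc)
        qed
        then have "L (t [^] j) \<le> L (t [^] i) + L ((t [^] m) [^] k)"
          using L(2)[of "t [^] i" "inv ((t [^] m) [^] k)"] L(3) t by simp
        also have "\<dots> < \<infinity>"
        proof -
          have "L ((t [^] m) [^] k) \<le> of_nat (nat \<bar>k\<bar>) * L (t [^] m)" using t by (intro L_pow) auto
          also have "\<dots> < \<infinity>" using m(2) by (simp add: ennreal_mult_less_top of_nat_less_top)
          finally show ?thesis using i by (simp add: less_top)
        qed
        finally have "L (t [^] (nat j)) < \<infinity>" using j by (metis int_pow_int nat_0_le)
        then have "j = 0" using least[of "nat j"] j by force
        then have "L (t [^] i) \<le> of_nat (nat \<bar>k\<bar>) * L (t [^] m)"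
          using L_pow[of "t [^] m" k] t mk i_eq by simp
        also have "\<dots> \<le> of_nat (nat \<bar>i\<bar>) * L (t [^] m)"
        proof -
          have "\<bar>k\<bar> \<le> \<bar>i\<bar>" using i_eq \<open>j = 0\<close> m(1) by (simp add: abs_mult mult_le_cancel_right1)
          then show ?thesis by (intro mult_right_mono) auto
        qed
        finally show "L (t [^] i) \<le> of_nat (nat \<bar>i\<bar>) * L (t [^] m)" .
      qed (use m in auto)
    qed
    define L' where "L' x = (INF i::int. L (x \<otimes> t [^] (- i)) + of_nat (nat \<bar>i\<bar>) * w)" for x
    have L'le: "L' x \<le> L (x \<otimes> t [^] (- i)) + of_nat (nat \<bar>i\<bar>) * w" for x i
      unfolding L'_def by (rule INF_lower) simp
    have L'L: "L' x \<le> L x" if "x \<in> carrier G" for x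
      using L'le[of x 0] that by simp
    have L'_fin: "L x \<le> L' x" if x: "x \<in> carrier G" and "L x < \<infinity>" for x
      unfolding L'_def
    proof (rule INF_greatest)
      fix i :: int
      show "L x \<le> L (x \<otimes> t [^] (- i)) + of_nat (nat \<bar>i\<bar>) * w"
      proof (cases "L (x \<otimes> t [^] (- i)) < \<infinity>")
        case True
        have "t [^] i = inv (x \<otimes> t [^] (- i)) \<otimes> x"
          using x t by (simp add: inv_mult int_pow_neg m_assoc m_comm[of "t [^] i"] inv_solve_left)
        then have "L (t [^] i) \<le> L (x \<otimes> t [^] (- i)) + L x"
          using L(2)[of "inv (x \<otimes> t [^] (- i))" x] L(3) x t by simp
        then have "L (t [^] i) < \<infinity>" using True \<open>L x < \<infinity>\<close> by (simp add: less_top order_le_less_trans)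
        then have le: "L (t [^] i) \<le> of_nat (nat \<bar>i\<bar>) * w" by (rule w(2))
        have "x = (x \<otimes> t [^] (- i)) \<otimes> t [^] i" using x t by (simp add: int_pow_neg m_assoc)
        then have "L x \<le> L (x \<otimes> t [^] (- i)) + L (t [^] i)"
          using L(2)[of "x \<otimes> t [^] (- i)" "t [^] i"] x t by simp
        then show ?thesis using le by (meson add_left_mono order_trans)
      next
        case False
        then have "L (x \<otimes> t [^] (- i)) = \<infinity>" by (simp add: less_top[symmetric])
        then show ?thesis by simp
      qed
    qed
    have "(\<lambda>x. if x \<in> carrier G then L' x else 0) \<in> F"
    proof (rule FI)
      show "L' \<one> = 0" using L'L[of \<one>] L(1) by simp
      show "L' x \<le> l x" if "x \<in> carrier G" for x using L'L[OF that] L(4)[OF that] by simp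
      show "L' x = l x" if "x \<in> carrier G" "l x < \<infinity>" for x
        using L'L[OF that(1)] L'_fin[OF that(1)] L(5)[OF that] that(2) by auto
      show "L' (x \<otimes> y) \<le> L' x + L' y" if xy: "x \<in> carrier G" "y \<in> carrier G" for x y
      proof -
        have le: "L' (x \<otimes> y) \<le> (L (x \<otimes> t [^] (- i)) + of_nat (nat \<bar>i\<bar>) * w) + (L (y \<otimes> t [^] (- j)) + of_nat (nat \<bar>j\<bar>) * w)"
          for i j :: int
        proof -
          have "(x \<otimes> y) \<otimes> t [^] (- (i + j)) = (x \<otimes> t [^] (- i)) \<otimes> (y \<otimes> t [^] (- j))"
            using xy t by (simp add: int_pow_neg int_pow_mult inv_mult m_ac del: minus_add_distrib)
          then have "L' (x \<otimes> y) \<le> L ((x \<otimes> t [^] (- i)) \<otimes> (y \<otimes> t [^] (- j))) + of_nat (nat \<bar>i + j\<bar>) * w"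
            using L'le[of "x \<otimes> y" "i + j"] by simp
          also have "\<dots> \<le> (L (x \<otimes> t [^] (- i)) + L (y \<otimes> t [^] (- j))) + (of_nat (nat \<bar>i\<bar>) + of_nat (nat \<bar>j\<bar>)) * w"
          proof (rule add_mono)
            show "L ((x \<otimes> t [^] (- i)) \<otimes> (y \<otimes> t [^] (- j))) \<le> L (x \<otimes> t [^] (- i)) + L (y \<otimes> t [^] (- j))"
              using xy t by (intro L(2)) auto
            have "nat \<bar>i + j\<bar> \<le> nat \<bar>i\<bar> + nat \<bar>j\<bar>" by linarith
            then show "of_nat (nat \<bar>i + j\<bar>) * w \<le> (of_nat (nat \<bar>i\<bar>) + of_nat (nat \<bar>j\<bar>)) * w"
              by (intro mult_right_mono) (simp_all flip: of_nat_add)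
          qed
          finally show ?thesis by (simp add: distrib_right add_ac)
        qed
        then show ?thesis
          unfolding L'_def[of x] L'_def[of y] by (intro ennreal_le_INF_add_INF) auto
      qed
      show "L' (inv x) = L' x" if x: "x \<in> carrier G" for x
      proof -
        have "L' (inv y) \<le> L' y" if y: "y \<in> carrier G" for y
          unfolding L'_def[of y]
        proof (rule INF_greatest)
          fix i :: int
          have "inv y \<otimes> t [^] (- (- i)) = inv (y \<otimes> t [^] (- i))"
            using y t by (simp add: inv_mult int_pow_neg)
          then show "L' (inv y) \<le> L (y \<otimes> t [^] (- i)) + of_nat (nat \<bar>i\<bar>) * w"
            using L'le[of "inv y" "- i"] L(3)[of "y \<otimes> t [^] (- i)"] y t by simp
        qed
        from this[OF x] this[of "inv x"] x show ?thesis by (intro antisym) auto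
      qed
    qed
    moreover have "(\<lambda>x. if x \<in> carrier G then L' x else 0) \<le> L"
      using L'L L(6) by (auto simp: le_fun_def)
    ultimately have "(\<lambda>x. if x \<in> carrier G then L' x else 0) = L" by (rule min)
    from fun_cong[OF this, of t] have "L t = L' t" using t by simp
    also have "\<dots> \<le> w" using L'le[of t 1] t L(1) by (simp add: int_pow_neg)
    finally show False using \<open>\<not> L t < \<infinity>\<close> w(1) by (simp add: less_top order_le_less_trans)
  qed
  show thesis using that L fin by blast
qed

section \<open>Neighbourhoods in topological groups\<close>

context topological_group
begin

lemma topspace [simp]: "topspace T = carrier G"
  by (rule topspace_eq_carrier)

lemma open_subset_carrier: "openin T U \<Longrightarrow> U \<subseteq> carrier G"
  using openin_subset by fastforce

lemma compact_subset_carrier: "compactin T K \<Longrightarrow> K \<subseteq> carrier G"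
  using compactin_subset_topspace by fastforce

lemma continuous_map_translate: "a \<in> carrier G \<Longrightarrow> continuous_map T T (\<lambda>x. a \<otimes> x)"
proof -
  assume a: "a \<in> carrier G"
  have "continuous_map T (prod_topology T T) (\<lambda>x. (a, x))"
    using a by (intro continuous_map_pairedI) auto
  from continuous_map_compose[OF this continuous_mult] show ?thesis by (simp add: o_def)
qed

lemma openin_translate:
  "\<lbrakk>openin T U; a \<in> carrier G\<rbrakk> \<Longrightarrow> openin T {x \<in> carrier G. a \<otimes> x \<in> U}"
  using openin_continuous_map_preimage[OF continuous_map_translate] by simp

lemma openin_inverse: "openin T U \<Longrightarrow> openin T {x \<in> carrier G. inv x \<in> U}"
  using openin_continuous_map_preimage[OF continuous_inv] by simp

lemma square_root_neighbourhood:
  assumes "openin T U" "\<one> \<in> U"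
  obtains V where "openin T V" "\<one> \<in> V" "V \<subseteq> U" "\<And>x. x \<in> V \<Longrightarrow> inv x \<in> V"
    "\<And>x y. \<lbrakk>x \<in> V; y \<in> V\<rbrakk> \<Longrightarrow> x \<otimes> y \<in> U"
proof -
  have "openin (prod_topology T T) {p \<in> topspace (prod_topology T T). (\<lambda>(x, y). x \<otimes> y) p \<in> U}"
    using openin_continuous_map_preimage[OF continuous_mult assms(1)] .
  moreover have "(\<one>, \<one>) \<in> {p \<in> topspace (prod_topology T T). (\<lambda>(x, y). x \<otimes> y) p \<in> U}"
    using assms(2) by simp
  ultimately obtain A B where AB: "openin T A" "openin T B" "\<one> \<in> A" "\<one> \<in> B"
    "A \<times> B \<subseteq> {p \<in> topspace (prod_topology T T). (\<lambda>(x, y). x \<otimes> y) p \<in> U}"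
    unfolding openin_prod_topology_alt by meson
  define W where "W = A \<inter> B \<inter> U"
  define V where "V = W \<inter> {x \<in> carrier G. inv x \<in> W}"
  have W: "openin T W" "\<one> \<in> W" using AB assms by (auto simp: W_def)
  show thesis
  proof (rule that[of V])
    show "openin T V" unfolding V_def using W openin_inverse by blast
    show "\<one> \<in> V" "V \<subseteq> U" using W by (auto simp: V_def W_def)
    show "inv x \<in> V" if "x \<in> V" for x using that by (auto simp: V_def)
    show "x \<otimes> y \<in> U" if "x \<in> V" "y \<in> V" for x y
      using that AB(5) by (auto simp: V_def W_def)
  qed
qed

text \<open>
  The neighbourhood may depend on the centre \<open>z\<close>; this flexibility is what uniform continuity
  needs.
\<close>

lemma compact_finitely_many_translates:
  assumes K: "compactin T K" and V: "\<And>z. z \<in> K \<Longrightarrow> openin T (V z) \<and> \<one> \<in> V z"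
  obtains Z where "finite Z" "Z \<subseteq> K" "\<And>x. x \<in> K \<Longrightarrow> \<exists>z\<in>Z. inv z \<otimes> x \<in> V z"
proof -
  define U where "U z = {x \<in> carrier G. inv z \<otimes> x \<in> V z}" for z
  note KG = compact_subset_carrier[OF K]
  have "\<And>u. u \<in> U ` K \<Longrightarrow> openin T u"
    using openin_translate V KG unfolding U_def by blast
  moreover have "K \<subseteq> \<Union> (U ` K)"
  proof
    fix x assume "x \<in> K"
    then have "x \<in> U x" using V KG by (auto simp: U_def)
    then show "x \<in> \<Union> (U ` K)" using \<open>x \<in> K\<close> by blast
  qed
  ultimately obtain \<F> where "finite \<F>" "\<F> \<subseteq> U ` K" "K \<subseteq> \<Union>\<F>"
    using compactinD[OF K, of "U ` K"] by blast
  then obtain Z where Z: "Z \<subseteq> K" "finite Z" "\<F> = U ` Z"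
    using finite_subset_image by metis
  show thesis using that[OF Z(2,1)] Z(3) \<open>K \<subseteq> \<Union>\<F>\<close> by (auto simp: U_def)
qed

end

context locally_compact_abelian_group
begin

lemma compact_neighbourhood_of_one:
  obtains U K where "openin T U" "\<one> \<in> U" "U \<subseteq> K" "compactin T K"
proof -
  have "\<one> \<in> topspace T" by simp
  then have "\<exists>U K. openin T U \<and> compactin T K \<and> \<one> \<in> U \<and> U \<subseteq> K"
    using locally_compact unfolding locally_compact_space_def by blast
  then show thesis using that by blast
qed

end


section \<open>The dual group\<close>

lemma continuous_map_euclidean_compose:
  assumes "continuous_map X euclidean f" "continuous_on UNIV h"
  shows "continuous_map X euclidean (\<lambda>x. h (f x))"
  using continuous_map_compose[of X euclidean f euclidean h] assms by (simp add: o_def)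

lemma continuous_map_euclidean_compose2:
  assumes "continuous_map X euclidean f" "continuous_map X euclidean g" "continuous_on UNIV (\<lambda>p. h (fst p) (snd p))"
  shows "continuous_map X euclidean (\<lambda>x. h (f x) (g x))"
proof -
  have "continuous_map X (prod_topology euclidean euclidean) (\<lambda>x. (f x, g x))"
    by (intro continuous_map_pairedI assms)
  then have "continuous_map X euclidean (\<lambda>x. (f x, g x))"
    by (simp add: euclidean_product_topology)
  from continuous_map_euclidean_compose[OF this assms(3)] show ?thesis by simp
qed

lemma continuous_map_mult_complex:
  fixes f g :: "'a \<Rightarrow> complex"
  assumes "continuous_map X euclidean f" "continuous_map X euclidean g"
  shows "continuous_map X euclidean (\<lambda>x. f x * g x)"
  by (rule continuous_map_euclidean_compose2[OF assms]) (intro continuous_intros)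

lemma continuous_map_diff_normed:
  fixes f g :: "'a \<Rightarrow> 'b::real_normed_vector"
  assumes "continuous_map X euclidean f" "continuous_map X euclidean g"
  shows "continuous_map X euclidean (\<lambda>x. f x - g x)"
  by (rule continuous_map_euclidean_compose2[OF assms]) (intro continuous_intros)

context topological_group
begin

abbreviation dual (\<open>\<D>\<close>) where "\<D> \<equiv> dual_group G T"
abbreviation dual_top (\<open>\<T>\<close>) where "\<T> \<equiv> dual_topology G T"

lemma continuous_map_circle:
  "continuous_map T circle_topology f \<longleftrightarrow> continuous_map T euclidean f \<and> (\<forall>x\<in>carrier G. norm (f x) = 1)"
  unfolding circle_topology_def by (auto simp: continuous_map_in_subtopology)

lemma dual_carrier_iff:
  "\<phi> \<in> carrier \<D> \<longleftrightarrow> \<phi> \<in> extensional (carrier G) \<and> (\<forall>x\<in>carrier G. norm (\<phi> x) = 1) \<and>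
     (\<forall>x\<in>carrier G. \<forall>y\<in>carrier G. \<phi> (x \<otimes> y) = \<phi> x * \<phi> y) \<and> continuous_map T euclidean \<phi>"
  by (auto simp: dual_group_def hom_def circle_group_def continuous_map_circle)

lemma dualD:
  assumes "\<phi> \<in> carrier \<D>"
  shows "\<phi> \<in> extensional (carrier G)" and "x \<in> carrier G \<Longrightarrow> norm (\<phi> x) = 1"
    and "\<lbrakk>x \<in> carrier G; y \<in> carrier G\<rbrakk> \<Longrightarrow> \<phi> (x \<otimes> y) = \<phi> x * \<phi> y"
    and "continuous_map T euclidean \<phi>"
  using assms by (auto simp: dual_carrier_iff)

lemma character_one [simp]:
  assumes "\<phi> \<in> carrier \<D>"
  shows "\<phi> \<one> = 1"
proof -
  have "\<phi> \<one> = \<phi> \<one> * \<phi> \<one>" using dualD(3)[OF assms, of \<one> \<one>] by simp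
  moreover have "\<phi> \<one> \<noteq> 0" using dualD(2)[OF assms, of \<one>] by auto
  ultimately show ?thesis by simp
qed

lemma dual_mult [simp]: "x \<in> carrier G \<Longrightarrow> (\<phi> \<otimes>\<^bsub>\<D>\<^esub> \<psi>) x = \<phi> x * \<psi> x"
  and dual_one [simp]: "x \<in> carrier G \<Longrightarrow> \<one>\<^bsub>\<D>\<^esub> x = 1"
  by (simp_all add: dual_group_def)

lemma dual_eqI:
  assumes "\<phi> \<in> carrier \<D>" "\<psi> \<in> carrier \<D>" "\<And>x. x \<in> carrier G \<Longrightarrow> \<phi> x = \<psi> x"
  shows "\<phi> = \<psi>"
  using assms dualD(1) extensionalityI by metis

lemma dual_mult_closed:
  assumes "\<phi> \<in> carrier \<D>" "\<psi> \<in> carrier \<D>"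
  shows "\<phi> \<otimes>\<^bsub>\<D>\<^esub> \<psi> \<in> carrier \<D>"
proof -
  have "continuous_map T euclidean (\<lambda>x. \<phi> x * \<psi> x)"
    using dualD(4)[OF assms(1)] dualD(4)[OF assms(2)] by (rule continuous_map_mult_complex)
  then have "continuous_map T euclidean (\<phi> \<otimes>\<^bsub>\<D>\<^esub> \<psi>)" by (rule continuous_map_eq) simp
  then show ?thesis
    unfolding dual_carrier_iff using dualD(2,3)[OF assms(1)] dualD(2,3)[OF assms(2)]
    by (auto simp: norm_mult) (simp add: dual_group_def)
qed

lemma dual_one_closed: "\<one>\<^bsub>\<D>\<^esub> \<in> carrier \<D>"
proof -
  have "continuous_map T euclidean (\<one>\<^bsub>\<D>\<^esub> :: 'a \<Rightarrow> complex)"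
    by (rule continuous_map_eq[of T euclidean "\<lambda>x. 1"]) auto
  then show ?thesis unfolding dual_carrier_iff by auto (simp add: dual_group_def)
qed

lemma dual_cnj_closed:
  assumes "\<phi> \<in> carrier \<D>"
  shows "(\<lambda>x\<in>carrier G. cnj (\<phi> x)) \<in> carrier \<D>"
proof -
  have "continuous_map T euclidean (\<lambda>x. cnj (\<phi> x))"
    using dualD(4)[OF assms] by (rule continuous_map_euclidean_compose) (intro continuous_intros)
  then have "continuous_map T euclidean (\<lambda>x\<in>carrier G. cnj (\<phi> x))" by (rule continuous_map_eq) simp
  then show ?thesis unfolding dual_carrier_iff using dualD(2,3)[OF assms] by auto
qed

lemma comm_group_dual: "comm_group \<D>"
proof (rule comm_groupI)
  show "\<exists>\<psi>\<in>carrier \<D>. \<psi> \<otimes>\<^bsub>\<D>\<^esub> \<phi> = \<one>\<^bsub>\<D>\<^esub>" if "\<phi> \<in> carrier \<D>" for \<phi>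
  proof (rule bexI[OF _ dual_cnj_closed[OF that]])
    show "(\<lambda>x\<in>carrier G. cnj (\<phi> x)) \<otimes>\<^bsub>\<D>\<^esub> \<phi> = \<one>\<^bsub>\<D>\<^esub>"
      using that dualD(2)[OF that]
      by (intro dual_eqI dual_mult_closed dual_one_closed dual_cnj_closed)
         (auto simp: complex_norm_square[symmetric] mult.commute)
  qed
next
  fix \<phi> \<psi> \<theta> assume *: "\<phi> \<in> carrier \<D>" "\<psi> \<in> carrier \<D>" "\<theta> \<in> carrier \<D>"
  show "\<phi> \<otimes>\<^bsub>\<D>\<^esub> \<psi> \<otimes>\<^bsub>\<D>\<^esub> \<theta> = \<phi> \<otimes>\<^bsub>\<D>\<^esub> (\<psi> \<otimes>\<^bsub>\<D>\<^esub> \<theta>)"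
    by (rule dual_eqI) (simp_all add: * dual_mult_closed mult.assoc)
next
  fix \<phi> \<psi> assume *: "\<phi> \<in> carrier \<D>" "\<psi> \<in> carrier \<D>"
  show "\<phi> \<otimes>\<^bsub>\<D>\<^esub> \<psi> = \<psi> \<otimes>\<^bsub>\<D>\<^esub> \<phi>"
    by (rule dual_eqI) (simp_all add: * dual_mult_closed mult.commute)
next
  fix \<phi> assume *: "\<phi> \<in> carrier \<D>"
  show "\<one>\<^bsub>\<D>\<^esub> \<otimes>\<^bsub>\<D>\<^esub> \<phi> = \<phi>"
    by (rule dual_eqI) (simp_all add: * dual_mult_closed dual_one_closed)
qed (simp_all add: dual_mult_closed dual_one_closed)

sublocale dual: comm_group \<D>
  by (rule comm_group_dual)

lemma dual_inv [simp]:
  assumes "\<phi> \<in> carrier \<D>" "x \<in> carrier G"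
  shows "(inv\<^bsub>\<D>\<^esub> \<phi>) x = cnj (\<phi> x)"
proof -
  have "(\<lambda>x\<in>carrier G. cnj (\<phi> x)) \<otimes>\<^bsub>\<D>\<^esub> \<phi> = \<one>\<^bsub>\<D>\<^esub>"
    using assms dualD(2)[OF assms(1)]
    by (intro dual_eqI dual_mult_closed dual_one_closed dual_cnj_closed)
       (auto simp: complex_norm_square[symmetric] mult.commute)
  then have "inv\<^bsub>\<D>\<^esub> \<phi> = (\<lambda>x\<in>carrier G. cnj (\<phi> x))"
    using dual.inv_equality dual_cnj_closed assms by blast
  then show ?thesis using assms(2) by simp
qed

lemma norm_quotient_minus_one:
  assumes "\<phi> \<in> carrier \<D>" "\<psi> \<in> carrier \<D>" "x \<in> carrier G"
  shows "norm ((inv\<^bsub>\<D>\<^esub> \<phi> \<otimes>\<^bsub>\<D>\<^esub> \<psi>) x - 1) = norm (\<psi> x - \<phi> x)"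
proof -
  have 1: "\<phi> x * cnj (\<phi> x) = 1" using dualD(2)[OF assms(1,3)] by (simp add: complex_norm_square[symmetric])
  have "norm (\<psi> x - \<phi> x) = norm (\<phi> x * (cnj (\<phi> x) * \<psi> x - 1))"
    using 1 by (simp add: right_diff_distrib mult.assoc[symmetric])
  then show ?thesis using assms dualD(2)[OF assms(1,3)] by (simp add: norm_mult)
qed

lemma topspace_dual [simp]: "topspace \<T> = carrier \<D>"
proof -
  have "carrier \<D> \<subseteq> topspace (compact_open_topology T circle_topology)"
  proof
    fix \<phi> assume \<phi>: "\<phi> \<in> carrier \<D>"
    have "\<phi> \<in> {f \<in> extensional (topspace T). continuous_map T circle_topology f \<and> f ` {} \<subseteq> {}}"
      using dualD[OF \<phi>] continuous_map_circle by auto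
    then show "\<phi> \<in> topspace (compact_open_topology T circle_topology)"
      unfolding compact_open_topology_def topology_generated_by_topspace
      using compactin_empty openin_empty by blast
  qed
  then show ?thesis unfolding dual_topology_def by auto
qed

lemma openin_dual_subbasic:
  assumes "compactin T K" "open U"
  shows "openin \<T> {\<phi> \<in> carrier \<D>. \<phi> ` K \<subseteq> U}"
proof -
  define B where "B = {f \<in> extensional (topspace T). continuous_map T circle_topology f \<and> f ` K \<subseteq> U \<inter> sphere 0 1}"
  have "openin circle_topology (U \<inter> sphere 0 1)"
    using assms(2) unfolding circle_topology_def by (metis inf_commute openin_open_Int)
  then have "openin (compact_open_topology T circle_topology) B"
    unfolding compact_open_topology_def B_def using assms(1)
    by (intro topology_generated_by_Basis) blast
  moreover have "{\<phi> \<in> carrier \<D>. \<phi> ` K \<subseteq> U} = carrier \<D> \<inter> B"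
    using dualD(1,2,4) compact_subset_carrier[OF assms(1)] unfolding B_def continuous_map_circle
    by (auto simp: image_subset_iff)
  ultimately show ?thesis
    unfolding dual_topology_def by (metis inf_commute openin_subtopology)
qed

lemma continuous_map_evaluation:
  assumes "x \<in> carrier G"
  shows "continuous_map \<T> euclidean (\<lambda>\<phi>. \<phi> x)"
proof -
  have "openin \<T> {\<phi> \<in> carrier \<D>. \<phi> x \<in> U}" if "open U" for U
    using openin_dual_subbasic[OF _ that, of "{x}"] assms by simp
  then show ?thesis by (simp add: continuous_map)
qed

lemma Hausdorff_dual: "Hausdorff_space \<T>"
  unfolding Hausdorff_space_def
proof (intro allI impI)
  fix \<phi> \<psi> assume *: "\<phi> \<in> topspace \<T> \<and> \<psi> \<in> topspace \<T> \<and> \<phi> \<noteq> \<psi>"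
  then obtain x where x: "x \<in> carrier G" "\<phi> x \<noteq> \<psi> x" using dual_eqI by auto
  then obtain U V where UV: "open U" "open V" "\<phi> x \<in> U" "\<psi> x \<in> V" "U \<inter> V = {}"
    using hausdorff by metis
  have "openin \<T> {\<phi> \<in> carrier \<D>. \<phi> x \<in> U}" "openin \<T> {\<phi> \<in> carrier \<D>. \<phi> x \<in> V}"
    using openin_continuous_map_preimage[OF continuous_map_evaluation[OF x(1)]] UV by auto
  then show "\<exists>U V. openin \<T> U \<and> openin \<T> V \<and> \<phi> \<in> U \<and> \<psi> \<in> V \<and> disjnt U V"
    using * UV by (intro exI[of _ "{\<phi> \<in> carrier \<D>. \<phi> x \<in> U}"] exI[of _ "{\<phi> \<in> carrier \<D>. \<phi> x \<in> V}"])
      (auto simp: disjnt_def)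
qed

text \<open>
  The compact-open topology contains the topology of uniform convergence on compact sets. \<open>K\<close>
  is cut into finitely many compact pieces \<open>C z\<close> on which \<open>\<phi>\<close> varies by at
  most \<open>\<delta> / 3\<close>; a character sending each piece into a small ball around
  \<open>\<phi> z\<close> is then uniformly close to \<open>\<phi>\<close>.
\<close>

lemma uniform_neighbourhood:
  assumes K: "compactin T K" and \<phi>: "\<phi> \<in> carrier \<D>" and \<delta>: "0 < \<delta>"
  obtains O' where "openin \<T> O'" "\<phi> \<in> O'" "\<And>\<psi> x. \<lbrakk>\<psi> \<in> O'; x \<in> K\<rbrakk> \<Longrightarrow> norm (\<psi> x - \<phi> x) < \<delta>"
proof -
  note KG = compact_subset_carrier[OF K]
  define V where "V z = {x \<in> carrier G. \<phi> x \<in> ball 1 (\<delta> / 3)}" for z :: 'a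
  have V: "openin T (V z) \<and> \<one> \<in> V z" for z
    unfolding V_def using openin_continuous_map_preimage[OF dualD(4)[OF \<phi>], of "ball 1 (\<delta> / 3)"] \<phi> \<delta> by simp
  obtain Z where Z: "finite Z" "Z \<subseteq> K" "\<And>x. x \<in> K \<Longrightarrow> \<exists>z\<in>Z. inv z \<otimes> x \<in> V z"
    using compact_finitely_many_translates[OF K] V by metis
  define C where "C z = K \<inter> {x \<in> carrier G. \<phi> x \<in> cball (\<phi> z) (\<delta> / 3)}" for z
  have "closedin T {x \<in> carrier G. \<phi> x \<in> cball (\<phi> z) (\<delta> / 3)}" for z
    using closedin_continuous_map_preimage[OF dualD(4)[OF \<phi>], of "cball (\<phi> z) (\<delta> / 3)"] by simp
  then have C: "compactin T (C z)" for z
    unfolding C_def using K by (metis closed_Int_compactin compact_Int_closedin)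
  have cover: "\<exists>z\<in>Z. x \<in> C z" if x: "x \<in> K" for x
  proof -
    obtain z where z: "z \<in> Z" "inv z \<otimes> x \<in> V z" using Z(3)[OF x] by blast
    have zx: "z \<in> carrier G" "x \<in> carrier G" using z Z KG x by auto
    have "\<phi> x = \<phi> z * \<phi> (inv z \<otimes> x)"
      using dualD(3)[OF \<phi>, of z "inv z \<otimes> x"] zx by (simp add: m_assoc[symmetric])
    then have "norm (\<phi> z - \<phi> x) = norm (\<phi> z) * norm (1 - \<phi> (inv z \<otimes> x))"
      by (simp add: norm_mult[symmetric] right_diff_distrib)
    also have "\<dots> < \<delta> / 3" using z(2) dualD(2)[OF \<phi> zx(1)] by (simp add: V_def dist_norm)
    finally show ?thesis using z x zx by (auto simp: C_def dist_norm intro!: bexI[of _ z])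
  qed
  define O' where "O' = carrier \<D> \<inter> (\<Inter>z\<in>Z. {\<psi> \<in> carrier \<D>. \<psi> ` C z \<subseteq> ball (\<phi> z) (2 * \<delta> / 3)})"
  show thesis
  proof (rule that[of O'])
    have "openin \<T> (carrier \<D>)" using openin_topspace[of \<T>] by simp
    then have "openin \<T> (topspace \<T> \<inter> (\<Inter>z\<in>Z. {\<psi> \<in> carrier \<D>. \<psi> ` C z \<subseteq> ball (\<phi> z) (2 * \<delta> / 3)}))"
      using Z(1) openin_dual_subbasic[OF C] by (intro openin_Int_Inter) auto
    then show "openin \<T> O'" by (simp add: O'_def)
    show "\<phi> \<in> O'" using \<phi> \<delta> by (auto simp: O'_def C_def)
    fix \<psi> x assume \<psi>: "\<psi> \<in> O'" and x: "x \<in> K"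
    obtain z where z: "z \<in> Z" "x \<in> C z" using cover[OF x] by blast
    have "\<psi> ` C z \<subseteq> ball (\<phi> z) (2 * \<delta> / 3)" using \<psi> z(1) unfolding O'_def by blast
    then have "\<psi> x \<in> ball (\<phi> z) (2 * \<delta> / 3)" using z(2) by blast
    moreover have "\<phi> x \<in> cball (\<phi> z) (\<delta> / 3)" using z by (simp add: C_def)
    ultimately have "dist (\<psi> x) (\<phi> x) < \<delta>"
      using dist_triangle[of "\<psi> x" "\<phi> x" "\<phi> z"] by (simp add: dist_commute)
    then show "norm (\<psi> x - \<phi> x) < \<delta>" by (simp add: dist_norm)
  qed
qed

end

section \<open>Equicontinuity and compactness in the dual\<close>

context topological_group
begin

text \<open>
  A unimodular homomorphism has the same modulus of continuity everywhere as at the identity.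
\<close>

lemma hom_eq_translate:
  assumes "\<And>x y. \<lbrakk>x \<in> carrier G; y \<in> carrier G\<rbrakk> \<Longrightarrow> f (x \<otimes> y) = f x * (f y :: complex)"
    "\<And>x. x \<in> carrier G \<Longrightarrow> norm (f x) = 1" "z \<in> carrier G" "x \<in> carrier G"
  shows "norm (f x - f z) = norm (f (inv z \<otimes> x) - 1)"
proof -
  have "f x = f z * f (inv z \<otimes> x)"
    using assms(1)[of z "inv z \<otimes> x"] assms by (simp add: m_assoc[symmetric])
  then have "f x - f z = f z * (f (inv z \<otimes> x) - 1)" by (simp add: right_diff_distrib)
  then show ?thesis using assms(2,3) by (simp add: norm_mult)
qed

text \<open>
  An instance of the Arzela-Ascoli theorem. The homomorphisms obeying the same equicontinuity estimates as
  \<open>A\<close> form a closed subset \<open>E\<close> of a product of circles, compact by Tychonoff. They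
  are automatically continuous, and on \<open>E\<close> pointwise convergence is uniform on compact sets, so
  \<open>E\<close> is also compact in the dual.
\<close>

lemma equicontinuous_imp_relatively_compact:
  assumes A: "A \<subseteq> carrier \<D>"
    and eq: "\<And>\<epsilon>. 0 < \<epsilon> \<Longrightarrow> \<exists>U. openin T U \<and> \<one> \<in> U \<and> (\<forall>\<phi>\<in>A. \<forall>x\<in>U. norm (\<phi> x - 1) \<le> \<epsilon>)"
  shows "A \<in> relatively_compact_sets \<T>"
proof -
  have "\<forall>j. \<exists>U. openin T U \<and> \<one> \<in> U \<and> (\<forall>\<phi>\<in>A. \<forall>x\<in>U. norm (\<phi> x - 1) \<le> 1 / real (Suc j))"
    using eq by simp
  then obtain U where U: "\<And>j. openin T (U j)" "\<And>j. \<one> \<in> U j"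
    "\<And>j \<phi> x. \<phi> \<in> A \<Longrightarrow> x \<in> U j \<Longrightarrow> norm (\<phi> x - 1) \<le> 1 / real (Suc j)"
    by metis
  have UG: "U j \<subseteq> carrier G" for j using open_subset_carrier U(1) by blast
  define P where "P = product_topology (\<lambda>_::'a. circle_topology) (carrier G)"
  have topP: "topspace P = (\<Pi>\<^sub>E x\<in>carrier G. sphere 0 1)"
    by (simp add: P_def circle_topology_def)
  have "compact_space circle_topology"
    unfolding circle_topology_def by (simp add: compact_space_subtopology)
  then have compP: "compact_space P"
    unfolding P_def by (simp add: compact_space_product_topology)
  have ev: "continuous_map P euclidean (\<lambda>f. f x)" if "x \<in> carrier G" for x
    using continuous_map_product_projection[of x "carrier G" "\<lambda>_. circle_topology"] that
    unfolding P_def circle_topology_def by (simp add: continuous_map_in_subtopology)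
  define H where "H x y = {f \<in> topspace P. f (x \<otimes> y) - f x * f y \<in> {0}}" for x y
  define N where "N j x = {f \<in> topspace P. f x \<in> cball 1 (1 / real (Suc j))}" for j x
  define E where "E = {f \<in> topspace P. (\<forall>x\<in>carrier G. \<forall>y\<in>carrier G. f (x \<otimes> y) = f x * f y) \<and>
    (\<forall>j. \<forall>x\<in>U j. norm (f x - 1) \<le> 1 / real (Suc j))}"
  have closed_H: "closedin P (H x y)" if xy: "x \<in> carrier G" "y \<in> carrier G" for x y
  proof -
    have "continuous_map P euclidean (\<lambda>f. f (x \<otimes> y) - f x * f y)"
      using xy by (intro continuous_map_diff_normed continuous_map_mult_complex ev) auto
    from closedin_continuous_map_preimage[OF this, of "{0}"] show ?thesis by (simp add: H_def)
  qed
  have closed_N: "closedin P (N j x)" if "x \<in> U j" for j x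
    using closedin_continuous_map_preimage[OF ev, of x "cball 1 (1 / real (Suc j))"] that UG
    by (auto simp: N_def)
  have "closedin P (topspace P \<inter> \<Inter> ((\<lambda>(x, y). H x y) ` (carrier G \<times> carrier G) \<union> (\<lambda>(j, x). N j x) ` (SIGMA j:UNIV. U j) \<union> {topspace P}))"
    using closed_H closed_N by (intro closedin_Int closedin_Inter) auto
  also have "(topspace P \<inter> \<Inter> ((\<lambda>(x, y). H x y) ` (carrier G \<times> carrier G) \<union> (\<lambda>(j, x). N j x) ` (SIGMA j:UNIV. U j) \<union> {topspace P})) = E"
    by (auto simp: E_def H_def N_def dist_norm norm_minus_commute)
  finally have "closedin P E" .
  then have compE: "compactin P E" using compP by (rule closedin_compact_space[rotated])
  have E_hom: "f (x \<otimes> y) = f x * f y" if "f \<in> E" "x \<in> carrier G" "y \<in> carrier G" for f x y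
    using that unfolding E_def by auto
  have E_norm: "norm (f x) = 1" if "f \<in> E" "x \<in> carrier G" for f x
    using that unfolding E_def topP by auto
  have E_U: "norm (f x - 1) \<le> 1 / real (Suc j)" if "f \<in> E" "x \<in> U j" for f x j
    using that unfolding E_def by auto
  have nbhd: "openin T {x \<in> carrier G. inv z \<otimes> x \<in> U j}" if "z \<in> carrier G" for z j
    using openin_translate U(1) that by blast
  have ED: "E \<subseteq> carrier \<D>"
  proof
    fix f assume f: "f \<in> E"
    have "openin T {x \<in> carrier G. f x \<in> W}" if W: "open W" for W
    proof (subst openin_subopen, intro ballI)
      fix z assume "z \<in> {x \<in> carrier G. f x \<in> W}"
      then have z: "z \<in> carrier G" "f z \<in> W" by auto
      then obtain e where e: "0 < e" "ball (f z) e \<subseteq> W" using W open_contains_ball by blast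
      then obtain j where j: "1 / real (Suc j) < e" using nat_approx_posE by blast
      have "{x \<in> carrier G. inv z \<otimes> x \<in> U j} \<subseteq> {x \<in> carrier G. f x \<in> W}"
      proof clarify
        fix x assume x: "x \<in> carrier G" "inv z \<otimes> x \<in> U j"
        have "norm (f x - f z) = norm (f (inv z \<otimes> x) - 1)"
          using E_hom[OF f] E_norm[OF f] z(1) x(1) by (intro hom_eq_translate) auto
        also have "\<dots> < e" using E_U[OF f x(2)] j by simp
        finally show "f x \<in> W" using e(2) by (auto simp: dist_norm norm_minus_commute)
      qed
      moreover have "z \<in> {x \<in> carrier G. inv z \<otimes> x \<in> U j}" using z(1) U(2) by simp
      ultimately show "\<exists>S. openin T S \<and> z \<in> S \<and> S \<subseteq> {x \<in> carrier G. f x \<in> W}"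
        using nbhd[OF z(1)] by blast
    qed
    then have "continuous_map T euclidean f" by (simp add: continuous_map)
    moreover have "f \<in> extensional (carrier G)" using f unfolding E_def topP by (auto simp: PiE_def)
    ultimately show "f \<in> carrier \<D>"
      unfolding dual_carrier_iff using E_hom[OF f] E_norm[OF f] by auto
  qed
  have "continuous_map (subtopology P E) (compact_open_topology T circle_topology) (\<lambda>f. f)"
    unfolding compact_open_topology_def
  proof (rule continuous_on_generated_topo)
    show "(\<lambda>f. f) ` topspace (subtopology P E) \<subseteq>
      \<Union> {{f \<in> extensional (topspace T). continuous_map T circle_topology f \<and> f ` K \<subseteq> U} |K U. compactin T K \<and> openin circle_topology U}"
    proof (rule image_subsetI)
      fix f assume "f \<in> topspace (subtopology P E)"
      then have "f \<in> carrier \<D>" using ED by auto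
      then have "f \<in> {f \<in> extensional (topspace T). continuous_map T circle_topology f \<and> f ` {} \<subseteq> {}}"
        using dualD continuous_map_circle by auto
      then show "f \<in> \<Union> {{f \<in> extensional (topspace T). continuous_map T circle_topology f \<and> f ` K \<subseteq> U} |K U. compactin T K \<and> openin circle_topology U}"
        using compactin_empty openin_empty by blast
    qed
  next
    fix B assume "B \<in> {{f \<in> extensional (topspace T). continuous_map T circle_topology f \<and> f ` K \<subseteq> U} |K U. compactin T K \<and> openin circle_topology U}"
    then obtain K W0 where B: "B = {f \<in> extensional (topspace T). continuous_map T circle_topology f \<and> f ` K \<subseteq> W0}"
      and K: "compactin T K" and "openin circle_topology W0" by blast
    then obtain W where W: "open W" "W0 = sphere 0 1 \<inter> W" unfolding circle_topology_def openin_open by blast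
    note KG = compact_subset_carrier[OF K]
    show "openin (subtopology P E) ((\<lambda>f. f) -` B \<inter> topspace (subtopology P E))"
    proof (subst openin_subopen, intro ballI)
      fix g assume "g \<in> (\<lambda>f. f) -` B \<inter> topspace (subtopology P E)"
      then have g: "g \<in> E" "g ` K \<subseteq> W" "g \<in> carrier \<D>" using ED by (auto simp: B W)
      have "compact (g ` K)"
        using image_compactin[OF K dualD(4)[OF g(3)]] by simp
      then obtain \<delta> where \<delta>: "0 < \<delta>" "(\<Union>x\<in>g ` K. ball x \<delta>) \<subseteq> W"
        using compact_subset_open_imp_ball_epsilon_subset[of "g ` K" W] W(1) g(2) by blast
      obtain j where j: "1 / real (Suc j) < \<delta> / 3" using \<delta>(1) nat_approx_posE[of "\<delta> / 3"] by auto
      obtain Z where Z: "finite Z" "Z \<subseteq> K" "\<And>x. x \<in> K \<Longrightarrow> \<exists>z\<in>Z. inv z \<otimes> x \<in> U j"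
        using compact_finitely_many_translates[OF K, of "\<lambda>_. U j"] U(1,2) by metis
      define S where "S = E \<inter> (topspace P \<inter> (\<Inter>z\<in>Z. {f \<in> topspace P. f z \<in> ball (g z) (\<delta> / 3)}))"
      have "openin P (topspace P \<inter> (\<Inter>z\<in>Z. {f \<in> topspace P. f z \<in> ball (g z) (\<delta> / 3)}))"
      proof (rule openin_Int_Inter)
        show "openin P X" if X: "X \<in> (\<lambda>z. {f \<in> topspace P. f z \<in> ball (g z) (\<delta> / 3)}) ` Z" for X
        proof -
          obtain z where "z \<in> Z" "X = {f \<in> topspace P. f z \<in> ball (g z) (\<delta> / 3)}" using X by blast
          then show ?thesis
            using openin_continuous_map_preimage[OF ev, of z "ball (g z) (\<delta> / 3)"] Z(2) KG by auto
        qed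
      qed (use Z(1) in auto)
      then have "openin (subtopology P E) S"
        unfolding S_def by (rule openin_subtopology_Int2)
      moreover have "g \<in> S" using g(1) \<delta>(1) unfolding S_def E_def by auto
      moreover have "S \<subseteq> (\<lambda>f. f) -` B \<inter> topspace (subtopology P E)"
      proof
        fix f assume "f \<in> S"
        then have f: "f \<in> E" "\<And>z. z \<in> Z \<Longrightarrow> norm (f z - g z) < \<delta> / 3"
          by (auto simp: S_def dist_norm norm_minus_commute)
        have "f x \<in> W" if x: "x \<in> K" for x
        proof -
          obtain z where z: "z \<in> Z" "inv z \<otimes> x \<in> U j" using Z(3)[OF x] by blast
          have zx: "z \<in> carrier G" "x \<in> carrier G" "z \<in> K" using z Z KG x by auto
          have "norm (f x - f z) = norm (f (inv z \<otimes> x) - 1)"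
            using E_hom[OF f(1)] E_norm[OF f(1)] zx by (intro hom_eq_translate) auto
          then have "norm (f x - f z) < \<delta> / 3" using E_U[OF f(1) z(2)] j by simp
          then have "norm (f x - g z) < \<delta>"
            using f(2)[OF z(1)] \<delta>(1) norm_triangle_ineq[of "f x - f z" "f z - g z"] by simp
          then have "f x \<in> ball (g z) \<delta>" by (simp add: dist_norm norm_minus_commute)
          then show ?thesis using \<delta>(2) zx(3) by blast
        qed
        moreover have "f \<in> carrier \<D>" using f ED by auto
        ultimately have "f \<in> B" unfolding B W(2) using dualD(1,2,4) KG
          by (auto simp: continuous_map_circle)
        then show "f \<in> (\<lambda>f. f) -` B \<inter> topspace (subtopology P E)"
          using f(1) by (simp add: E_def)
      qed
      ultimately show "\<exists>S. openin (subtopology P E) S \<and> g \<in> S \<and> S \<subseteq> (\<lambda>f. f) -` B \<inter> topspace (subtopology P E)"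
        by blast
    qed
  qed
  then have "continuous_map (subtopology P E) \<T> (\<lambda>f. f)"
    unfolding dual_topology_def continuous_map_in_subtopology using ED by auto
  moreover have "compactin (subtopology P E) E" using compE by (simp add: compactin_subtopology)
  ultimately have "compactin \<T> E" using image_compactin[of "subtopology P E" E \<T> "\<lambda>f. f"] by simp
  moreover have "A \<subseteq> E"
  proof
    fix \<phi> assume \<phi>: "\<phi> \<in> A"
    then have "\<phi> \<in> carrier \<D>" using A by blast
    then show "\<phi> \<in> E" using U(3)[OF \<phi>] unfolding E_def topP
      by (auto simp: dualD PiE_iff)
  qed
  ultimately have "compactin \<T> (\<T> closure_of A)"
    using closed_compactin closure_of_minimal compactin_imp_closedin[OF Hausdorff_dual] closedin_closure_of
    by metis
  then show ?thesis using A unfolding relatively_compact_sets_def by simp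
qed

end

context locally_compact_abelian_group
begin

text \<open>
  Finitely many neighbourhoods in the dual, uniform over a compact neighbourhood \<open>K\<close> of the
  identity, cover \<open>C\<close>. Local compactness enters here.
\<close>

lemma compact_imp_equicontinuous:
  assumes C: "compactin \<T> C" and \<epsilon>: "0 < \<epsilon>"
  obtains U where "openin T U" "\<one> \<in> U" "\<And>\<phi> x. \<lbrakk>\<phi> \<in> C; x \<in> U\<rbrakk> \<Longrightarrow> norm (\<phi> x - 1) < \<epsilon>"
proof -
  obtain U0 K where K: "openin T U0" "\<one> \<in> U0" "U0 \<subseteq> K" "compactin T K"
    using compact_neighbourhood_of_one .
  have CD: "C \<subseteq> carrier \<D>" using compactin_subset_topspace[OF C] by simp
  have "\<forall>\<phi>\<in>C. \<exists>O'. openin \<T> O' \<and> \<phi> \<in> O' \<and> (\<forall>\<psi>\<in>O'. \<forall>x\<in>K. norm (\<psi> x - \<phi> x) < \<epsilon> / 2)"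
  proof
    fix \<phi> assume "\<phi> \<in> C"
    then have \<phi>: "\<phi> \<in> carrier \<D>" using CD by blast
    have "0 < \<epsilon> / 2" using \<epsilon> by simp
    from uniform_neighbourhood[OF K(4) \<phi> this]
    obtain O' where "openin \<T> O'" "\<phi> \<in> O'" "\<And>\<psi> x. \<lbrakk>\<psi> \<in> O'; x \<in> K\<rbrakk> \<Longrightarrow> norm (\<psi> x - \<phi> x) < \<epsilon> / 2" by blast
    then show "\<exists>O'. openin \<T> O' \<and> \<phi> \<in> O' \<and> (\<forall>\<psi>\<in>O'. \<forall>x\<in>K. norm (\<psi> x - \<phi> x) < \<epsilon> / 2)" by blast
  qed
  then obtain N where N: "\<And>\<phi>. \<phi> \<in> C \<Longrightarrow> openin \<T> (N \<phi>)" "\<And>\<phi>. \<phi> \<in> C \<Longrightarrow> \<phi> \<in> N \<phi>"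
    "\<And>\<phi> \<psi> x. \<lbrakk>\<phi> \<in> C; \<psi> \<in> N \<phi>; x \<in> K\<rbrakk> \<Longrightarrow> norm (\<psi> x - \<phi> x) < \<epsilon> / 2"
    by metis
  obtain \<F> where "finite \<F>" "\<F> \<subseteq> N ` C" "C \<subseteq> \<Union>\<F>"
    using compactinD[OF C, of "N ` C"] N(1,2) by blast
  then obtain Z where Z: "Z \<subseteq> C" "finite Z" "\<F> = N ` Z"
    using finite_subset_image by metis
  define U where "U = U0 \<inter> (\<Inter>\<phi>\<in>Z. {x \<in> carrier G. \<phi> x \<in> ball 1 (\<epsilon> / 2)})"
  show thesis
  proof (rule that[of U])
    have "openin T {x \<in> carrier G. \<phi> x \<in> ball 1 (\<epsilon> / 2)}" if "\<phi> \<in> Z" for \<phi>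
      using openin_continuous_map_preimage[OF dualD(4), of \<phi> "ball 1 (\<epsilon> / 2)"] that Z(1) CD by auto
    then show "openin T U" unfolding U_def using K(1) Z(2) by (intro openin_Int_Inter) auto
    show "\<one> \<in> U" unfolding U_def using K(2) \<epsilon> Z(1) CD by auto
    fix \<phi> x assume \<phi>: "\<phi> \<in> C" and x: "x \<in> U"
    obtain \<psi> where \<psi>: "\<psi> \<in> Z" "\<phi> \<in> N \<psi>" using \<phi> Z(3) \<open>C \<subseteq> \<Union>\<F>\<close> by blast
    have "norm (\<phi> x - \<psi> x) < \<epsilon> / 2" using N(3)[of \<psi> \<phi> x] \<psi> Z(1) x K(3) by (auto simp: U_def)
    moreover have "norm (\<psi> x - 1) < \<epsilon> / 2"
      using x \<psi>(1) by (auto simp: U_def dist_norm norm_minus_commute)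
    ultimately show "norm (\<phi> x - 1) < \<epsilon>"
      using norm_triangle_ineq[of "\<phi> x - \<psi> x" "\<psi> x - 1"] by simp
  qed
qed

end

section \<open>Length functions on the dual\<close>

context topological_group
begin

text \<open>
  The values lie in \<open>ennreal\<close> since the supremum may be infinite for a character that is not
  within \<open>1/2\<close> of \<open>1\<close> on any \<open>V n\<close>.
\<close>

definition dual_length :: "(nat \<Rightarrow> 'a set) \<Rightarrow> ('a \<Rightarrow> complex) \<Rightarrow> ennreal" where
  "dual_length V \<phi> = (SUP n. SUP x\<in>V n. ennreal ((3 / 2) ^ n * norm (\<phi> x - 1)))"

lemma dual_length_ge: "x \<in> V n \<Longrightarrow> ennreal ((3 / 2) ^ n * norm (\<phi> x - 1)) \<le> dual_length V \<phi>"
  unfolding dual_length_def by (intro SUP_upper2[of n] SUP_upper2[of x]) auto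

lemma dual_length_leI:
  "(\<And>n x. x \<in> V n \<Longrightarrow> ennreal ((3 / 2) ^ n * norm (\<phi> x - 1)) \<le> b) \<Longrightarrow> dual_length V \<phi> \<le> b"
  unfolding dual_length_def by (intro SUP_least) auto

context
  fixes V :: "nat \<Rightarrow> 'a set"
  assumes V_carrier: "\<And>n. V n \<subseteq> carrier G"
    and V_square: "\<And>n. \<forall>x\<in>V (Suc n). x \<otimes> x \<in> V n"
    and V_Suc: "\<And>n. V (Suc n) \<subseteq> V n"
begin

lemma dual_length_one: "dual_length V \<one>\<^bsub>\<D>\<^esub> = 0"
proof -
  have "dual_length V \<one>\<^bsub>\<D>\<^esub> \<le> 0" by (rule dual_length_leI) (simp add: subsetD[OF V_carrier])
  then show ?thesis by simp
qed

lemma dual_length_inv: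
  assumes "\<phi> \<in> carrier \<D>"
  shows "dual_length V (inv\<^bsub>\<D>\<^esub> \<phi>) = dual_length V \<phi>"
  unfolding dual_length_def
proof (intro SUP_cong refl)
  fix n x assume "x \<in> V n"
  then have "x \<in> carrier G" using V_carrier by auto
  moreover have "norm (cnj (\<phi> x) - 1) = norm (cnj (\<phi> x - 1))" by simp
  ultimately show "ennreal ((3 / 2) ^ n * norm ((inv\<^bsub>\<D>\<^esub> \<phi>) x - 1)) = ennreal ((3 / 2) ^ n * norm (\<phi> x - 1))"
    using assms by (simp only: dual_inv complex_mod_cnj)
qed

lemma dual_length_mult:
  assumes "\<phi> \<in> carrier \<D>" "\<psi> \<in> carrier \<D>"
  shows "dual_length V (\<phi> \<otimes>\<^bsub>\<D>\<^esub> \<psi>) \<le> dual_length V \<phi> + dual_length V \<psi>"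
proof (rule dual_length_leI)
  fix n x assume x: "x \<in> V n"
  then have xG: "x \<in> carrier G" using V_carrier by auto
  have "(\<phi> \<otimes>\<^bsub>\<D>\<^esub> \<psi>) x - 1 = \<phi> x * (\<psi> x - 1) + (\<phi> x - 1)"
    using xG by (simp add: algebra_simps)
  then have "norm ((\<phi> \<otimes>\<^bsub>\<D>\<^esub> \<psi>) x - 1) \<le> norm (\<phi> x - 1) + norm (\<psi> x - 1)"
    using norm_triangle_ineq[of "\<phi> x * (\<psi> x - 1)" "\<phi> x - 1"] dualD(2)[OF assms(1) xG]
    by (simp only: norm_mult)
  then have "(3 / 2) ^ n * norm ((\<phi> \<otimes>\<^bsub>\<D>\<^esub> \<psi>) x - 1)
      \<le> (3 / 2) ^ n * norm (\<phi> x - 1) + (3 / 2) ^ n * norm (\<psi> x - 1)"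
    by (simp flip: distrib_left)
  then have "ennreal ((3 / 2) ^ n * norm ((\<phi> \<otimes>\<^bsub>\<D>\<^esub> \<psi>) x - 1))
      \<le> ennreal ((3 / 2) ^ n * norm (\<phi> x - 1)) + ennreal ((3 / 2) ^ n * norm (\<psi> x - 1))"
    by (simp add: ennreal_leI flip: ennreal_plus)
  also have "\<dots> \<le> dual_length V \<phi> + dual_length V \<psi>"
    using x by (intro add_mono dual_length_ge)
  finally show "ennreal ((3 / 2) ^ n * norm ((\<phi> \<otimes>\<^bsub>\<D>\<^esub> \<psi>) x - 1)) \<le> dual_length V \<phi> + dual_length V \<psi>" .
qed

lemma V_antimono: "m \<le> n \<Longrightarrow> V n \<subseteq> V m"
  by (rule lift_Suc_antimono_le[of V]) (use V_Suc in auto)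

text \<open>
  Passing from \<open>V n\<close> to \<open>V (n + 1)\<close> shrinks \<open>\<phi> - 1\<close> by the
  factor \<open>2/3\<close>: from
  \<open>\<phi> (x \<otimes> x) - 1 = (\<phi> x - 1) * (\<phi> x + 1)\<close> and
  \<open>norm (\<phi> x + 1) \<ge> 3/2\<close>. The weights \<open>(3/2)^n\<close> in the length are chosen
  to cancel this factor.
\<close>

lemma character_decay:
  assumes \<phi>: "\<phi> \<in> carrier \<D>" and s: "s \<le> 1 / 2" and V: "\<And>x. x \<in> V m \<Longrightarrow> norm (\<phi> x - 1) \<le> s"
  shows "x \<in> V (m + k) \<Longrightarrow> norm (\<phi> x - 1) \<le> (2 / 3) ^ k * s"
proof (induction k arbitrary: x)
  case (Suc k)
  have xV: "x \<in> V m" "x \<in> carrier G" using Suc.prems V_antimono[of m "m + Suc k"] V_carrier by auto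
  have "x \<otimes> x \<in> V (m + k)" using Suc.prems V_square by simp
  then have "norm (\<phi> (x \<otimes> x) - 1) \<le> (2 / 3) ^ k * s" by (rule Suc.IH)
  moreover have "\<phi> (x \<otimes> x) - 1 = (\<phi> x - 1) * (\<phi> x + 1)"
    using dualD(3)[OF \<phi> xV(2) xV(2)] by (simp add: algebra_simps)
  moreover have "3 / 2 \<le> norm (\<phi> x + 1)"
  proof -
    have "norm (2 :: complex) \<le> norm (\<phi> x + 1) + norm (\<phi> x - 1)"
      using norm_triangle_ineq4[of "\<phi> x + 1" "\<phi> x - 1"] by simp
    then show ?thesis using V[OF xV(1)] s by simp
  qed
  then have "norm (\<phi> x - 1) * (3 / 2) \<le> norm (\<phi> x - 1) * norm (\<phi> x + 1)"
    by (rule mult_left_mono) simp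
  ultimately have "norm (\<phi> x - 1) * (3 / 2) \<le> (2 / 3) ^ k * s" by (simp add: norm_mult)
  then show ?case by simp
qed (use V in simp)

lemma dual_length_le:
  assumes \<phi>: "\<phi> \<in> carrier \<D>" and s: "s \<le> 1 / 2" and V: "\<And>x. x \<in> V 0 \<Longrightarrow> norm (\<phi> x - 1) \<le> s"
  shows "dual_length V \<phi> \<le> ennreal s"
proof (rule dual_length_leI)
  fix n x assume "x \<in> V n"
  then have "norm (\<phi> x - 1) \<le> (2 / 3) ^ n * s"
    using character_decay[OF \<phi> s V, where x = x and k = n] by simp
  then have "(3 / 2) ^ n * norm (\<phi> x - 1) \<le> (3 / 2) ^ n * ((2 / 3) ^ n * s)" by simp
  also have "\<dots> = s" by (simp add: power_mult_distrib[symmetric] mult.assoc[symmetric])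
  finally show "ennreal ((3 / 2) ^ n * norm (\<phi> x - 1)) \<le> ennreal s" by (rule ennreal_leI)
qed

lemma dual_length_finite:
  assumes \<phi>: "\<phi> \<in> carrier \<D>" and V: "\<And>x. x \<in> V m \<Longrightarrow> norm (\<phi> x - 1) \<le> 1 / 2"
  shows "dual_length V \<phi> < \<infinity>"
proof -
  have "dual_length V \<phi> \<le> ennreal ((3 / 2) ^ m * 2)"
  proof (rule dual_length_leI)
    fix n x assume x: "x \<in> V n"
    have "(3 / 2) ^ n * norm (\<phi> x - 1) \<le> (3 / 2) ^ m * 2"
    proof (cases "n \<le> m")
      case True
      have "norm (\<phi> x) = 1" using dualD(2)[OF \<phi>] x V_carrier by blast
      then have "norm (\<phi> x - 1) \<le> 2" using norm_triangle_ineq4[of "\<phi> x" 1] by simp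
      then show ?thesis using True by (intro mult_mono power_increasing) auto
    next
      case False
      then obtain k where n: "n = m + k" using less_imp_add_positive by (metis not_le)
      have "norm (\<phi> x - 1) \<le> (2 / 3) ^ k * (1 / 2)"
        using character_decay[OF \<phi> _ V, where x = x and k = k] x n by simp
      then have "(3 / 2) ^ n * norm (\<phi> x - 1) \<le> (3 / 2) ^ n * ((2 / 3) ^ k * (1 / 2))" by simp
      also have "\<dots> = (3 / 2) ^ m * (1 / 2) * ((3 / 2) ^ k * (2 / 3) ^ k)" by (simp add: n power_add)
      also have "\<dots> = (3 / 2) ^ m * (1 / 2)" by (simp flip: power_mult_distrib)
      also have "\<dots> \<le> (3 / 2) ^ m * 2" by (intro mult_left_mono) auto
      finally show ?thesis .
    qed
    then show "ennreal ((3 / 2) ^ n * norm (\<phi> x - 1)) \<le> ennreal ((3 / 2) ^ m * 2)" by (rule ennreal_leI)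
  qed
  then show ?thesis by (simp add: order_le_less_trans)
qed

end

text \<open>
  A bound on the length is an equicontinuity estimate: on \<open>V n\<close> the distance to
  \<open>1\<close> is at most \<open>(2/3)^n * R\<close>.
\<close>

lemma dual_length_bounded_relatively_compact:
  assumes V: "\<And>n. openin T (V n)" "\<And>n. \<one> \<in> V n" and A: "A \<subseteq> carrier \<D>"
    and R: "\<And>\<phi>. \<phi> \<in> A \<Longrightarrow> dual_length V \<phi> \<le> ennreal R" "0 \<le> R"
  shows "A \<in> relatively_compact_sets \<T>"
proof (rule equicontinuous_imp_relatively_compact[OF A])
  fix \<epsilon> :: real assume \<epsilon>: "0 < \<epsilon>"
  obtain n where n: "R / \<epsilon> < (3 / 2) ^ n" using real_arch_pow[of "3 / 2" "R / \<epsilon>"] by auto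
  have "norm (\<phi> x - 1) \<le> \<epsilon>" if "\<phi> \<in> A" "x \<in> V n" for \<phi> x
  proof -
    have "ennreal ((3 / 2) ^ n * norm (\<phi> x - 1)) \<le> ennreal R"
      by (rule order_trans[OF dual_length_ge[where V = V and n = n and x = x, OF that(2)] R(1)[OF that(1)]])
    then have "(3 / 2) ^ n * norm (\<phi> x - 1) \<le> R" using R(2) by simp
    also have "R \<le> (3 / 2) ^ n * \<epsilon>" using n \<epsilon> by (simp add: field_simps)
    finally show ?thesis by simp
  qed
  then show "\<exists>U. openin T U \<and> \<one> \<in> U \<and> (\<forall>\<phi>\<in>A. \<forall>x\<in>U. norm (\<phi> x - 1) \<le> \<epsilon>)"
    using V by blast
qed

lemma pseudometric_of_length:
  fixes r :: "('a \<Rightarrow> complex) \<Rightarrow> real"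
  assumes one: "r \<one>\<^bsub>\<D>\<^esub> = 0"
    and mult: "\<And>\<phi> \<psi>. \<lbrakk>\<phi> \<in> carrier \<D>; \<psi> \<in> carrier \<D>\<rbrakk> \<Longrightarrow> r (\<phi> \<otimes>\<^bsub>\<D>\<^esub> \<psi>) \<le> r \<phi> + r \<psi>"
    and inv: "\<And>\<phi>. \<phi> \<in> carrier \<D> \<Longrightarrow> r (inv\<^bsub>\<D>\<^esub> \<phi>) = r \<phi>"
  shows "pseudometric_on (carrier \<D>) (\<lambda>\<phi> \<psi>. r (inv\<^bsub>\<D>\<^esub> \<phi> \<otimes>\<^bsub>\<D>\<^esub> \<psi>))"
    and "left_invariant \<D> (\<lambda>\<phi> \<psi>. r (inv\<^bsub>\<D>\<^esub> \<phi> \<otimes>\<^bsub>\<D>\<^esub> \<psi>))"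
proof -
  have nonneg: "0 \<le> r \<phi>" if "\<phi> \<in> carrier \<D>" for \<phi>
    using mult[of "inv\<^bsub>\<D>\<^esub> \<phi>" \<phi>] inv one that by simp
  have sym: "r (inv\<^bsub>\<D>\<^esub> \<phi> \<otimes>\<^bsub>\<D>\<^esub> \<psi>) = r (inv\<^bsub>\<D>\<^esub> \<psi> \<otimes>\<^bsub>\<D>\<^esub> \<phi>)" if "\<phi> \<in> carrier \<D>" "\<psi> \<in> carrier \<D>" for \<phi> \<psi>
    using inv[of "inv\<^bsub>\<D>\<^esub> \<phi> \<otimes>\<^bsub>\<D>\<^esub> \<psi>"] that by (simp add: dual.inv_mult_group)
  have tri: "r (inv\<^bsub>\<D>\<^esub> \<phi> \<otimes>\<^bsub>\<D>\<^esub> \<theta>) \<le> r (inv\<^bsub>\<D>\<^esub> \<phi> \<otimes>\<^bsub>\<D>\<^esub> \<psi>) + r (inv\<^bsub>\<D>\<^esub> \<psi> \<otimes>\<^bsub>\<D>\<^esub> \<theta>)"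
    if "\<phi> \<in> carrier \<D>" "\<psi> \<in> carrier \<D>" "\<theta> \<in> carrier \<D>" for \<phi> \<psi> \<theta>
  proof -
    have "(inv\<^bsub>\<D>\<^esub> \<phi> \<otimes>\<^bsub>\<D>\<^esub> \<psi>) \<otimes>\<^bsub>\<D>\<^esub> (inv\<^bsub>\<D>\<^esub> \<psi> \<otimes>\<^bsub>\<D>\<^esub> \<theta>) = inv\<^bsub>\<D>\<^esub> \<phi> \<otimes>\<^bsub>\<D>\<^esub> \<theta>"
      using that by (simp add: dual.m_assoc dual.inv_solve_left[symmetric] flip: dual.m_assoc[of \<psi>])
    then show ?thesis using mult[of "inv\<^bsub>\<D>\<^esub> \<phi> \<otimes>\<^bsub>\<D>\<^esub> \<psi>" "inv\<^bsub>\<D>\<^esub> \<psi> \<otimes>\<^bsub>\<D>\<^esub> \<theta>"] that by simp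
  qed
  show "pseudometric_on (carrier \<D>) (\<lambda>\<phi> \<psi>. r (inv\<^bsub>\<D>\<^esub> \<phi> \<otimes>\<^bsub>\<D>\<^esub> \<psi>))"
    unfolding pseudometric_on_def using nonneg sym tri one by auto
  have "inv\<^bsub>\<D>\<^esub> (\<theta> \<otimes>\<^bsub>\<D>\<^esub> \<phi>) \<otimes>\<^bsub>\<D>\<^esub> (\<theta> \<otimes>\<^bsub>\<D>\<^esub> \<psi>) = inv\<^bsub>\<D>\<^esub> \<phi> \<otimes>\<^bsub>\<D>\<^esub> \<psi>"
    if "\<phi> \<in> carrier \<D>" "\<psi> \<in> carrier \<D>" "\<theta> \<in> carrier \<D>" for \<phi> \<psi> \<theta>
    using that by (simp add: dual.inv_mult_group dual.m_assoc flip: dual.m_assoc[of "inv\<^bsub>\<D>\<^esub> \<theta>"])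
  then show "left_invariant \<D> (\<lambda>\<phi> \<psi>. r (inv\<^bsub>\<D>\<^esub> \<phi> \<otimes>\<^bsub>\<D>\<^esub> \<psi>))"
    unfolding left_invariant_def by simp
qed

text \<open>
  Continuity at the diagonal suffices by the triangle inequality, and there it is the smallness of
  \<open>r\<close> on characters that are uniformly close to \<open>1\<close> on the compact set
  \<open>K\<close>.
\<close>

lemma continuous_pseudometric_of_length:
  fixes r :: "('a \<Rightarrow> complex) \<Rightarrow> real"
  assumes one: "r \<one>\<^bsub>\<D>\<^esub> = 0"
    and mult: "\<And>\<phi> \<psi>. \<lbrakk>\<phi> \<in> carrier \<D>; \<psi> \<in> carrier \<D>\<rbrakk> \<Longrightarrow> r (\<phi> \<otimes>\<^bsub>\<D>\<^esub> \<psi>) \<le> r \<phi> + r \<psi>"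
    and inv: "\<And>\<phi>. \<phi> \<in> carrier \<D> \<Longrightarrow> r (inv\<^bsub>\<D>\<^esub> \<phi>) = r \<phi>"
    and K: "compactin T K"
    and small: "\<And>\<phi> s. \<lbrakk>\<phi> \<in> carrier \<D>; 0 \<le> s; s \<le> 1 / 2; \<And>x. x \<in> K \<Longrightarrow> norm (\<phi> x - 1) \<le> s\<rbrakk> \<Longrightarrow> r \<phi> \<le> s"
  shows "continuous_map (prod_topology \<T> \<T>) euclideanreal (\<lambda>(\<phi>, \<psi>). r (inv\<^bsub>\<D>\<^esub> \<phi> \<otimes>\<^bsub>\<D>\<^esub> \<psi>))"
proof -
  define d where "d \<phi> \<psi> = r (inv\<^bsub>\<D>\<^esub> \<phi> \<otimes>\<^bsub>\<D>\<^esub> \<psi>)" for \<phi> \<psi>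
  note KG = compact_subset_carrier[OF K]
  have pm: "pseudometric_on (carrier \<D>) d"
    using pseudometric_of_length(1)[OF one mult inv] unfolding d_def by blast
  have sym: "d \<phi> \<psi> = d \<psi> \<phi>" if "\<phi> \<in> carrier \<D>" "\<psi> \<in> carrier \<D>" for \<phi> \<psi>
    using pm that unfolding pseudometric_on_def by blast
  have tri: "d \<phi> \<theta> \<le> d \<phi> \<psi> + d \<psi> \<theta>" if "\<phi> \<in> carrier \<D>" "\<psi> \<in> carrier \<D>" "\<theta> \<in> carrier \<D>" for \<phi> \<psi> \<theta>
    using pm that unfolding pseudometric_on_def by blast
  have near: "\<exists>O'. openin \<T> O' \<and> \<phi> \<in> O' \<and> O' \<subseteq> carrier \<D> \<and> (\<forall>\<psi>\<in>O'. d \<phi> \<psi> < e)"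
    if \<phi>: "\<phi> \<in> carrier \<D>" and e: "0 < e" for \<phi> e
  proof -
    define s where "s = min (e / 2) (1 / 2)"
    have s: "0 < s" "s \<le> 1 / 2" "s < e" using e by (auto simp: s_def)
    obtain O' where O': "openin \<T> O'" "\<phi> \<in> O'" "\<And>\<psi> x. \<lbrakk>\<psi> \<in> O'; x \<in> K\<rbrakk> \<Longrightarrow> norm (\<psi> x - \<phi> x) < s"
      using uniform_neighbourhood[OF K \<phi> s(1)] by blast
    have sub: "O' \<subseteq> carrier \<D>" using openin_subset[OF O'(1)] by simp
    have "d \<phi> \<psi> \<le> s" if "\<psi> \<in> O'" for \<psi>
      unfolding d_def
    proof (rule small)
      show "norm ((inv\<^bsub>\<D>\<^esub> \<phi> \<otimes>\<^bsub>\<D>\<^esub> \<psi>) x - 1) \<le> s" if "x \<in> K" for x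
      proof -
        have "x \<in> carrier G" "\<psi> \<in> carrier \<D>" using sub \<open>\<psi> \<in> O'\<close> that KG by auto
        then show ?thesis
          using O'(3)[OF \<open>\<psi> \<in> O'\<close> that] norm_quotient_minus_one[OF \<phi>, of \<psi> x] by simp
      qed
    qed (use \<phi> sub that s in auto)
    then have "\<forall>\<psi>\<in>O'. d \<phi> \<psi> < e" using s(3) by force
    then show ?thesis using O'(1,2) sub by blast
  qed
  have "openin (prod_topology \<T> \<T>) {p \<in> carrier \<D> \<times> carrier \<D>. (\<lambda>(\<phi>, \<psi>). d \<phi> \<psi>) p \<in> W}" if W: "open W" for W
    unfolding openin_prod_topology_alt
  proof (intro allI impI)
    fix \<phi> \<psi> assume "(\<phi>, \<psi>) \<in> {p \<in> carrier \<D> \<times> carrier \<D>. (\<lambda>(\<phi>, \<psi>). d \<phi> \<psi>) p \<in> W}"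
    then have *: "\<phi> \<in> carrier \<D>" "\<psi> \<in> carrier \<D>" "d \<phi> \<psi> \<in> W" by auto
    then obtain e where e: "0 < e" "ball (d \<phi> \<psi>) e \<subseteq> W" using W open_contains_ball by blast
    obtain A where A: "openin \<T> A" "\<phi> \<in> A" "A \<subseteq> carrier \<D>" "\<And>\<theta>. \<theta> \<in> A \<Longrightarrow> d \<phi> \<theta> < e / 2"
      using near[OF *(1), of "e / 2"] e(1) by auto
    obtain B where B: "openin \<T> B" "\<psi> \<in> B" "B \<subseteq> carrier \<D>" "\<And>\<theta>. \<theta> \<in> B \<Longrightarrow> d \<psi> \<theta> < e / 2"
      using near[OF *(2), of "e / 2"] e(1) by auto
    have "d \<theta> \<eta> \<in> W" if "\<theta> \<in> A" "\<eta> \<in> B" for \<theta> \<eta>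
    proof -
      have c: "\<theta> \<in> carrier \<D>" "\<eta> \<in> carrier \<D>" using that A(3) B(3) by auto
      have "d \<theta> \<eta> \<le> d \<phi> \<theta> + d \<phi> \<psi> + d \<psi> \<eta>"
        using tri[of \<theta> \<phi> \<eta>] tri[of \<phi> \<psi> \<eta>] sym[of \<theta> \<phi>] c * by simp
      moreover have "d \<phi> \<psi> \<le> d \<phi> \<theta> + d \<theta> \<eta> + d \<psi> \<eta>"
        using tri[of \<phi> \<theta> \<psi>] tri[of \<theta> \<eta> \<psi>] sym[of \<eta> \<psi>] c * by simp
      ultimately have "\<bar>d \<phi> \<psi> - d \<theta> \<eta>\<bar> < e" using A(4)[OF that(1)] B(4)[OF that(2)] by linarith
      then show ?thesis using e(2) by (auto simp: dist_real_def)
    qed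
    then show "\<exists>U V. openin \<T> U \<and> openin \<T> V \<and> \<phi> \<in> U \<and> \<psi> \<in> V \<and>
        U \<times> V \<subseteq> {p \<in> carrier \<D> \<times> carrier \<D>. (\<lambda>(\<phi>, \<psi>). d \<phi> \<psi>) p \<in> W}"
      using A B by (intro exI[of _ A] exI[of _ B]) auto
  qed
  then have "continuous_map (prod_topology \<T> \<T>) euclideanreal (\<lambda>(\<phi>, \<psi>). d \<phi> \<psi>)"
    by (simp add: continuous_map)
  then show ?thesis by (simp add: d_def)
qed

lemma continuous_pseudometric_bounded:
  assumes d: "pseudometric_on (carrier \<D>) d" "continuous_map (prod_topology \<T> \<T>) euclideanreal (\<lambda>(\<phi>, \<psi>). d \<phi> \<psi>)"
    and A: "A \<in> relatively_compact_sets \<T>"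
  obtains R where "\<And>\<phi> \<psi>. \<lbrakk>\<phi> \<in> A; \<psi> \<in> A\<rbrakk> \<Longrightarrow> d \<phi> \<psi> \<le> R"
proof -
  define C where "C = \<T> closure_of A"
  have C: "compactin \<T> C" "A \<subseteq> C"
    using A closure_of_subset[of A \<T>] unfolding relatively_compact_sets_def C_def by auto
  then have "compactin (prod_topology \<T> \<T>) (C \<times> C)" by (simp add: compactin_Times)
  from image_compactin[OF this d(2)] have "bounded ((\<lambda>(\<phi>, \<psi>). d \<phi> \<psi>) ` (C \<times> C))"
    by (simp add: compact_imp_bounded)
  then obtain R where R: "\<And>x. x \<in> (\<lambda>(\<phi>, \<psi>). d \<phi> \<psi>) ` (C \<times> C) \<Longrightarrow> norm x \<le> R"
    unfolding bounded_iff by blast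
  show thesis
  proof (rule that)
    fix \<phi> \<psi> assume "\<phi> \<in> A" "\<psi> \<in> A"
    then have "(\<lambda>(\<phi>, \<psi>). d \<phi> \<psi>) (\<phi>, \<psi>) \<in> (\<lambda>(\<phi>, \<psi>). d \<phi> \<psi>) ` (C \<times> C)" using C(2) by (intro imageI) auto
    then have "norm (d \<phi> \<psi>) \<le> R" using R by simp
    then show "d \<phi> \<psi> \<le> R" by simp
  qed
qed

end

section \<open>Coarsely bounded sets and the coarse metric\<close>

context locally_compact_abelian_group
begin

lemma neighbourhood_square_choice:
  assumes "openin T U" "\<one> \<in> U" "openin T W" "\<one> \<in> W"
  shows "\<exists>V. openin T V \<and> \<one> \<in> V \<and> V \<subseteq> U \<and> V \<subseteq> W \<and> (\<forall>x\<in>V. x \<otimes> x \<in> U)"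
proof -
  obtain V where V: "openin T V" "\<one> \<in> V" "V \<subseteq> U" "\<And>x y. \<lbrakk>x \<in> V; y \<in> V\<rbrakk> \<Longrightarrow> x \<otimes> y \<in> U"
    by (rule square_root_neighbourhood[OF assms(1,2)]) blast
  have "openin T (V \<inter> W)" "\<one> \<in> V \<inter> W" using V(1,2) assms(3,4) by auto
  moreover have "\<forall>x\<in>V \<inter> W. x \<otimes> x \<in> U" using V(4) by blast
  ultimately show ?thesis using V(3) by blast
qed

text \<open>
  If \<open>A\<close> is not equicontinuous, neighbourhoods \<open>V n\<close> and witnesses
  \<open>w (V n) \<in> A\<close> are built together: the witness is at distance more than
  \<open>\<epsilon>\<close> from \<open>1\<close> somewhere on \<open>V n\<close>, and
  \<open>V (n + 1)\<close> is so small that the witness stays within \<open>1/2\<close> of \<open>1\<close>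
  on it. The second property makes the length of the witness finite, the first makes it at least
  \<open>(3/2)^n * \<epsilon>\<close>. The finite extension of the length then defines a pseudometric that
  is unbounded on \<open>A\<close>.
\<close>

lemma bounded_by_continuous_pseudometrics_imp_relatively_compact:
  assumes AD: "A \<subseteq> carrier \<D>"
    and bdd: "\<And>d. \<lbrakk>pseudometric_on (carrier \<D>) d; left_invariant \<D> d;
      continuous_map (prod_topology \<T> \<T>) euclideanreal (\<lambda>(\<phi>, \<psi>). d \<phi> \<psi>)\<rbrakk>
      \<Longrightarrow> bdd_above {d \<phi> \<psi> |\<phi> \<psi>. \<phi> \<in> A \<and> \<psi> \<in> A}"
  shows "A \<in> relatively_compact_sets \<T>"
proof (rule ccontr)
  assume "A \<notin> relatively_compact_sets \<T>"
  then obtain \<epsilon> :: real where \<epsilon>: "0 < \<epsilon>"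
    and fail: "\<And>U. \<lbrakk>openin T U; \<one> \<in> U\<rbrakk> \<Longrightarrow> \<exists>\<phi>\<in>A. \<exists>x\<in>U. \<epsilon> < norm (\<phi> x - 1)"
    using equicontinuous_imp_relatively_compact[OF AD] by (metis not_le)
  obtain U0 K where K: "openin T U0" "\<one> \<in> U0" "U0 \<subseteq> K" "compactin T K"
    using compact_neighbourhood_of_one .
  define w where "w U = (SOME \<phi>. \<phi> \<in> A \<and> (\<exists>x\<in>U. \<epsilon> < norm (\<phi> x - 1)))" for U
  have w: "w U \<in> A" "\<exists>x\<in>U. \<epsilon> < norm (w U x - 1)" if "openin T U" "\<one> \<in> U" for U
    using someI_ex[of "\<lambda>\<phi>. \<phi> \<in> A \<and> (\<exists>x\<in>U. \<epsilon> < norm (\<phi> x - 1))"] fail[OF that] unfolding w_def by blast+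
  define next_nbhd where "next_nbhd U = (SOME V. openin T V \<and> \<one> \<in> V \<and> V \<subseteq> U \<and>
    (\<forall>x\<in>V. norm (w U x - 1) \<le> 1 / 2) \<and> (\<forall>x\<in>V. x \<otimes> x \<in> U))" for U
  have next_nbhd: "openin T (next_nbhd U) \<and> \<one> \<in> next_nbhd U \<and> next_nbhd U \<subseteq> U \<and>
      (\<forall>x\<in>next_nbhd U. norm (w U x - 1) \<le> 1 / 2) \<and> (\<forall>x\<in>next_nbhd U. x \<otimes> x \<in> U)"
    if U: "openin T U" "\<one> \<in> U" for U
  proof -
    have wD: "w U \<in> carrier \<D>" using w(1)[OF U] AD by blast
    define W where "W = {x \<in> carrier G. w U x \<in> ball 1 (1 / 2)}"
    have W: "openin T W" "\<one> \<in> W"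
      unfolding W_def using openin_continuous_map_preimage[OF dualD(4)[OF wD], of "ball 1 (1 / 2)"] wD by auto
    obtain V where V: "openin T V" "\<one> \<in> V" "V \<subseteq> U" "V \<subseteq> W" "\<forall>x\<in>V. x \<otimes> x \<in> U"
      using neighbourhood_square_choice[OF U W] by blast
    have "\<forall>x\<in>V. norm (w U x - 1) \<le> 1 / 2"
      using V(4) by (auto simp: W_def dist_norm norm_minus_commute intro: less_imp_le)
    with V have "\<exists>V. openin T V \<and> \<one> \<in> V \<and> V \<subseteq> U \<and>
        (\<forall>x\<in>V. norm (w U x - 1) \<le> 1 / 2) \<and> (\<forall>x\<in>V. x \<otimes> x \<in> U)" by blast
    then show ?thesis unfolding next_nbhd_def by (rule someI_ex)
  qed
  define V where "V n = (next_nbhd ^^ n) U0" for n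
  have V_Suc: "V (Suc n) = next_nbhd (V n)" for n by (simp add: V_def)
  have V: "openin T (V n) \<and> \<one> \<in> V n" for n
  proof (induction n)
    case 0 then show ?case using K by (simp add: V_def)
  next
    case (Suc n) then show ?case using next_nbhd[of "V n"] by (simp add: V_Suc)
  qed
  have V_props: "V (Suc n) \<subseteq> V n" "\<And>x. x \<in> V (Suc n) \<Longrightarrow> norm (w (V n) x - 1) \<le> 1 / 2"
    "\<forall>x\<in>V (Suc n). x \<otimes> x \<in> V n" for n
    using next_nbhd[of "V n"] V[of n] by (auto simp: V_Suc)
  have V_carrier: "V n \<subseteq> carrier G" for n using V open_subset_carrier by blast
  note len = dual_length_one[where V = V, OF V_carrier V_props(3,1)] dual_length_inv[where V = V, OF V_carrier V_props(3,1)]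
    dual_length_mult[where V = V, OF V_carrier V_props(3,1)] dual_length_le[where V = V, OF V_carrier V_props(3,1)]
    dual_length_finite[where V = V, OF V_carrier V_props(3,1)]
  define l where "l = dual_length V"
  obtain L where L: "L \<one>\<^bsub>\<D>\<^esub> = 0"
    "\<And>x y. \<lbrakk>x \<in> carrier \<D>; y \<in> carrier \<D>\<rbrakk> \<Longrightarrow> L (x \<otimes>\<^bsub>\<D>\<^esub> y) \<le> L x + L y"
    "\<And>x. x \<in> carrier \<D> \<Longrightarrow> L (inv\<^bsub>\<D>\<^esub> x) = L x"
    "\<And>x. x \<in> carrier \<D> \<Longrightarrow> L x < \<infinity>"
    "\<And>x. x \<in> carrier \<D> \<Longrightarrow> L x \<le> l x"
    "\<And>x. \<lbrakk>x \<in> carrier \<D>; l x < \<infinity>\<rbrakk> \<Longrightarrow> L x = l x"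
  proof (rule dual.extend_length_function[of l])
    show "l \<one>\<^bsub>\<D>\<^esub> = 0" unfolding l_def by (rule len(1))
    show "\<And>x y. \<lbrakk>x \<in> carrier \<D>; y \<in> carrier \<D>\<rbrakk> \<Longrightarrow> l (x \<otimes>\<^bsub>\<D>\<^esub> y) \<le> l x + l y"
      unfolding l_def by (rule len(3))
    show "\<And>x. x \<in> carrier \<D> \<Longrightarrow> l (inv\<^bsub>\<D>\<^esub> x) = l x" unfolding l_def by (rule len(2))
  qed blast
  define r where "r \<phi> = enn2real (L \<phi>)" for \<phi>
  have r_L: "ennreal (r \<phi>) = L \<phi>" if "\<phi> \<in> carrier \<D>" for \<phi>
    using L(4)[OF that] by (simp add: r_def less_top)
  have r0: "0 \<le> r \<phi>" for \<phi> by (simp add: r_def)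
  have r1: "r \<one>\<^bsub>\<D>\<^esub> = 0" by (simp add: r_def L(1))
  have r_mult: "r (\<phi> \<otimes>\<^bsub>\<D>\<^esub> \<psi>) \<le> r \<phi> + r \<psi>" if "\<phi> \<in> carrier \<D>" "\<psi> \<in> carrier \<D>" for \<phi> \<psi>
  proof -
    have "ennreal (r (\<phi> \<otimes>\<^bsub>\<D>\<^esub> \<psi>)) \<le> ennreal (r \<phi> + r \<psi>)"
      using L(2)[OF that] that r0 by (simp add: r_L)
    then show ?thesis using r0[of \<phi>] r0[of \<psi>] by (subst (asm) ennreal_le_iff) auto
  qed
  have r_inv: "r (inv\<^bsub>\<D>\<^esub> \<phi>) = r \<phi>" if "\<phi> \<in> carrier \<D>" for \<phi>
    using L(3)[OF that] by (simp add: r_def)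
  have r_small: "r \<phi> \<le> s"
    if "\<phi> \<in> carrier \<D>" "0 \<le> s" "s \<le> 1 / 2" "\<And>x. x \<in> K \<Longrightarrow> norm (\<phi> x - 1) \<le> s" for \<phi> s
  proof -
    have "norm (\<phi> x - 1) \<le> s" if "x \<in> V 0" for x using that \<open>\<And>x. x \<in> K \<Longrightarrow> _\<close> K(3) by (auto simp: V_def)
    then have "l \<phi> \<le> ennreal s" unfolding l_def using len(4)[OF that(1,3)] by blast
    then have "ennreal (r \<phi>) \<le> ennreal s" using L(5)[OF that(1)] r_L[OF that(1)] by simp
    then show ?thesis using that(2) by (simp add: ennreal_le_iff)
  qed
  define d where "d \<phi> \<psi> = r (inv\<^bsub>\<D>\<^esub> \<phi> \<otimes>\<^bsub>\<D>\<^esub> \<psi>)" for \<phi> \<psi>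
  have "bdd_above {d \<phi> \<psi> |\<phi> \<psi>. \<phi> \<in> A \<and> \<psi> \<in> A}"
    unfolding d_def
    by (rule bdd pseudometric_of_length continuous_pseudometric_of_length[OF _ _ _ K(4)] | fact r1 r_mult r_inv r_small)+
  then obtain R where R: "\<And>\<phi> \<psi>. \<lbrakk>\<phi> \<in> A; \<psi> \<in> A\<rbrakk> \<Longrightarrow> d \<phi> \<psi> \<le> R"
    unfolding bdd_above_def by blast
  have wA: "w (V n) \<in> A" for n using w(1) V by blast
  have wD: "w (V n) \<in> carrier \<D>" for n using wA AD by blast
  have upper: "r (w (V n)) \<le> r (w (V 0)) + R" for n
  proof -
    have "w (V n) = w (V 0) \<otimes>\<^bsub>\<D>\<^esub> (inv\<^bsub>\<D>\<^esub> w (V 0) \<otimes>\<^bsub>\<D>\<^esub> w (V n))"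
      using wD[of 0] wD[of n] by (simp flip: dual.m_assoc)
    then have "r (w (V n)) \<le> r (w (V 0)) + d (w (V 0)) (w (V n))"
      using r_mult[of "w (V 0)" "inv\<^bsub>\<D>\<^esub> w (V 0) \<otimes>\<^bsub>\<D>\<^esub> w (V n)"] wD[of 0] wD[of n] by (simp add: d_def)
    then show ?thesis using R[OF wA[of 0] wA[of n]] by linarith
  qed
  have lower: "(3 / 2) ^ n * \<epsilon> \<le> r (w (V n))" for n
  proof -
    obtain x where x: "x \<in> V n" "\<epsilon> < norm (w (V n) x - 1)" using w(2) V by blast
    have "l (w (V n)) < \<infinity>"
      unfolding l_def using len(5)[OF wD V_props(2)] by blast
    then have "L (w (V n)) = l (w (V n))" using L(6) wD by blast
    then have "ennreal ((3 / 2) ^ n * norm (w (V n) x - 1)) \<le> ennreal (r (w (V n)))"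
      using dual_length_ge[where V = V and n = n and x = x, OF x(1)] r_L[OF wD] by (simp add: l_def)
    then have "(3 / 2) ^ n * norm (w (V n) x - 1) \<le> r (w (V n))" using r0 by (simp add: ennreal_le_iff)
    moreover have "(3 / 2) ^ n * \<epsilon> \<le> (3 / 2) ^ n * norm (w (V n) x - 1)" using x(2) by simp
    ultimately show ?thesis by linarith
  qed
  obtain n where "(r (w (V 0)) + R) / \<epsilon> < (3 / 2) ^ n" using real_arch_pow[of "3 / 2"] by auto
  then have "r (w (V 0)) + R < (3 / 2) ^ n * \<epsilon>" using \<epsilon> by (simp add: field_simps)
  then show False using upper[of n] lower[of n] by linarith
qed

theorem coarsely_bounded_eq_relatively_compact:
  "coarsely_bounded_sets \<D> \<T> = relatively_compact_sets \<T>"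
proof (intro equalityI subsetI)
  fix A assume "A \<in> coarsely_bounded_sets \<D> \<T>"
  then show "A \<in> relatively_compact_sets \<T>"
    unfolding coarsely_bounded_sets_def
    by (intro bounded_by_continuous_pseudometrics_imp_relatively_compact) auto
next
  fix A assume A: "A \<in> relatively_compact_sets \<T>"
  then have "A \<subseteq> carrier \<D>" by (auto simp: relatively_compact_sets_def)
  moreover have "bdd_above {d \<phi> \<psi> |\<phi> \<psi>. \<phi> \<in> A \<and> \<psi> \<in> A}"
    if d: "pseudometric_on (carrier \<D>) d" "continuous_map (prod_topology \<T> \<T>) euclideanreal (\<lambda>(\<phi>, \<psi>). d \<phi> \<psi>)" for d
  proof -
    obtain R where "\<And>\<phi> \<psi>. \<lbrakk>\<phi> \<in> A; \<psi> \<in> A\<rbrakk> \<Longrightarrow> d \<phi> \<psi> \<le> R"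
      using continuous_pseudometric_bounded[OF d A] by blast
    then show ?thesis unfolding bdd_above_def by blast
  qed
  ultimately show "A \<in> coarsely_bounded_sets \<D> \<T>"
    unfolding coarsely_bounded_sets_def by auto
qed

text \<open>
  With \<open>V (n + 1)\<close> inside the ball of radius \<open>1 / (n + 1)\<close>, each character is
  close to \<open>1\<close> on some \<open>V n\<close> and so has finite length. The length gives a
  continuous invariant pseudometric whose balls are relatively compact; adding the discrete metric turns it
  into a metric with the same bounded sets.
\<close>

theorem metrizable_imp_coarse_metrisable:
  assumes "metrizable_space T"
  shows "coarse_group_metrisable \<D> (relatively_compact_sets \<T>)"
proof -
  obtain M \<rho> where \<rho>: "Metric_space M \<rho>" "T = Metric_space.mtopology M \<rho>"
    using assms unfolding metrizable_space_def by blast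
  interpret met: Metric_space M \<rho> by (rule \<rho>(1))
  have M: "M = carrier G" using topspace met.topspace_mtopology \<rho>(2) by metis
  obtain U0 K where K: "openin T U0" "\<one> \<in> U0" "U0 \<subseteq> K" "compactin T K"
    using compact_neighbourhood_of_one .
  define B where "B n = met.mball \<one> (1 / real (Suc n))" for n
  have "\<one> \<in> M" unfolding M by simp
  then have B: "openin T (B n)" "\<one> \<in> B n" for n
    unfolding B_def \<rho>(2) by (simp_all add: met.in_mball)
  define next_nbhd where "next_nbhd n U = (SOME V. openin T V \<and> \<one> \<in> V \<and> V \<subseteq> U \<and> V \<subseteq> B n \<and> (\<forall>x\<in>V. x \<otimes> x \<in> U))" for n U
  have next_nbhd: "openin T (next_nbhd n U) \<and> \<one> \<in> next_nbhd n U \<and> next_nbhd n U \<subseteq> U \<and> next_nbhd n U \<subseteq> B n \<and>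
      (\<forall>x\<in>next_nbhd n U. x \<otimes> x \<in> U)" if "openin T U" "\<one> \<in> U" for n U
    unfolding next_nbhd_def by (rule someI_ex[OF neighbourhood_square_choice[OF that B]])
  define V where "V = rec_nat U0 next_nbhd"
  have V_0: "V 0 = U0" and V_Suc: "V (Suc n) = next_nbhd n (V n)" for n by (simp_all add: V_def)
  have V: "openin T (V n) \<and> \<one> \<in> V n" for n
  proof (induction n)
    case 0 then show ?case using K by (simp add: V_0)
  next
    case (Suc n) then show ?case using next_nbhd[of "V n"] by (simp add: V_Suc)
  qed
  have V_props: "V (Suc n) \<subseteq> V n" "V (Suc n) \<subseteq> B n" "\<forall>x\<in>V (Suc n). x \<otimes> x \<in> V n" for n
    using next_nbhd[of "V n" n] V[of n] by (auto simp: V_Suc)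
  have V_carrier: "V n \<subseteq> carrier G" for n using V open_subset_carrier by blast
  note len = dual_length_one[where V = V, OF V_carrier V_props(3,1)] dual_length_inv[where V = V, OF V_carrier V_props(3,1)]
    dual_length_mult[where V = V, OF V_carrier V_props(3,1)] dual_length_le[where V = V, OF V_carrier V_props(3,1)]
    dual_length_finite[where V = V, OF V_carrier V_props(3,1)]
  define l where "l = dual_length V"
  have l_fin: "l \<phi> < \<infinity>" if \<phi>: "\<phi> \<in> carrier \<D>" for \<phi>
  proof -
    define W where "W = {x \<in> carrier G. \<phi> x \<in> ball 1 (1 / 2)}"
    have W: "openin T W" "\<one> \<in> W"
      unfolding W_def using openin_continuous_map_preimage[OF dualD(4)[OF \<phi>], of "ball 1 (1 / 2)"] \<phi> by auto
    then obtain e where e: "0 < e" "met.mball \<one> e \<subseteq> W" unfolding \<rho>(2) met.openin_mtopology by blast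
    obtain n where n: "1 / real (Suc n) < e" using e(1) nat_approx_posE by blast
    then have "B n \<subseteq> W" using e(2) unfolding B_def by (meson less_imp_le met.mball_subset_concentric order_trans)
    then have "V (Suc n) \<subseteq> W" using V_props(2) by blast
    then show ?thesis
      unfolding l_def using len(5)[OF \<phi>, of "Suc n"]
      by (force simp: W_def dist_norm norm_minus_commute)
  qed
  define r where "r \<phi> = enn2real (l \<phi>)" for \<phi>
  have r_l: "ennreal (r \<phi>) = l \<phi>" if "\<phi> \<in> carrier \<D>" for \<phi>
    using l_fin[OF that] by (simp add: r_def less_top)
  have r0: "0 \<le> r \<phi>" for \<phi> by (simp add: r_def)
  have r1: "r \<one>\<^bsub>\<D>\<^esub> = 0" using len(1) by (simp add: r_def l_def)
  have r_mult: "r (\<phi> \<otimes>\<^bsub>\<D>\<^esub> \<psi>) \<le> r \<phi> + r \<psi>" if "\<phi> \<in> carrier \<D>" "\<psi> \<in> carrier \<D>" for \<phi> \<psi>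
  proof -
    have "ennreal (r (\<phi> \<otimes>\<^bsub>\<D>\<^esub> \<psi>)) \<le> ennreal (r \<phi> + r \<psi>)"
      using len(3)[OF that] that r0 by (simp add: r_l) (simp add: l_def)
    then show ?thesis using r0[of \<phi>] r0[of \<psi>] by (subst (asm) ennreal_le_iff) auto
  qed
  have r_inv: "r (inv\<^bsub>\<D>\<^esub> \<phi>) = r \<phi>" if "\<phi> \<in> carrier \<D>" for \<phi>
    using len(2)[OF that] by (simp add: r_def l_def)
  have r_small: "r \<phi> \<le> s"
    if "\<phi> \<in> carrier \<D>" "0 \<le> s" "s \<le> 1 / 2" "\<And>x. x \<in> K \<Longrightarrow> norm (\<phi> x - 1) \<le> s" for \<phi> s
  proof -
    have "norm (\<phi> x - 1) \<le> s" if "x \<in> V 0" for x using that \<open>\<And>x. x \<in> K \<Longrightarrow> _\<close> K(3) by (auto simp: V_0)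
    then have "l \<phi> \<le> ennreal s" unfolding l_def using len(4)[OF that(1,3)] by blast
    then have "ennreal (r \<phi>) \<le> ennreal s" using r_l[OF that(1)] by simp
    then show ?thesis using that(2) by (simp add: ennreal_le_iff)
  qed
  define d where "d \<phi> \<psi> = r (inv\<^bsub>\<D>\<^esub> \<phi> \<otimes>\<^bsub>\<D>\<^esub> \<psi>)" for \<phi> \<psi>
  have pm: "pseudometric_on (carrier \<D>) d" and left: "left_invariant \<D> d"
    unfolding d_def by (rule pseudometric_of_length | fact r1 r_mult r_inv)+
  have cont: "continuous_map (prod_topology \<T> \<T>) euclideanreal (\<lambda>(\<phi>, \<psi>). d \<phi> \<psi>)"
    unfolding d_def by (rule continuous_pseudometric_of_length[OF _ _ _ K(4)] | fact r1 r_mult r_inv r_small)+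
  \<comment> \<open>A \<open>Metric_space\<close> requires nonnegativity and symmetry at all arguments, also off the carrier.\<close>
  define \<delta> where "\<delta> \<phi> \<psi> = (if \<phi> = \<psi> then 0 else if \<phi> \<in> carrier \<D> \<and> \<psi> \<in> carrier \<D> then 1 + d \<phi> \<psi> else 1)" for \<phi> \<psi>
  have d0: "0 \<le> d \<phi> \<psi>" for \<phi> \<psi> by (simp add: d_def r0)
  have "Metric_space (carrier \<D>) \<delta>"
  proof
    show "0 \<le> \<delta> \<phi> \<psi>" for \<phi> \<psi> using d0 by (simp add: \<delta>_def)
    show "\<delta> \<phi> \<psi> = \<delta> \<psi> \<phi>" for \<phi> \<psi> using pm unfolding pseudometric_on_def \<delta>_def by auto
    show "(\<delta> \<phi> \<psi> = 0) = (\<phi> = \<psi>)" for \<phi> \<psi> using d0[of \<phi> \<psi>] by (simp add: \<delta>_def)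
    show "\<delta> \<phi> \<theta> \<le> \<delta> \<phi> \<psi> + \<delta> \<psi> \<theta>" if "\<phi> \<in> carrier \<D>" "\<psi> \<in> carrier \<D>" "\<theta> \<in> carrier \<D>" for \<phi> \<psi> \<theta>
    proof -
      have "d \<phi> \<theta> \<le> d \<phi> \<psi> + d \<psi> \<theta>" using pm that unfolding pseudometric_on_def by blast
      then show ?thesis using d0[of \<phi> \<psi>] d0[of \<psi> \<theta>] that by (auto simp: \<delta>_def)
    qed
  qed
  moreover have "left_invariant \<D> \<delta>"
    using left unfolding left_invariant_def \<delta>_def by auto
  moreover have "ideal_coarse_structure \<D> (relatively_compact_sets \<T>) = metric_coarse_structure (carrier \<D>) \<delta>"
  proof (intro equalityI subsetI)
    fix E assume "E \<in> ideal_coarse_structure \<D> (relatively_compact_sets \<T>)"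
    then obtain C where E: "E \<subseteq> carrier \<D> \<times> carrier \<D>" and C: "C \<in> relatively_compact_sets \<T>"
      and EC: "\<And>\<phi> \<psi>. (\<phi>, \<psi>) \<in> E \<Longrightarrow> inv\<^bsub>\<D>\<^esub> \<phi> \<otimes>\<^bsub>\<D>\<^esub> \<psi> \<in> C"
      unfolding ideal_coarse_structure_def by auto
    obtain R where R: "\<And>\<phi> \<psi>. \<lbrakk>\<phi> \<in> C; \<psi> \<in> C\<rbrakk> \<Longrightarrow> d \<phi> \<psi> \<le> R"
      using continuous_pseudometric_bounded[OF pm cont C] by blast
    have CD: "C \<subseteq> carrier \<D>" using C by (auto simp: relatively_compact_sets_def)
    have "\<exists>R'. \<forall>\<theta>\<in>C. r \<theta> \<le> R'"
    proof (cases "C = {}")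
      case False
      then obtain \<theta>0 where \<theta>0: "\<theta>0 \<in> C" by blast
      have "r \<theta> \<le> r \<theta>0 + R" if "\<theta> \<in> C" for \<theta>
      proof -
        have c: "\<theta> \<in> carrier \<D>" "\<theta>0 \<in> carrier \<D>" using that \<theta>0 CD by auto
        have "\<theta> = \<theta>0 \<otimes>\<^bsub>\<D>\<^esub> (inv\<^bsub>\<D>\<^esub> \<theta>0 \<otimes>\<^bsub>\<D>\<^esub> \<theta>)" using c by (simp flip: dual.m_assoc)
        then have "r \<theta> \<le> r \<theta>0 + d \<theta>0 \<theta>"
          using r_mult[of \<theta>0 "inv\<^bsub>\<D>\<^esub> \<theta>0 \<otimes>\<^bsub>\<D>\<^esub> \<theta>"] c by (simp add: d_def)
        then show ?thesis using R[OF \<theta>0 that] by linarith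
      qed
      then show ?thesis by blast
    qed auto
    then obtain R' where R': "\<And>\<theta>. \<theta> \<in> C \<Longrightarrow> r \<theta> \<le> R'" by blast
    have "\<delta> \<phi> \<psi> \<le> 1 + \<bar>R'\<bar>" if "(\<phi>, \<psi>) \<in> E" for \<phi> \<psi>
      using R'[OF EC[OF that]] d0[of \<phi> \<psi>] unfolding \<delta>_def d_def by auto
    then have "\<forall>(\<phi>, \<psi>)\<in>E. \<delta> \<phi> \<psi> \<le> 1 + \<bar>R'\<bar>" by auto
    moreover have "0 < 1 + \<bar>R'\<bar>" by linarith
    ultimately show "E \<in> metric_coarse_structure (carrier \<D>) \<delta>"
      unfolding metric_coarse_structure_def using E by blast
  next
    fix E assume "E \<in> metric_coarse_structure (carrier \<D>) \<delta>"
    then obtain R where E: "E \<subseteq> carrier \<D> \<times> carrier \<D>" and "0 < R" "\<forall>(\<phi>, \<psi>)\<in>E. \<delta> \<phi> \<psi> \<le> R"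
      unfolding metric_coarse_structure_def by blast
    then have R: "0 < R" "\<And>\<phi> \<psi>. (\<phi>, \<psi>) \<in> E \<Longrightarrow> \<delta> \<phi> \<psi> \<le> R" by auto
    define C where "C = {\<theta> \<in> carrier \<D>. dual_length V \<theta> \<le> ennreal R}"
    have "C \<in> relatively_compact_sets \<T>"
      using R(1) V by (intro dual_length_bounded_relatively_compact[of V C R]) (auto simp: C_def)
    moreover have "inv\<^bsub>\<D>\<^esub> \<phi> \<otimes>\<^bsub>\<D>\<^esub> \<psi> \<in> C" if "(\<phi>, \<psi>) \<in> E" for \<phi> \<psi>
    proof -
      have c: "\<phi> \<in> carrier \<D>" "\<psi> \<in> carrier \<D>" using that E by auto
      have "d \<phi> \<psi> \<le> R"
        using R(2)[OF that] R(1) c r1 unfolding \<delta>_def d_def by (auto split: if_splits)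
      then have "ennreal (r (inv\<^bsub>\<D>\<^esub> \<phi> \<otimes>\<^bsub>\<D>\<^esub> \<psi>)) \<le> ennreal R" by (simp add: d_def ennreal_leI)
      then show ?thesis using c r_l[of "inv\<^bsub>\<D>\<^esub> \<phi> \<otimes>\<^bsub>\<D>\<^esub> \<psi>"] by (simp add: C_def l_def)
    qed
    ultimately show "E \<in> ideal_coarse_structure \<D> (relatively_compact_sets \<T>)"
      unfolding ideal_coarse_structure_def using E by blast
  qed
  ultimately show ?thesis unfolding coarse_group_metrisable_def by blast
qed

text \<open>
  The pairs \<open>(\<one>, \<phi>)\<close> with \<open>\<phi>\<close> in a fixed metric ball form a
  controlled set, so each ball around the trivial character has compact closure.
\<close>

lemma coarse_metrisable_imp_sigma_compact:
  assumes "coarse_group_metrisable \<D> (relatively_compact_sets \<T>)"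
  obtains C :: "nat \<Rightarrow> ('a \<Rightarrow> complex) set" where "\<And>n. compactin \<T> (C n)" "carrier \<D> = (\<Union>n. C n)"
proof -
  obtain d where d: "Metric_space (carrier \<D>) d"
    "ideal_coarse_structure \<D> (relatively_compact_sets \<T>) = metric_coarse_structure (carrier \<D>) d"
    using assms unfolding coarse_group_metrisable_def by blast
  define E where "E n = {(\<one>\<^bsub>\<D>\<^esub>, \<phi>) |\<phi>. \<phi> \<in> carrier \<D> \<and> d \<one>\<^bsub>\<D>\<^esub> \<phi> \<le> real (Suc n)}" for n
  have "E n \<in> metric_coarse_structure (carrier \<D>) d" for n
    unfolding metric_coarse_structure_def E_def by (auto intro!: exI[of _ "real (Suc n)"])
  then have "E n \<in> ideal_coarse_structure \<D> (relatively_compact_sets \<T>)" for n using d(2) by simp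
  then have "\<forall>n. \<exists>K\<in>relatively_compact_sets \<T>. E n \<subseteq> {(x, y). inv\<^bsub>\<D>\<^esub> x \<otimes>\<^bsub>\<D>\<^esub> y \<in> K}"
    unfolding ideal_coarse_structure_def by blast
  then obtain K where K: "\<And>n. K n \<in> relatively_compact_sets \<T>"
    "\<And>n. E n \<subseteq> {(x, y). inv\<^bsub>\<D>\<^esub> x \<otimes>\<^bsub>\<D>\<^esub> y \<in> K n}" by metis
  have cov: "\<exists>n. \<phi> \<in> K n" if \<phi>: "\<phi> \<in> carrier \<D>" for \<phi>
  proof -
    obtain n where "d \<one>\<^bsub>\<D>\<^esub> \<phi> \<le> real n" using real_arch_simple by blast
    then have "(\<one>\<^bsub>\<D>\<^esub>, \<phi>) \<in> E n" using \<phi> by (simp add: E_def)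
    then have "inv\<^bsub>\<D>\<^esub> \<one>\<^bsub>\<D>\<^esub> \<otimes>\<^bsub>\<D>\<^esub> \<phi> \<in> K n" using K(2)[of n] by auto
    then show ?thesis using \<phi> by auto
  qed
  have sub: "K n \<subseteq> \<T> closure_of (K n)" for n
    using K(1)[of n] closure_of_subset[of "K n" \<T>] unfolding relatively_compact_sets_def by auto
  have comp: "compactin \<T> (\<T> closure_of (K n))" for n
    using K(1)[of n] unfolding relatively_compact_sets_def by auto
  have "carrier \<D> = (\<Union>n. \<T> closure_of (K n))"
  proof (intro equalityI subsetI)
    show "\<phi> \<in> (\<Union>n. \<T> closure_of (K n))" if "\<phi> \<in> carrier \<D>" for \<phi> using cov[OF that] sub by blast
    show "\<phi> \<in> carrier \<D>" if "\<phi> \<in> (\<Union>n. \<T> closure_of (K n))" for \<phi>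
      using that compactin_subset_topspace[OF comp] by auto
  qed
  with comp show thesis by (rule that)
qed

end

section \<open>Compactly supported functions\<close>

context locally_compact_abelian_group
begin

text \<open>
  Elements vanish off a compact subset of the carrier, in particular at every point outside the carrier; two
  of them that agree on the carrier are therefore equal.
\<close>

definition Cc :: "('a \<Rightarrow> 'v::real_normed_vector) set" where
  "Cc = {f. continuous_map T euclidean f \<and> (\<exists>K. compactin T K \<and> (\<forall>x. x \<notin> K \<longrightarrow> f x = 0))}"

lemma openin_carrier: "openin T (carrier G)"
  using openin_topspace[of T] by simp

lemma CcI:
  "\<lbrakk>continuous_map T euclidean f; compactin T K; \<And>x. x \<notin> K \<Longrightarrow> f x = 0\<rbrakk> \<Longrightarrow> f \<in> Cc"
  unfolding Cc_def by blast

lemma CcE: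
  assumes "f \<in> Cc"
  obtains K where "continuous_map T euclidean f" "compactin T K" "\<And>x. x \<notin> K \<Longrightarrow> f x = 0"
  using assms unfolding Cc_def by blast

lemma Cc_continuous: "f \<in> Cc \<Longrightarrow> continuous_map T euclidean f"
  unfolding Cc_def by blast

lemma Cc_outside: "\<lbrakk>f \<in> Cc; x \<notin> carrier G\<rbrakk> \<Longrightarrow> f x = 0"
  unfolding Cc_def using compact_subset_carrier by blast

lemma Cc_compose:
  assumes "f \<in> Cc" "continuous_on UNIV h" "h 0 = 0"
  shows "(\<lambda>x. h (f x)) \<in> Cc"
proof -
  obtain K where K: "continuous_map T euclidean f" "compactin T K" "\<And>x. x \<notin> K \<Longrightarrow> f x = 0"
    using assms(1) unfolding Cc_def by blast
  show ?thesis
    by (rule CcI[OF continuous_map_euclidean_compose[OF K(1) assms(2)] K(2)]) (simp add: K(3) assms(3))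
qed

lemma Cc_add:
  assumes "f \<in> Cc" "g \<in> Cc"
  shows "(\<lambda>x. f x + g x) \<in> Cc"
proof -
  obtain K where K: "continuous_map T euclidean f" "compactin T K" "\<And>x. x \<notin> K \<Longrightarrow> f x = 0"
    using assms(1) unfolding Cc_def by blast
  obtain L where L: "continuous_map T euclidean g" "compactin T L" "\<And>x. x \<notin> L \<Longrightarrow> g x = 0"
    using assms(2) unfolding Cc_def by blast
  have "continuous_map T euclidean (\<lambda>x. f x + g x)"
    by (rule continuous_map_euclidean_compose2[OF K(1) L(1)]) (intro continuous_intros)
  then show ?thesis by (rule CcI[of _ "K \<union> L"]) (use K L in \<open>auto intro: compactin_Un\<close>)
qed

lemma Cc_zero: "(\<lambda>x. 0) \<in> Cc"
  by (rule CcI[of _ "{}"]) auto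

lemma Cc_cmult: "f \<in> Cc \<Longrightarrow> (\<lambda>x. c * f x) \<in> Cc" for c :: "'v::real_normed_algebra"
  by (rule Cc_compose) (intro continuous_intros | simp)+

lemma Cc_uminus: "f \<in> Cc \<Longrightarrow> (\<lambda>x. - f x) \<in> Cc"
  by (rule Cc_compose) (intro continuous_intros | simp)+

lemma Cc_diff: "\<lbrakk>f \<in> Cc; g \<in> Cc\<rbrakk> \<Longrightarrow> (\<lambda>x. f x - g x) \<in> Cc"
  using Cc_add[OF _ Cc_uminus, of f g] by simp

lemma Cc_abs: "f \<in> Cc \<Longrightarrow> (\<lambda>x. \<bar>f x :: real\<bar>) \<in> Cc"
  by (rule Cc_compose) (intro continuous_intros | simp)+

lemma Cc_mult:
  fixes f g :: "'a \<Rightarrow> 'v::real_normed_algebra"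
  assumes "f \<in> Cc" "continuous_map T euclidean g"
  shows "(\<lambda>x. f x * g x) \<in> Cc"
proof -
  obtain K where K: "continuous_map T euclidean f" "compactin T K" "\<And>x. x \<notin> K \<Longrightarrow> f x = 0"
    using assms(1) unfolding Cc_def by blast
  have "continuous_map T euclidean (\<lambda>x. f x * g x)"
    by (rule continuous_map_euclidean_compose2[OF K(1) assms(2)]) (intro continuous_intros)
  then show ?thesis by (rule CcI[OF _ K(2)]) (simp add: K(3))
qed

lemma Cc_sum:
  assumes "finite Z" "\<And>z. z \<in> Z \<Longrightarrow> F z \<in> Cc"
  shows "(\<lambda>x. \<Sum>z\<in>Z. F z x) \<in> Cc"
  using assms by (induction Z) (auto intro: Cc_zero Cc_add)

definition translate :: "'a \<Rightarrow> ('a \<Rightarrow> 'v) \<Rightarrow> 'a \<Rightarrow> 'v::real_normed_vector" where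
  "translate a f = (\<lambda>x. if x \<in> carrier G then f (inv a \<otimes> x) else 0)"

definition reflect :: "('a \<Rightarrow> 'v) \<Rightarrow> 'a \<Rightarrow> 'v::real_normed_vector" where
  "reflect f = (\<lambda>x. if x \<in> carrier G then f (inv x) else 0)"

lemma continuous_map_translated:
  assumes "continuous_map T euclidean f" "a \<in> carrier G"
  shows "continuous_map T euclidean (\<lambda>x. f (a \<otimes> x))"
  using continuous_map_compose[OF continuous_map_translate[OF assms(2)] assms(1)] by (simp add: o_def)

lemma continuous_map_translate_fun:
  assumes "continuous_map T euclidean f" "a \<in> carrier G"
  shows "continuous_map T euclidean (translate a f)"
  unfolding translate_def
  by (rule continuous_map_eq[OF continuous_map_translated[OF assms(1) inv_closed[OF assms(2)]]]) simp

lemma Cc_translate: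
  assumes "f \<in> Cc" "a \<in> carrier G"
  shows "translate a f \<in> Cc"
proof -
  obtain K where K: "continuous_map T euclidean f" "compactin T K" "\<And>x. x \<notin> K \<Longrightarrow> f x = 0"
    using assms(1) unfolding Cc_def by blast
  show ?thesis
  proof (rule CcI[OF continuous_map_translate_fun[OF K(1) assms(2)]])
    show "compactin T ((\<lambda>x. a \<otimes> x) ` K)"
      by (rule image_compactin[OF K(2) continuous_map_translate[OF assms(2)]])
    fix x assume x: "x \<notin> (\<lambda>x. a \<otimes> x) ` K"
    have "inv a \<otimes> x \<notin> K" if "x \<in> carrier G"
    proof
      assume "inv a \<otimes> x \<in> K"
      then have "a \<otimes> (inv a \<otimes> x) \<in> (\<lambda>x. a \<otimes> x) ` K" by (rule imageI)
      then show False using x that assms(2) by (simp add: m_assoc[symmetric])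
    qed
    then show "translate a f x = 0" using K(3) by (simp add: translate_def)
  qed
qed

lemma Cc_reflect:
  assumes "f \<in> Cc"
  shows "reflect f \<in> Cc"
proof -
  obtain K where K: "continuous_map T euclidean f" "compactin T K" "\<And>x. x \<notin> K \<Longrightarrow> f x = 0"
    using assms(1) unfolding Cc_def by blast
  have "continuous_map T euclidean (\<lambda>x. f (inv x))"
    using continuous_map_compose[OF continuous_inv K(1)] by (simp add: o_def)
  then have "continuous_map T euclidean (reflect f)"
    unfolding reflect_def by (rule continuous_map_eq) simp
  then show ?thesis
  proof (rule CcI)
    show "compactin T ((\<lambda>x. inv x) ` K)" by (rule image_compactin[OF K(2) continuous_inv])
    fix x assume x: "x \<notin> (\<lambda>x. inv x) ` K"
    have "inv x \<notin> K" if "x \<in> carrier G"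
    proof
      assume "inv x \<in> K"
      then have "inv (inv x) \<in> (\<lambda>x. inv x) ` K" by (rule imageI)
      then show False using x that by simp
    qed
    then show "reflect f x = 0" using K(3) by (simp add: reflect_def)
  qed
qed

lemma translate_one: "f \<in> Cc \<Longrightarrow> translate \<one> f = f"
  by (auto simp: translate_def fun_eq_iff Cc_outside)

lemma translate_translate: "\<lbrakk>a \<in> carrier G; b \<in> carrier G\<rbrakk> \<Longrightarrow> translate a (translate b f) = translate (a \<otimes> b) f"
  by (auto simp: translate_def fun_eq_iff inv_mult m_ac)

lemma reflect_translate: "a \<in> carrier G \<Longrightarrow> reflect (translate a f) = translate (inv a) (reflect f)"
  by (auto simp: translate_def reflect_def fun_eq_iff inv_mult)

lemma reflect_reflect: "f \<in> Cc \<Longrightarrow> reflect (reflect f) = f"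
  by (auto simp: reflect_def fun_eq_iff Cc_outside)

lemma Cc_bounded:
  assumes "f \<in> Cc"
  obtains B where "0 \<le> B" "\<And>x. norm (f x) \<le> B"
proof -
  obtain K where K: "continuous_map T euclidean f" "compactin T K" "\<And>x. x \<notin> K \<Longrightarrow> f x = 0"
    using assms(1) unfolding Cc_def by blast
  have "bounded (f ` K)"
    using image_compactin[OF K(2,1)] by (simp add: compact_imp_bounded)
  then obtain B where B: "\<And>y. y \<in> f ` K \<Longrightarrow> norm y \<le> B" unfolding bounded_iff by blast
  show thesis
  proof (rule that[of "\<bar>B\<bar>"])
    show "norm (f x) \<le> \<bar>B\<bar>" for x
      using B[of "f x"] K(3)[of x] by (cases "x \<in> K") auto
  qed simp
qed

text \<open>
  The square root \<open>W z\<close> of the neighbourhood \<open>U z\<close> leaves room to move from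
  \<open>z\<close> first to \<open>x\<close> and then to \<open>x \<otimes> v\<close>. Points
  \<open>x\<close> outside the support are reached from \<open>x \<otimes> v\<close> by the inverse of
  \<open>v\<close>.
\<close>

lemma Cc_uniformly_continuous:
  assumes f: "f \<in> Cc" and \<epsilon>: "0 < \<epsilon>"
  obtains V where "openin T V" "\<one> \<in> V" "\<And>x v. \<lbrakk>x \<in> carrier G; v \<in> V\<rbrakk> \<Longrightarrow> norm (f (x \<otimes> v) - f x) < \<epsilon>"
proof -
  obtain K where K: "continuous_map T euclidean f" "compactin T K" "\<And>x. x \<notin> K \<Longrightarrow> f x = 0"
    using f unfolding Cc_def by blast
  note KG = compact_subset_carrier[OF K(2)]
  have "\<exists>W U. openin T W \<and> \<one> \<in> W \<and> W \<subseteq> U \<and> (\<forall>x\<in>W. \<forall>y\<in>W. x \<otimes> y \<in> U) \<and> (\<forall>v\<in>U. norm (f (z \<otimes> v) - f z) < \<epsilon> / 2)"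
    if z: "z \<in> K" for z
  proof -
    have zG: "z \<in> carrier G" using z KG by blast
    define U where "U = {v \<in> carrier G. f (z \<otimes> v) \<in> ball (f z) (\<epsilon> / 2)}"
    have "openin T U"
      using openin_continuous_map_preimage[OF continuous_map_translated[OF K(1) zG], of "ball (f z) (\<epsilon> / 2)"]
      by (simp add: U_def)
    moreover have "\<one> \<in> U" using zG \<epsilon> by (simp add: U_def)
    ultimately obtain W where "openin T W" "\<one> \<in> W" "W \<subseteq> U" "\<And>x y. \<lbrakk>x \<in> W; y \<in> W\<rbrakk> \<Longrightarrow> x \<otimes> y \<in> U"
      by (rule square_root_neighbourhood) blast
    moreover have "\<forall>v\<in>U. norm (f (z \<otimes> v) - f z) < \<epsilon> / 2"
      by (auto simp: U_def dist_norm norm_minus_commute)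
    ultimately show ?thesis by blast
  qed
  then obtain W U where "\<forall>z\<in>K. openin T (W z) \<and> \<one> \<in> W z \<and> W z \<subseteq> U z \<and>
      (\<forall>x\<in>W z. \<forall>y\<in>W z. x \<otimes> y \<in> U z) \<and> (\<forall>v\<in>U z. norm (f (z \<otimes> v) - f z) < \<epsilon> / 2)"
    by metis
  then have WU: "\<And>z. z \<in> K \<Longrightarrow> openin T (W z)" "\<And>z. z \<in> K \<Longrightarrow> \<one> \<in> W z" "\<And>z. z \<in> K \<Longrightarrow> W z \<subseteq> U z"
    "\<And>z x y. \<lbrakk>z \<in> K; x \<in> W z; y \<in> W z\<rbrakk> \<Longrightarrow> x \<otimes> y \<in> U z"
    "\<And>z v. \<lbrakk>z \<in> K; v \<in> U z\<rbrakk> \<Longrightarrow> norm (f (z \<otimes> v) - f z) < \<epsilon> / 2"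
    by blast+
  have nbhd_W: "openin T (W z) \<and> \<one> \<in> W z" if "z \<in> K" for z using WU(1,2) that by blast
  obtain Z where Z: "finite Z" "Z \<subseteq> K" "\<And>x. x \<in> K \<Longrightarrow> \<exists>z\<in>Z. inv z \<otimes> x \<in> W z"
    by (rule compact_finitely_many_translates[of K W, OF K(2) nbhd_W]) auto
  define V0 where "V0 = topspace T \<inter> (\<Inter>z\<in>Z. W z)"
  have V0: "openin T V0" "\<one> \<in> V0"
    unfolding V0_def using Z WU(1,2) openin_carrier by (auto intro!: openin_Int_Inter)
  obtain V where V: "openin T V" "\<one> \<in> V" "V \<subseteq> V0" "\<And>x. x \<in> V \<Longrightarrow> inv x \<in> V"
    by (rule square_root_neighbourhood[OF V0]) blast
  have near: "norm (f (x \<otimes> v) - f x) < \<epsilon>" if x: "x \<in> K" and v: "v \<in> V" for x v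
  proof -
    obtain z where z: "z \<in> Z" "inv z \<otimes> x \<in> W z" using Z(3)[OF x] by blast
    have zK: "z \<in> K" using z Z by blast
    have c: "z \<in> carrier G" "x \<in> carrier G" "v \<in> carrier G"
      using zK KG x v V(1) open_subset_carrier by blast+
    have vW: "v \<in> W z" using v V(3) z(1) by (auto simp: V0_def)
    have e1: "z \<otimes> (inv z \<otimes> x) = x" "z \<otimes> ((inv z \<otimes> x) \<otimes> v) = x \<otimes> v"
      using c by (simp_all flip: m_assoc)
    have "norm (f x - f z) < \<epsilon> / 2"
      using WU(5)[OF zK, of "inv z \<otimes> x"] WU(3)[OF zK] z(2) e1(1) by auto
    moreover have "norm (f (x \<otimes> v) - f z) < \<epsilon> / 2"
      using WU(5)[OF zK WU(4)[OF zK z(2) vW]] e1(2) by simp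
    ultimately show ?thesis
      using norm_triangle_ineq4[of "f (x \<otimes> v) - f z" "f x - f z"] by simp
  qed
  show thesis
  proof (rule that[OF V(1,2)])
    fix x v assume x: "x \<in> carrier G" and v: "v \<in> V"
    have vG: "v \<in> carrier G" using v V(1) open_subset_carrier by blast
    consider "x \<in> K" | "x \<otimes> v \<in> K" | "x \<notin> K" "x \<otimes> v \<notin> K" by blast
    then show "norm (f (x \<otimes> v) - f x) < \<epsilon>"
    proof cases
      case 1 then show ?thesis using near v by blast
    next
      case 2
      have "norm (f ((x \<otimes> v) \<otimes> inv v) - f (x \<otimes> v)) < \<epsilon>" using near[OF 2] V(4)[OF v] by blast
      then show ?thesis using x vG by (simp add: m_assoc norm_minus_commute)
    next
      case 3 then show ?thesis using K(3) \<epsilon> by simp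
    qed
  qed
qed

text \<open>
  Locally compact Hausdorff spaces are completely regular, so Urysohn functions exist; cutting down to a
  compact neighbourhood makes the support compact.
\<close>

lemma bump_function:
  assumes "openin T U" "\<one> \<in> U"
  obtains \<phi> :: "'a \<Rightarrow> real" where "\<phi> \<in> Cc" "\<And>x. 0 \<le> \<phi> x" "\<And>x. \<phi> x \<le> 1" "\<phi> \<one> = 1" "\<And>x. x \<notin> U \<Longrightarrow> \<phi> x = 0"
proof -
  obtain U0 K where K: "openin T U0" "\<one> \<in> U0" "U0 \<subseteq> K" "compactin T K"
    by (rule compact_neighbourhood_of_one) blast
  define W where "W = U \<inter> U0"
  have W: "openin T W" "\<one> \<in> W" "W \<subseteq> K" using K assms by (auto simp: W_def)
  have "completely_regular_space T"
    using locally_compact Hausdorff locally_compact_regular_imp_completely_regular_space by blast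
  moreover have "closedin T (carrier G - W)" using W(1) by (metis openin_closedin_eq topspace)
  moreover have "\<one> \<in> topspace T - (carrier G - W)" using W(2) by simp
  ultimately obtain f :: "'a \<Rightarrow> real" where f: "continuous_map T (top_of_set {0..1}) f" "f \<one> = 0" "f ` (carrier G - W) \<subseteq> {1}"
    unfolding completely_regular_space_def by blast
  have fc: "continuous_map T euclidean f" and f01: "\<And>x. x \<in> carrier G \<Longrightarrow> 0 \<le> f x \<and> f x \<le> 1"
    using f(1) by (auto simp: continuous_map_in_subtopology image_subset_iff)
  define \<phi> where "\<phi> x = (if x \<in> carrier G then 1 - f x else 0)" for x
  have zero: "\<phi> x = 0" if "x \<notin> W" for x using f(3) that by (auto simp: \<phi>_def)
  have "continuous_map T euclidean (\<lambda>x. 1 - f x)"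
    by (rule continuous_map_diff_normed[OF _ fc]) simp
  then have "continuous_map T euclidean \<phi>" by (rule continuous_map_eq) (simp add: \<phi>_def)
  then have "\<phi> \<in> Cc" using K(4) W(3) zero by (intro CcI[of _ K]) auto
  then show thesis
    by (rule that) (use f01 f(2) zero in \<open>auto simp: \<phi>_def W_def\<close>)
qed

end

section \<open>The Haar integral\<close>

text \<open>
  Invariance under inversion is part of the notion because it makes convolution by a symmetric kernel
  self-adjoint.
\<close>

locale haar_integral = locally_compact_abelian_group G T for G (structure) and T +
  fixes I :: "('a \<Rightarrow> real) \<Rightarrow> real"
  assumes I_add: "\<lbrakk>f \<in> Cc; g \<in> Cc\<rbrakk> \<Longrightarrow> I (\<lambda>x. f x + g x) = I f + I g"
    and I_cmult: "f \<in> Cc \<Longrightarrow> I (\<lambda>x. c * f x) = c * I f"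
    and I_nonneg: "\<lbrakk>f \<in> Cc; \<And>x. 0 \<le> f x\<rbrakk> \<Longrightarrow> 0 \<le> I f"
    and I_translate: "\<lbrakk>f \<in> Cc; a \<in> carrier G\<rbrakk> \<Longrightarrow> I (translate a f) = I f"
    and I_reflect: "f \<in> Cc \<Longrightarrow> I (reflect f) = I f"
    and I_pos: "\<lbrakk>f \<in> Cc; \<And>x. 0 \<le> f x; 0 < f x0\<rbrakk> \<Longrightarrow> 0 < I f"

context locally_compact_abelian_group
begin

text \<open>
  The group need not be compact, so the maximal \<open>V\<close>-separated set is obtained from Zorn's
  lemma. By maximality every translate \<open>x \<otimes> P\<close> meets \<open>V\<close>.
\<close>

lemma maximal_separated_set:
  assumes V: "\<one> \<in> V" "\<forall>x\<in>V. inv x \<in> V"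
  obtains P where "P \<subseteq> carrier G" "\<forall>p\<in>P. \<forall>q\<in>P. inv p \<otimes> q \<in> V \<longrightarrow> p = q"
    "\<And>x. x \<in> carrier G \<Longrightarrow> \<exists>p\<in>P. x \<otimes> p \<in> V"
proof -
  define \<A> where "\<A> = {P. P \<subseteq> carrier G \<and> (\<forall>p\<in>P. \<forall>q\<in>P. inv p \<otimes> q \<in> V \<longrightarrow> p = q)}"
  have "\<exists>M\<in>\<A>. \<forall>X\<in>\<A>. M \<subseteq> X \<longrightarrow> X = M"
  proof (rule subset_Zorn_nonempty)
    show "\<A> \<noteq> {}" unfolding \<A>_def by blast
    fix \<C> assume "\<C> \<noteq> {}" and ch: "subset.chain \<A> \<C>"
    then have C: "\<C> \<subseteq> \<A>" "\<And>X Y. X \<in> \<C> \<Longrightarrow> Y \<in> \<C> \<Longrightarrow> X \<subseteq> Y \<or> Y \<subseteq> X"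
      by (auto simp: subset_chain_def)
    show "\<Union>\<C> \<in> \<A>"
      unfolding \<A>_def
    proof (intro CollectI conjI ballI impI)
      show "\<Union>\<C> \<subseteq> carrier G" using C(1) unfolding \<A>_def by blast
      fix p q assume "p \<in> \<Union>\<C>" "q \<in> \<Union>\<C>" and pq: "inv p \<otimes> q \<in> V"
      then obtain X Y where XY: "X \<in> \<C>" "Y \<in> \<C>" "p \<in> X" "q \<in> Y" by blast
      then obtain W where "W \<in> \<C>" "p \<in> W" "q \<in> W" using C(2)[OF XY(1,2)] by blast
      then show "p = q" using C(1) pq unfolding \<A>_def by blast
    qed
  qed
  then obtain P where P: "P \<in> \<A>" and max: "\<And>X. \<lbrakk>X \<in> \<A>; P \<subseteq> X\<rbrakk> \<Longrightarrow> X = P" by blast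
  have PG: "P \<subseteq> carrier G" and sep: "\<forall>p\<in>P. \<forall>q\<in>P. inv p \<otimes> q \<in> V \<longrightarrow> p = q"
    using P unfolding \<A>_def by blast+
  have near: "\<exists>p\<in>P. inv y \<otimes> p \<in> V" if y: "y \<in> carrier G" for y
  proof (rule ccontr)
    assume none: "\<not> (\<exists>p\<in>P. inv y \<otimes> p \<in> V)"
    have none': "inv p \<otimes> y \<notin> V" if "p \<in> P" for p
    proof
      assume "inv p \<otimes> y \<in> V"
      then have "inv (inv p \<otimes> y) \<in> V" using V(2) by blast
      moreover have "inv (inv p \<otimes> y) = inv y \<otimes> p" using y that PG by (auto simp: inv_mult_group)
      ultimately show False using none that by auto
    qed
    have "insert y P \<in> \<A>"
      unfolding \<A>_def using y PG sep none none' by auto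
    then have "y \<in> P" using max by blast
    then show False using none y V(1) by auto
  qed
  show thesis
  proof (rule that[OF PG sep])
    show "\<exists>p\<in>P. x \<otimes> p \<in> V" if "x \<in> carrier G" for x
      using near[of "inv x"] that by simp
  qed
qed

text \<open>
  Cover \<open>K\<close> by finitely many translates of a square root \<open>W\<close> of \<open>V\<close>.
  Two points \<open>p\<close>, \<open>q\<close> with \<open>x \<otimes> p\<close> and
  \<open>x \<otimes> q\<close> in the same translate would be \<open>V\<close>-close, so the number of
  translates is a bound that does not depend on \<open>x\<close>.
\<close>

lemma separated_set_uniformly_finite:
  assumes V: "openin T V" "\<one> \<in> V" and P: "P \<subseteq> carrier G" "\<forall>p\<in>P. \<forall>q\<in>P. inv p \<otimes> q \<in> V \<longrightarrow> p = q"
    and K: "compactin T K"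
  obtains m where "\<And>x. x \<in> carrier G \<Longrightarrow> finite {p \<in> P. x \<otimes> p \<in> K} \<and> card {p \<in> P. x \<otimes> p \<in> K} \<le> m"
proof -
  note KG = compact_subset_carrier[OF K]
  obtain W where W: "openin T W" "\<one> \<in> W" "\<And>x. x \<in> W \<Longrightarrow> inv x \<in> W" "\<And>x y. \<lbrakk>x \<in> W; y \<in> W\<rbrakk> \<Longrightarrow> x \<otimes> y \<in> V"
    by (rule square_root_neighbourhood[OF V]) blast
  have W': "openin T W \<and> \<one> \<in> W" if "z \<in> K" for z using W by simp
  obtain Z where Z: "finite Z" "Z \<subseteq> K" "\<And>x. x \<in> K \<Longrightarrow> \<exists>z\<in>Z. inv z \<otimes> x \<in> W"
    by (rule compact_finitely_many_translates[of K "\<lambda>_. W", OF K W']) auto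
  show thesis
  proof (rule that[of "card Z"])
    fix x assume x: "x \<in> carrier G"
    define A where "A = {p \<in> P. x \<otimes> p \<in> K}"
    have "\<forall>p\<in>A. \<exists>z\<in>Z. inv z \<otimes> (x \<otimes> p) \<in> W" using Z(3) by (auto simp: A_def)
    then obtain c where c: "\<And>p. p \<in> A \<Longrightarrow> c p \<in> Z" "\<And>p. p \<in> A \<Longrightarrow> inv (c p) \<otimes> (x \<otimes> p) \<in> W"
      by metis
    have "inj_on c A"
    proof (rule inj_onI)
      fix p q assume pq: "p \<in> A" "q \<in> A" "c p = c q"
      have G: "p \<in> carrier G" "q \<in> carrier G" "c p \<in> carrier G"
        using pq(1,2) P(1) c(1)[OF pq(1)] Z(2) KG by (auto simp: A_def)
      have "inv (inv (c p) \<otimes> (x \<otimes> p)) \<otimes> (inv (c p) \<otimes> (x \<otimes> q)) \<in> V"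
        using W(4)[OF W(3)[OF c(2)[OF pq(1)]], of "inv (c q) \<otimes> (x \<otimes> q)"] c(2)[OF pq(2)] pq(3) by simp
      also have "inv (inv (c p) \<otimes> (x \<otimes> p)) \<otimes> (inv (c p) \<otimes> (x \<otimes> q)) = inv p \<otimes> q" (is "inv ?u \<otimes> ?v = _")
      proof -
        have "p \<otimes> (inv p \<otimes> q) = q" using G by (simp flip: m_assoc)
        then have "?v = ?u \<otimes> (inv p \<otimes> q)" using G x by (simp add: m_assoc)
        then have "inv ?u \<otimes> ?v = (inv ?u \<otimes> ?u) \<otimes> (inv p \<otimes> q)" using G x by (simp only: m_assoc m_closed inv_closed)
        then show ?thesis using G x by simp
      qed
      finally show "p = q" using P(2) pq(1,2) by (auto simp: A_def)
    qed
    moreover have "c ` A \<subseteq> Z" using c(1) by blast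
    ultimately have "finite A" "card A \<le> card Z"
      using Z(1) by (auto intro: inj_on_finite card_inj_on_le)
    then show "finite {p \<in> P. x \<otimes> p \<in> K} \<and> card {p \<in> P. x \<otimes> p \<in> K} \<le> card Z" by (simp add: A_def)
  qed
qed

text \<open>
  Counting points of a maximal separated set \<open>P\<close> is a crude Haar measure: \<open>S f x\<close>
  sums \<open>f\<close> over the translate \<open>x \<otimes> P\<close>. It depends on \<open>x\<close>, but
  its supremum over \<open>x\<close> is a sublinear functional that is invariant under translations, and an
  invariant linear functional below it exists since translations commute. The supremum is finite because
  \<open>P\<close> is separated, and the functional is nonzero because \<open>P\<close> is maximal: every
  translate of \<open>P\<close> meets \<open>V\<close>, where twice the bump exceeds \<open>1\<close>.
\<close>

lemma translation_invariant_functional: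
  obtains J :: "('a \<Rightarrow> real) \<Rightarrow> real" and g :: "'a \<Rightarrow> real" where
    "\<And>f h. \<lbrakk>f \<in> Cc; h \<in> Cc\<rbrakk> \<Longrightarrow> J (\<lambda>x. f x + h x) = J f + J h"
    "\<And>f c. f \<in> Cc \<Longrightarrow> J (\<lambda>x. c * f x) = c * J f"
    "\<And>f. \<lbrakk>f \<in> Cc; \<And>x. 0 \<le> f x\<rbrakk> \<Longrightarrow> 0 \<le> J f"
    "\<And>f a. \<lbrakk>f \<in> Cc; a \<in> carrier G\<rbrakk> \<Longrightarrow> J (translate a f) = J f"
    "g \<in> Cc" "0 < J g"
proof -
  obtain \<phi> :: "'a \<Rightarrow> real" where \<phi>: "\<phi> \<in> Cc" "\<phi> \<one> = 1" "\<And>x. 0 \<le> \<phi> x"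
    by (rule bump_function[OF openin_carrier one_closed]) blast
  define V0 where "V0 = {x \<in> carrier G. \<phi> x \<in> {1 / 2<..}}"
  have "openin T V0"
    unfolding V0_def using openin_continuous_map_preimage[OF Cc_continuous[OF \<phi>(1)], of "{1 / 2<..}"] by simp
  moreover have "\<one> \<in> V0" using \<phi>(2) by (simp add: V0_def)
  ultimately obtain V where V: "openin T V" "\<one> \<in> V" "V \<subseteq> V0" "\<forall>x\<in>V. inv x \<in> V"
    by (rule square_root_neighbourhood) blast
  obtain P where P: "P \<subseteq> carrier G" "\<forall>p\<in>P. \<forall>q\<in>P. inv p \<otimes> q \<in> V \<longrightarrow> p = q"
    "\<And>x. x \<in> carrier G \<Longrightarrow> \<exists>p\<in>P. x \<otimes> p \<in> V"
    by (rule maximal_separated_set[OF V(2,4)]) blast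
  define S where "S f x = (\<Sum>p\<in>{p \<in> P. f (x \<otimes> p) \<noteq> 0}. f (x \<otimes> p))" for f :: "'a \<Rightarrow> real" and x
  have fin: "finite {p \<in> P. f (x \<otimes> p) \<noteq> 0}" if f: "f \<in> Cc" and x: "x \<in> carrier G" for f :: "'a \<Rightarrow> real" and x
  proof -
    obtain K where K: "compactin T K" "\<And>x. x \<notin> K \<Longrightarrow> f x = 0"
      by (rule CcE[OF f]) auto
    obtain m where "\<And>x. x \<in> carrier G \<Longrightarrow> finite {p \<in> P. x \<otimes> p \<in> K} \<and> card {p \<in> P. x \<otimes> p \<in> K} \<le> m"
      by (rule separated_set_uniformly_finite[OF V(1,2) P(1,2) K(1)]) blast
    then have "finite {p \<in> P. x \<otimes> p \<in> K}" using x by blast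
    then show ?thesis by (rule rev_finite_subset) (use K(2) in auto)
  qed
  have S_bound: "\<exists>B. \<forall>x\<in>carrier G. \<bar>S f x\<bar> \<le> B" if f: "f \<in> Cc" for f
  proof -
    obtain K where K: "compactin T K" "\<And>x. x \<notin> K \<Longrightarrow> f x = 0"
      by (rule CcE[OF f]) auto
    obtain m where m: "\<And>x. x \<in> carrier G \<Longrightarrow> finite {p \<in> P. x \<otimes> p \<in> K} \<and> card {p \<in> P. x \<otimes> p \<in> K} \<le> m"
      by (rule separated_set_uniformly_finite[OF V(1,2) P(1,2) K(1)]) blast
    obtain b where b: "0 \<le> b" "\<And>x. norm (f x) \<le> b" using Cc_bounded[OF f] by metis
    have "\<bar>S f x\<bar> \<le> real m * b" if x: "x \<in> carrier G" for x
    proof -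
      have "\<bar>S f x\<bar> \<le> (\<Sum>p\<in>{p \<in> P. f (x \<otimes> p) \<noteq> 0}. \<bar>f (x \<otimes> p)\<bar>)"
        unfolding S_def by (rule sum_abs)
      also have "\<dots> \<le> (\<Sum>p\<in>{p \<in> P. f (x \<otimes> p) \<noteq> 0}. b)" using b(2) by (intro sum_mono) simp
      also have "\<dots> = real (card {p \<in> P. f (x \<otimes> p) \<noteq> 0}) * b" by simp
      also have "\<dots> \<le> real m * b"
      proof (rule mult_right_mono)
        have "card {p \<in> P. f (x \<otimes> p) \<noteq> 0} \<le> card {p \<in> P. x \<otimes> p \<in> K}"
          using m[OF x] K(2) by (intro card_mono) auto
        then show "real (card {p \<in> P. f (x \<otimes> p) \<noteq> 0}) \<le> real m" using m[OF x] by linarith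
      qed (rule b(1))
      finally show ?thesis .
    qed
    then show ?thesis by blast
  qed
  have S_eq: "S f x = (\<Sum>p\<in>A. f (x \<otimes> p))"
    if "finite A" "A \<subseteq> P" "\<And>p. \<lbrakk>p \<in> P; p \<notin> A\<rbrakk> \<Longrightarrow> f (x \<otimes> p) = 0" for f x A
    unfolding S_def using that by (intro sum.mono_neutral_left) auto
  have S_add: "S (\<lambda>x. f x + h x) x = S f x + S h x" if "f \<in> Cc" "h \<in> Cc" "x \<in> carrier G" for f h x
  proof -
    define A where "A = {p \<in> P. f (x \<otimes> p) \<noteq> 0} \<union> {p \<in> P. h (x \<otimes> p) \<noteq> 0}"
    have A: "finite A" "A \<subseteq> P" unfolding A_def using fin that by auto
    have "S (\<lambda>x. f x + h x) x = (\<Sum>p\<in>A. f (x \<otimes> p) + h (x \<otimes> p))" by (rule S_eq[OF A]) (auto simp: A_def)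
    moreover have "S f x = (\<Sum>p\<in>A. f (x \<otimes> p))" by (rule S_eq[OF A]) (auto simp: A_def)
    moreover have "S h x = (\<Sum>p\<in>A. h (x \<otimes> p))" by (rule S_eq[OF A]) (auto simp: A_def)
    ultimately show ?thesis by (simp add: sum.distrib)
  qed
  have S_cmult: "S (\<lambda>x. c * f x) x = c * S f x" for c f x
  proof (cases "c = 0")
    case False
    then show ?thesis by (simp add: S_def sum_distrib_left)
  qed (simp add: S_def)
  have S_translate: "S (translate a f) x = S f (inv a \<otimes> x)" if "a \<in> carrier G" "x \<in> carrier G" for a f x
  proof -
    have "translate a f (x \<otimes> p) = f (inv a \<otimes> x \<otimes> p)" if "p \<in> P" for p
      using that P(1) \<open>a \<in> carrier G\<close> \<open>x \<in> carrier G\<close> by (auto simp: translate_def m_assoc)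
    then show ?thesis unfolding S_def by (intro sum.cong) auto
  qed
  define p where "p f = (SUP x\<in>carrier G. S f x)" for f
  have bdd: "bdd_above (S f ` carrier G)" if f: "f \<in> Cc" for f
  proof -
    obtain B where "\<forall>x\<in>carrier G. \<bar>S f x\<bar> \<le> B" using S_bound[OF f] by blast
    then show ?thesis by (intro bdd_aboveI2[of _ _ B]) (auto simp: abs_le_iff)
  qed
  have p_ge: "S f x \<le> p f" if "f \<in> Cc" "x \<in> carrier G" for f x
    unfolding p_def using bdd that by (intro cSUP_upper) auto
  have p_least: "p f \<le> b" if "\<And>x. x \<in> carrier G \<Longrightarrow> S f x \<le> b" for f b
    unfolding p_def using that by (intro cSUP_least) auto
  define scale where "scale c f = (\<lambda>x. c * f x)" for c :: real and f :: "'a \<Rightarrow> real"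
  have vs: "vector_space scale"
    by unfold_locales (auto simp: scale_def fun_eq_iff algebra_simps)
  interpret vs: vector_space scale by (rule vs)
  have plus: "f + h = (\<lambda>x. f x + h x)" for f h :: "'a \<Rightarrow> real" by (simp add: fun_eq_iff)
  have W: "vs.subspace Cc"
  proof (rule vs.subspaceI)
    show "0 \<in> (Cc :: ('a \<Rightarrow> real) set)" using Cc_zero by (simp add: zero_fun_def)
    show "f + h \<in> Cc" if "f \<in> Cc" "h \<in> Cc" for f h :: "'a \<Rightarrow> real" using Cc_add[OF that] by (simp add: plus)
    show "scale c f \<in> Cc" if "f \<in> Cc" for c f using Cc_cmult[OF that] by (simp add: scale_def)
  qed
  obtain J where J: "\<And>f h. \<lbrakk>f \<in> Cc; h \<in> Cc\<rbrakk> \<Longrightarrow> J (f + h) = J f + J h"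
    "\<And>f c. f \<in> Cc \<Longrightarrow> J (scale c f) = c * J f"
    "\<And>f. f \<in> Cc \<Longrightarrow> J f \<le> p f"
    "\<And>g f. \<lbrakk>g \<in> translate ` carrier G; f \<in> Cc\<rbrakk> \<Longrightarrow> J (g f) = J f"
  proof (rule invariant_hahn_banach[OF vs W, where \<Gamma> = "translate ` carrier G" and p = p])
    show "g f \<in> Cc" if "g \<in> translate ` carrier G" "f \<in> Cc" for g and f :: "'a \<Rightarrow> real"
      using that Cc_translate by blast
    show "g (f + h) = g f + g h" if "g \<in> translate ` carrier G" for g and f h :: "'a \<Rightarrow> real"
      using that by (auto simp: translate_def fun_eq_iff)
    show "g (scale c f) = scale c (g f)" if "g \<in> translate ` carrier G" for g f c
      using that by (auto simp: translate_def fun_eq_iff scale_def)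
    show "g (h f) = h (g f)" if "g \<in> translate ` carrier G" "h \<in> translate ` carrier G" for g h and f :: "'a \<Rightarrow> real"
      using that by (auto simp: translate_translate m_comm)
    show "p (f + h) \<le> p f + p h" if "f \<in> Cc" "h \<in> Cc" for f h
      using p_ge that S_add[OF that] by (intro p_least) (auto simp: plus intro!: add_mono)
    show "p (scale c f) \<le> c * p f" if "f \<in> Cc" "0 \<le> c" for f c
      using p_ge that by (intro p_least) (auto simp: scale_def S_cmult intro!: mult_left_mono)
    show "p (g f) \<le> p f" if "g \<in> translate ` carrier G" "f \<in> Cc" for g f
      using that p_ge by (intro p_least) (auto simp: S_translate)
  qed blast
  show thesis
  proof (rule that[of J "\<lambda>x. 2 * \<phi> x"])
    show "J (\<lambda>x. f x + h x) = J f + J h" if "f \<in> Cc" "h \<in> Cc" for f h using J(1)[OF that] by (simp add: plus)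
    show mult: "J (\<lambda>x. c * f x) = c * J f" if "f \<in> Cc" for f c using J(2)[OF that] by (simp add: scale_def)
    show "J (translate a f) = J f" if "f \<in> Cc" "a \<in> carrier G" for f a using J(4)[OF _ that(1)] that(2) by blast
    have neg: "J (\<lambda>x. - 1 * f x) \<le> p (\<lambda>x. - 1 * f x)" if "f \<in> Cc" for f
      by (rule J(3)[OF Cc_cmult[OF that]])
    have lower: "b \<le> J f" if f: "f \<in> Cc" and b: "\<And>x. x \<in> carrier G \<Longrightarrow> b \<le> S f x" for f b
    proof -
      have "S (\<lambda>x. - 1 * f x) x \<le> - b" if "x \<in> carrier G" for x
        using b[OF that] S_cmult[of "-1" f x] by linarith
      then have "p (\<lambda>x. - 1 * f x) \<le> - b" by (intro p_least)
      then show ?thesis using neg[OF f] mult[OF f, of "-1"] by linarith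
    qed
    show "0 \<le> J f" if "f \<in> Cc" "\<And>x. 0 \<le> f x" for f
      using that by (intro lower) (auto simp: S_def intro!: sum_nonneg)
    show \<phi>2: "(\<lambda>x. 2 * \<phi> x) \<in> Cc" by (rule Cc_cmult[OF \<phi>(1)])
    have "1 \<le> J (\<lambda>x. 2 * \<phi> x)"
    proof (rule lower[OF \<phi>2])
      fix x assume x: "x \<in> carrier G"
      obtain q where q: "q \<in> P" "x \<otimes> q \<in> V" using P(3)[OF x] by blast
      then have "1 < 2 * \<phi> (x \<otimes> q)" using V(3) by (auto simp: V0_def)
      also have "\<dots> \<le> S (\<lambda>x. 2 * \<phi> x) x"
        unfolding S_def using q(1) \<open>1 < 2 * \<phi> (x \<otimes> q)\<close> \<phi>(3) fin[OF \<phi>2 x]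
        by (intro member_le_sum[of q _ "\<lambda>q. 2 * \<phi> (x \<otimes> q)"]) auto
      finally show "1 \<le> S (\<lambda>x. 2 * \<phi> x) x" by simp
    qed
    then show "0 < J (\<lambda>x. 2 * \<phi> x)" by simp
  qed
qed

text \<open>
  Adding the reflected functional makes the integral invariant under inversion. It is strictly positive
  since finitely many translates of a nonzero nonnegative function dominate a positive multiple of a given
  function with positive integral.
\<close>

lemma exists_haar_integral:
  obtains I where "haar_integral G T I"
proof -
  obtain J :: "('a \<Rightarrow> real) \<Rightarrow> real" and g :: "'a \<Rightarrow> real" where
    J_add: "\<And>f h. \<lbrakk>f \<in> Cc; h \<in> Cc\<rbrakk> \<Longrightarrow> J (\<lambda>x. f x + h x) = J f + J h" and
    J_mult: "\<And>f c. f \<in> Cc \<Longrightarrow> J (\<lambda>x. c * f x) = c * J f" and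
    J_nonneg: "\<And>f. \<lbrakk>f \<in> Cc; \<And>x. 0 \<le> f x\<rbrakk> \<Longrightarrow> 0 \<le> J f" and
    J_trans: "\<And>f a. \<lbrakk>f \<in> Cc; a \<in> carrier G\<rbrakk> \<Longrightarrow> J (translate a f) = J f" and
    g: "g \<in> Cc" "0 < J g"
    by (rule translation_invariant_functional) blast
  have J_sum: "J (\<lambda>x. \<Sum>z\<in>Z. F z x) = (\<Sum>z\<in>Z. J (F z))"
    if "finite Z" "\<And>z. z \<in> Z \<Longrightarrow> F z \<in> Cc" for Z :: "'a set" and F
    using that
  proof (induction Z)
    case empty
    show ?case using J_mult[OF Cc_zero, of 0] by simp
  next
    case (insert z Z)
    then have "(\<lambda>x. \<Sum>z\<in>Z. F z x) \<in> Cc" by (intro Cc_sum) auto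
    then show ?case using insert J_add[of "F z" "\<lambda>x. \<Sum>z\<in>Z. F z x"] by simp
  qed
  have J_mono: "J f \<le> J h" if "f \<in> Cc" "h \<in> Cc" "\<And>x. f x \<le> h x" for f h
  proof -
    have "0 \<le> J (\<lambda>x. h x + - 1 * f x)"
      using that by (intro J_nonneg Cc_add Cc_cmult) auto
    then show ?thesis using J_add[OF that(2) Cc_cmult[OF that(1)], of "-1"] J_mult[OF that(1), of "-1"] by linarith
  qed
  have J_pos: "0 < J f" if f: "f \<in> Cc" and nonneg: "\<And>x. 0 \<le> f x" and pos: "0 < f x0" for f x0
  proof -
    have x0: "x0 \<in> carrier G" using Cc_outside[OF f, of x0] pos by force
    define U where "U = {u \<in> carrier G. f (x0 \<otimes> u) \<in> {f x0 / 2<..}}"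
    have U: "openin T U \<and> \<one> \<in> U"
      using openin_continuous_map_preimage[OF continuous_map_translated[OF Cc_continuous[OF f] x0], of "{f x0 / 2<..}"] x0 pos
      by (simp add: U_def)
    obtain K where K: "compactin T K" "\<And>x. x \<notin> K \<Longrightarrow> g x = 0"
      by (rule CcE[OF g(1)]) auto
    note KG = compact_subset_carrier[OF K(1)]
    obtain Z where Z: "finite Z" "Z \<subseteq> K" "\<And>x. x \<in> K \<Longrightarrow> \<exists>z\<in>Z. inv z \<otimes> x \<in> U"
      by (rule compact_finitely_many_translates[of K "\<lambda>_. U", OF K(1) U]) auto
    have ZG: "z \<in> carrier G" if "z \<in> Z" for z using that Z(2) KG by blast
    define F where "F z = translate (z \<otimes> inv x0) f" for z
    have F: "F z \<in> Cc" "J (F z) = J f" if "z \<in> Z" for z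
      using ZG[OF that] x0 f by (simp_all add: F_def Cc_translate J_trans)
    have F_nonneg: "0 \<le> F z x" for z x using nonneg by (simp add: F_def translate_def)
    obtain B where B: "0 \<le> B" "\<And>x. norm (g x) \<le> B" using Cc_bounded[OF g(1)] by metis
    have sumF: "(\<lambda>x. \<Sum>z\<in>Z. F z x) \<in> Cc" using Z(1) F(1) by (rule Cc_sum)
    have le: "(f x0 / 2) * g x \<le> B * (\<Sum>z\<in>Z. F z x)" for x
    proof (cases "x \<in> K")
      case True
      obtain z where z: "z \<in> Z" "inv z \<otimes> x \<in> U" using Z(3)[OF True] by blast
      have c: "z \<in> carrier G" "x \<in> carrier G" using ZG[OF z(1)] True KG by auto
      have "F z x = f (x0 \<otimes> (inv z \<otimes> x))"
        using c x0 by (simp add: F_def translate_def inv_mult m_ac)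
      then have "f x0 / 2 \<le> F z x" using z(2) by (simp add: U_def)
      also have "\<dots> \<le> (\<Sum>z\<in>Z. F z x)" using z(1) Z(1) F_nonneg by (intro member_le_sum) auto
      finally have "f x0 / 2 \<le> (\<Sum>z\<in>Z. F z x)" .
      then have "(f x0 / 2) * B \<le> (\<Sum>z\<in>Z. F z x) * B" using B(1) by (rule mult_right_mono)
      moreover have "(f x0 / 2) * g x \<le> (f x0 / 2) * B"
        using B(2)[of x] pos by (intro mult_left_mono) auto
      ultimately show ?thesis by (simp add: mult.commute)
    next
      case False
      then show ?thesis using K(2) B(1) F_nonneg by (simp add: sum_nonneg)
    qed
    have "(f x0 / 2) * J g \<le> B * (\<Sum>z\<in>Z. J (F z))"
    proof -
      have "J (\<lambda>x. (f x0 / 2) * g x) \<le> J (\<lambda>x. B * (\<Sum>z\<in>Z. F z x))"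
        by (rule J_mono[OF Cc_cmult[OF g(1)] Cc_cmult[OF sumF] le])
      moreover have "J (\<lambda>x. \<Sum>z\<in>Z. F z x) = (\<Sum>z\<in>Z. J (F z))" by (rule J_sum[OF Z(1) F(1)])
      ultimately show ?thesis by (simp only: J_mult[OF g(1)] J_mult[OF sumF])
    qed
    also have "\<dots> = B * (real (card Z) * J f)" using F(2) by simp
    finally have "(f x0 / 2) * J g \<le> B * real (card Z) * J f" by (simp add: mult.assoc)
    moreover have "0 < (f x0 / 2) * J g" using pos g(2) by simp
    ultimately have "0 < B * real (card Z) * J f" by linarith
    then show ?thesis using J_nonneg[OF f nonneg] by (cases "J f = 0") auto
  qed
  have reflect_add: "reflect (\<lambda>x. f x + h x) = (\<lambda>x. reflect f x + reflect h x)" for f h :: "'a \<Rightarrow> real"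
    by (auto simp: reflect_def)
  have reflect_mult: "reflect (\<lambda>x. c * f x) = (\<lambda>x. c * reflect f x)" for c and f :: "'a \<Rightarrow> real"
    by (auto simp: reflect_def)
  have refl_nonneg: "0 \<le> reflect f x" if "\<And>x. 0 \<le> f x" for f :: "'a \<Rightarrow> real" and x
    using that by (simp add: reflect_def)
  have "haar_integral G T (\<lambda>f. J f + J (reflect f))"
  proof unfold_locales
    fix f h :: "'a \<Rightarrow> real" assume fh: "f \<in> Cc" "h \<in> Cc"
    show "J (\<lambda>x. f x + h x) + J (reflect (\<lambda>x. f x + h x)) = (J f + J (reflect f)) + (J h + J (reflect h))"
      using fh by (simp add: reflect_add J_add Cc_reflect)
  next
    fix f :: "'a \<Rightarrow> real" and c :: real assume f: "f \<in> Cc"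
    show "J (\<lambda>x. c * f x) + J (reflect (\<lambda>x. c * f x)) = c * (J f + J (reflect f))"
      using f by (simp add: reflect_mult J_mult Cc_reflect distrib_left)
  next
    fix f :: "'a \<Rightarrow> real" assume f: "f \<in> Cc" "\<And>x. 0 \<le> f x"
    show "0 \<le> J f + J (reflect f)"
      using f by (intro add_nonneg_nonneg J_nonneg Cc_reflect refl_nonneg)
  next
    fix f :: "'a \<Rightarrow> real" and a assume f: "f \<in> Cc" "a \<in> carrier G"
    show "J (translate a f) + J (reflect (translate a f)) = J f + J (reflect f)"
      using f by (simp add: reflect_translate J_trans Cc_reflect)
  next
    fix f :: "'a \<Rightarrow> real" assume f: "f \<in> Cc"
    show "J (reflect f) + J (reflect (reflect f)) = J f + J (reflect f)"
      using f by (simp add: reflect_reflect)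
  next
    fix f :: "'a \<Rightarrow> real" and x0 assume f: "f \<in> Cc" "\<And>x. 0 \<le> f x" "0 < f x0"
    show "0 < J f + J (reflect f)"
      using f by (intro add_pos_nonneg J_pos[of f x0] J_nonneg Cc_reflect refl_nonneg)
  qed
  then show thesis by (rule that)
qed

end

section \<open>Convolution operators\<close>

context haar_integral
begin

lemma I_zero: "I (\<lambda>x. 0) = 0"
  using I_cmult[OF Cc_zero, of 0] by simp

lemma I_uminus: "f \<in> Cc \<Longrightarrow> I (\<lambda>x. - f x) = - I f"
  using I_cmult[of f "-1"] by simp

lemma I_diff: "\<lbrakk>f \<in> Cc; g \<in> Cc\<rbrakk> \<Longrightarrow> I (\<lambda>x. f x - g x) = I f - I g"
  using I_add[OF _ Cc_uminus, of f g] I_uminus[of g] by simp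

lemma I_mono: "\<lbrakk>f \<in> Cc; g \<in> Cc; \<And>x. f x \<le> g x\<rbrakk> \<Longrightarrow> I f \<le> I g"
  using I_nonneg[OF Cc_diff, of g f] I_diff[of g f] by simp

lemma I_abs_le: "\<lbrakk>f \<in> Cc; g \<in> Cc; \<And>x. \<bar>f x\<bar> \<le> g x\<rbrakk> \<Longrightarrow> \<bar>I f\<bar> \<le> I g"
  using I_mono[of f g] I_mono[of "\<lambda>x. - f x" g] I_uminus[of f] Cc_uminus[of f] by (fastforce simp: abs_le_iff)

lemma I_sum:
  assumes "finite Z" "\<And>z. z \<in> Z \<Longrightarrow> F z \<in> Cc"
  shows "I (\<lambda>x. \<Sum>z\<in>Z. F z x) = (\<Sum>z\<in>Z. I (F z))"
  using assms
proof (induction Z)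
  case empty
  show ?case using I_zero by simp
next
  case (insert z Z)
  then have "(\<lambda>x. \<Sum>z\<in>Z. F z x) \<in> Cc" by (intro Cc_sum) auto
  then show ?case using insert I_add[of "F z" "\<lambda>x. \<Sum>z\<in>Z. F z x"] by simp
qed

text \<open>
  A single finite set of nodes serves all integrands \<open>F\<close> that vary by at most
  \<open>\<epsilon>\<close> along \<open>V\<close>: the weights are the integrals of \<open>\<kappa>\<close>
  against a partition of unity subordinate to translates of \<open>V\<close>. Applied to convolutions, this
  approximates them uniformly by combinations of translates.
\<close>

lemma riemann_sum:
  assumes \<kappa>: "\<kappa> \<in> Cc" and V: "openin T V" "\<one> \<in> V"
  obtains Z c where "finite Z" "Z \<subseteq> carrier G" "(\<Sum>z\<in>Z. \<bar>c z\<bar>) \<le> I (\<lambda>x. \<bar>\<kappa> x\<bar>)"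
    "\<And>F \<epsilon>. \<lbrakk>continuous_map T euclideanreal F;
        \<And>y z. \<lbrakk>y \<in> carrier G; z \<in> carrier G; inv z \<otimes> y \<in> V\<rbrakk> \<Longrightarrow> \<bar>F y - F z\<bar> \<le> \<epsilon>\<rbrakk>
      \<Longrightarrow> \<bar>I (\<lambda>y. \<kappa> y * F y) - (\<Sum>z\<in>Z. c z * F z)\<bar> \<le> \<epsilon> * I (\<lambda>x. \<bar>\<kappa> x\<bar>)"
proof -
  obtain K where K: "compactin T K" "\<And>x. x \<notin> K \<Longrightarrow> \<kappa> x = 0"
    by (rule CcE[OF \<kappa>]) auto
  note KG = compact_subset_carrier[OF K(1)]
  obtain \<phi> :: "'a \<Rightarrow> real" where \<phi>: "\<phi> \<in> Cc" "\<And>x. 0 \<le> \<phi> x" "\<phi> \<one> = 1" "\<And>x. x \<notin> V \<Longrightarrow> \<phi> x = 0"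
    by (rule bump_function[OF V]) blast
  define U where "U = {u \<in> carrier G. \<phi> u \<in> {0<..}}"
  have U: "openin T U \<and> \<one> \<in> U"
    using openin_continuous_map_preimage[OF Cc_continuous[OF \<phi>(1)], of "{0<..}"] \<phi>(3) by (simp add: U_def)
  obtain Z where Z: "finite Z" "Z \<subseteq> K" "\<And>x. x \<in> K \<Longrightarrow> \<exists>z\<in>Z. inv z \<otimes> x \<in> U"
    by (rule compact_finitely_many_translates[of K "\<lambda>_. U", OF K(1) U]) auto
  have ZG: "z \<in> carrier G" if "z \<in> Z" for z using that Z(2) KG by blast
  define D where "D y = (\<Sum>z\<in>Z. translate z \<phi> y)" for y
  have tr_nonneg: "0 \<le> translate z \<phi> y" for z y using \<phi>(2) by (simp add: translate_def)
  have trC: "translate z \<phi> \<in> Cc" if "z \<in> Z" for z using Cc_translate[OF \<phi>(1) ZG[OF that]] .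
  have DC: "D \<in> Cc" unfolding D_def using Z(1) trC by (rule Cc_sum)
  have D_pos: "0 < D y" if y: "y \<in> K" for y
  proof -
    obtain z where z: "z \<in> Z" "inv z \<otimes> y \<in> U" using Z(3)[OF y] by blast
    then have "0 < translate z \<phi> y" using y KG by (auto simp: translate_def U_def)
    also have "\<dots> \<le> D y" unfolding D_def using z(1) Z(1) tr_nonneg by (intro member_le_sum) auto
    finally show ?thesis .
  qed
  obtain \<delta> where \<delta>: "0 < \<delta>" "\<And>y. y \<in> K \<Longrightarrow> \<delta> \<le> D y"
  proof (cases "K = {}")
    case False
    have "compact (D ` K)" using image_compactin[OF K(1) Cc_continuous[OF DC]] by simp
    then obtain s where "s \<in> D ` K" "\<forall>t\<in>D ` K. s \<le> t"
      using compact_attains_inf[of "D ` K"] False by blast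
    then show thesis using D_pos by (intro that[of s]) auto
  qed (use that[of 1] in auto)
  \<comment> \<open>The sum \<open>D\<close> of the translated bumps is bounded below only on \<open>K\<close>; truncating it from below allows division everywhere.\<close>
  define E where "E y = max (D y) \<delta>" for y
  have E: "0 < E y" for y using \<delta>(1) by (simp add: E_def)
  have E_D: "E y = D y" if "y \<in> K" for y using \<delta>(2)[OF that] by (simp add: E_def)
  have "continuous_map T euclidean (\<lambda>y. 1 / max (D y) \<delta>)"
    by (rule continuous_map_euclidean_compose[OF Cc_continuous[OF DC], of "\<lambda>d. 1 / max d \<delta>"])
      (intro continuous_intros, use \<delta>(1) in auto)
  then have E_cont: "continuous_map T euclidean (\<lambda>y. 1 / E y)" by (simp add: E_def)
  define \<psi> where "\<psi> z y = \<kappa> y * (translate z \<phi> y * (1 / E y))" for z y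
  have \<psi>C: "\<psi> z \<in> Cc" if "z \<in> Z" for z
    unfolding \<psi>_def by (rule Cc_mult[OF \<kappa> Cc_continuous[OF Cc_mult[OF trC[OF that] E_cont]]])
  have part: "(\<Sum>z\<in>Z. translate z \<phi> y * (1 / E y)) = 1" if "y \<in> K" for y
    using E_D[OF that] D_pos[OF that] by (simp add: D_def sum_divide_distrib[symmetric])
  have sum_\<psi>: "(\<Sum>z\<in>Z. \<psi> z y) = \<kappa> y" for y
    using part[of y] K(2)[of y] by (cases "y \<in> K") (simp_all add: \<psi>_def sum_distrib_left[symmetric] del: times_divide_eq_right)
  have sum_abs_\<psi>: "(\<Sum>z\<in>Z. \<bar>\<psi> z y\<bar>) = \<bar>\<kappa> y\<bar>" for y
  proof -
    have "\<bar>\<psi> z y\<bar> = \<bar>\<kappa> y\<bar> * (translate z \<phi> y * (1 / E y))" for z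
      using tr_nonneg[of z y] E[of y] by (simp add: \<psi>_def abs_mult)
    then have "(\<Sum>z\<in>Z. \<bar>\<psi> z y\<bar>) = \<bar>\<kappa> y\<bar> * (\<Sum>z\<in>Z. translate z \<phi> y * (1 / E y))"
      by (simp only: sum_distrib_left)
    then show ?thesis using part[of y] K(2)[of y] by (cases "y \<in> K") auto
  qed
  have sum_I_abs: "(\<Sum>z\<in>Z. I (\<lambda>y. \<bar>\<psi> z y\<bar>)) = I (\<lambda>y. \<bar>\<kappa> y\<bar>)"
    using I_sum[OF Z(1), of "\<lambda>z y. \<bar>\<psi> z y\<bar>"] Cc_abs[OF \<psi>C] by (simp add: sum_abs_\<psi>)
  show thesis
  proof (rule that[of Z "\<lambda>z. I (\<psi> z)"])
    show "finite Z" "Z \<subseteq> carrier G" using Z(1) ZG by auto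
    have "(\<Sum>z\<in>Z. \<bar>I (\<psi> z)\<bar>) \<le> (\<Sum>z\<in>Z. I (\<lambda>y. \<bar>\<psi> z y\<bar>))"
      by (intro sum_mono I_abs_le \<psi>C Cc_abs) auto
    then show "(\<Sum>z\<in>Z. \<bar>I (\<psi> z)\<bar>) \<le> I (\<lambda>x. \<bar>\<kappa> x\<bar>)" by (simp add: sum_I_abs)
  next
    fix F :: "'a \<Rightarrow> real" and \<epsilon> :: real
    assume F: "continuous_map T euclideanreal F"
      and near: "\<And>y z. \<lbrakk>y \<in> carrier G; z \<in> carrier G; inv z \<otimes> y \<in> V\<rbrakk> \<Longrightarrow> \<bar>F y - F z\<bar> \<le> \<epsilon>"
    have \<psi>F: "(\<lambda>y. \<psi> z y * F y) \<in> Cc" if "z \<in> Z" for z by (rule Cc_mult[OF \<psi>C[OF that] F])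
    have "I (\<lambda>y. \<Sum>z\<in>Z. \<psi> z y * F y) = (\<Sum>z\<in>Z. I (\<lambda>y. \<psi> z y * F y))"
      by (rule I_sum[OF Z(1) \<psi>F])
    then have "I (\<lambda>y. \<kappa> y * F y) = (\<Sum>z\<in>Z. I (\<lambda>y. \<psi> z y * F y))"
      by (simp add: sum_distrib_right[symmetric] sum_\<psi>)
    then have "I (\<lambda>y. \<kappa> y * F y) - (\<Sum>z\<in>Z. I (\<psi> z) * F z) = (\<Sum>z\<in>Z. I (\<lambda>y. \<psi> z y * F y) - F z * I (\<psi> z))"
      by (simp add: sum_subtractf mult.commute)
    also have "\<bar>\<dots>\<bar> \<le> (\<Sum>z\<in>Z. \<bar>I (\<lambda>y. \<psi> z y * F y) - F z * I (\<psi> z)\<bar>)" by (rule sum_abs)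
    also have "\<dots> \<le> (\<Sum>z\<in>Z. \<epsilon> * I (\<lambda>y. \<bar>\<psi> z y\<bar>))"
    proof (rule sum_mono)
      fix z assume z: "z \<in> Z"
      have "I (\<lambda>y. \<psi> z y * F y) - F z * I (\<psi> z) = I (\<lambda>y. \<psi> z y * F y - F z * \<psi> z y)"
        using I_diff[OF \<psi>F[OF z] Cc_cmult[OF \<psi>C[OF z]], of "F z"] I_cmult[OF \<psi>C[OF z], of "F z"] by simp
      also have "\<bar>\<dots>\<bar> \<le> I (\<lambda>y. \<epsilon> * \<bar>\<psi> z y\<bar>)"
      proof (rule I_abs_le)
        show "(\<lambda>y. \<psi> z y * F y - F z * \<psi> z y) \<in> Cc" by (rule Cc_diff[OF \<psi>F[OF z] Cc_cmult[OF \<psi>C[OF z]]])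
        show "(\<lambda>y. \<epsilon> * \<bar>\<psi> z y\<bar>) \<in> Cc" by (rule Cc_cmult[OF Cc_abs[OF \<psi>C[OF z]]])
        fix y
        have eq: "\<psi> z y * F y - F z * \<psi> z y = (F y - F z) * \<psi> z y" by (simp add: algebra_simps)
        show "\<bar>\<psi> z y * F y - F z * \<psi> z y\<bar> \<le> \<epsilon> * \<bar>\<psi> z y\<bar>"
        proof (cases "\<psi> z y = 0")
          case False
          then have "translate z \<phi> y \<noteq> 0" by (auto simp: \<psi>_def)
          then have "y \<in> carrier G" "inv z \<otimes> y \<in> V"
            using \<phi>(4) by (auto simp: translate_def split: if_splits)
          then have "\<bar>F y - F z\<bar> \<le> \<epsilon>" using near ZG[OF z] by blast
          then show ?thesis unfolding eq abs_mult by (rule mult_right_mono) simp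
        qed simp
      qed
      finally show "\<bar>I (\<lambda>y. \<psi> z y * F y) - F z * I (\<psi> z)\<bar> \<le> \<epsilon> * I (\<lambda>y. \<bar>\<psi> z y\<bar>)"
        using I_cmult[OF Cc_abs[OF \<psi>C[OF z]], of \<epsilon>] by simp
    qed
    also have "\<dots> = \<epsilon> * I (\<lambda>x. \<bar>\<kappa> x\<bar>)" by (simp add: sum_distrib_left[symmetric] sum_I_abs)
    finally show "\<bar>I (\<lambda>y. \<kappa> y * F y) - (\<Sum>z\<in>Z. I (\<psi> z) * F z)\<bar> \<le> \<epsilon> * I (\<lambda>x. \<bar>\<kappa> x\<bar>)" .
  qed
qed

definition L2 :: "('a \<Rightarrow> 'v::real_normed_vector) \<Rightarrow> real" where
  "L2 f = sqrt (I (\<lambda>x. (norm (f x))\<^sup>2))"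

lemma Cc_norm_square: "f \<in> Cc \<Longrightarrow> (\<lambda>x. (norm (f x))\<^sup>2) \<in> Cc"
  by (rule Cc_compose) (intro continuous_intros | simp)+

lemma Cc_inner:
  fixes f g :: "'a \<Rightarrow> 'v::real_inner"
  assumes "f \<in> Cc" "g \<in> Cc"
  shows "(\<lambda>x. inner (f x) (g x)) \<in> Cc"
proof -
  obtain K where K: "continuous_map T euclidean f" "compactin T K" "\<And>x. x \<notin> K \<Longrightarrow> f x = 0"
    using assms(1) unfolding Cc_def by blast
  have "continuous_map T euclidean (\<lambda>x. inner (f x) (g x))"
    by (rule continuous_map_euclidean_compose2[OF K(1) Cc_continuous[OF assms(2)]]) (intro continuous_intros)
  then show ?thesis by (rule CcI[OF _ K(2)]) (simp add: K(3))
qed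

lemma L2_square: "f \<in> Cc \<Longrightarrow> (L2 f)\<^sup>2 = I (\<lambda>x. (norm (f x))\<^sup>2)"
  unfolding L2_def using I_nonneg[OF Cc_norm_square] by simp

lemma L2_nonneg: "f \<in> Cc \<Longrightarrow> 0 \<le> L2 f"
  unfolding L2_def using I_nonneg[OF Cc_norm_square] by simp

text \<open>
  The weighted arithmetic-geometric mean inequality, with weight \<open>s\<close> the ratio of the two
  norms; \<open>e\<close> keeps the ratio defined and is then sent to \<open>0\<close>.
\<close>

lemma L2_Cauchy_Schwarz:
  fixes f g :: "'a \<Rightarrow> 'v::real_inner"
  assumes f: "f \<in> Cc" and g: "g \<in> Cc"
  shows "\<bar>I (\<lambda>x. inner (f x) (g x))\<bar> \<le> L2 f * L2 g"
proof -
  have "\<bar>I (\<lambda>x. inner (f x) (g x))\<bar> \<le> (L2 f + e) * (L2 g + e)" if e: "0 < e" for e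
  proof -
    define s where "s = (L2 g + e) / (L2 f + e)"
    have A: "0 < L2 f + e" "0 < L2 g + e" using L2_nonneg[OF f] L2_nonneg[OF g] e by auto
    then have s: "0 < s" by (simp add: s_def)
    have bound: "\<bar>inner (f x) (g x)\<bar> \<le> s / 2 * (norm (f x))\<^sup>2 + 1 / (2 * s) * (norm (g x))\<^sup>2" for x
    proof -
      have "0 \<le> (s * norm (f x) - norm (g x))\<^sup>2" by simp
      then have "2 * s * (norm (f x) * norm (g x)) \<le> s * s * (norm (f x))\<^sup>2 + (norm (g x))\<^sup>2"
        by (simp add: power2_eq_square algebra_simps)
      then have "norm (f x) * norm (g x) \<le> s / 2 * (norm (f x))\<^sup>2 + 1 / (2 * s) * (norm (g x))\<^sup>2"
        using s by (simp add: field_simps power2_eq_square)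
      then show ?thesis using Cauchy_Schwarz_ineq2[of "f x" "g x"] by linarith
    qed
    have C: "(\<lambda>x. s / 2 * (norm (f x))\<^sup>2) \<in> Cc" "(\<lambda>x. 1 / (2 * s) * (norm (g x))\<^sup>2) \<in> Cc"
      by (rule Cc_cmult[OF Cc_norm_square[OF f]], rule Cc_cmult[OF Cc_norm_square[OF g]])
    have "\<bar>I (\<lambda>x. inner (f x) (g x))\<bar> \<le> I (\<lambda>x. s / 2 * (norm (f x))\<^sup>2 + 1 / (2 * s) * (norm (g x))\<^sup>2)"
      by (intro I_abs_le Cc_inner f g Cc_add C bound)
    also have "\<dots> = s / 2 * (L2 f)\<^sup>2 + 1 / (2 * s) * (L2 g)\<^sup>2"
      by (simp only: I_add[OF C] I_cmult[OF Cc_norm_square[OF f]] I_cmult[OF Cc_norm_square[OF g]] L2_square[OF f] L2_square[OF g])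
    also have "\<dots> \<le> s / 2 * (L2 f + e)\<^sup>2 + 1 / (2 * s) * (L2 g + e)\<^sup>2"
      using s e L2_nonneg[OF f] L2_nonneg[OF g] by (intro add_mono mult_left_mono power_mono) auto
    also have "\<dots> = (L2 f + e) * (L2 g + e)"
    proof -
      have "b / a / 2 * a\<^sup>2 + 1 / (2 * (b / a)) * b\<^sup>2 = a * b" if "0 < a" "0 < b" for a b :: real
        using that by (simp add: field_simps power2_eq_square)
      from this[OF A] show ?thesis by (simp only: s_def)
    qed
    finally show ?thesis .
  qed
  then have "\<forall>\<^sub>F e in at_right 0. \<bar>I (\<lambda>x. inner (f x) (g x))\<bar> \<le> (L2 f + e) * (L2 g + e)"
    by (simp add: eventually_at_right_less eventually_mono[OF eventually_at_right_less])
  moreover have "((\<lambda>e. (L2 f + e) * (L2 g + e)) \<longlongrightarrow> (L2 f + 0) * (L2 g + 0)) (at_right 0)"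
    by (intro tendsto_intros)
  ultimately have "\<bar>I (\<lambda>x. inner (f x) (g x))\<bar> \<le> (L2 f + 0) * (L2 g + 0)"
    by (intro tendsto_lowerbound) auto
  then show ?thesis by simp
qed

lemma L2_triangle:
  fixes f g :: "'a \<Rightarrow> 'v::real_inner"
  assumes f: "f \<in> Cc" and g: "g \<in> Cc"
  shows "L2 (\<lambda>x. f x + g x) \<le> L2 f + L2 g"
proof (rule power2_le_imp_le)
  have eq: "(norm (f x + g x))\<^sup>2 = (norm (f x))\<^sup>2 + (2 * inner (f x) (g x) + (norm (g x))\<^sup>2)" for x
    by (simp add: power2_norm_eq_inner inner_simps inner_commute)
  have C: "(\<lambda>x. 2 * inner (f x) (g x)) \<in> Cc" by (rule Cc_cmult[OF Cc_inner[OF f g]])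
  have "(L2 (\<lambda>x. f x + g x))\<^sup>2 = (L2 f)\<^sup>2 + (2 * I (\<lambda>x. inner (f x) (g x)) + (L2 g)\<^sup>2)"
    unfolding L2_square[OF Cc_add[OF f g]] eq
    by (simp only: I_add[OF Cc_norm_square[OF f] Cc_add[OF C Cc_norm_square[OF g]]] I_add[OF C Cc_norm_square[OF g]]
        I_cmult[OF Cc_inner[OF f g]] L2_square[OF f] L2_square[OF g])
  also have "\<dots> \<le> (L2 f + L2 g)\<^sup>2"
    using L2_Cauchy_Schwarz[OF f g] by (simp add: power2_sum)
  finally show "(L2 (\<lambda>x. f x + g x))\<^sup>2 \<le> (L2 f + L2 g)\<^sup>2" .
  show "0 \<le> L2 f + L2 g" using L2_nonneg[OF f] L2_nonneg[OF g] by simp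
qed

lemma L2_translate:
  assumes f: "f \<in> Cc" and a: "a \<in> carrier G"
  shows "L2 (translate a f) = L2 f"
proof -
  have "(\<lambda>x. (norm (translate a f x))\<^sup>2) = translate a (\<lambda>x. (norm (f x))\<^sup>2)"
    by (auto simp: translate_def)
  then show ?thesis unfolding L2_def using I_translate[OF Cc_norm_square[OF f] a] by simp
qed

text \<open>
  The convolution \<open>x \<mapsto> \<integral> \<kappa> y * g (inv y \<otimes> x)\<close>, with the second
  factor written as a translate of the reflection of \<open>g\<close> so that it visibly belongs to
  \<open>Cc\<close> as a function of \<open>y\<close>.
\<close>

definition conv :: "('a \<Rightarrow> real) \<Rightarrow> ('a \<Rightarrow> real) \<Rightarrow> 'a \<Rightarrow> real" where
  "conv \<kappa> g = (\<lambda>x. if x \<in> carrier G then I (\<lambda>y. \<kappa> y * translate x (reflect g) y) else 0)"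

lemma translate_reflect: "\<lbrakk>x \<in> carrier G; y \<in> carrier G\<rbrakk> \<Longrightarrow> translate x (reflect g) y = g (inv y \<otimes> x)"
  by (simp add: translate_def reflect_def inv_mult m_comm)

lemma conv_integrand:
  fixes \<kappa> g :: "'a \<Rightarrow> real"
  assumes "\<kappa> \<in> Cc" "g \<in> Cc" "x \<in> carrier G"
  shows "(\<lambda>y. \<kappa> y * translate x (reflect g) y) \<in> Cc"
  by (rule Cc_mult[OF assms(1) Cc_continuous[OF Cc_translate[OF Cc_reflect[OF assms(2)] assms(3)]]])

lemma Cc_conv:
  assumes \<kappa>: "\<kappa> \<in> Cc" and g: "g \<in> Cc"
  shows "conv \<kappa> g \<in> Cc"
proof -
  obtain K where K: "compactin T K" "\<And>x. x \<notin> K \<Longrightarrow> \<kappa> x = 0" by (rule CcE[OF \<kappa>]) auto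
  obtain L where L: "compactin T L" "\<And>x. x \<notin> L \<Longrightarrow> g x = 0" by (rule CcE[OF g]) auto
  note KG = compact_subset_carrier[OF K(1)] and LG = compact_subset_carrier[OF L(1)]
  define C where "C = I (\<lambda>x. \<bar>\<kappa> x\<bar>)"
  have C: "0 \<le> C" unfolding C_def by (rule I_nonneg[OF Cc_abs[OF \<kappa>]]) simp
  have "openin T {x \<in> carrier G. conv \<kappa> g x \<in> W}" if W: "open W" for W
  proof (subst openin_subopen, intro ballI)
    fix z assume "z \<in> {x \<in> carrier G. conv \<kappa> g x \<in> W}"
    then have z: "z \<in> carrier G" "conv \<kappa> g z \<in> W" by auto
    then obtain e where e: "0 < e" "ball (conv \<kappa> g z) e \<subseteq> W" using W open_contains_ball by blast
    define \<eta> where "\<eta> = e / (C + 1)"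
    have \<eta>: "0 < \<eta>" using e(1) C by (simp add: \<eta>_def)
    obtain V where V: "openin T V" "\<one> \<in> V" "\<And>x v. \<lbrakk>x \<in> carrier G; v \<in> V\<rbrakk> \<Longrightarrow> norm (g (x \<otimes> v) - g x) < \<eta>"
      by (rule Cc_uniformly_continuous[OF g \<eta>]) blast
    have "conv \<kappa> g x \<in> W" if x: "x \<in> carrier G" "inv z \<otimes> x \<in> V" for x
    proof -
      have C1: "(\<lambda>y. \<kappa> y * translate x (reflect g) y) \<in> Cc" "(\<lambda>y. \<kappa> y * translate z (reflect g) y) \<in> Cc"
        using conv_integrand[OF \<kappa> g] x(1) z(1) by auto
      have "\<bar>I (\<lambda>y. \<kappa> y * translate x (reflect g) y - \<kappa> y * translate z (reflect g) y)\<bar> \<le> I (\<lambda>y. \<eta> * \<bar>\<kappa> y\<bar>)"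
      proof (intro I_abs_le Cc_diff C1 Cc_cmult Cc_abs \<kappa>)
        fix y
        show "\<bar>\<kappa> y * translate x (reflect g) y - \<kappa> y * translate z (reflect g) y\<bar> \<le> \<eta> * \<bar>\<kappa> y\<bar>"
        proof (cases "y \<in> carrier G")
          case True
          have "(inv y \<otimes> z) \<otimes> (inv z \<otimes> x) = inv y \<otimes> ((z \<otimes> inv z) \<otimes> x)"
            using True x z by (simp only: m_assoc m_closed inv_closed)
          then have "(inv y \<otimes> z) \<otimes> (inv z \<otimes> x) = inv y \<otimes> x" using True x z by simp
          then have "\<bar>translate x (reflect g) y - translate z (reflect g) y\<bar> \<le> \<eta>"
            using V(3)[of "inv y \<otimes> z" "inv z \<otimes> x"] True x z by (simp add: translate_reflect)
          from mult_left_mono[OF this, of "\<bar>\<kappa> y\<bar>"] show ?thesis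
            by (simp add: right_diff_distrib[symmetric] abs_mult mult.commute)
        qed (simp add: Cc_outside[OF \<kappa>])
      qed
      also have "\<dots> = \<eta> * C" using I_cmult[OF Cc_abs[OF \<kappa>]] by (simp add: C_def)
      also have "\<dots> < e" using e(1) C by (simp add: \<eta>_def field_simps)
      finally have "\<bar>conv \<kappa> g x - conv \<kappa> g z\<bar> < e"
        using I_diff[OF C1] x(1) z(1) by (simp add: conv_def)
      then show ?thesis using e(2) by (auto simp: dist_real_def abs_minus_commute)
    qed
    moreover have "openin T {x \<in> carrier G. inv z \<otimes> x \<in> V}" using openin_translate[OF V(1)] z(1) by simp
    moreover have "z \<in> {x \<in> carrier G. inv z \<otimes> x \<in> V}" using z(1) V(2) by simp
    ultimately show "\<exists>S. openin T S \<and> z \<in> S \<and> S \<subseteq> {x \<in> carrier G. conv \<kappa> g x \<in> W}" by blast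
  qed
  then have "continuous_map T euclidean (conv \<kappa> g)" by (simp add: continuous_map)
  moreover have "compactin T ((\<lambda>(x, y). x \<otimes> y) ` (K \<times> L))"
    using image_compactin[OF _ continuous_mult, of "K \<times> L"] K(1) L(1) by (simp add: compactin_Times)
  moreover have "conv \<kappa> g x = 0" if "x \<notin> (\<lambda>(x, y). x \<otimes> y) ` (K \<times> L)" for x
  proof (cases "x \<in> carrier G")
    case True
    have "\<kappa> y * translate x (reflect g) y = 0" for y
    proof (cases "y \<in> K")
      case y: True
      have yG: "y \<in> carrier G" using y KG by blast
      have "x = y \<otimes> (inv y \<otimes> x)" using True yG by (simp flip: m_assoc)
      moreover have "(\<lambda>(x, y). x \<otimes> y) (y, inv y \<otimes> x) \<in> (\<lambda>(x, y). x \<otimes> y) ` (K \<times> L)" if "inv y \<otimes> x \<in> L"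
        using that y by (intro imageI) simp
      ultimately have "inv y \<otimes> x \<notin> L" using that by auto
      then show ?thesis using L(2) True yG by (simp add: translate_reflect)
    qed (simp add: K(2))
    then have "(\<lambda>y. \<kappa> y * translate x (reflect g) y) = (\<lambda>y. 0)" by (rule ext)
    then show ?thesis using I_zero True by (simp only: conv_def if_True)
  qed (simp add: conv_def)
  ultimately show ?thesis by (intro CcI)
qed

end

context haar_integral
begin

lemma conv_add:
  assumes "\<kappa> \<in> Cc" "g \<in> Cc" "h \<in> Cc"
  shows "conv \<kappa> (\<lambda>x. g x + h x) = (\<lambda>x. conv \<kappa> g x + conv \<kappa> h x)"
proof
  fix x
  have "translate x (reflect (\<lambda>x. g x + h x)) y = translate x (reflect g) y + translate x (reflect h) y" for y
    by (simp add: translate_def reflect_def)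
  then show "conv \<kappa> (\<lambda>x. g x + h x) x = conv \<kappa> g x + conv \<kappa> h x"
    using I_add[OF conv_integrand[OF assms(1,2)] conv_integrand[OF assms(1,3)], of x x]
    by (simp add: conv_def distrib_left)
qed

lemma conv_cmult:
  assumes "\<kappa> \<in> Cc" "g \<in> Cc"
  shows "conv \<kappa> (\<lambda>x. c * g x) = (\<lambda>x. c * conv \<kappa> g x)"
proof
  fix x
  have "\<kappa> y * translate x (reflect (\<lambda>x. c * g x)) y = c * (\<kappa> y * translate x (reflect g) y)" for y
    by (simp add: translate_def reflect_def)
  then have "(\<lambda>y. \<kappa> y * translate x (reflect (\<lambda>x. c * g x)) y) = (\<lambda>y. c * (\<kappa> y * translate x (reflect g) y))"
    by (rule ext)
  then show "conv \<kappa> (\<lambda>x. c * g x) x = c * conv \<kappa> g x"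
    using I_cmult[OF conv_integrand[OF assms], of x c] by (simp add: conv_def)
qed

lemma conv_kernel_diff:
  assumes "\<kappa> \<in> Cc" "\<kappa>' \<in> Cc" "g \<in> Cc"
  shows "conv (\<lambda>x. \<kappa> x - \<kappa>' x) g = (\<lambda>x. conv \<kappa> g x - conv \<kappa>' g x)"
proof
  fix x
  show "conv (\<lambda>x. \<kappa> x - \<kappa>' x) g x = conv \<kappa> g x - conv \<kappa>' g x"
    using I_diff[OF conv_integrand[OF assms(1,3)] conv_integrand[OF assms(2,3)], of x x]
    by (simp add: conv_def left_diff_distrib)
qed

lemma conv_translate:
  assumes "\<kappa> \<in> Cc" and a: "a \<in> carrier G"
  shows "conv \<kappa> (translate a g) = translate a (conv \<kappa> g)"
proof
  fix x
  have "\<kappa> y * translate x (reflect (translate a g)) y = \<kappa> y * translate (inv a \<otimes> x) (reflect g) y"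
    if x: "x \<in> carrier G" for y
  proof (cases "y \<in> carrier G")
    case True
    have "translate x (reflect (translate a g)) y = g (inv a \<otimes> (inv y \<otimes> x))"
      using True x a by (simp add: translate_reflect) (simp add: translate_def)
    also have "\<dots> = translate (inv a \<otimes> x) (reflect g) y"
      using True x a by (simp add: translate_reflect m_lcomm)
    finally show ?thesis by simp
  qed (simp add: Cc_outside[OF assms(1)])
  then have "(\<lambda>y. \<kappa> y * translate x (reflect (translate a g)) y) = (\<lambda>y. \<kappa> y * translate (inv a \<otimes> x) (reflect g) y)"
    if "x \<in> carrier G" using that by (intro ext) blast
  then show "conv \<kappa> (translate a g) x = translate a (conv \<kappa> g) x"
    using a by (simp add: conv_def translate_def[of a "\<lambda>x. if x \<in> carrier G then I (\<lambda>y. \<kappa> y * translate x (reflect g) y) else 0"])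
qed

lemma conv_translate_kernel:
  assumes \<kappa>: "\<kappa> \<in> Cc" and g: "g \<in> Cc" and a: "a \<in> carrier G"
  shows "conv (translate a \<kappa>) g = translate a (conv \<kappa> g)"
proof
  fix x
  show "conv (translate a \<kappa>) g x = translate a (conv \<kappa> g) x"
  proof (cases "x \<in> carrier G")
    case x: True
    have "translate a \<kappa> y * translate x (reflect g) y
        = translate a (\<lambda>y. \<kappa> y * translate (inv a \<otimes> x) (reflect g) y) y" for y
    proof (cases "y \<in> carrier G")
      case y: True
      have "inv (inv a \<otimes> y) \<otimes> (inv a \<otimes> x) = inv y \<otimes> ((a \<otimes> inv a) \<otimes> x)"
        using x y a by (simp only: inv_mult inv_inv inv_closed m_ac m_closed)
      then have "inv (inv a \<otimes> y) \<otimes> (inv a \<otimes> x) = inv y \<otimes> x" using x y a by simp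
      then have "translate (inv a \<otimes> x) (reflect g) (inv a \<otimes> y) = translate x (reflect g) y"
        using x y a by (simp only: translate_reflect m_closed inv_closed)
      then show ?thesis using y by (simp add: translate_def[of a])
    qed (simp add: translate_def)
    then have "(\<lambda>y. translate a \<kappa> y * translate x (reflect g) y)
        = translate a (\<lambda>y. \<kappa> y * translate (inv a \<otimes> x) (reflect g) y)" by (rule ext)
    then show ?thesis
      using x a I_translate[OF conv_integrand[OF \<kappa> g, of "inv a \<otimes> x"] a]
      by (simp add: conv_def translate_def[of a "\<lambda>x. if x \<in> carrier G then I (\<lambda>y. \<kappa> y * translate x (reflect g) y) else 0"])
  qed (simp add: conv_def translate_def)
qed

lemma I_mult_near:
  fixes u v h :: "'a \<Rightarrow> real"
  assumes C: "u \<in> Cc" "v \<in> Cc" "h \<in> Cc" and near: "\<And>x. x \<in> carrier G \<Longrightarrow> \<bar>u x - v x\<bar> \<le> \<delta>"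
  shows "\<bar>I (\<lambda>x. u x * h x) - I (\<lambda>x. v x * h x)\<bar> \<le> \<delta> * I (\<lambda>x. \<bar>h x\<bar>)"
proof -
  have P: "(\<lambda>x. u x * h x) \<in> Cc" "(\<lambda>x. v x * h x) \<in> Cc"
    by (rule Cc_mult[OF C(1) Cc_continuous[OF C(3)]], rule Cc_mult[OF C(2) Cc_continuous[OF C(3)]])
  have "\<bar>I (\<lambda>x. u x * h x - v x * h x)\<bar> \<le> I (\<lambda>x. \<delta> * \<bar>h x\<bar>)"
  proof (intro I_abs_le Cc_diff P Cc_cmult Cc_abs C(3))
    fix x
    show "\<bar>u x * h x - v x * h x\<bar> \<le> \<delta> * \<bar>h x\<bar>"
    proof (cases "x \<in> carrier G")
      case True
      from mult_right_mono[OF near[OF True], of "\<bar>h x\<bar>"] show ?thesis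
        by (simp add: abs_mult left_diff_distrib[symmetric])
    qed (simp add: Cc_outside[OF C(3)])
  qed
  then show ?thesis using I_diff[OF P] I_cmult[OF Cc_abs[OF C(3)], of \<delta>] by simp
qed

text \<open>
  Both pairings are approximated with the same nodes and weights: once for \<open>conv \<kappa> g\<close> as
  a combination of translates of \<open>g\<close>, and once, for a symmetric kernel, for
  \<open>conv \<kappa> h\<close> as the same combination of the inverse translates of \<open>h\<close>.
  Self-adjointness and the norm bound of the convolution are then inherited from translations.
\<close>

lemma conv_weak_approximation:
  assumes \<kappa>: "\<kappa> \<in> Cc" and g: "g \<in> Cc" and h: "h \<in> Cc" and e: "0 < e"
  obtains Z c where "finite Z" "Z \<subseteq> carrier G" "(\<Sum>z\<in>Z. \<bar>c z\<bar>) \<le> I (\<lambda>x. \<bar>\<kappa> x\<bar>)"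
    "\<bar>I (\<lambda>x. conv \<kappa> g x * h x) - (\<Sum>z\<in>Z. c z * I (\<lambda>x. translate z g x * h x))\<bar> \<le> e"
    "reflect \<kappa> = \<kappa> \<Longrightarrow> \<bar>I (\<lambda>x. conv \<kappa> h x * g x) - (\<Sum>z\<in>Z. c z * I (\<lambda>x. translate (inv z) h x * g x))\<bar> \<le> e"
proof -
  define C where "C = I (\<lambda>x. \<bar>\<kappa> x\<bar>)"
  define B where "B = I (\<lambda>x. \<bar>g x\<bar>) + I (\<lambda>x. \<bar>h x\<bar>)"
  have nonneg: "0 \<le> C" "0 \<le> I (\<lambda>x. \<bar>g x\<bar>)" "0 \<le> I (\<lambda>x. \<bar>h x\<bar>)"
    unfolding C_def using I_nonneg[OF Cc_abs] \<kappa> g h by auto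
  define \<eta> where "\<eta> = e / (C * B + 1)"
  have CB: "0 \<le> C * B" using nonneg by (simp add: B_def)
  then have \<eta>: "0 < \<eta>" using e by (simp add: \<eta>_def)
  have small: "\<eta> * C * b \<le> e" if "b \<le> B" for b
  proof -
    have "\<eta> * C * b \<le> \<eta> * (C * B)" using \<eta> nonneg(1) that by (simp add: mult.assoc mult_left_mono)
    also have "\<dots> \<le> e" using e CB by (simp add: \<eta>_def field_simps)
    finally show ?thesis .
  qed
  obtain V1 where V1: "openin T V1" "\<one> \<in> V1" "\<And>x v. \<lbrakk>x \<in> carrier G; v \<in> V1\<rbrakk> \<Longrightarrow> norm (g (x \<otimes> v) - g x) < \<eta>"
    by (rule Cc_uniformly_continuous[OF g \<eta>]) blast
  obtain V2 where V2: "openin T V2" "\<one> \<in> V2" "\<And>x v. \<lbrakk>x \<in> carrier G; v \<in> V2\<rbrakk> \<Longrightarrow> norm (h (x \<otimes> v) - h x) < \<eta>"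
    by (rule Cc_uniformly_continuous[OF h \<eta>]) blast
  have V: "openin T (V1 \<inter> V2)" "\<one> \<in> V1 \<inter> V2" using V1 V2 by auto
  obtain Z c where Z: "finite Z" "Z \<subseteq> carrier G" "(\<Sum>z\<in>Z. \<bar>c z\<bar>) \<le> C"
    and R: "\<And>F \<epsilon>. \<lbrakk>continuous_map T euclideanreal F;
        \<And>y z. \<lbrakk>y \<in> carrier G; z \<in> carrier G; inv z \<otimes> y \<in> V1 \<inter> V2\<rbrakk> \<Longrightarrow> \<bar>F y - F z\<bar> \<le> \<epsilon>\<rbrakk>
      \<Longrightarrow> \<bar>I (\<lambda>y. \<kappa> y * F y) - (\<Sum>z\<in>Z. c z * F z)\<bar> \<le> \<epsilon> * C"
    unfolding C_def by (rule riemann_sum[OF \<kappa> V]) blast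
  have ZG: "z \<in> carrier G" if "z \<in> Z" for z using that Z(2) by blast
  have I_comb: "I (\<lambda>x. (\<Sum>z\<in>Z. c z * u z x) * w x) = (\<Sum>z\<in>Z. c z * I (\<lambda>x. u z x * w x))"
    if u: "\<And>z. z \<in> Z \<Longrightarrow> u z \<in> Cc" and w: "w \<in> Cc" for u w
  proof -
    have uw: "(\<lambda>x. u z x * w x) \<in> Cc" if "z \<in> Z" for z by (rule Cc_mult[OF u[OF that] Cc_continuous[OF w]])
    have "I (\<lambda>x. (\<Sum>z\<in>Z. c z * u z x) * w x) = I (\<lambda>x. \<Sum>z\<in>Z. c z * (u z x * w x))"
      by (simp add: sum_distrib_right mult.assoc)
    also have "\<dots> = (\<Sum>z\<in>Z. I (\<lambda>x. c z * (u z x * w x)))"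
      by (rule I_sum[OF Z(1)]) (rule Cc_cmult[OF uw])
    also have "\<dots> = (\<Sum>z\<in>Z. c z * I (\<lambda>x. u z x * w x))"
      by (intro sum.cong refl I_cmult[OF uw])
    finally show ?thesis .
  qed
  have comb: "(\<lambda>x. \<Sum>z\<in>Z. c z * u z x) \<in> Cc" if "\<And>z. z \<in> Z \<Longrightarrow> u z \<in> Cc" for u
    using Z(1) Cc_cmult[OF that] by (rule Cc_sum)
  have g_near: "\<bar>conv \<kappa> g x - (\<Sum>z\<in>Z. c z * translate z g x)\<bar> \<le> \<eta> * C" if x: "x \<in> carrier G" for x
  proof -
    have "\<bar>I (\<lambda>y. \<kappa> y * translate x (reflect g) y) - (\<Sum>z\<in>Z. c z * translate x (reflect g) z)\<bar> \<le> \<eta> * C"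
    proof (rule R)
      show "continuous_map T euclideanreal (translate x (reflect g))"
        using Cc_continuous[OF Cc_translate[OF Cc_reflect[OF g] x]] .
      fix y z assume yz: "y \<in> carrier G" "z \<in> carrier G" "inv z \<otimes> y \<in> V1 \<inter> V2"
      have "(inv y \<otimes> x) \<otimes> (inv z \<otimes> y) = inv z \<otimes> ((inv y \<otimes> y) \<otimes> x)"
        using x yz by (simp only: m_ac m_closed inv_closed)
      then have "(inv y \<otimes> x) \<otimes> (inv z \<otimes> y) = inv z \<otimes> x" using x yz by simp
      then show "\<bar>translate x (reflect g) y - translate x (reflect g) z\<bar> \<le> \<eta>"
        using V1(3)[of "inv y \<otimes> x" "inv z \<otimes> y"] x yz by (simp add: translate_reflect abs_minus_commute)
    qed
    moreover have "(\<Sum>z\<in>Z. c z * translate x (reflect g) z) = (\<Sum>z\<in>Z. c z * translate z g x)"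
      using ZG x by (intro sum.cong refl) (simp add: translate_reflect, simp add: translate_def)
    ultimately show ?thesis using x by (simp add: conv_def)
  qed
  have h_near: "\<bar>conv \<kappa> h x - (\<Sum>z\<in>Z. c z * translate (inv z) h x)\<bar> \<le> \<eta> * C"
    if x: "x \<in> carrier G" and sym: "reflect \<kappa> = \<kappa>" for x
  proof -
    have "\<kappa> (inv y) = \<kappa> y" if "y \<in> carrier G" for y
      using fun_cong[OF sym, of y] that by (simp add: reflect_def)
    then have "(\<lambda>y. \<kappa> y * translate (inv x) h y) = reflect (\<lambda>y. \<kappa> y * translate x (reflect h) y)"
      using x Cc_outside[OF \<kappa>] by (auto simp: fun_eq_iff translate_def reflect_def inv_mult)
    then have eq: "I (\<lambda>y. \<kappa> y * translate x (reflect h) y) = I (\<lambda>y. \<kappa> y * translate (inv x) h y)"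
      using I_reflect[OF conv_integrand[OF \<kappa> h x]] by simp
    have "\<bar>I (\<lambda>y. \<kappa> y * translate (inv x) h y) - (\<Sum>z\<in>Z. c z * translate (inv x) h z)\<bar> \<le> \<eta> * C"
    proof (rule R)
      show "continuous_map T euclideanreal (translate (inv x) h)"
        using Cc_continuous[OF Cc_translate[OF h inv_closed[OF x]]] .
      fix y z assume yz: "y \<in> carrier G" "z \<in> carrier G" "inv z \<otimes> y \<in> V1 \<inter> V2"
      have "(x \<otimes> z) \<otimes> (inv z \<otimes> y) = x \<otimes> ((z \<otimes> inv z) \<otimes> y)"
        using x yz by (simp only: m_assoc m_closed inv_closed)
      then have "(x \<otimes> z) \<otimes> (inv z \<otimes> y) = x \<otimes> y" using x yz by simp
      then show "\<bar>translate (inv x) h y - translate (inv x) h z\<bar> \<le> \<eta>"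
        using V2(3)[of "x \<otimes> z" "inv z \<otimes> y"] x yz by (simp add: translate_def)
    qed
    moreover have "(\<Sum>z\<in>Z. c z * translate (inv x) h z) = (\<Sum>z\<in>Z. c z * translate (inv z) h x)"
      using ZG x by (intro sum.cong refl) (simp add: translate_def m_comm)
    ultimately show ?thesis using x eq by (simp add: conv_def)
  qed
  have tg: "translate z g \<in> Cc" and th: "translate (inv z) h \<in> Cc" if "z \<in> Z" for z
    using Cc_translate g h ZG[OF that] by blast+
  show thesis
  proof (rule that[OF Z(1,2)])
    show "(\<Sum>z\<in>Z. \<bar>c z\<bar>) \<le> I (\<lambda>x. \<bar>\<kappa> x\<bar>)" using Z(3) by (simp add: C_def)
    have "\<bar>I (\<lambda>x. conv \<kappa> g x * h x) - I (\<lambda>x. (\<Sum>z\<in>Z. c z * translate z g x) * h x)\<bar> \<le> \<eta> * C * I (\<lambda>x. \<bar>h x\<bar>)"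
      by (rule I_mult_near[OF Cc_conv[OF \<kappa> g] comb[OF tg] h g_near])
    also have "\<dots> \<le> e" using nonneg by (intro small) (simp add: B_def)
    finally show "\<bar>I (\<lambda>x. conv \<kappa> g x * h x) - (\<Sum>z\<in>Z. c z * I (\<lambda>x. translate z g x * h x))\<bar> \<le> e"
      using I_comb[OF tg h] by simp
    assume sym: "reflect \<kappa> = \<kappa>"
    have "\<bar>I (\<lambda>x. conv \<kappa> h x * g x) - I (\<lambda>x. (\<Sum>z\<in>Z. c z * translate (inv z) h x) * g x)\<bar> \<le> \<eta> * C * I (\<lambda>x. \<bar>g x\<bar>)"
      by (rule I_mult_near[OF Cc_conv[OF \<kappa> h] comb[OF th] g h_near[OF _ sym]])
    also have "\<dots> \<le> e" using nonneg by (intro small) (simp add: B_def)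
    finally show "\<bar>I (\<lambda>x. conv \<kappa> h x * g x) - (\<Sum>z\<in>Z. c z * I (\<lambda>x. translate (inv z) h x * g x))\<bar> \<le> e"
      using I_comb[OF th g] by simp
  qed
qed

lemma translate_adjoint:
  assumes g: "g \<in> Cc" and h: "h \<in> Cc" and z: "z \<in> carrier G"
  shows "I (\<lambda>x. translate z g x * h x) = I (\<lambda>x. translate (inv z) h x * g x :: real)"
proof -
  have C: "(\<lambda>x. translate (inv z) h x * g x) \<in> Cc"
    by (rule Cc_mult[OF Cc_translate[OF h inv_closed[OF z]] Cc_continuous[OF g]])
  have "translate z (\<lambda>x. translate (inv z) h x * g x) = (\<lambda>x. translate z g x * h x)"
    using z Cc_outside[OF h] by (auto simp: fun_eq_iff translate_def m_assoc[symmetric])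
  then show ?thesis using I_translate[OF C z] by simp
qed

lemma conv_self_adjoint:
  assumes \<kappa>: "\<kappa> \<in> Cc" "reflect \<kappa> = \<kappa>" and g: "g \<in> Cc" and h: "h \<in> Cc"
  shows "I (\<lambda>x. conv \<kappa> g x * h x) = I (\<lambda>x. conv \<kappa> h x * g x)"
proof -
  have "\<bar>I (\<lambda>x. conv \<kappa> g x * h x) - I (\<lambda>x. conv \<kappa> h x * g x)\<bar> \<le> 0 + e" if e: "0 < e" for e
  proof -
    obtain Z c where Z: "Z \<subseteq> carrier G"
      "\<bar>I (\<lambda>x. conv \<kappa> g x * h x) - (\<Sum>z\<in>Z. c z * I (\<lambda>x. translate z g x * h x))\<bar> \<le> e / 2"
      "reflect \<kappa> = \<kappa> \<Longrightarrow> \<bar>I (\<lambda>x. conv \<kappa> h x * g x) - (\<Sum>z\<in>Z. c z * I (\<lambda>x. translate (inv z) h x * g x))\<bar> \<le> e / 2"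
      by (rule conv_weak_approximation[OF \<kappa>(1) g h half_gt_zero[OF e]]) blast
    have "(\<Sum>z\<in>Z. c z * I (\<lambda>x. translate z g x * h x)) = (\<Sum>z\<in>Z. c z * I (\<lambda>x. translate (inv z) h x * g x))"
      using Z(1) translate_adjoint[OF g h] by (intro sum.cong refl) auto
    then show ?thesis using Z(2) Z(3)[OF \<kappa>(2)] by linarith
  qed
  then have "\<bar>I (\<lambda>x. conv \<kappa> g x * h x) - I (\<lambda>x. conv \<kappa> h x * g x)\<bar> \<le> 0" by (rule field_le_epsilon)
  then show ?thesis by simp
qed

text \<open>
  Pair \<open>conv \<kappa> g\<close> with itself: the approximating combination of translates has total
  weight at most the \<open>L1\<close> norm of \<open>\<kappa>\<close>, and translations preserve
  \<open>L2\<close>.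
\<close>

lemma L2_conv_le:
  assumes \<kappa>: "\<kappa> \<in> Cc" and g: "g \<in> Cc"
  shows "L2 (conv \<kappa> g) \<le> I (\<lambda>x. \<bar>\<kappa> x\<bar>) * L2 g"
proof -
  define C where "C = I (\<lambda>x. \<bar>\<kappa> x\<bar>)"
  have C: "0 \<le> C" unfolding C_def using I_nonneg[OF Cc_abs[OF \<kappa>]] by simp
  define h where "h = conv \<kappa> g"
  have h: "h \<in> Cc" unfolding h_def by (rule Cc_conv[OF \<kappa> g])
  have "I (\<lambda>x. conv \<kappa> g x * h x) \<le> C * L2 g * L2 h + e" if e: "0 < e" for e
  proof -
    obtain Z c where Z: "Z \<subseteq> carrier G" "(\<Sum>z\<in>Z. \<bar>c z\<bar>) \<le> C"
      "\<bar>I (\<lambda>x. conv \<kappa> g x * h x) - (\<Sum>z\<in>Z. c z * I (\<lambda>x. translate z g x * h x))\<bar> \<le> e"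
      unfolding C_def by (rule conv_weak_approximation[OF \<kappa> g h e]) blast
    have "(\<Sum>z\<in>Z. c z * I (\<lambda>x. translate z g x * h x)) \<le> (\<Sum>z\<in>Z. \<bar>c z\<bar> * (L2 g * L2 h))"
    proof (rule sum_mono)
      fix z assume "z \<in> Z"
      then have z: "z \<in> carrier G" using Z(1) by blast
      have "\<bar>I (\<lambda>x. translate z g x * h x)\<bar> \<le> L2 g * L2 h"
        using L2_Cauchy_Schwarz[OF Cc_translate[OF g z] h] L2_translate[OF g z] by simp
      then have "\<bar>c z * I (\<lambda>x. translate z g x * h x)\<bar> \<le> \<bar>c z\<bar> * (L2 g * L2 h)"
        unfolding abs_mult by (rule mult_left_mono) simp
      then show "c z * I (\<lambda>x. translate z g x * h x) \<le> \<bar>c z\<bar> * (L2 g * L2 h)" by linarith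
    qed
    also have "\<dots> = (\<Sum>z\<in>Z. \<bar>c z\<bar>) * (L2 g * L2 h)" by (rule sum_distrib_right[symmetric])
    also have "\<dots> \<le> C * (L2 g * L2 h)"
      using Z(2) L2_nonneg[OF g] L2_nonneg[OF h] by (intro mult_right_mono) auto
    finally show ?thesis using Z(3) by (simp add: mult.assoc)
  qed
  then have "I (\<lambda>x. conv \<kappa> g x * h x) \<le> C * L2 g * L2 h" by (rule field_le_epsilon)
  moreover have "I (\<lambda>x. conv \<kappa> g x * h x) = (L2 h)\<^sup>2"
    unfolding L2_square[OF h] by (simp add: h_def power2_eq_square)
  ultimately have "L2 h * L2 h \<le> (C * L2 g) * L2 h" by (simp add: power2_eq_square)
  then have "L2 h \<le> C * L2 g"
    using L2_nonneg[OF h] L2_nonneg[OF g] C by (cases "L2 h = 0") auto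
  then show ?thesis by (simp add: C_def h_def)
qed

end

section \<open>Complex-valued functions: convolution, inner product, translation\<close>

context haar_integral
begin

lemma Cc_Re: "f \<in> Cc \<Longrightarrow> (\<lambda>x. Re (f x)) \<in> Cc"
  by (rule Cc_compose) (intro continuous_intros | simp)+

lemma Cc_Im: "f \<in> Cc \<Longrightarrow> (\<lambda>x. Im (f x)) \<in> Cc"
  by (rule Cc_compose) (intro continuous_intros | simp)+

lemma Cc_of_real: "f \<in> Cc \<Longrightarrow> (\<lambda>x. complex_of_real (f x)) \<in> Cc"
  by (rule Cc_compose) (intro continuous_intros | simp)+

lemma Cc_Complex:
  assumes "f \<in> Cc" "g \<in> Cc"
  shows "(\<lambda>x. Complex (f x) (g x)) \<in> Cc"
  using Cc_add[OF Cc_of_real[OF assms(1)] Cc_cmult[OF Cc_of_real[OF assms(2)], of \<i>]] by (simp add: Complex_eq)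

text \<open>
  The kernel is real, so a complex function is convolved through its real and imaginary parts.
\<close>

definition cconv :: "('a \<Rightarrow> real) \<Rightarrow> ('a \<Rightarrow> complex) \<Rightarrow> 'a \<Rightarrow> complex" where
  "cconv \<kappa> f = (\<lambda>x. Complex (conv \<kappa> (\<lambda>x. Re (f x)) x) (conv \<kappa> (\<lambda>x. Im (f x)) x))"

lemma Cc_cconv: "\<lbrakk>\<kappa> \<in> Cc; f \<in> Cc\<rbrakk> \<Longrightarrow> cconv \<kappa> f \<in> Cc"
  unfolding cconv_def by (intro Cc_Complex Cc_conv Cc_Re Cc_Im)

lemma cconv_add:
  assumes "\<kappa> \<in> Cc" "f \<in> Cc" "g \<in> Cc"
  shows "cconv \<kappa> (\<lambda>x. f x + g x) = (\<lambda>x. cconv \<kappa> f x + cconv \<kappa> g x)"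
  using conv_add[OF assms(1) Cc_Re[OF assms(2)] Cc_Re[OF assms(3)]]
    conv_add[OF assms(1) Cc_Im[OF assms(2)] Cc_Im[OF assms(3)]]
  by (simp add: cconv_def complex_eq_iff fun_eq_iff)

lemma cconv_cmult:
  assumes "\<kappa> \<in> Cc" "f \<in> Cc"
  shows "cconv \<kappa> (\<lambda>x. c * f x) = (\<lambda>x. c * cconv \<kappa> f x)"
proof -
  have 1: "conv \<kappa> (\<lambda>x. s * Re (f x) + t * Im (f x)) = (\<lambda>x. s * conv \<kappa> (\<lambda>x. Re (f x)) x + t * conv \<kappa> (\<lambda>x. Im (f x)) x)" for s t
    using conv_add[OF assms(1) Cc_cmult[OF Cc_Re[OF assms(2)]] Cc_cmult[OF Cc_Im[OF assms(2)]], of s t]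
      conv_cmult[OF assms(1) Cc_Re[OF assms(2)], of s] conv_cmult[OF assms(1) Cc_Im[OF assms(2)], of t]
    by simp
  have Re: "(\<lambda>x. Re (c * f x)) = (\<lambda>x. Re c * Re (f x) + (- Im c) * Im (f x))" by (simp add: fun_eq_iff)
  have Im: "(\<lambda>x. Im (c * f x)) = (\<lambda>x. Im c * Re (f x) + Re c * Im (f x))" by (simp add: fun_eq_iff algebra_simps)
  show ?thesis
    unfolding cconv_def Re Im 1 by (simp add: complex_eq_iff fun_eq_iff algebra_simps)
qed

lemma cconv_translate: "\<lbrakk>\<kappa> \<in> Cc; a \<in> carrier G\<rbrakk> \<Longrightarrow> cconv \<kappa> (translate a f) = translate a (cconv \<kappa> f)"
proof -
  assume *: "\<kappa> \<in> Cc" "a \<in> carrier G"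
  have eq: "(\<lambda>x. Re (translate a f x)) = translate a (\<lambda>x. Re (f x))" "(\<lambda>x. Im (translate a f x)) = translate a (\<lambda>x. Im (f x))"
    by (auto simp: translate_def)
  show ?thesis
    unfolding cconv_def eq conv_translate[OF *] by (auto simp: translate_def fun_eq_iff complex_eq_iff)
qed

lemma cconv_translate_kernel_diff:
  assumes "\<kappa> \<in> Cc" "f \<in> Cc" "a \<in> carrier G"
  shows "cconv (\<lambda>x. translate a \<kappa> x - \<kappa> x) f = (\<lambda>x. translate a (cconv \<kappa> f) x - cconv \<kappa> f x)"
proof -
  have "conv (\<lambda>x. translate a \<kappa> x - \<kappa> x) g = (\<lambda>x. translate a (conv \<kappa> g) x - conv \<kappa> g x)" if "g \<in> Cc" for g
    using conv_kernel_diff[OF Cc_translate[OF assms(1,3)] assms(1) that] conv_translate_kernel[OF assms(1) that assms(3)]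
    by simp
  from this[OF Cc_Re[OF assms(2)]] this[OF Cc_Im[OF assms(2)]] show ?thesis
    unfolding cconv_def by (auto simp: translate_def fun_eq_iff complex_eq_iff)
qed

lemma L2_complex_square:
  assumes "f \<in> Cc"
  shows "(L2 f)\<^sup>2 = (L2 (\<lambda>x. Re (f x)))\<^sup>2 + (L2 (\<lambda>x. Im (f x)))\<^sup>2"
  using I_add[OF Cc_norm_square[OF Cc_Re[OF assms]] Cc_norm_square[OF Cc_Im[OF assms]]]
  by (simp add: L2_square assms Cc_Re Cc_Im cmod_power2)

lemma L2_cconv_le:
  assumes \<kappa>: "\<kappa> \<in> Cc" and f: "f \<in> Cc"
  shows "L2 (cconv \<kappa> f) \<le> I (\<lambda>x. \<bar>\<kappa> x\<bar>) * L2 f"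
proof (rule power2_le_imp_le)
  have C: "0 \<le> I (\<lambda>x. \<bar>\<kappa> x\<bar>)" using I_nonneg[OF Cc_abs[OF \<kappa>]] by simp
  then show "0 \<le> I (\<lambda>x. \<bar>\<kappa> x\<bar>) * L2 f" using L2_nonneg[OF f] by simp
  have "(L2 (cconv \<kappa> f))\<^sup>2 = (L2 (conv \<kappa> (\<lambda>x. Re (f x))))\<^sup>2 + (L2 (conv \<kappa> (\<lambda>x. Im (f x))))\<^sup>2"
    using L2_complex_square[OF Cc_cconv[OF \<kappa> f]] by (simp add: cconv_def)
  also have "\<dots> \<le> (I (\<lambda>x. \<bar>\<kappa> x\<bar>) * L2 (\<lambda>x. Re (f x)))\<^sup>2 + (I (\<lambda>x. \<bar>\<kappa> x\<bar>) * L2 (\<lambda>x. Im (f x)))\<^sup>2"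
    by (intro add_mono power_mono L2_conv_le \<kappa> Cc_Re Cc_Im f L2_nonneg Cc_conv)
  also have "\<dots> = (I (\<lambda>x. \<bar>\<kappa> x\<bar>) * L2 f)\<^sup>2"
    using L2_complex_square[OF f] by (simp add: power_mult_distrib distrib_left)
  finally show "(L2 (cconv \<kappa> f))\<^sup>2 \<le> (I (\<lambda>x. \<bar>\<kappa> x\<bar>) * L2 f)\<^sup>2" .
qed

text \<open>
  Only the real part of the complex inner product. That suffices for self-adjointness and the Cauchy-Schwarz
  inequality, and it keeps the integral real-valued.
\<close>

definition ip :: "('a \<Rightarrow> complex) \<Rightarrow> ('a \<Rightarrow> complex) \<Rightarrow> real" where
  "ip f g = I (\<lambda>x. inner (f x) (g x))"

lemma ip_commute: "ip f g = ip g f"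
  by (simp add: ip_def inner_commute)

lemma ip_self: "f \<in> Cc \<Longrightarrow> ip f f = (L2 f)\<^sup>2"
  by (simp add: ip_def L2_square power2_norm_eq_inner)

lemma ip_le: "\<lbrakk>f \<in> Cc; g \<in> Cc\<rbrakk> \<Longrightarrow> ip f g \<le> L2 f * L2 g"
  using L2_Cauchy_Schwarz[of f g] by (simp add: ip_def)

lemma ip_Re_Im:
  assumes "f \<in> Cc" "g \<in> Cc"
  shows "ip f g = I (\<lambda>x. Re (f x) * Re (g x)) + I (\<lambda>x. Im (f x) * Im (g x))"
  using I_add[OF Cc_mult[OF Cc_Re[OF assms(1)] Cc_continuous[OF Cc_Re[OF assms(2)]]]
      Cc_mult[OF Cc_Im[OF assms(1)] Cc_continuous[OF Cc_Im[OF assms(2)]]]]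
  by (simp add: ip_def inner_complex_def)

lemma ip_cconv:
  assumes \<kappa>: "\<kappa> \<in> Cc" "reflect \<kappa> = \<kappa>" and fg: "f \<in> Cc" "g \<in> Cc"
  shows "ip (cconv \<kappa> f) g = ip f (cconv \<kappa> g)"
  using conv_self_adjoint[OF \<kappa> Cc_Re[OF fg(1)] Cc_Re[OF fg(2)]] conv_self_adjoint[OF \<kappa> Cc_Im[OF fg(1)] Cc_Im[OF fg(2)]]
  by (simp add: ip_Re_Im Cc_cconv \<kappa> fg) (simp add: cconv_def mult.commute)

lemma ip_translate:
  assumes "f \<in> Cc" "g \<in> Cc" "a \<in> carrier G"
  shows "ip (translate a f) g = ip f (translate (inv a) g)"
proof -
  have eq: "(\<lambda>x. Re (translate b u x)) = translate b (\<lambda>x. Re (u x))" "(\<lambda>x. Im (translate b u x)) = translate b (\<lambda>x. Im (u x))"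
    for b and u :: "'a \<Rightarrow> complex" by (auto simp: translate_def)
  show ?thesis
    using translate_adjoint[OF Cc_Re[OF assms(1)] Cc_Re[OF assms(2)] assms(3)]
      translate_adjoint[OF Cc_Im[OF assms(1)] Cc_Im[OF assms(2)] assms(3)] assms
    by (simp add: ip_Re_Im Cc_translate eq[THEN fun_cong] mult.commute)
qed

lemma ip_add_left: "\<lbrakk>f \<in> Cc; g \<in> Cc; h \<in> Cc\<rbrakk> \<Longrightarrow> ip (\<lambda>x. f x + g x) h = ip f h + ip g h"
  using I_add[OF Cc_inner Cc_inner, of f h g h] by (simp add: ip_def inner_add_left)

lemma ip_real_cmult_left: "\<lbrakk>f \<in> Cc; h \<in> Cc\<rbrakk> \<Longrightarrow> ip (\<lambda>x. of_real c * f x) h = c * ip f h"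
  using I_cmult[OF Cc_inner, of f h c] by (simp add: ip_def inner_complex_def algebra_simps)

text \<open>
  The operator \<open>2 - translate a - translate (inv a)\<close>. An algebra character that maps
  translations to unimodular numbers vanishes on it exactly when it sends \<open>translate a\<close> to
  \<open>1\<close>. The scalars are written with \<open>of_real\<close> for compatibility with the real
  inner product.
\<close>

definition second_difference :: "'a \<Rightarrow> ('a \<Rightarrow> complex) \<Rightarrow> 'a \<Rightarrow> complex" where
  "second_difference a f = (\<lambda>x. of_real 2 * f x + of_real (- 1) * (translate a f x + translate (inv a) f x))"

lemma Cc_second_difference: "\<lbrakk>f \<in> Cc; a \<in> carrier G\<rbrakk> \<Longrightarrow> second_difference a f \<in> Cc"
  unfolding second_difference_def by (intro Cc_add Cc_cmult Cc_translate) auto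

lemma ip_second_difference:
  assumes f: "f \<in> Cc" and g: "g \<in> Cc" and a: "a \<in> carrier G"
  shows "ip (second_difference a f) g = ip f (second_difference a g)"
proof -
  have *: "ip (second_difference a u) v = 2 * ip u v - (ip (translate a u) v + ip (translate (inv a) u) v)"
    if uv: "u \<in> Cc" "v \<in> Cc" for u v
  proof -
    have C: "translate a u \<in> Cc" "translate (inv a) u \<in> Cc" using Cc_translate uv(1) a by auto
    show ?thesis
      unfolding second_difference_def
      using ip_add_left[OF Cc_cmult[OF uv(1)] Cc_cmult[OF Cc_add[OF C]] uv(2), of "of_real 2" "of_real (- 1)"]
        ip_real_cmult_left[OF uv, of 2] ip_real_cmult_left[OF Cc_add[OF C] uv(2), of "-1"] ip_add_left[OF C uv(2)]
      by simp
  qed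
  show ?thesis
    unfolding ip_commute[of f] *[OF f g] *[OF g f]
    using ip_translate[OF f g a] ip_translate[OF f g inv_closed[OF a]] a by (simp add: ip_commute)
qed

lemma compact_dominated:
  assumes K: "compactin T K"
  obtains \<psi> :: "'a \<Rightarrow> real" where "\<psi> \<in> Cc" "\<And>x. 0 \<le> \<psi> x" "\<And>x. x \<in> K \<Longrightarrow> 1 \<le> \<psi> x"
proof -
  obtain \<phi> :: "'a \<Rightarrow> real" where \<phi>: "\<phi> \<in> Cc" "\<phi> \<one> = 1" "\<And>x. 0 \<le> \<phi> x"
    by (rule bump_function[OF openin_carrier one_closed]) blast
  define U where "U = {u \<in> carrier G. \<phi> u \<in> {1 / 2<..}}"
  have U: "openin T U \<and> \<one> \<in> U"
    using openin_continuous_map_preimage[OF Cc_continuous[OF \<phi>(1)], of "{1 / 2<..}"] \<phi>(2) by (simp add: U_def)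
  obtain Z where Z: "finite Z" "Z \<subseteq> K" "\<And>x. x \<in> K \<Longrightarrow> \<exists>z\<in>Z. inv z \<otimes> x \<in> U"
    by (rule compact_finitely_many_translates[of K "\<lambda>_. U", OF K U]) auto
  have KG: "K \<subseteq> carrier G" by (rule compact_subset_carrier[OF K])
  have nonneg: "0 \<le> translate z \<phi> x" for z x using \<phi>(3) by (simp add: translate_def)
  show thesis
  proof (rule that[of "\<lambda>x. 2 * (\<Sum>z\<in>Z. translate z \<phi> x)"])
    have "translate z \<phi> \<in> Cc" if "z \<in> Z" for z using Cc_translate[OF \<phi>(1)] that Z(2) KG by blast
    then show "(\<lambda>x. 2 * (\<Sum>z\<in>Z. translate z \<phi> x)) \<in> Cc" using Z(1) by (intro Cc_cmult Cc_sum)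
    show "0 \<le> 2 * (\<Sum>z\<in>Z. translate z \<phi> x)" for x using nonneg by (simp add: sum_nonneg)
    fix x assume x: "x \<in> K"
    obtain z where z: "z \<in> Z" "inv z \<otimes> x \<in> U" using Z(3)[OF x] by blast
    have "1 / 2 \<le> translate z \<phi> x" using z(2) x KG by (auto simp: U_def translate_def)
    also have "\<dots> \<le> (\<Sum>z\<in>Z. translate z \<phi> x)" using z(1) Z(1) nonneg by (intro member_le_sum) auto
    finally show "1 \<le> 2 * (\<Sum>z\<in>Z. translate z \<phi> x)" by simp
  qed
qed

text \<open>
  For \<open>a\<close> in a compact neighbourhood, the difference is supported in a fixed compact set, where
  it is uniformly small; a compactly supported majorant of that set turns this into smallness of the
  integral.
\<close>

lemma translation_continuous_L1:
  assumes \<kappa>: "\<kappa> \<in> Cc" and e: "0 < e"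
  obtains V where "openin T V" "\<one> \<in> V" "\<And>a. a \<in> V \<Longrightarrow> I (\<lambda>x. \<bar>translate a \<kappa> x - \<kappa> x\<bar>) < e"
proof -
  obtain K where K: "compactin T K" "\<And>x. x \<notin> K \<Longrightarrow> \<kappa> x = 0" by (rule CcE[OF \<kappa>]) auto
  obtain U0 K0 where K0: "openin T U0" "\<one> \<in> U0" "U0 \<subseteq> K0" "compactin T K0"
    by (rule compact_neighbourhood_of_one) blast
  have "compactin T ((\<lambda>(x, y). x \<otimes> y) ` (K0 \<times> K))"
    using image_compactin[OF _ continuous_mult, of "K0 \<times> K"] K(1) K0(4) by (simp add: compactin_Times)
  then have "compactin T ((\<lambda>(x, y). x \<otimes> y) ` (K0 \<times> K) \<union> K)" using K(1) by (rule compactin_Un)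
  then obtain \<psi> :: "'a \<Rightarrow> real" where \<psi>: "\<psi> \<in> Cc" "\<And>x. 0 \<le> \<psi> x" "\<And>x. x \<in> (\<lambda>(x, y). x \<otimes> y) ` (K0 \<times> K) \<union> K \<Longrightarrow> 1 \<le> \<psi> x"
    by (rule compact_dominated) blast
  have I\<psi>: "0 \<le> I \<psi>" by (rule I_nonneg[OF \<psi>(1,2)])
  define \<eta> where "\<eta> = e / (I \<psi> + 1)"
  have \<eta>: "0 < \<eta>" using e I\<psi> by (simp add: \<eta>_def)
  obtain V1 where V1: "openin T V1" "\<one> \<in> V1" "\<And>x v. \<lbrakk>x \<in> carrier G; v \<in> V1\<rbrakk> \<Longrightarrow> norm (\<kappa> (x \<otimes> v) - \<kappa> x) < \<eta>"
    by (rule Cc_uniformly_continuous[OF \<kappa> \<eta>]) blast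
  have "openin T (V1 \<inter> U0)" "\<one> \<in> V1 \<inter> U0" using V1 K0 by auto
  then obtain V where V: "openin T V" "\<one> \<in> V" "V \<subseteq> V1 \<inter> U0" "\<forall>x\<in>V. inv x \<in> V"
    by (rule square_root_neighbourhood) blast
  show thesis
  proof (rule that[OF V(1,2)])
    fix a assume aV: "a \<in> V"
    then have a: "a \<in> carrier G" using V(1) open_subset_carrier by blast
    have "I (\<lambda>x. \<bar>translate a \<kappa> x - \<kappa> x\<bar>) \<le> I (\<lambda>x. \<eta> * \<psi> x)"
    proof (intro I_mono Cc_abs Cc_diff Cc_translate \<kappa> a Cc_cmult \<psi>(1))
      fix x
      show "\<bar>translate a \<kappa> x - \<kappa> x\<bar> \<le> \<eta> * \<psi> x"
      proof (cases "x \<in> (\<lambda>(x, y). x \<otimes> y) ` (K0 \<times> K) \<union> K \<and> x \<in> carrier G")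
        case True
        have "\<bar>translate a \<kappa> x - \<kappa> x\<bar> \<le> \<eta> * 1"
          using V1(3)[of x "inv a"] V(3,4) aV True a by (force simp: translate_def m_comm)
        also have "\<dots> \<le> \<eta> * \<psi> x" using \<psi>(3)[of x] True \<eta> by (intro mult_left_mono) auto
        finally show ?thesis .
      next
        case False
        have "translate a \<kappa> x = 0 \<and> \<kappa> x = 0"
        proof (cases "x \<in> carrier G")
          case xG: True
          have notin: "x \<notin> (\<lambda>(x, y). x \<otimes> y) ` (K0 \<times> K)" "x \<notin> K" using False xG by auto
          have "x = a \<otimes> (inv a \<otimes> x)" using a xG by (simp flip: m_assoc)
          moreover have "(\<lambda>(x, y). x \<otimes> y) (a, inv a \<otimes> x) \<in> (\<lambda>(x, y). x \<otimes> y) ` (K0 \<times> K)" if "inv a \<otimes> x \<in> K"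
            using that aV V(3) K0(3) by (intro imageI) auto
          ultimately have "inv a \<otimes> x \<notin> K" using notin(1) by auto
          then show ?thesis using K(2) notin(2) by (simp add: translate_def)
        qed (use Cc_outside[OF \<kappa>] in \<open>simp add: translate_def\<close>)
        then show ?thesis using \<psi>(2)[of x] \<eta> by simp
      qed
    qed
    also have "\<dots> = \<eta> * I \<psi>" by (rule I_cmult[OF \<psi>(1)])
    also have "\<dots> < e" using e I\<psi> by (simp add: \<eta>_def field_simps)
    finally show "I (\<lambda>x. \<bar>translate a \<kappa> x - \<kappa> x\<bar>) < e" .
  qed
qed

end

section \<open>Bounded operators and bicommutants\<close>

context haar_integral
begin

text \<open>
  Bounded operators on \<open>Cc\<close> for the \<open>L2\<close> norm. They are made \<open>0\<close> off
  \<open>Cc\<close>, so that operators agreeing on \<open>Cc\<close> are equal and composition is the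
  composition of HOL functions.
\<close>

definition bounded_operators :: "(('a \<Rightarrow> complex) \<Rightarrow> 'a \<Rightarrow> complex) set" where
  "bounded_operators = {A. (\<forall>f. f \<notin> Cc \<longrightarrow> A f = 0) \<and> (\<forall>f\<in>Cc. A f \<in> Cc) \<and>
     (\<forall>f\<in>Cc. \<forall>g\<in>Cc. A (f + g) = A f + A g) \<and> (\<forall>f\<in>Cc. \<forall>c. A (\<lambda>x. c * f x) = (\<lambda>x. c * A f x)) \<and>
     (\<exists>C\<ge>0. \<forall>f\<in>Cc. L2 (A f) \<le> C * L2 f)}"

definition op_norm :: "(('a \<Rightarrow> complex) \<Rightarrow> 'a \<Rightarrow> complex) \<Rightarrow> real" where
  "op_norm A = Inf {C. 0 \<le> C \<and> (\<forall>f\<in>Cc. L2 (A f) \<le> C * L2 f)}"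

definition op_scale :: "complex \<Rightarrow> (('a \<Rightarrow> complex) \<Rightarrow> 'a \<Rightarrow> complex) \<Rightarrow> ('a \<Rightarrow> complex) \<Rightarrow> 'a \<Rightarrow> complex" where
  "op_scale c A = (\<lambda>f x. c * A f x)"

definition restrict_op :: "(('a \<Rightarrow> complex) \<Rightarrow> 'a \<Rightarrow> complex) \<Rightarrow> ('a \<Rightarrow> complex) \<Rightarrow> 'a \<Rightarrow> complex" where
  "restrict_op A = (\<lambda>f. if f \<in> Cc then A f else 0)"

lemma restrict_op_apply [simp]: "f \<in> Cc \<Longrightarrow> restrict_op A f = A f"
  by (simp add: restrict_op_def)

lemma bounded_operatorsD:
  assumes "A \<in> bounded_operators"
  shows "f \<notin> Cc \<Longrightarrow> A f = 0" and "f \<in> Cc \<Longrightarrow> A f \<in> Cc"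
    and "\<lbrakk>f \<in> Cc; g \<in> Cc\<rbrakk> \<Longrightarrow> A (f + g) = A f + A g"
    and "f \<in> Cc \<Longrightarrow> A (\<lambda>x. c * f x) = (\<lambda>x. c * A f x)"
  using assms unfolding bounded_operators_def by blast+

lemma Cc_zero_fun [simp]: "(0 :: 'a \<Rightarrow> complex) \<in> Cc"
  using Cc_zero by (simp add: zero_fun_def)

lemma Cc_plus [simp]: "\<lbrakk>f \<in> Cc; g \<in> Cc\<rbrakk> \<Longrightarrow> f + g \<in> Cc" for f g :: "'a \<Rightarrow> complex"
  using Cc_add[of f g] by (simp add: plus_fun_def)

lemma L2_plus: "\<lbrakk>f \<in> Cc; g \<in> Cc\<rbrakk> \<Longrightarrow> L2 (f + g) \<le> L2 f + L2 g" for f g :: "'a \<Rightarrow> complex"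
  using L2_triangle[of f g] by (simp add: plus_fun_def)

lemma L2_cmult: "f \<in> Cc \<Longrightarrow> L2 (\<lambda>x. c * f x) = cmod c * L2 f" for f :: "'a \<Rightarrow> complex"
  using I_cmult[OF Cc_norm_square, of f "(cmod c)\<^sup>2"]
  by (simp add: L2_def norm_mult power_mult_distrib real_sqrt_mult)

lemma bounded_operator_zero: "A \<in> bounded_operators \<Longrightarrow> A 0 = 0"
  using bounded_operatorsD(4)[of A 0 0] by (simp add: zero_fun_def Cc_zero)

lemma restrict_op_bounded:
  assumes "\<And>f. f \<in> Cc \<Longrightarrow> A f \<in> Cc" "\<And>f g. \<lbrakk>f \<in> Cc; g \<in> Cc\<rbrakk> \<Longrightarrow> A (\<lambda>x. f x + g x) = (\<lambda>x. A f x + A g x)"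
    "\<And>f c. f \<in> Cc \<Longrightarrow> A (\<lambda>x. c * f x) = (\<lambda>x. c * A f x)" "0 \<le> C" "\<And>f. f \<in> Cc \<Longrightarrow> L2 (A f) \<le> C * L2 f"
  shows "restrict_op A \<in> bounded_operators"
proof -
  have "restrict_op A (f + g) = restrict_op A f + restrict_op A g" if "f \<in> Cc" "g \<in> Cc" for f g
    using assms(2)[OF that] that Cc_plus[OF that] by (simp add: plus_fun_def)
  moreover have "restrict_op A (\<lambda>x. c * f x) = (\<lambda>x. c * restrict_op A f x)" if "f \<in> Cc" for f c
    using assms(3)[OF that] Cc_cmult[OF that] that by simp
  moreover have "\<exists>C\<ge>0. \<forall>f\<in>Cc. L2 (restrict_op A f) \<le> C * L2 f" using assms(4,5) by auto
  moreover have "restrict_op A f \<in> Cc" if "f \<in> Cc" for f using assms(1) that by simp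
  moreover have "restrict_op A f = 0" if "f \<notin> Cc" for f using that by (simp add: restrict_op_def)
  ultimately show ?thesis
    unfolding bounded_operators_def by (intro CollectI conjI ballI allI impI) blast+
qed

lemma op_norm_bound:
  assumes "A \<in> bounded_operators" "f \<in> Cc"
  shows "L2 (A f) \<le> op_norm A * L2 f"
proof -
  have ne: "{C. 0 \<le> C \<and> (\<forall>f\<in>Cc. L2 (A f) \<le> C * L2 f)} \<noteq> {}"
    using assms(1) unfolding bounded_operators_def by auto
  have "L2 (A f) \<le> L2 f * (INF C\<in>{C. 0 \<le> C \<and> (\<forall>f\<in>Cc. L2 (A f) \<le> C * L2 f)}. C)"
  proof (rule le_mult_INF[OF ne L2_nonneg[OF assms(2)]])
    show "L2 (A f) \<le> 0" if "L2 f = 0" using ne assms(2) that by fastforce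
  qed (use assms(2) in \<open>auto simp: mult.commute\<close>)
  then show ?thesis by (simp add: op_norm_def mult.commute)
qed

lemma op_norm_least:
  assumes "0 \<le> C" "\<And>f. f \<in> Cc \<Longrightarrow> L2 (A f) \<le> C * L2 f"
  shows "op_norm A \<le> C"
  unfolding op_norm_def using assms by (intro cInf_lower bdd_belowI[of _ 0]) auto

lemma op_norm_nonneg: "A \<in> bounded_operators \<Longrightarrow> 0 \<le> op_norm A"
  unfolding op_norm_def bounded_operators_def by (intro cInf_greatest) auto

lemma op_norm_add:
  assumes "A \<in> bounded_operators" "B \<in> bounded_operators"
  shows "op_norm (A + B) \<le> op_norm A + op_norm B"
proof (rule op_norm_least)
  fix f :: "'a \<Rightarrow> complex" assume f: "f \<in> Cc"
  show "L2 ((A + B) f) \<le> (op_norm A + op_norm B) * L2 f"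
    using L2_plus[OF bounded_operatorsD(2)[OF assms(1) f] bounded_operatorsD(2)[OF assms(2) f]]
      op_norm_bound[OF assms(1) f] op_norm_bound[OF assms(2) f] by (simp add: distrib_right)
qed (use op_norm_nonneg assms in auto)

lemma op_norm_comp:
  assumes "A \<in> bounded_operators" "B \<in> bounded_operators"
  shows "op_norm (A \<circ> B) \<le> op_norm A * op_norm B"
proof (rule op_norm_least)
  fix f :: "'a \<Rightarrow> complex" assume f: "f \<in> Cc"
  have "L2 (A (B f)) \<le> op_norm A * L2 (B f)" by (rule op_norm_bound[OF assms(1) bounded_operatorsD(2)[OF assms(2) f]])
  also have "\<dots> \<le> op_norm A * (op_norm B * L2 f)"
    by (rule mult_left_mono[OF op_norm_bound[OF assms(2) f] op_norm_nonneg[OF assms(1)]])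
  finally show "L2 ((A \<circ> B) f) \<le> op_norm A * op_norm B * L2 f" by (simp add: mult.assoc)
qed (use op_norm_nonneg assms in auto)

lemma op_norm_scale:
  assumes "A \<in> bounded_operators"
  shows "op_norm (op_scale c A) \<le> cmod c * op_norm A"
proof (rule op_norm_least)
  fix f :: "'a \<Rightarrow> complex" assume f: "f \<in> Cc"
  show "L2 (op_scale c A f) \<le> cmod c * op_norm A * L2 f"
    using mult_left_mono[OF op_norm_bound[OF assms f], of "cmod c"] L2_cmult[OF bounded_operatorsD(2)[OF assms f], of c]
    by (simp add: op_scale_def mult.assoc)
qed (use op_norm_nonneg assms in auto)

lemma bounded_operators_add:
  assumes "A \<in> bounded_operators" "B \<in> bounded_operators"
  shows "A + B \<in> bounded_operators"
proof -
  note A = bounded_operatorsD[OF assms(1)] and B = bounded_operatorsD[OF assms(2)]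
  have "L2 ((A + B) f) \<le> (op_norm A + op_norm B) * L2 f" if "f \<in> Cc" for f
    using L2_plus[OF A(2)[OF that] B(2)[OF that]] op_norm_bound[OF assms(1) that] op_norm_bound[OF assms(2) that]
    by (simp add: distrib_right)
  then have "\<exists>C\<ge>0. \<forall>f\<in>Cc. L2 ((A + B) f) \<le> C * L2 f"
    using op_norm_nonneg assms by (intro exI[of _ "op_norm A + op_norm B"]) auto
  moreover have "(A + B) (f + g) = (A + B) f + (A + B) g" if "f \<in> Cc" "g \<in> Cc" for f g
    using A(3)[OF that] B(3)[OF that] by (simp add: fun_eq_iff)
  moreover have "(A + B) (\<lambda>x. c * f x) = (\<lambda>x. c * (A + B) f x)" if "f \<in> Cc" for f c
    using A(4)[OF that] B(4)[OF that] by (simp add: fun_eq_iff distrib_left)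
  ultimately show ?thesis
    using A(1,2) B(1,2) unfolding bounded_operators_def by (simp del: plus_fun_apply add: plus_fun_apply[of A B])
qed

lemma bounded_operators_comp:
  assumes "A \<in> bounded_operators" "B \<in> bounded_operators"
  shows "A \<circ> B \<in> bounded_operators"
proof -
  note A = bounded_operatorsD[OF assms(1)] and B = bounded_operatorsD[OF assms(2)]
  have "L2 ((A \<circ> B) f) \<le> op_norm A * op_norm B * L2 f" if "f \<in> Cc" for f
  proof -
    have "L2 (A (B f)) \<le> op_norm A * L2 (B f)" by (rule op_norm_bound[OF assms(1) B(2)[OF that]])
    also have "\<dots> \<le> op_norm A * (op_norm B * L2 f)"
      by (rule mult_left_mono[OF op_norm_bound[OF assms(2) that] op_norm_nonneg[OF assms(1)]])
    finally show ?thesis by (simp add: mult.assoc)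
  qed
  then have "\<exists>C\<ge>0. \<forall>f\<in>Cc. L2 ((A \<circ> B) f) \<le> C * L2 f"
    using op_norm_nonneg assms by (intro exI[of _ "op_norm A * op_norm B"]) auto
  moreover have "(A \<circ> B) f = 0" if "f \<notin> Cc" for f
    using B(1)[OF that] bounded_operator_zero[OF assms(1)] by simp
  ultimately show ?thesis
    unfolding bounded_operators_def using A(2,3,4) B(2,3,4) by simp
qed

lemma bounded_operators_scale:
  assumes "A \<in> bounded_operators"
  shows "op_scale c A \<in> bounded_operators"
proof -
  note A = bounded_operatorsD[OF assms]
  have "L2 (op_scale c A f) \<le> cmod c * op_norm A * L2 f" if "f \<in> Cc" for f
    using mult_left_mono[OF op_norm_bound[OF assms that], of "cmod c"] L2_cmult[OF A(2)[OF that], of c]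
    by (simp add: op_scale_def mult.assoc)
  then have "\<exists>C\<ge>0. \<forall>f\<in>Cc. L2 (op_scale c A f) \<le> C * L2 f"
    using op_norm_nonneg[OF assms] by (intro exI[of _ "cmod c * op_norm A"]) auto
  moreover have "op_scale c A f = 0" if "f \<notin> Cc" for f
    using A(1)[OF that] by (simp add: op_scale_def fun_eq_iff)
  moreover have "op_scale c A (f + g) = op_scale c A f + op_scale c A g" if "f \<in> Cc" "g \<in> Cc" for f g
    using A(3)[OF that] by (simp add: op_scale_def fun_eq_iff distrib_left)
  moreover have "op_scale c A (\<lambda>x. d * f x) = (\<lambda>x. d * op_scale c A f x)" if "f \<in> Cc" for f d
    using A(4)[OF that] by (simp add: op_scale_def fun_eq_iff mult.left_commute)
  moreover have "op_scale c A f \<in> Cc" if "f \<in> Cc" for f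
    using Cc_cmult[OF A(2)[OF that]] by (simp add: op_scale_def)
  ultimately show ?thesis unfolding bounded_operators_def by simp
qed

lemma bounded_operators_unit: "restrict_op id \<in> bounded_operators"
  by (rule restrict_op_bounded[of _ 1]) auto

lemma bounded_operators_zero: "0 \<in> bounded_operators"
  unfolding bounded_operators_def using L2_cmult[OF Cc_zero_fun, of 0]
  by (auto simp: zero_fun_def Cc_zero intro!: exI[of _ 0])

text \<open>
  For commuting \<open>\<Gamma>\<close> the bicommutant is a commutative algebra containing
  \<open>\<Gamma>\<close>, and belonging to it is checked by a commutation property instead of an explicit
  polynomial expression.
\<close>

definition bicommutant ::
  "(('a \<Rightarrow> complex) \<Rightarrow> 'a \<Rightarrow> complex) set \<Rightarrow> (('a \<Rightarrow> complex) \<Rightarrow> 'a \<Rightarrow> complex) set" where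
  "bicommutant \<Gamma> = {A \<in> bounded_operators. \<forall>B\<in>bounded_operators. (\<forall>C\<in>\<Gamma>. B \<circ> C = C \<circ> B) \<longrightarrow> A \<circ> B = B \<circ> A}"

lemma commutative_algebra_bicommutant:
  assumes \<Gamma>: "\<Gamma> \<subseteq> bounded_operators" "\<And>A B. \<lbrakk>A \<in> \<Gamma>; B \<in> \<Gamma>\<rbrakk> \<Longrightarrow> A \<circ> B = B \<circ> A"
  shows "commutative_algebra op_scale (bicommutant \<Gamma>) (\<circ>) (restrict_op id)"
    and "\<Gamma> \<subseteq> bicommutant \<Gamma>"
proof -
  show sub: "\<Gamma> \<subseteq> bicommutant \<Gamma>"
    using \<Gamma> unfolding bicommutant_def by auto
  have bd: "A \<in> bounded_operators" if "A \<in> bicommutant \<Gamma>" for A using that by (simp add: bicommutant_def)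
  have comm: "A \<circ> B = B \<circ> A" if A: "A \<in> bicommutant \<Gamma>" and B: "B \<in> bicommutant \<Gamma>" for A B
  proof -
    have "B \<circ> C = C \<circ> B" if "C \<in> \<Gamma>" for C
      using B that \<Gamma> unfolding bicommutant_def by blast
    then show ?thesis using A bd[OF B] unfolding bicommutant_def by blast
  qed
  have vs: "vector_space op_scale"
    by unfold_locales (auto simp: op_scale_def fun_eq_iff algebra_simps)
  interpret vector_space op_scale by (rule vs)
  have lin: "B (op_scale c A f) = op_scale c (B \<circ> A) f" "B (A f + A' f) = B (A f) + B (A' f)"
    if "A \<in> bounded_operators" "A' \<in> bounded_operators" "B \<in> bounded_operators" for A A' B c f
  proof -
    have "A f \<in> Cc" "A' f \<in> Cc" using bounded_operatorsD(1,2) that by (metis Cc_zero_fun)+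
    then show "B (op_scale c A f) = op_scale c (B \<circ> A) f" "B (A f + A' f) = B (A f) + B (A' f)"
      using bounded_operatorsD(3,4)[OF that(3)] by (simp_all add: op_scale_def)
  qed
  have S: "subspace (bicommutant \<Gamma>)"
  proof (rule subspaceI)
    show "0 \<in> bicommutant \<Gamma>"
      unfolding bicommutant_def using bounded_operators_zero bounded_operator_zero by (auto simp: fun_eq_iff zero_fun_def)
    show "A + B \<in> bicommutant \<Gamma>" if AB: "A \<in> bicommutant \<Gamma>" "B \<in> bicommutant \<Gamma>" for A B
      unfolding bicommutant_def
    proof (intro CollectI conjI ballI impI)
      show "A + B \<in> bounded_operators" using AB bd bounded_operators_add by blast
      fix C assume C: "C \<in> bounded_operators" "\<forall>D\<in>\<Gamma>. C \<circ> D = D \<circ> C"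
      then have "A \<circ> C = C \<circ> A" "B \<circ> C = C \<circ> B" using AB unfolding bicommutant_def by blast+
      then have "A (C f) = C (A f)" "B (C f) = C (B f)" for f by (metis comp_apply)+
      note e = this
      show "(A + B) \<circ> C = C \<circ> (A + B)"
      proof
        fix f
        have "((A + B) \<circ> C) f = A (C f) + B (C f)" by simp
        also have "\<dots> = C (A f) + C (B f)" by (simp only: e)
        also have "\<dots> = C (A f + B f)" by (rule lin(2)[OF bd[OF AB(1)] bd[OF AB(2)] C(1), symmetric])
        finally show "((A + B) \<circ> C) f = (C \<circ> (A + B)) f" by simp
      qed
    qed
    show "op_scale c A \<in> bicommutant \<Gamma>" if A: "A \<in> bicommutant \<Gamma>" for c A
      unfolding bicommutant_def
    proof (intro CollectI conjI ballI impI)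
      show "op_scale c A \<in> bounded_operators" using A bd bounded_operators_scale by blast
      fix C assume C: "C \<in> bounded_operators" "\<forall>D\<in>\<Gamma>. C \<circ> D = D \<circ> C"
      then have "A \<circ> C = C \<circ> A" using A unfolding bicommutant_def by blast
      then have "A (C f) = C (A f)" for f by (metis comp_apply)
      then show "op_scale c A \<circ> C = C \<circ> op_scale c A"
        using lin(1)[OF bd[OF A] bd[OF A] C(1)] by (intro ext) (simp add: op_scale_def)
    qed
  qed
  show "commutative_algebra op_scale (bicommutant \<Gamma>) (\<circ>) (restrict_op id)"
  proof (unfold_locales)
    show "subspace (bicommutant \<Gamma>)" by (rule S)
    show "A \<circ> B \<in> bicommutant \<Gamma>" if AB: "A \<in> bicommutant \<Gamma>" "B \<in> bicommutant \<Gamma>" for A B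
      unfolding bicommutant_def
    proof (intro CollectI conjI ballI impI)
      show "A \<circ> B \<in> bounded_operators" using AB bd bounded_operators_comp by blast
      fix C assume C: "C \<in> bounded_operators" "\<forall>D\<in>\<Gamma>. C \<circ> D = D \<circ> C"
      then have "A \<circ> C = C \<circ> A" "B \<circ> C = C \<circ> B" using AB unfolding bicommutant_def by blast+
      then show "A \<circ> B \<circ> C = C \<circ> (A \<circ> B)" by (metis comp_assoc)
    qed
    have unit_l: "restrict_op id \<circ> A = A" if "A \<in> bounded_operators" for A
    proof
      fix f show "(restrict_op id \<circ> A) f = A f"
        using bounded_operatorsD(1,2)[OF that, of f] by (cases "f \<in> Cc") auto
    qed
    have unit_r: "A \<circ> restrict_op id = A" if "A \<in> bounded_operators" for A
    proof
      fix f show "(A \<circ> restrict_op id) f = A f"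
        using bounded_operatorsD(1)[OF that, of f] bounded_operator_zero[OF that]
        by (cases "f \<in> Cc") (auto simp: restrict_op_def)
    qed
    show "restrict_op id \<in> bicommutant \<Gamma>"
      unfolding bicommutant_def using bounded_operators_unit unit_l unit_r by auto
    show "restrict_op id \<circ> A = A" if "A \<in> bicommutant \<Gamma>" for A using unit_l bd that by blast
    show "A \<circ> B = B \<circ> A" if "A \<in> bicommutant \<Gamma>" "B \<in> bicommutant \<Gamma>" for A B using comm that by blast
    show "(A \<circ> B) \<circ> C = A \<circ> (B \<circ> C)" for A B C :: "('a \<Rightarrow> complex) \<Rightarrow> 'a \<Rightarrow> complex" by (rule comp_assoc)
    show "(A + B) \<circ> C = (A \<circ> C) + (B \<circ> C)" for A B C :: "('a \<Rightarrow> complex) \<Rightarrow> 'a \<Rightarrow> complex"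
      by (simp add: fun_eq_iff)
    show "op_scale c A \<circ> B = op_scale c (A \<circ> B)" for c A B by (simp add: op_scale_def fun_eq_iff)
  qed
qed

end

section \<open>Characters separate points\<close>

context haar_integral
begin

text \<open>
  Self-adjointness and the Cauchy-Schwarz inequality make the norms \<open>N n\<close> of
  \<open>h^n u\<close> logarithmically convex, so the ratios \<open>N (n + 1) / N n\<close> increase from
  their initial value.
\<close>

lemma self_adjoint_power_growth:
  assumes h: "\<And>f. f \<in> Cc \<Longrightarrow> h f \<in> Cc" and sa: "\<And>f g. \<lbrakk>f \<in> Cc; g \<in> Cc\<rbrakk> \<Longrightarrow> ip (h f) g = ip f (h g)"
    and u: "u \<in> Cc" and pos: "0 < L2 (h u)" "0 < L2 u"
  shows "(L2 (h u) / L2 u) ^ n * L2 u \<le> L2 ((h ^^ n) u)"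
proof -
  define N where "N n = L2 ((h ^^ n) u)" for n
  have C: "(h ^^ n) u \<in> Cc" for n by (induction n) (auto simp: u h)
  have convex: "(N (Suc n))\<^sup>2 \<le> N n * N (Suc (Suc n))" for n
  proof -
    have "(N (Suc n))\<^sup>2 = ip (h ((h ^^ n) u)) ((h ^^ Suc n) u)"
      using ip_self[OF C[of "Suc n"]] by (simp add: N_def)
    also have "\<dots> = ip ((h ^^ n) u) ((h ^^ Suc (Suc n)) u)" using sa[OF C C, of n "Suc n"] by simp
    also have "\<dots> \<le> N n * N (Suc (Suc n))" unfolding N_def by (rule ip_le[OF C C])
    finally show ?thesis .
  qed
  define \<rho> where "\<rho> = N 1 / N 0"
  have \<rho>: "0 < \<rho>" using pos by (simp add: \<rho>_def N_def)
  have step: "0 < N n \<and> \<rho> * N n \<le> N (Suc n)" for n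
  proof (induction n)
    case 0
    then show ?case using pos by (simp add: \<rho>_def N_def)
  next
    case (Suc n)
    have pos1: "0 < N (Suc n)" using Suc \<rho> by (metis less_le_trans mult_pos_pos)
    have "\<rho> * N (Suc n) * N n \<le> N (Suc n) * N (Suc n)"
      using mult_right_mono[of "\<rho> * N n" "N (Suc n)" "N (Suc n)"] Suc pos1 by (simp add: mult_ac)
    also have "\<dots> \<le> N (Suc (Suc n)) * N n" using convex[of n] by (simp add: power2_eq_square mult.commute)
    finally have "\<rho> * N (Suc n) \<le> N (Suc (Suc n))" using Suc by (simp add: mult_le_cancel_right)
    then show ?case using pos1 by simp
  qed
  have "\<rho> ^ n * N 0 \<le> N n"
  proof (induction n)
    case (Suc n)
    have "\<rho> ^ Suc n * N 0 = \<rho> * (\<rho> ^ n * N 0)" by simp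
    also have "\<dots> \<le> \<rho> * N n" using Suc \<rho> by (intro mult_left_mono) auto
    also have "\<dots> \<le> N (Suc n)" using step by blast
    finally show ?case .
  qed simp
  then show ?thesis by (simp add: N_def \<rho>_def)
qed

lemma restrict_translate_bounded: "a \<in> carrier G \<Longrightarrow> restrict_op (translate a) \<in> bounded_operators"
  by (rule restrict_op_bounded[of _ 1])
    (auto simp: Cc_translate L2_translate, auto simp: translate_def)

lemma op_norm_translate_le: "a \<in> carrier G \<Longrightarrow> op_norm (restrict_op (translate a)) \<le> 1"
  by (rule op_norm_least) (auto simp: L2_translate)

lemma restrict_cconv_bounded:
  assumes "\<kappa> \<in> Cc"
  shows "restrict_op (cconv \<kappa>) \<in> bounded_operators"
  by (rule restrict_op_bounded[of _ "I (\<lambda>x. \<bar>\<kappa> x\<bar>)"])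
    (use I_nonneg[OF Cc_abs[OF assms]] L2_cconv_le[OF assms] in \<open>auto simp: assms Cc_cconv cconv_add cconv_cmult\<close>)

lemma exists_symmetric_bump:
  assumes "openin T U" "\<one> \<in> U"
  obtains \<kappa> :: "'a \<Rightarrow> real" where "\<kappa> \<in> Cc" "\<And>x. 0 \<le> \<kappa> x" "reflect \<kappa> = \<kappa>" "\<kappa> \<one> = 1" "\<And>x. x \<notin> U \<Longrightarrow> \<kappa> x = 0"
proof -
  obtain \<phi> :: "'a \<Rightarrow> real" where \<phi>: "\<phi> \<in> Cc" "\<And>x. 0 \<le> \<phi> x" "\<phi> \<one> = 1" "\<And>x. x \<notin> U \<Longrightarrow> \<phi> x = 0"
    by (rule bump_function[OF assms]) blast
  show thesis
  proof (rule that[of "\<lambda>x. \<phi> x * reflect \<phi> x"])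
    show "(\<lambda>x. \<phi> x * reflect \<phi> x) \<in> Cc"
      by (rule Cc_mult[OF \<phi>(1) Cc_continuous[OF Cc_reflect[OF \<phi>(1)]]])
    show "reflect (\<lambda>x. \<phi> x * reflect \<phi> x) = (\<lambda>x. \<phi> x * reflect \<phi> x)"
      using Cc_outside[OF \<phi>(1)] by (auto simp: reflect_def fun_eq_iff)
  qed (use \<phi> in \<open>auto simp: reflect_def\<close>)
qed

text \<open>
  Let \<open>V \<cdot> V\<close> avoid \<open>a\<close> and \<open>inv a\<close>, and let
  \<open>\<kappa>\<close> be a symmetric bump in \<open>V\<close>. Then
  \<open>conv \<kappa> \<kappa>\<close> vanishes at \<open>a\<close> and \<open>inv a\<close> and is
  positive at \<open>\<one>\<close>, so the operator \<open>h\<close>, convolution by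
  \<open>\<kappa>\<close> after the second difference, does not annihilate \<open>\<kappa>\<close>. It is
  self-adjoint, so its powers do not decay faster than geometrically, and an algebra character
  \<open>\<Phi>\<close> with \<open>\<Phi> h \<noteq> 0\<close> exists. On translations it is unimodular,
  since they are contractions with contractive inverses; \<open>\<Phi> K \<noteq> 0\<close> for the
  convolution \<open>K\<close> makes it continuous, and \<open>\<Phi> D \<noteq> 0\<close> for the second
  difference \<open>D\<close> makes it nontrivial at \<open>a\<close>.
\<close>

lemma exists_separating_character:
  assumes a: "a \<in> carrier G" "a \<noteq> \<one>"
  obtains \<phi> where "\<phi> \<in> carrier \<D>" "\<phi> a \<noteq> 1"
proof -
  define U where "U = carrier G - {a, inv a}"
  have "closedin T {a, inv a}"
    using a(1) Hausdorff by (intro closedin_Hausdorff_finite) auto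
  then have "openin T U" unfolding U_def using openin_diff[OF openin_carrier] by blast
  moreover have "\<one> \<noteq> inv a" using a by (metis inv_inv inv_one)
  then have "\<one> \<in> U" using a(2) not_sym[OF a(2)] by (auto simp: U_def)
  ultimately obtain V where V: "openin T V" "\<one> \<in> V" "\<And>x y. \<lbrakk>x \<in> V; y \<in> V\<rbrakk> \<Longrightarrow> x \<otimes> y \<in> U"
    by (rule square_root_neighbourhood) blast
  obtain \<kappa> :: "'a \<Rightarrow> real" where \<kappa>: "\<kappa> \<in> Cc" "\<And>x. 0 \<le> \<kappa> x" "reflect \<kappa> = \<kappa>" "\<kappa> \<one> = 1" "\<And>x. x \<notin> V \<Longrightarrow> \<kappa> x = 0"
    by (rule exists_symmetric_bump[OF V(1,2)]) blast
  define \<tau> where "\<tau> x = restrict_op (translate x)" for x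
  define K where "K = restrict_op (cconv \<kappa>)"
  define \<Gamma> where "\<Gamma> = insert K (\<tau> ` carrier G)"
  have \<tau>_bd: "\<tau> x \<in> bounded_operators" if "x \<in> carrier G" for x
    unfolding \<tau>_def using restrict_translate_bounded[OF that] .
  have K_bd: "K \<in> bounded_operators" unfolding K_def by (rule restrict_cconv_bounded[OF \<kappa>(1)])
  have \<Gamma>_bd: "\<Gamma> \<subseteq> bounded_operators" using \<tau>_bd K_bd by (auto simp: \<Gamma>_def)
  have \<tau>_mult: "\<tau> x \<circ> \<tau> y = \<tau> (x \<otimes> y)" if "x \<in> carrier G" "y \<in> carrier G" for x y
    using that by (auto simp: fun_eq_iff \<tau>_def restrict_op_def Cc_translate translate_translate translate_def[of x 0])
  have K_\<tau>: "K \<circ> \<tau> x = \<tau> x \<circ> K" if x: "x \<in> carrier G" for x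
  proof
    fix f
    show "(K \<circ> \<tau> x) f = (\<tau> x \<circ> K) f"
    proof (cases "f \<in> Cc")
      case True
      then show ?thesis
        using cconv_translate[OF \<kappa>(1) x, of f] Cc_translate[OF True x] Cc_cconv[OF \<kappa>(1) True] by (simp add: K_def \<tau>_def)
    next
      case False
      then show ?thesis
        using bounded_operatorsD(1)[OF K_bd False] bounded_operatorsD(1)[OF \<tau>_bd[OF x] False]
          bounded_operator_zero[OF K_bd] bounded_operator_zero[OF \<tau>_bd[OF x]] by simp
    qed
  qed
  have \<Gamma>_comm: "A \<circ> B = B \<circ> A" if "A \<in> \<Gamma>" "B \<in> \<Gamma>" for A B
    using that \<tau>_mult K_\<tau> by (auto simp: \<Gamma>_def m_comm)
  interpret alg: commutative_algebra op_scale "bicommutant \<Gamma>" "(\<circ>)" "restrict_op id"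
    by (rule commutative_algebra_bicommutant(1)[OF \<Gamma>_bd \<Gamma>_comm])
  have \<Gamma>_S: "\<Gamma> \<subseteq> bicommutant \<Gamma>" by (rule commutative_algebra_bicommutant(2)[OF \<Gamma>_bd \<Gamma>_comm])
  have K_S: "K \<in> bicommutant \<Gamma>" using \<Gamma>_S by (auto simp: \<Gamma>_def)
  have \<tau>_S: "\<tau> x \<in> bicommutant \<Gamma>" if "x \<in> carrier G" for x using \<Gamma>_S that by (auto simp: \<Gamma>_def)
  have S_bd: "A \<in> bounded_operators" if "A \<in> bicommutant \<Gamma>" for A using that by (simp add: bicommutant_def)
  have seminorm: "alg.submultiplicative_seminorm op_norm"
    unfolding alg.submultiplicative_seminorm_def using op_norm_nonneg op_norm_add op_norm_comp op_norm_scale S_bd by simp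
  define D where "D = op_scale 2 (restrict_op id) + op_scale (- 1) (\<tau> a + \<tau> (inv a))"
  have D_S: "D \<in> bicommutant \<Gamma>" unfolding D_def using \<tau>_S a(1) by auto
  have D_apply: "D f = second_difference a f" if "f \<in> Cc" for f
    using that by (simp add: D_def second_difference_def op_scale_def \<tau>_def fun_eq_iff)
  define h where "h = K \<circ> D"
  have h_S: "h \<in> bicommutant \<Gamma>" unfolding h_def using K_S D_S by blast
  have h_apply: "h f = cconv \<kappa> (second_difference a f)" if "f \<in> Cc" for f
    using that Cc_second_difference[OF that a(1)] by (simp add: h_def K_def D_apply)
  have h_apply': "h f = second_difference a (cconv \<kappa> f)" if "f \<in> Cc" for f
  proof -
    have "h = D \<circ> K" unfolding h_def by (rule alg.mul_commute[OF K_S D_S])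
    then show ?thesis using that Cc_cconv[OF \<kappa>(1) that] by (simp add: K_def D_apply)
  qed
  have h_C: "h f \<in> Cc" if "f \<in> Cc" for f using bounded_operatorsD(2)[OF S_bd[OF h_S] that] .
  have h_sa: "ip (h f) g = ip f (h g)" if "f \<in> Cc" "g \<in> Cc" for f g
  proof -
    have "ip (h f) g = ip (second_difference a f) (cconv \<kappa> g)"
      using ip_cconv[OF \<kappa>(1,3) Cc_second_difference[OF that(1) a(1)] that(2)] h_apply[OF that(1)] by simp
    also have "\<dots> = ip f (second_difference a (cconv \<kappa> g))"
      by (rule ip_second_difference[OF that(1) Cc_cconv[OF \<kappa>(1) that(2)] a(1)])
    finally show ?thesis using h_apply'[OF that(2)] by simp
  qed
  define u where "u x = complex_of_real (\<kappa> x)" for x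
  have u: "u \<in> Cc" unfolding u_def by (rule Cc_of_real[OF \<kappa>(1)])
  have cu: "cconv \<kappa> u x = of_real (conv \<kappa> \<kappa> x)" for x
    using conv_cmult[OF \<kappa>(1) \<kappa>(1), of 0] by (simp add: cconv_def u_def complex_eq_iff)
  have conv_zero: "conv \<kappa> \<kappa> b = 0" if b: "b \<in> {a, inv a}" for b
  proof -
    have bG: "b \<in> carrier G" using b a by auto
    have "\<kappa> y * translate b (reflect \<kappa>) y = 0" for y
    proof (rule ccontr)
      assume nz: "\<kappa> y * translate b (reflect \<kappa>) y \<noteq> 0"
      then have yV: "y \<in> V" using \<kappa>(5) by auto
      then have yG: "y \<in> carrier G" using V(1) open_subset_carrier by blast
      have "inv y \<otimes> b \<in> V" using nz \<kappa>(5) yG bG by (auto simp: translate_reflect)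
      then have "y \<otimes> (inv y \<otimes> b) \<in> U" using V(3) yV by blast
      then show False using yG bG b by (auto simp: U_def m_assoc[symmetric])
    qed
    then have "(\<lambda>y. \<kappa> y * translate b (reflect \<kappa>) y) = (\<lambda>y. 0)" by (rule ext)
    then show ?thesis using I_zero by (simp add: conv_def)
  qed
  have conv_one: "0 < conv \<kappa> \<kappa> \<one>"
  proof -
    have "translate \<one> (reflect \<kappa>) = \<kappa>" using translate_one[OF \<kappa>(1)] \<kappa>(3) by simp
    then have "conv \<kappa> \<kappa> \<one> = I (\<lambda>y. \<kappa> y * \<kappa> y)" by (simp add: conv_def)
    also have "0 < \<dots>"
      using \<kappa>(4) by (intro I_pos[of _ \<one>] Cc_mult[OF \<kappa>(1) Cc_continuous[OF \<kappa>(1)]]) auto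
    finally show ?thesis .
  qed
  have "h u \<one> = of_real (2 * conv \<kappa> \<kappa> \<one>)"
    using h_apply'[OF u] a(1) conv_zero by (simp add: second_difference_def translate_def cu)
  then have hu1: "h u \<one> \<noteq> 0" using conv_one by simp
  have L2_pos: "0 < L2 f" if "f \<in> Cc" "f \<one> \<noteq> 0" for f :: "'a \<Rightarrow> complex"
    unfolding L2_def using that I_pos[OF Cc_norm_square[OF that(1)], of \<one>] by simp
  have pos: "0 < L2 (h u)" "0 < L2 u"
  proof -
    have "u \<one> \<noteq> 0" using \<kappa>(4) by (simp add: u_def)
    then show "0 < L2 (h u)" "0 < L2 u" using L2_pos[OF h_C[OF u] hu1] L2_pos[OF u] by blast+
  qed
  define \<rho> where "\<rho> = L2 (h u) / L2 u"
  have pow_h: "alg.pow h n u = (h ^^ n) u" for n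
  proof (induction n)
    case 0
    show ?case unfolding alg.pow_0 using u by simp
  next
    case (Suc n)
    have "alg.pow h (Suc n) u = h (alg.pow h n u)" unfolding alg.pow_Suc by (rule comp_apply)
    also have "\<dots> = h ((h ^^ n) u)" by (rule arg_cong[OF Suc.IH])
    also have "\<dots> = (h ^^ Suc n) u" by simp
    finally show ?case .
  qed
  have growth: "\<rho> ^ n \<le> op_norm (alg.pow h n)" for n
  proof -
    have "\<rho> ^ n * L2 u \<le> L2 (alg.pow h n u)"
      unfolding pow_h \<rho>_def by (rule self_adjoint_power_growth[OF h_C h_sa u pos])
    also have "\<dots> \<le> op_norm (alg.pow h n) * L2 u"
      by (rule op_norm_bound[OF S_bd[OF alg.pow_closed[OF h_S]] u])
    finally show ?thesis using pos(2) by simp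
  qed
  have "0 < \<rho>" using pos by (simp add: \<rho>_def)
  then obtain \<Phi> where \<Phi>_add: "\<And>x y. \<lbrakk>x \<in> bicommutant \<Gamma>; y \<in> bicommutant \<Gamma>\<rbrakk> \<Longrightarrow> \<Phi> (x + y) = \<Phi> x + \<Phi> y"
    and \<Phi>_mult: "\<And>x y. \<lbrakk>x \<in> bicommutant \<Gamma>; y \<in> bicommutant \<Gamma>\<rbrakk> \<Longrightarrow> \<Phi> (x \<circ> y) = \<Phi> x * \<Phi> y"
    and \<Phi>_scale: "\<And>x c. x \<in> bicommutant \<Gamma> \<Longrightarrow> \<Phi> (op_scale c x) = c * \<Phi> x"
    and \<Phi>_unit: "\<Phi> (restrict_op id) = 1" and \<Phi>_le: "\<And>x. x \<in> bicommutant \<Gamma> \<Longrightarrow> cmod (\<Phi> x) \<le> op_norm x"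
    and \<Phi>_h: "\<Phi> h \<noteq> 0"
    by (rule alg.exists_character_of_commutative_algebra[OF seminorm h_S _ growth]) blast
  have \<Phi>K: "\<Phi> K \<noteq> 0" "\<Phi> D \<noteq> 0" using \<Phi>_h \<Phi>_mult[OF K_S D_S] by (auto simp: h_def)
  define \<theta> where "\<theta> x = \<Phi> (\<tau> x)" for x
  have \<theta>_mult: "\<theta> (x \<otimes> y) = \<theta> x * \<theta> y" if "x \<in> carrier G" "y \<in> carrier G" for x y
    using \<Phi>_mult[OF \<tau>_S \<tau>_S, of x y] \<tau>_mult[OF that] that by (simp add: \<theta>_def)
  have \<tau>_one: "\<tau> \<one> = restrict_op id"
    by (auto simp: fun_eq_iff \<tau>_def restrict_op_def translate_one)
  have \<theta>_one: "\<theta> \<one> = 1" by (simp add: \<theta>_def \<tau>_one \<Phi>_unit)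
  have \<theta>_le: "cmod (\<theta> x) \<le> 1" if "x \<in> carrier G" for x
    using \<Phi>_le[OF \<tau>_S[OF that]] op_norm_translate_le[OF that] by (simp add: \<theta>_def \<tau>_def)
  have \<theta>_norm: "cmod (\<theta> x) = 1" if x: "x \<in> carrier G" for x
  proof -
    have "cmod (\<theta> x) * cmod (\<theta> (inv x)) = 1"
      using \<theta>_mult[OF x inv_closed[OF x]] \<theta>_one x by (simp flip: norm_mult)
    moreover have "cmod (\<theta> x) * cmod (\<theta> (inv x)) \<le> cmod (\<theta> x) * 1"
      using \<theta>_le[OF inv_closed[OF x]] by (intro mult_left_mono) auto
    ultimately show ?thesis using \<theta>_le[OF x] by linarith
  qed
  \<comment> \<open>\<open>(\<theta> x - 1) * \<Phi> K\<close> is the value of \<open>\<Phi>\<close> at convolution with the kernel \<open>translate x \<kappa> - \<kappa>\<close>, whose norm is small for \<open>x\<close> near \<open>\<one>\<close>.\<close>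
  have near_one: "cmod (\<theta> x - 1) * cmod (\<Phi> K) \<le> I (\<lambda>y. \<bar>translate x \<kappa> y - \<kappa> y\<bar>)" if x: "x \<in> carrier G" for x
  proof -
    define A where "A = (\<tau> x + op_scale (- 1) (restrict_op id)) \<circ> K"
    have B_S: "\<tau> x + op_scale (- 1) (restrict_op id) \<in> bicommutant \<Gamma>" using \<tau>_S[OF x] by auto
    have A_S: "A \<in> bicommutant \<Gamma>" unfolding A_def using B_S K_S by blast
    have "\<Phi> A = (\<theta> x - 1) * \<Phi> K"
      unfolding A_def using \<Phi>_mult[OF B_S K_S] \<Phi>_add[OF \<tau>_S[OF x], of "op_scale (- 1) (restrict_op id)"]
        \<Phi>_scale[OF alg.unit_closed, of "-1"] \<Phi>_unit by (simp add: \<theta>_def)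
    then have "cmod (\<theta> x - 1) * cmod (\<Phi> K) \<le> op_norm A" using \<Phi>_le[OF A_S] by (simp add: norm_mult)
    also have "op_norm A \<le> I (\<lambda>y. \<bar>translate x \<kappa> y - \<kappa> y\<bar>)"
    proof (rule op_norm_least)
      have C: "(\<lambda>y. translate x \<kappa> y - \<kappa> y) \<in> Cc" by (rule Cc_diff[OF Cc_translate[OF \<kappa>(1) x] \<kappa>(1)])
      show "0 \<le> I (\<lambda>y. \<bar>translate x \<kappa> y - \<kappa> y\<bar>)" using I_nonneg[OF Cc_abs[OF C]] by simp
      fix f :: "'a \<Rightarrow> complex" assume f: "f \<in> Cc"
      have "A f = cconv (\<lambda>y. translate x \<kappa> y - \<kappa> y) f"
        using cconv_translate_kernel_diff[OF \<kappa>(1) f x] f Cc_cconv[OF \<kappa>(1) f]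
        by (simp add: A_def K_def \<tau>_def op_scale_def fun_eq_iff)
      then show "L2 (A f) \<le> I (\<lambda>y. \<bar>translate x \<kappa> y - \<kappa> y\<bar>) * L2 f" using L2_cconv_le[OF C f] by simp
    qed
    finally show ?thesis .
  qed
  have cont: "openin T {x \<in> carrier G. \<theta> x \<in> W}" if W: "open W" for W
  proof (subst openin_subopen, intro ballI)
    fix z assume "z \<in> {x \<in> carrier G. \<theta> x \<in> W}"
    then have z: "z \<in> carrier G" "\<theta> z \<in> W" by auto
    then obtain e where e: "0 < e" "ball (\<theta> z) e \<subseteq> W" using W open_contains_ball by blast
    have "0 < e * cmod (\<Phi> K)" using e \<Phi>K by simp
    then obtain N where N: "openin T N" "\<one> \<in> N" "\<And>x. x \<in> N \<Longrightarrow> I (\<lambda>y. \<bar>translate x \<kappa> y - \<kappa> y\<bar>) < e * cmod (\<Phi> K)"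
      by (rule translation_continuous_L1[OF \<kappa>(1)]) blast
    have "\<theta> x \<in> W" if x: "x \<in> carrier G" "inv z \<otimes> x \<in> N" for x
    proof -
      have "cmod (\<theta> (inv z \<otimes> x) - 1) * cmod (\<Phi> K) < e * cmod (\<Phi> K)"
        using near_one[of "inv z \<otimes> x"] N(3)[OF x(2)] x z by simp
      then have "cmod (\<theta> (inv z \<otimes> x) - 1) < e" by (simp add: mult_less_cancel_right)
      then have "cmod (\<theta> x - \<theta> z) < e"
        using hom_eq_translate[of \<theta> z x] \<theta>_mult \<theta>_norm x z by simp
      then show ?thesis using e(2) by (auto simp: dist_norm norm_minus_commute)
    qed
    moreover have "openin T {x \<in> carrier G. inv z \<otimes> x \<in> N}" using openin_translate[OF N(1)] z(1) by simp
    moreover have "z \<in> {x \<in> carrier G. inv z \<otimes> x \<in> N}" using z(1) N(2) by simp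
    ultimately show "\<exists>S. openin T S \<and> z \<in> S \<and> S \<subseteq> {x \<in> carrier G. \<theta> x \<in> W}" by blast
  qed
  have "continuous_map T euclidean \<theta>" using cont by (simp add: continuous_map)
  then have "continuous_map T euclidean (restrict \<theta> (carrier G))" by (rule continuous_map_eq) simp
  then have "restrict \<theta> (carrier G) \<in> carrier \<D>"
    unfolding dual_carrier_iff using \<theta>_mult \<theta>_norm by simp
  moreover have "restrict \<theta> (carrier G) a \<noteq> 1"
  proof
    assume "restrict \<theta> (carrier G) a = 1"
    then have 1: "\<theta> a = 1" using a(1) by simp
    then have "\<theta> (inv a) = 1" using \<theta>_mult[OF a(1) inv_closed[OF a(1)]] \<theta>_one a(1) by simp
    then have "\<Phi> (\<tau> a + \<tau> (inv a)) = 2" using \<Phi>_add[OF \<tau>_S \<tau>_S, of a "inv a"] a(1) 1 by (simp add: \<theta>_def)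
    moreover have S: "\<tau> a + \<tau> (inv a) \<in> bicommutant \<Gamma>" using \<tau>_S a(1) by auto
    ultimately have "\<Phi> (op_scale (- 1) (\<tau> a + \<tau> (inv a))) = - 2" by (simp only: \<Phi>_scale) simp
    moreover have "\<Phi> (op_scale 2 (restrict_op id)) = 2"
      by (simp only: \<Phi>_scale[OF alg.unit_closed] \<Phi>_unit) simp
    ultimately have "\<Phi> D = 0"
      unfolding D_def using \<Phi>_add[OF alg.S_closed(4)[OF alg.unit_closed] alg.S_closed(4)[OF S], of 2 "- 1"] by simp
    then show False using \<Phi>K by simp
  qed
  ultimately show thesis by (rule that)
qed

end

context locally_compact_abelian_group
begin

theorem characters_separate_points:
  assumes "a \<in> carrier G" "a \<noteq> \<one>"
  obtains \<phi> where "\<phi> \<in> carrier \<D>" "\<phi> a \<noteq> 1"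
proof -
  obtain I where "haar_integral G T I" by (rule exists_haar_integral)
  then interpret haar_integral G T I .
  show thesis by (rule exists_separating_character[OF assms that])
qed

end

section \<open>From a coarse metric on the dual to a metric on the group\<close>

context locally_compact_abelian_group
begin

lemma closure_square_root:
  assumes V: "openin T V" "\<And>x. x \<in> V \<Longrightarrow> inv x \<in> V" "\<one> \<in> V" "\<And>x y. \<lbrakk>x \<in> V; y \<in> V\<rbrakk> \<Longrightarrow> x \<otimes> y \<in> U"
  shows "T closure_of V \<subseteq> U"
proof
  fix x assume x: "x \<in> T closure_of V"
  then have xG: "x \<in> carrier G" using closure_of_subset_topspace by fastforce
  define N where "N = {y \<in> carrier G. inv x \<otimes> y \<in> V}"
  have "openin T N" unfolding N_def using openin_translate[OF V(1)] xG by simp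
  moreover have "x \<in> N" using xG V(3) by (simp add: N_def)
  ultimately have "\<exists>y. y \<in> V \<and> y \<in> N" using x unfolding in_closure_of by simp
  then obtain y where y: "y \<in> V" "y \<in> carrier G" "inv x \<otimes> y \<in> V" unfolding N_def by blast
  have "y \<otimes> inv (inv x \<otimes> y) \<in> U" using V(2,4) y by blast
  moreover have "y \<otimes> inv (inv x \<otimes> y) = x" using xG y(2) by (simp add: inv_mult m_lcomm)
  ultimately show "x \<in> U" by simp
qed

text \<open>
  In a locally compact group a decreasing sequence of relatively compact neighbourhoods, each containing the
  closure of the next, is a base as soon as it shrinks to the identity: the part of a compact set outside an
  open \<open>U\<close> is covered by the complements of the closures, and finitely many of them suffice.
\<close>

lemma countable_neighbourhood_base:
  assumes V: "\<And>n::nat. openin T (V n)" "\<And>n. \<one> \<in> V n"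
    and sep: "\<forall>x\<in>carrier G. (\<forall>n. x \<in> V n) \<longrightarrow> x = \<one>"
  obtains W :: "nat \<Rightarrow> 'a set" where "\<And>n. openin T (W n)" "\<And>n. \<one> \<in> W n"
    "\<And>U. \<lbrakk>openin T U; \<one> \<in> U\<rbrakk> \<Longrightarrow> \<exists>n. W n \<subseteq> U"
proof -
  obtain O' K where K: "openin T O'" "\<one> \<in> O'" "O' \<subseteq> K" "compactin T K"
    by (rule compact_neighbourhood_of_one) blast
  have "\<forall>U\<in>{U. openin T U \<and> \<one> \<in> U}. \<exists>W. openin T W \<and> \<one> \<in> W \<and> W \<subseteq> U \<and> (T closure_of W) \<subseteq> U"
  proof
    fix U assume "U \<in> {U. openin T U \<and> \<one> \<in> U}"
    then have U: "openin T U" "\<one> \<in> U" by auto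
    obtain W where W: "openin T W" "\<one> \<in> W" "W \<subseteq> U" "\<And>x. x \<in> W \<Longrightarrow> inv x \<in> W"
      "\<And>x y. \<lbrakk>x \<in> W; y \<in> W\<rbrakk> \<Longrightarrow> x \<otimes> y \<in> U"
      by (rule square_root_neighbourhood[OF U]) blast
    have "(T closure_of W) \<subseteq> U" by (rule closure_square_root[OF W(1,4,2,5)])
    with W(1-3) show "\<exists>W. openin T W \<and> \<one> \<in> W \<and> W \<subseteq> U \<and> (T closure_of W) \<subseteq> U"
      by (intro exI[of _ W] conjI)
  qed
  from bchoice[OF this] obtain r where
    "\<forall>U\<in>{U. openin T U \<and> \<one> \<in> U}. openin T (r U) \<and> \<one> \<in> r U \<and> r U \<subseteq> U \<and> (T closure_of r U) \<subseteq> U" ..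
  then have r: "openin T (r U) \<and> \<one> \<in> r U \<and> r U \<subseteq> U \<and> (T closure_of r U) \<subseteq> U"
    if "openin T U" "\<one> \<in> U" for U
    using that by simp
  define W where "W = rec_nat O' (\<lambda>n X. r (X \<inter> V n))"
  have W_simps: "W 0 = O'" "W (Suc n) = r (W n \<inter> V n)" for n by (simp_all add: W_def)
  have W: "openin T (W n) \<and> \<one> \<in> W n" for n
    by (induction n) (use r V K in \<open>auto simp: W_simps\<close>)
  have step: "W (Suc n) \<subseteq> W n \<and> (T closure_of (W (Suc n))) \<subseteq> W n \<inter> V n" for n
    using r[OF openin_Int[of T "W n" "V n"]] W[of n] V[of n] by (simp add: W_simps)
  have mono: "W n \<subseteq> W m" if "m \<le> n" for m n
    by (rule lift_Suc_antimono_le[of W, OF _ that]) (use step in blast)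
  have base: "\<exists>n. W n \<subseteq> U" if U: "openin T U" "\<one> \<in> U" for U
  proof -
    define F where "F n = carrier G - (T closure_of (W (Suc n)))" for n
    have F: "openin T (F n)" for n unfolding F_def by (intro openin_diff openin_carrier) simp
    have "K \<subseteq> \<Union> (insert U (range F))"
    proof
      fix x assume "x \<in> K"
      then have xG: "x \<in> carrier G" using compact_subset_carrier[OF K(4)] by blast
      show "x \<in> \<Union> (insert U (range F))"
      proof (cases "x = \<one>")
        case False
        then obtain n where "x \<notin> V n" using sep xG by blast
        then have "x \<in> F n" using step xG by (auto simp: F_def)
        then show ?thesis by blast
      qed (use U in simp)
    qed
    moreover have "\<And>X. X \<in> insert U (range F) \<Longrightarrow> openin T X" using U F by blast
    ultimately obtain \<F> where \<F>: "finite \<F>" "\<F> \<subseteq> insert U (range F)" "K \<subseteq> \<Union>\<F>"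
      using compactinD[OF K(4), of "insert U (range F)"] by metis
    have "finite (\<F> - {U})" "\<F> - {U} \<subseteq> range F" using \<F> by auto
    from finite_subset_image[OF this] obtain A where A: "finite A" "\<F> - {U} = F ` A" by blast
    from A(1) obtain N where N: "\<forall>n\<in>A. n < N" unfolding finite_nat_set_iff_bounded ..
    have "W N \<subseteq> U"
    proof
      fix x assume x: "x \<in> W N"
      then have "x \<in> K" using mono[of 0 N] K(3) by (auto simp: W_simps)
      then obtain X where X: "x \<in> X" "X \<in> \<F>" using \<F>(3) by blast
      show "x \<in> U"
      proof (rule ccontr)
        assume "x \<notin> U"
        then have "X \<in> \<F> - {U}" using X by blast
        then obtain n where n: "n \<in> A" "X = F n" using A(2) by blast
        have "W N \<subseteq> W (Suc n)" using N n(1) by (intro mono Suc_leI) blast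
        moreover have "W (Suc n) \<subseteq> (T closure_of (W (Suc n)))"
          using W[of "Suc n"] by (intro closure_of_subset openin_subset) blast
        ultimately show False using x X(1) n(2) by (auto simp: F_def)
      qed
    qed
    then show ?thesis by blast
  qed
  show thesis
  proof (rule that[of W])
    show "openin T (W n)" "\<one> \<in> W n" for n using W by blast+
  qed (rule base)
qed

text \<open>
  The Birkhoff-Kakutani theorem, simplified by bump functions. The functions \<open>f n\<close>, equal to
  \<open>1\<close> at \<open>\<one>\<close> and supported in \<open>W n\<close>, are compared at all
  translates of \<open>x\<close> and \<open>y\<close>; the weights \<open>(1/2)^n\<close> make the supremum
  continuous, because only finitely many \<open>f n\<close> matter up to a given error and each is uniformly
  continuous.
\<close>

lemma first_countable_imp_metrizable:
  assumes W: "\<And>n::nat. openin T (W n)" "\<And>n. \<one> \<in> W n"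
    and base: "\<And>U. \<lbrakk>openin T U; \<one> \<in> U\<rbrakk> \<Longrightarrow> \<exists>n. W n \<subseteq> U"
  shows "metrizable_space T"
proof -
  have "\<forall>n. \<exists>f::'a \<Rightarrow> real. f \<in> Cc \<and> (\<forall>x. 0 \<le> f x \<and> f x \<le> 1) \<and> f \<one> = 1 \<and> (\<forall>x. x \<notin> W n \<longrightarrow> f x = 0)"
  proof
    fix n
    obtain \<phi> :: "'a \<Rightarrow> real" where "\<phi> \<in> Cc" "\<And>x. 0 \<le> \<phi> x" "\<And>x. \<phi> x \<le> 1" "\<phi> \<one> = 1" "\<And>x. x \<notin> W n \<Longrightarrow> \<phi> x = 0"
      by (rule bump_function[OF W(1)[of n] W(2)[of n]]) blast
    then show "\<exists>f::'a \<Rightarrow> real. f \<in> Cc \<and> (\<forall>x. 0 \<le> f x \<and> f x \<le> 1) \<and> f \<one> = 1 \<and> (\<forall>x. x \<notin> W n \<longrightarrow> f x = 0)" by blast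
  qed
  then obtain f :: "nat \<Rightarrow> 'a \<Rightarrow> real" where f: "\<And>n. f n \<in> Cc" "\<And>n x. 0 \<le> f n x" "\<And>n x. f n x \<le> 1"
    "\<And>n. f n \<one> = 1" "\<And>n x. x \<notin> W n \<Longrightarrow> f n x = 0"
    by metis
  define q where "q x y p = (1/2) ^ fst p * \<bar>f (fst p) (x \<otimes> snd p) - f (fst p) (y \<otimes> snd p)\<bar>" for x y p
  define d where "d x y = (SUP p\<in>UNIV \<times> carrier G. q x y p)" for x y
  have q_le_power: "q x y p \<le> (1/2) ^ fst p" for x y p
  proof -
    have "\<bar>f (fst p) (x \<otimes> snd p) - f (fst p) (y \<otimes> snd p)\<bar> \<le> 1"
      using f(2,3)[of "fst p" "x \<otimes> snd p"] f(2,3)[of "fst p" "y \<otimes> snd p"] by linarith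
    then show ?thesis unfolding q_def by (simp add: mult_left_le)
  qed
  have bdd: "bdd_above (q x y ` (UNIV \<times> carrier G))" for x y
  proof (rule bdd_aboveI2)
    fix p show "q x y p \<le> 1" using q_le_power[of x y p] power_le_one[of "1/2::real" "fst p"] by linarith
  qed
  have q_le_d: "q x y (n, z) \<le> d x y" if "z \<in> carrier G" for x y n z
    unfolding d_def by (rule cSUP_upper[OF _ bdd]) (use that in simp)
  have d_le: "d x y \<le> c" if "\<And>n z. z \<in> carrier G \<Longrightarrow> q x y (n, z) \<le> c" for x y c
    unfolding d_def using that by (intro cSUP_least) auto
  have q_nonneg: "0 \<le> q x y p" for x y p by (simp add: q_def)
  \<comment> \<open>Evaluate at the translate by \<open>inv x\<close>, which moves \<open>x\<close> to the peak of the bump.\<close>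
  have near: "y \<otimes> inv x \<in> W n" if "d x y < (1/2) ^ n" "x \<in> carrier G" for x y n
  proof (rule ccontr)
    assume "y \<otimes> inv x \<notin> W n"
    then have "q x y (n, inv x) = (1/2) ^ n" using f(4,5) that by (simp add: q_def)
    then show False using q_le_d[of "inv x" x y n] that by simp
  qed
  have one: "x = \<one>" if x: "x \<in> carrier G" "\<And>n. x \<in> W n" for x
  proof (rule ccontr)
    assume "x \<noteq> \<one>"
    moreover have "closedin T {x}" using x Hausdorff by (intro closedin_Hausdorff_finite) auto
    ultimately have "openin T (carrier G - {x})" "\<one> \<in> carrier G - {x}" using openin_diff[OF openin_carrier] by auto
    then show False using base x(2) by blast
  qed
  interpret d: Metric_space "carrier G" d
  proof
    show "0 \<le> d x y" for x y using q_le_d[OF one_closed] q_nonneg order_trans by blast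
    show "d x y = d y x" for x y unfolding d_def q_def by (simp add: abs_minus_commute)
    show "d x y = 0 \<longleftrightarrow> x = y" if xy: "x \<in> carrier G" "y \<in> carrier G" for x y
    proof
      assume "d x y = 0"
      then have "y \<otimes> inv x \<in> W n" for n using near xy(1) by simp
      then have "y \<otimes> inv x = \<one>" using one xy by simp
      then show "x = y" using xy by (metis inv_equality inv_inv inv_closed)
    next
      assume "x = y"
      then show "d x y = 0"
        using d_le[of x y 0] q_le_d[OF one_closed, of x y 0] q_nonneg[of x y "(0, \<one>)"] by (simp add: q_def)
    qed
    show "d x z \<le> d x y + d y z" if "x \<in> carrier G" "y \<in> carrier G" "z \<in> carrier G" for x y z
    proof (rule d_le)
      fix n w assume w: "w \<in> carrier G"
      have "q x z (n, w) \<le> q x y (n, w) + q y z (n, w)"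
        unfolding q_def distrib_left[symmetric] by (intro mult_left_mono) auto
      then show "q x z (n, w) \<le> d x y + d y z" using q_le_d[OF w, of x y n] q_le_d[OF w, of y z n] by linarith
    qed
  qed
  have small: "\<exists>N. openin T N \<and> \<one> \<in> N \<and> (\<forall>x\<in>carrier G. \<forall>v\<in>N. d x (x \<otimes> v) < e)" if e: "0 < e" for e
  proof -
    obtain m where m: "(1/2::real) ^ m < e / 2" using real_arch_pow_inv[of "e / 2" "1/2"] e by auto
    have "\<forall>n. \<exists>N. openin T N \<and> \<one> \<in> N \<and> (\<forall>x\<in>carrier G. \<forall>v\<in>N. norm (f n (x \<otimes> v) - f n x) < e / 2)"
    proof
      fix n
      obtain N where "openin T N" "\<one> \<in> N" "\<And>x v. \<lbrakk>x \<in> carrier G; v \<in> N\<rbrakk> \<Longrightarrow> norm (f n (x \<otimes> v) - f n x) < e / 2"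
        by (rule Cc_uniformly_continuous[OF f(1)[of n], of "e / 2"]) (use e in auto)
      then show "\<exists>N. openin T N \<and> \<one> \<in> N \<and> (\<forall>x\<in>carrier G. \<forall>v\<in>N. norm (f n (x \<otimes> v) - f n x) < e / 2)" by blast
    qed
    then obtain N where N: "\<And>n. openin T (N n)" "\<And>n. \<one> \<in> N n"
      "\<And>n x v. \<lbrakk>x \<in> carrier G; v \<in> N n\<rbrakk> \<Longrightarrow> norm (f n (x \<otimes> v) - f n x) < e / 2"
      by metis
    define M where "M = (\<Inter>n\<in>{..m}. N n)"
    have M: "openin T M" "\<one> \<in> M" unfolding M_def using N by (auto intro!: openin_INT2)
    have "d x (x \<otimes> v) < e" if x: "x \<in> carrier G" and v: "v \<in> M" for x v
    proof -
      have vG: "v \<in> carrier G" using v open_subset_carrier[OF M(1)] by blast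
      have "d x (x \<otimes> v) \<le> e / 2"
      proof (rule d_le)
        fix n z assume z: "z \<in> carrier G"
        show "q x (x \<otimes> v) (n, z) \<le> e / 2"
        proof (cases "n \<le> m")
          case True
          then have "norm (f n (x \<otimes> z \<otimes> v) - f n (x \<otimes> z)) < e / 2"
            using N(3)[of "x \<otimes> z" v n] x z v by (simp add: M_def)
          moreover have "x \<otimes> z \<otimes> v = x \<otimes> v \<otimes> z" using x z vG by (simp add: m_ac)
          ultimately have b: "\<bar>f n (x \<otimes> z) - f n (x \<otimes> v \<otimes> z)\<bar> \<le> e / 2" by (simp add: abs_minus_commute)
          have "q x (x \<otimes> v) (n, z) \<le> 1 * \<bar>f n (x \<otimes> z) - f n (x \<otimes> v \<otimes> z)\<bar>"
            unfolding q_def fst_conv snd_conv by (intro mult_right_mono power_le_one) auto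
          also have "\<dots> \<le> e / 2" using b by simp
          finally show ?thesis .
        next
          case False
          then have "(1/2::real) ^ n \<le> (1/2) ^ m" by (intro power_decreasing) auto
          moreover have "0 < (1/2::real) ^ m" by simp
          moreover have "q x (x \<otimes> v) (n, z) \<le> (1/2) ^ n" using q_le_power[of x "x \<otimes> v" "(n, z)"] by simp
          ultimately show ?thesis using m by linarith
        qed
      qed
      then show ?thesis using e by linarith
    qed
    then show ?thesis using M by blast
  qed
  have "d.mtopology = T"
  proof (rule topology_eq[THEN iffD2], intro allI)
    fix U
    show "openin d.mtopology U = openin T U"
    proof
      assume U: "openin d.mtopology U"
      show "openin T U"
      proof (subst openin_subopen, intro ballI)
        fix x assume x: "x \<in> U"
        then obtain e where e: "0 < e" "d.mball x e \<subseteq> U" and xG: "x \<in> carrier G"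
          using U unfolding d.openin_mtopology by blast
        obtain N where N: "openin T N" "\<one> \<in> N" "\<forall>x\<in>carrier G. \<forall>v\<in>N. d x (x \<otimes> v) < e" using small[OF e(1)] by blast
        define S where "S = {y \<in> carrier G. inv x \<otimes> y \<in> N}"
        have "openin T S" unfolding S_def using openin_translate[OF N(1)] xG by simp
        moreover have "x \<in> S" using xG N(2) by (simp add: S_def)
        moreover have "S \<subseteq> U"
        proof
          fix y assume y: "y \<in> S"
          then have yG: "y \<in> carrier G" by (simp add: S_def)
          have "d x (x \<otimes> (inv x \<otimes> y)) < e" using N(3) xG y by (simp add: S_def)
          moreover have "x \<otimes> (inv x \<otimes> y) = y" using xG yG by (simp add: m_assoc[symmetric])
          ultimately show "y \<in> U" using e(2) xG yG by auto
        qed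
        ultimately show "\<exists>S. openin T S \<and> x \<in> S \<and> S \<subseteq> U" by blast
      qed
    next
      assume U: "openin T U"
      show "openin d.mtopology U"
        unfolding d.openin_mtopology
      proof (intro conjI allI impI)
        show UG: "U \<subseteq> carrier G" by (rule open_subset_carrier[OF U])
        fix x assume x: "x \<in> U"
        then have xG: "x \<in> carrier G" using UG by blast
        have "openin T {y \<in> carrier G. x \<otimes> y \<in> U}" by (rule openin_translate[OF U xG])
        moreover have "\<one> \<in> {y \<in> carrier G. x \<otimes> y \<in> U}" using x xG by simp
        ultimately obtain n where n: "W n \<subseteq> {y \<in> carrier G. x \<otimes> y \<in> U}" using base by blast
        have "d.mball x ((1/2) ^ n) \<subseteq> U"
        proof
          fix y assume "y \<in> d.mball x ((1/2) ^ n)"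
          then have y: "d x y < (1/2) ^ n" "y \<in> carrier G" by auto
          have "x \<otimes> (y \<otimes> inv x) \<in> U" using near[OF y(1) xG] n by blast
          moreover have "x \<otimes> (y \<otimes> inv x) = y" using m_lcomm[of x y "inv x"] xG y(2) by simp
          ultimately show "y \<in> U" by simp
        qed
        then show "\<exists>r>0. d.mball x r \<subseteq> U" by (intro exI[of _ "(1/2) ^ n"]) simp
      qed
    qed
  qed
  then show ?thesis unfolding metrizable_space_def using d.Metric_space_axioms by metis
qed

text \<open>
  Let \<open>V n\<close> be a neighbourhood on which the first \<open>n + 1\<close> compact sets exhausting
  the dual are within \<open>1 / (n + 1)\<close> of \<open>1\<close>. A point in all \<open>V n\<close> is
  sent to \<open>1\<close> by every character.
\<close>

theorem coarse_metrisable_imp_metrizable: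
  assumes "coarse_group_metrisable \<D> (relatively_compact_sets \<T>)"
  shows "metrizable_space T"
proof -
  obtain C :: "nat \<Rightarrow> ('a \<Rightarrow> complex) set" where C: "\<And>n. compactin \<T> (C n)" "carrier \<D> = (\<Union>n. C n)"
    by (rule coarse_metrisable_imp_sigma_compact[OF assms]) blast
  have "\<forall>n. \<exists>U. openin T U \<and> \<one> \<in> U \<and> (\<forall>\<phi>\<in>\<Union>i\<le>n. C i. \<forall>x\<in>U. norm (\<phi> x - 1) < 1 / real (Suc n))"
  proof
    fix n
    have "compactin \<T> (\<Union>i\<le>n. C i)" using C(1) by (intro compactin_Union) auto
    then obtain U where "openin T U" "\<one> \<in> U" "\<And>\<phi> x. \<lbrakk>\<phi> \<in> (\<Union>i\<le>n. C i); x \<in> U\<rbrakk> \<Longrightarrow> norm (\<phi> x - 1) < 1 / real (Suc n)"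
      by (rule compact_imp_equicontinuous[of _ "1 / real (Suc n)"]) auto
    then show "\<exists>U. openin T U \<and> \<one> \<in> U \<and> (\<forall>\<phi>\<in>\<Union>i\<le>n. C i. \<forall>x\<in>U. norm (\<phi> x - 1) < 1 / real (Suc n))"
      by blast
  qed
  then obtain V where V: "\<And>n. openin T (V n)" "\<And>n. \<one> \<in> V n"
    "\<And>n \<phi> x. \<lbrakk>\<phi> \<in> (\<Union>i\<le>n. C i); x \<in> V n\<rbrakk> \<Longrightarrow> norm (\<phi> x - 1) < 1 / real (Suc n)"
    by metis
  have sep: "\<forall>x\<in>carrier G. (\<forall>n. x \<in> V n) \<longrightarrow> x = \<one>"
  proof (intro ballI impI, rule ccontr)
    fix x assume x: "x \<in> carrier G" "\<forall>n. x \<in> V n"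
    assume "x \<noteq> \<one>"
    then obtain \<phi> where \<phi>: "\<phi> \<in> carrier \<D>" "\<phi> x \<noteq> 1" by (rule characters_separate_points[OF x(1)]) blast
    then obtain m where m: "\<phi> \<in> C m" using C(2) by blast
    have "0 < norm (\<phi> x - 1)" using \<phi>(2) by simp
    then obtain k where "1 / real (Suc k) < norm (\<phi> x - 1)" by (metis nat_approx_posE)
    moreover have "1 / real (Suc (max k m)) \<le> 1 / real (Suc k)" by (intro divide_left_mono) auto
    moreover have "norm (\<phi> x - 1) < 1 / real (Suc (max k m))"
      using m x(2) by (intro V(3)) fastforce+
    ultimately show False by linarith
  qed
  obtain W :: "nat \<Rightarrow> 'a set" where W: "\<And>n. openin T (W n)" "\<And>n. \<one> \<in> W n"
    "\<And>U. \<lbrakk>openin T U; \<one> \<in> U\<rbrakk> \<Longrightarrow> \<exists>n. W n \<subseteq> U"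
    by (rule countable_neighbourhood_base[OF V(1,2) sep]) blast
  show ?thesis by (rule first_countable_imp_metrizable[OF W])
qed

end

theorem corollary7p2:
  fixes G :: "('a, 'b) monoid_scheme" and T :: "'a topology"
  assumes "locally_compact_abelian_group G T"
  shows "(metrizable_space T \<longleftrightarrow>
            coarse_group_metrisable (dual_group G T) (relatively_compact_sets (dual_topology G T))) \<and>
         (coarse_group_metrisable (dual_group G T) (relatively_compact_sets (dual_topology G T)) \<longleftrightarrow>
            coarse_group_metrisable (dual_group G T)
              (coarsely_bounded_sets (dual_group G T) (dual_topology G T)))"
proof -
  interpret locally_compact_abelian_group G T by (rule assms)
  show ?thesis
    unfolding coarsely_bounded_eq_relatively_compact
    using metrizable_imp_coarse_metrisable coarse_metrisable_imp_metrizable by blast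
qed

end
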